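(* Let $T>0$, $f\in W^{1,1}(0,T;C(\Omega))$, $n\in\mathbb N$, and let $\mu_0\in X_n$ satisfy the stability condition $$\mathcal F_n(\mu_0)-\int_\Omega f(0)\,d\mu_0\le\mathcal F_n(\nu)+d(\nu,\mu_0)-\int_\Omega f(0)\,d\nu\qquad\text{for every }\nu\in X_n .$$ Then there exists a curve $t\mapsto\mu(t)$ from $[0,T]$ into $\mathcal P(\Omega)$ such that $\mu(0)=\mu_0$ and: (qs1)$_n$ global stability: for every $t\in[0,T]$ we have $\mu(t)\in X_n$ and $$\mathcal F_n(\mu(t))-\int_\Omega f(t)\,d\mu(t)\le\mathcal F_n(\nu)+d(\nu,\mu(t))-\int_\Omega f(t)\,d\nu\qquad\text{for every }\nu\in X_n;$$ (qs2)$_n$ energy balance: the map $s\mapsto\int_\Omega\dot f(s)\,d\mu(s)$ is integrable on $[0,T]$ and for every $t\in[0,T]$ $$\mathcal F_n(\mu(t))+\mathcal D(\mu,[0,t])-\int_\Omega f(t)\,d\mu(t)=\mathcal F_n(\mu(0))-\int_\Omega f(0)\,d\mu(0)-\int_0^t\int_\Omega\dot f(s)\,d\mu(s)\,ds .$$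
   Context: Setting. $\Omega\subset\mathbb R^2$ is a bounded, simply connected domain with Lipschitz boundary; $\mathcal R\subset\Omega$ is a closed rectangle with sides parallel to the coordinate axes and $\operatorname{dist}(\mathcal R,\partial\Omega)=\ell>0$. $\mathcal P(\Omega)$ is the set of Borel probability measures on $\Omega$. $C(\Omega)$ in $W^{1,1}(0,T;C(\Omega))$ denotes bounded continuous functions with the sup norm; $f$ is identified with its absolutely continuous representative, $\dot f$ is its time derivative. $e_1,e_2$ is the canonical basis, $\pi_2(x)=x_2$, $x^\perp=(-x_2,x_1)$, $(a\otimes b)_{ij}=a_ib_j$, $F:G=\sum_{ij}F_{ij}G_{ij}$, $\operatorname{sym}F=(F+F^T)/2$, $(\operatorname{Curl}\beta)_i=\partial_1\beta_{i2}-\partial_2\beta_{i1}$. The elasticity tensor is $\mathbb CF=\bar\lambda\,\mathrm{tr}(\operatorname{sym}F)\,\mathrm{Id}+2\bar\mu\operatorname{sym}F$ with $\bar\mu>0$, $\bar\lambda+\bar\mu>0$. $(\varepsilon_n),(r_n)$ are positive sequences with $\varepsilon_n\to0$, $r_n\to0$, $\varepsilon_n/r_n^3\to0$, $r_nn\to0$; it is tacit that $2\varepsilon_n<r_n$ and $2\varepsilon_n\le\ell$ (automatic for $n$ large), so the disks removed below are disjoint and contained in $\Omega$. Singular strains. For $x\ne z$, $$K(x;z):=\frac{1}{2\pi|x-z|^2}e_1\otimes(x-z)^\perp+\nabla v_0(x-z),\quad v_0(x):=-\frac{\bar\mu\log|x|}{2\pi(\bar\lambda+2\bar\mu)}e_2-\frac{\bar\lambda+\bar\mu}{4\pi(\bar\lambda+2\bar\mu)|x|^2}\big[(e_1\cdot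 x^\perp)x+(e_1\cdot x)x^\perp\big],$$ $$K^n(x;z):=K(x;z)+\varepsilon_n^2\nabla w(x-z),\quad w(x):=\frac{\bar\lambda+\bar\mu}{4\pi(\bar\lambda+2\bar\mu)|x|^4}\big[(e_1\cdot x^\perp)x+(e_1\cdot x)x^\perp\big],$$ where $K^n$ satisfies $\operatorname{div}\mathbb CK^n(\cdot;z)=0$ in $\mathbb R^2\setminus B_{\varepsilon_n}(z)$, $\mathbb CK^n(\cdot;z)\nu=0$ on $\partial B_{\varepsilon_n}(z)$, $\int_{\partial B_{\varepsilon_n}(z)}K^n\tau\,d\mathcal H^1=e_1$. Discrete energies. $X_n:=\{\mu=\frac1n\sum_{i=1}^n\delta_{z_i}:\{z_i\}\subset\mathcal R,\ |z_i-z_j|\ge r_n\text{ for }i\ne j\}$. For $\mu\in X_n$, $\Omega_n(\mu):=\Omega\setminus\bigcup_j\overline B_{\varepsilon_n}(z_j)$, $E_n(\mu,\beta):=\frac12\int_{\Omega_n(\mu)}\mathbb C\beta:\beta\,dx$, and $\mathcal A_n(\mu)$ is the set of $\beta\in L^2(\Omega;\mathbb R^{2\times2})$ with $\beta=0$ in $\Omega\setminus\Omega_n(\mu)$, $\operatorname{Curl}\beta=0$ in $\Omega_n(\mu)$, $\int_{\partial B_{\varepsilon_n}(z_i)}\beta\tau\,d\mathcal H^1=\frac1ne_1$ for every $i$ (in the sense of traces; $\tau$ counterclockwise unit tangent). $F_n(\mu):=\inf_{\beta\in\mathcal A_n(\mu)}E_n(\mu,\beta)$, and $$\mathcal F_n(\mu):=F_n(\mu)-\frac1{2n^2}\sum_{i=1}^n\int_{\Omega_n(\mu)}\mathbb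 CK^n(x;z_i):K^n(x;z_i)\,dx\ \text{ if }\mu\in X_n,\qquad\mathcal F_n(\mu):=+\infty\ \text{ if }\mu\in\mathcal P(\Omega)\setminus X_n.$$ Dissipation. $d(\mu,\nu):=\inf_{\sigma\in\Gamma(\mu,\nu)}\iint|x-y|\,d\sigma(x,y)$ if $(\pi_2)_\#\mu=(\pi_2)_\#\nu$, and $+\infty$ otherwise, where $\Gamma(\mu,\nu)$ is the set of couplings $\sigma\in\mathcal P(\Omega\times\Omega)$ of $\mu$ and $\nu$ with $\pi_2(x)=\pi_2(y)$ for $\sigma$-a.e. $(x,y)$. For a curve $\mu$, $\mathcal D(\mu,[0,t]):=\sup\{\sum_{i=1}^Md(\mu(t_i),\mu(t_{i-1})):0=t_0<\dots<t_M=t,\ M\in\mathbb N\}$. *)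

theory Defs
  imports "HOL-Probability.Probability"
begin

section \<open>Test functions and domains\<close>

primrec Ck :: "nat \<Rightarrow> ('a::euclidean_space \<Rightarrow> real) \<Rightarrow> bool" where
  "Ck 0 \<phi> \<longleftrightarrow> continuous_on UNIV \<phi>"
| "Ck (Suc k) \<phi> \<longleftrightarrow> (\<forall>x. \<phi> differentiable (at x)) \<and>
     (\<forall>b\<in>Basis. Ck k (\<lambda>x. frechet_derivative \<phi> (at x) b))"

text \<open>\<open>C\<^sub>c\<^sup>\<infinity>(U)\<close>; its elements are extended by zero to the whole space.\<close>

definition test_functions :: "'a::euclidean_space set \<Rightarrow> ('a \<Rightarrow> real) set" where
  "test_functions U =
     {\<phi>. (\<forall>k. Ck k \<phi>) \<and> (\<exists>C. compact C \<and> C \<subseteq> U \<and> (\<forall>x. x \<notin> C \<longrightarrow> \<phi> x = 0))}"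

definition lipschitz_boundary :: "(real^2) set \<Rightarrow> bool" where
  "lipschitz_boundary \<Omega> \<longleftrightarrow>
     (\<forall>p\<in>frontier \<Omega>. \<exists>\<rho>>0. \<exists>(Q :: real^2 \<Rightarrow> real^2) (\<gamma> :: real \<Rightarrow> real) L. orthogonal_transformation Q \<and> L-lipschitz_on UNIV \<gamma> \<and>
        \<Omega> \<inter> ball p \<rho> = {x \<in> ball p \<rho>. \<gamma> (Q x $ 1) < Q x $ 2})"

text \<open>Borel probability measures on \<open>S\<close> have \<open>S\<close> itself as underlying space.\<close>

definition borel_prob :: "'a::topological_space set \<Rightarrow> 'a measure set" where
  "borel_prob S = {\<mu>. prob_space \<mu> \<and> sets \<mu> = sets (restrict_space borel S)}"


section \<open>The space \<open>W\<^sup>1\<^sup>,\<^sup>1(0,T;C(\<Omega>))\<close>\<close>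

text \<open>A curve in \<open>C(\<Omega>)\<close> is a function of time and space of which only the values at points
  of \<open>\<Omega>\<close> matter.\<close>

definition bounded_continuous :: "(real^2) set \<Rightarrow> (real^2 \<Rightarrow> real) set" where
  "bounded_continuous \<Omega> = {g. continuous_on \<Omega> g \<and> bounded (g ` \<Omega>)}"

definition sup_norm :: "(real^2) set \<Rightarrow> (real^2 \<Rightarrow> real) \<Rightarrow> real" where
  "sup_norm \<Omega> g = (SUP x\<in>\<Omega>. \<bar>g x\<bar>)"

text \<open>Bochner integrability: strong measurability (almost everywhere a limit, in the sup norm,
  of simple functions) and integrability of the norm.\<close>

definition bochner_L1 :: "(real^2) set \<Rightarrow> real \<Rightarrow> (real \<Rightarrow> real^2 \<Rightarrow> real) \<Rightarrow> bool" where
  "bochner_L1 \<Omega> T g \<longleftrightarrow>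
     (\<forall>t\<in>{0..T}. g t \<in> bounded_continuous \<Omega>) \<and>
     (\<exists>s. (\<forall>k. simple_function (lebesgue_on {0..T}) (s k)) \<and>
          (\<forall>k. \<forall>t\<in>{0..T}. s k t \<in> bounded_continuous \<Omega>) \<and>
          (AE t in lebesgue_on {0..T}.
             (\<lambda>k. sup_norm \<Omega> (\<lambda>x. g t x - s k t x)) \<longlonglongrightarrow> 0)) \<and>
     integrable (lebesgue_on {0..T}) (\<lambda>t. sup_norm \<Omega> (g t))"

definition abs_continuous :: "(real^2) set \<Rightarrow> real \<Rightarrow> (real \<Rightarrow> real^2 \<Rightarrow> real) \<Rightarrow> bool" where
  "abs_continuous \<Omega> T f \<longleftrightarrow>
     (\<forall>e>0. \<exists>\<delta>>0. \<forall>(N::nat) a b.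
        (\<forall>i<N. 0 \<le> a i \<and> a i \<le> b i \<and> b i \<le> T) \<and>
        disjoint_family_on (\<lambda>i. {a i<..<b i}) {..<N} \<and> (\<Sum>i<N. b i - a i) < \<delta> \<longrightarrow>
        (\<Sum>i<N. sup_norm \<Omega> (\<lambda>x. f (b i) x - f (a i) x)) < e)"

text \<open>\<open>f\<close> is the absolutely continuous representative of an element of
  \<open>W\<^sup>1\<^sup>,\<^sup>1(0,T;C(\<Omega>))\<close> and \<open>f'\<close> is (a representative of) its time derivative.
  The identity of Bochner integrals defining the weak derivative is tested pointwise in \<open>\<Omega>\<close>,
  since evaluation at a point is a bounded linear functional on \<open>C(\<Omega>)\<close>.\<close>

definition W11 ::
  "(real^2) set \<Rightarrow> real \<Rightarrow> (real \<Rightarrow> real^2 \<Rightarrow> real) \<Rightarrow> (real \<Rightarrow> real^2 \<Rightarrow> real) \<Rightarrow> bool" where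
  "W11 \<Omega> T f f' \<longleftrightarrow>
     bochner_L1 \<Omega> T f \<and> bochner_L1 \<Omega> T f' \<and> abs_continuous \<Omega> T f \<and>
     (\<forall>\<phi>\<in>test_functions {0<..<T}. \<forall>x\<in>\<Omega>.
        (LINT t:{0..T}|lebesgue. deriv \<phi> t * f t x) = - (LINT t:{0..T}|lebesgue. \<phi> t * f' t x))"


section \<open>Elasticity and singular strains\<close>

definition perp :: "real^2 \<Rightarrow> real^2" where
  "perp x = vector [- (x $ 2), x $ 1]"

definition tensor :: "real^2 \<Rightarrow> real^2 \<Rightarrow> real^2^2" where
  "tensor a b = (\<chi> i j. a $ i * b $ j)"

definition sym_part :: "real^2^2 \<Rightarrow> real^2^2" where
  "sym_part F = (1/2) *\<^sub>R (F + transpose F)"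

definition elasticity :: "real \<Rightarrow> real \<Rightarrow> real^2^2 \<Rightarrow> real^2^2" where
  "elasticity lam shear F =
     (lam * trace (sym_part F)) *\<^sub>R mat 1 + (2 * shear) *\<^sub>R sym_part F"

abbreviation e1 :: "real^2" where "e1 \<equiv> axis 1 1"
abbreviation e2 :: "real^2" where "e2 \<equiv> axis 2 1"

definition v0_field :: "real \<Rightarrow> real \<Rightarrow> real^2 \<Rightarrow> real^2" where
  "v0_field lam shear x =
     - (shear * ln (norm x) / (2 * pi * (lam + 2 * shear))) *\<^sub>R e2
     - ((lam + shear) / (4 * pi * (lam + 2 * shear) * (norm x)\<^sup>2)) *\<^sub>R
         ((e1 \<bullet> perp x) *\<^sub>R x + (e1 \<bullet> x) *\<^sub>R perp x)"

definition w_field :: "real \<Rightarrow> real \<Rightarrow> real^2 \<Rightarrow> real^2" where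
  "w_field lam shear x =
     ((lam + shear) / (4 * pi * (lam + 2 * shear) * (norm x)^4)) *\<^sub>R
         ((e1 \<bullet> perp x) *\<^sub>R x + (e1 \<bullet> x) *\<^sub>R perp x)"

text \<open>The entry \<open>(i,j)\<close> of \<open>jacobian u (at x)\<close> is \<open>\<partial>\<^sub>j u\<^sub>i(x)\<close>.\<close>

definition K_strain :: "real \<Rightarrow> real \<Rightarrow> real^2 \<Rightarrow> real^2 \<Rightarrow> real^2^2" where
  "K_strain lam shear x z =
     (1 / (2 * pi * (norm (x - z))\<^sup>2)) *\<^sub>R tensor e1 (perp (x - z))
     + jacobian (v0_field lam shear) (at (x - z))"

definition Kn_strain :: "real \<Rightarrow> real \<Rightarrow> real \<Rightarrow> real^2 \<Rightarrow> real^2 \<Rightarrow> real^2^2" where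
  "Kn_strain lam shear eps x z =
     K_strain lam shear x z + eps\<^sup>2 *\<^sub>R jacobian (w_field lam shear) (at (x - z))"


section \<open>Discrete energies\<close>

text \<open>\<open>\<mu> = (1/n) \<Sum>\<^sub>i \<delta>\<^bsub>z\<^sub>i\<^esub>\<close> as measures on \<open>\<Omega>\<close>; the points are indexed by \<open>{..<n}\<close>.\<close>

definition Xn :: "(real^2) set \<Rightarrow> (real^2) set \<Rightarrow> (nat \<Rightarrow> real) \<Rightarrow> nat \<Rightarrow> (real^2) measure set" where
  "Xn \<Omega> R r n =
     {\<mu> \<in> borel_prob \<Omega>. \<exists>z. (\<forall>i<n. z i \<in> R) \<and>
        (\<forall>i<n. \<forall>j<n. i \<noteq> j \<longrightarrow> norm (z i - z j) \<ge> r n) \<and>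
        (\<forall>A\<in>sets \<mu>. emeasure \<mu> A =
           (\<Sum>i<n. emeasure (return (restrict_space borel \<Omega>) (z i)) A) / of_nat n)}"

text \<open>For \<open>\<mu>\<close> in \<open>Xn\<close> (with \<open>r n > 0\<close>) the \<open>z\<^sub>i\<close> are distinct and the atoms of \<open>\<mu>\<close> are exactly
  the points \<open>z\<^sub>i\<close>. All quantities below depend on the points only through this set, hence are
  functions of \<open>\<mu>\<close>.\<close>

definition atoms :: "(real^2) measure \<Rightarrow> (real^2) set" where
  "atoms \<mu> = {z \<in> space \<mu>. emeasure \<mu> {z} \<noteq> 0}"

definition Omega_n :: "(real^2) set \<Rightarrow> (nat \<Rightarrow> real) \<Rightarrow> nat \<Rightarrow> (real^2) measure \<Rightarrow> (real^2) set" where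
  "Omega_n \<Omega> \<epsilon> n \<mu> = \<Omega> - (\<Union>z\<in>atoms \<mu>. cball z (\<epsilon> n))"

definition E_n :: "(real^2) set \<Rightarrow> real \<Rightarrow> real \<Rightarrow> (nat \<Rightarrow> real) \<Rightarrow> nat \<Rightarrow> (real^2) measure
    \<Rightarrow> (real^2 \<Rightarrow> real^2^2) \<Rightarrow> real" where
  "E_n \<Omega> lam shear \<epsilon> n \<mu> \<beta> =
     1/2 * (LINT x:Omega_n \<Omega> \<epsilon> n \<mu>|lebesgue. elasticity lam shear (\<beta> x) \<bullet> \<beta> x)"

definition grad :: "(real^2 \<Rightarrow> real) \<Rightarrow> real^2 \<Rightarrow> real^2" where
  "grad \<phi> x = (\<chi> i. frechet_derivative \<phi> (at x) (axis i 1))"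

text \<open>For smooth \<open>\<beta>\<close>, Green's formula (row by row) reads
  \<open>\<integral>\<^sub>U \<beta> (\<nabla>\<phi>)\<^sup>\<bottom> dx = \<integral>\<^bsub>\<partial>U\<^esub> \<phi> \<beta>\<tau>\<^sub>U d\<H>\<^sup>1 - \<integral>\<^sub>U \<phi> Curl \<beta> dx\<close>,
  with \<open>\<tau>\<^sub>U\<close> the positively oriented tangent of \<open>\<partial>U\<close> (so \<open>U\<close> lies on its left).
  For \<open>\<beta>\<close> in \<open>L\<^sup>2\<close> the left-hand side defines \<open>Curl \<beta>\<close> as a distribution and, when
  \<open>Curl \<beta> = 0\<close>, the tangential trace \<open>\<beta>\<tau>\<^sub>U\<close> as a functional of the boundary values of \<open>\<phi>\<close>.\<close>

definition curl_pairing ::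
  "(real^2) set \<Rightarrow> (real^2 \<Rightarrow> real^2^2) \<Rightarrow> (real^2 \<Rightarrow> real) \<Rightarrow> real^2" where
  "curl_pairing U \<beta> \<phi> = (LINT x:U|lebesgue. \<beta> x *v perp (grad \<phi> x))"

definition curl_free :: "(real^2) set \<Rightarrow> (real^2 \<Rightarrow> real^2^2) \<Rightarrow> bool" where
  "curl_free U \<beta> \<longleftrightarrow> (\<forall>\<phi>\<in>test_functions U. curl_pairing U \<beta> \<phi> = 0)"

text \<open>\<open>\<integral>\<^bsub>\<partial>B\<^esub> \<beta>\<tau> d\<H>\<^sup>1 = c\<close> in the sense of traces, for a curl-free \<open>\<beta>\<close> on \<open>U\<close> and
  a disk \<open>B = cball z \<rho>\<close> that is one of the holes of \<open>U\<close> in \<open>\<Omega>\<close>: the tangential trace is tested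
  with functions equal to 1 near \<open>B\<close> and to 0 near the rest of \<open>\<partial>U\<close>. The minus sign is there
  because the counterclockwise tangent \<open>\<tau>\<close> of \<open>\<partial>B\<close> is \<open>- \<tau>\<^sub>U\<close>.\<close>

definition trace_circulation ::
  "(real^2) set \<Rightarrow> (real^2) set \<Rightarrow> (real^2 \<Rightarrow> real^2^2) \<Rightarrow> real^2 \<Rightarrow> real \<Rightarrow> real^2 \<Rightarrow> bool" where
  "trace_circulation \<Omega> U \<beta> z \<rho> c \<longleftrightarrow>
     (\<forall>\<phi>\<in>test_functions \<Omega>.
        (\<exists>V. open V \<and> cball z \<rho> \<subseteq> V \<and> (\<forall>x\<in>V. \<phi> x = 1)) \<and>
        (\<exists>V. open V \<and> \<Omega> - U - cball z \<rho> \<subseteq> V \<and> (\<forall>x\<in>V. \<phi> x = 0)) \<longrightarrow>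
        - curl_pairing U \<beta> \<phi> = c)"

definition admissible :: "(real^2) set \<Rightarrow> (nat \<Rightarrow> real) \<Rightarrow> nat \<Rightarrow> (real^2) measure
    \<Rightarrow> (real^2 \<Rightarrow> real^2^2) set" where
  "admissible \<Omega> \<epsilon> n \<mu> =
     {\<beta>. \<beta> \<in> borel_measurable (lebesgue_on \<Omega>) \<and>
         integrable (lebesgue_on \<Omega>) (\<lambda>x. (norm (\<beta> x))\<^sup>2) \<and>
         (AE x in lebesgue. x \<in> \<Omega> - Omega_n \<Omega> \<epsilon> n \<mu> \<longrightarrow> \<beta> x = 0) \<and>
         curl_free (Omega_n \<Omega> \<epsilon> n \<mu>) \<beta> \<and>
         (\<forall>z\<in>atoms \<mu>. trace_circulation \<Omega> (Omega_n \<Omega> \<epsilon> n \<mu>) \<beta> z (\<epsilon> n) ((1 / real n) *\<^sub>R e1))}"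

definition F_n :: "(real^2) set \<Rightarrow> real \<Rightarrow> real \<Rightarrow> (nat \<Rightarrow> real) \<Rightarrow> nat \<Rightarrow> (real^2) measure \<Rightarrow> ereal" where
  "F_n \<Omega> lam shear \<epsilon> n \<mu> = (INF \<beta>\<in>admissible \<Omega> \<epsilon> n \<mu>. ereal (E_n \<Omega> lam shear \<epsilon> n \<mu> \<beta>))"

definition ren_F :: "(real^2) set \<Rightarrow> (real^2) set \<Rightarrow> real \<Rightarrow> real \<Rightarrow> (nat \<Rightarrow> real) \<Rightarrow> (nat \<Rightarrow> real)
    \<Rightarrow> nat \<Rightarrow> (real^2) measure \<Rightarrow> ereal" where
  "ren_F \<Omega> R lam shear \<epsilon> r n \<mu> =
     (if \<mu> \<in> Xn \<Omega> R r n
      then F_n \<Omega> lam shear \<epsilon> n \<mu>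
        - ereal (1 / (2 * (real n)\<^sup>2) * (\<Sum>z\<in>atoms \<mu>. LINT x:Omega_n \<Omega> \<epsilon> n \<mu>|lebesgue.
            elasticity lam shear (Kn_strain lam shear (\<epsilon> n) x z) \<bullet> Kn_strain lam shear (\<epsilon> n) x z))
      else \<infinity>)"


section \<open>Dissipation\<close>

definition couplings ::
  "(real^2) set \<Rightarrow> (real^2) measure \<Rightarrow> (real^2) measure \<Rightarrow> ((real^2) \<times> (real^2)) measure set" where
  "couplings \<Omega> \<mu> \<nu> =
     {\<sigma> \<in> borel_prob (\<Omega> \<times> \<Omega>).
        distr \<sigma> (restrict_space borel \<Omega>) fst = \<mu> \<and>
        distr \<sigma> (restrict_space borel \<Omega>) snd = \<nu> \<and>
        (AE p in \<sigma>. fst p $ 2 = snd p $ 2)}"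

definition diss_dist :: "(real^2) set \<Rightarrow> (real^2) measure \<Rightarrow> (real^2) measure \<Rightarrow> ereal" where
  "diss_dist \<Omega> \<mu> \<nu> =
     (if distr \<mu> borel (\<lambda>x. x $ 2) = distr \<nu> borel (\<lambda>x. x $ 2)
      then (INF \<sigma>\<in>couplings \<Omega> \<mu> \<nu>. enn2ereal (\<integral>\<^sup>+p. ennreal (norm (fst p - snd p)) \<partial>\<sigma>))
      else \<infinity>)"

text \<open>Total dissipation on \<open>[0,t]\<close>. For \<open>t = 0\<close> the only partition has \<open>M = 0\<close>, with sum 0.\<close>

definition dissipation :: "(real^2) set \<Rightarrow> (real \<Rightarrow> (real^2) measure) \<Rightarrow> real \<Rightarrow> ereal" where
  "dissipation \<Omega> m t =
     Sup {(\<Sum>i<M. diss_dist \<Omega> (m (\<tau> (Suc i))) (m (\<tau> i))) | (M::nat) \<tau>.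
            \<tau> 0 = 0 \<and> \<tau> M = t \<and> (\<forall>i<M. \<tau> i < \<tau> (Suc i))}"

end

theory Submission
  imports Defs
begin

text \<open>Since dissipation is finite only between measures with the same heights, the evolution moves
  \<open>n\<close> points along \<open>n\<close> fixed horizontal segments, and the dissipation distance is a continuous
  pseudometric on this compact set of configurations. The evolution is the limit of the
  time-incremental scheme minimizing \<open>F + d(\<cdot>, x\<^sub>k) - L(t, \<cdot>)\<close>: a cluster point of its
  interpolants satisfies global stability and the upper energy inequality because \<open>F\<close> is lower
  semicontinuous, and stability along fine partitions gives the lower energy inequality.
  If the energy of the initial datum is infinite, the constant curve is a solution.

  Lower semicontinuity of the relaxed energy is the analytic core. An admissible strain of a
  configuration is turned into one of a nearby configuration by shifting it by the horizontal
  displacement \<open>h\<close> around each hole and gluing on an annulus, where the shifted field differs from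
  the original one by a gradient because the circulations agree. The potential of this gradient
  has to be small in \<open>L\<^sup>2\<close> in terms of the strain only, although the full gradient is not bounded
  by the strain; no Korn inequality is needed, since a potential with this property can be built
  explicitly by averaging along coordinate directions.\<close>

section \<open>Smooth functions\<close>

text \<open>Lower semicontinuity needs a displacement threshold that is uniform over all admissible
  strains of all nearby configurations: of a near-optimal strain only its energy is controlled.
  Hence strains are carried from the nearby configuration to the limit one, and the potential must
  be estimated by the strain alone. As moves are horizontal, the two rows behave differently. With a
  local potential \<open>u\<^sub>1\<close> of the first row, its increment over a step
  \<open>h\<close> is an average of \<open>\<partial>\<^sub>1u\<^sub>1\<close>, a strain entry; for
  the second row it is an average of \<open>\<partial>\<^sub>1u\<^sub>2\<close>, which is not. The
  hard estimates on annuli serve this second row. Curl and circulation are given only by duality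
  with smooth functions. So each operator occurs twice, on test functions and, as its adjoint, on
  square-integrable fields, and a potential is never differentiated: it is known through an integral
  identity, up to a constant that drops out in gluing. Finiteness of the energy also passes to
  limits by moving strains, which is what makes the set of configurations compact.\<close>

definition smooth :: "('a::euclidean_space \<Rightarrow> real) \<Rightarrow> bool" where
  "smooth \<phi> \<longleftrightarrow> (\<forall>k. Ck k \<phi>)"

abbreviation pd :: "'a \<Rightarrow> ('a::euclidean_space \<Rightarrow> real) \<Rightarrow> 'a \<Rightarrow> real" where
  "pd b \<phi> \<equiv> (\<lambda>x. frechet_derivative \<phi> (at x) b)"

lemma pd_eqI:
  assumes "\<And>x. (\<phi> has_derivative D x) (at x)"
  shows "pd b \<phi> = (\<lambda>x. D x b)"
  using frechet_derivative_at[OF assms] by (metis (no_types))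

text \<open>Works with any explicitly known derivative, so that the choice operator inside
  \<open>frechet_derivative\<close> is dealt with once and the closure lemmas reduce to the usual
  differentiation rules.\<close>

lemma Ck_SucI:
  assumes "\<And>x. (\<phi> has_derivative D x) (at x)" "\<And>b. b \<in> Basis \<Longrightarrow> Ck k (\<lambda>x. D x b)"
  shows "Ck (Suc k) \<phi>"
  using assms(2) unfolding pd_eqI[OF assms(1), symmetric]
  by (auto simp: differentiable_def intro!: exI[of _ "D _"] assms(1))

lemma Ck_SucD:
  assumes "Ck (Suc k) \<phi>"
  shows "(\<phi> has_derivative frechet_derivative \<phi> (at x)) (at x)"
    "b \<in> Basis \<Longrightarrow> Ck k (pd b \<phi>)"
  using assms by (auto simp: frechet_derivative_works)

lemma Ck_imp_continuous: "Ck k \<phi> \<Longrightarrow> continuous_on UNIV \<phi>"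
  by (cases k) (auto intro: differentiable_imp_continuous_on simp: differentiable_on_def)

lemma Ck_Suc_imp: "Ck (Suc k) \<phi> \<Longrightarrow> Ck k \<phi>"
proof (induction k arbitrary: \<phi>)
  case 0 then show ?case using Ck_imp_continuous[of "Suc 0" \<phi>] by simp
next
  case (Suc k)
  show ?case by (rule Ck_SucI[OF Ck_SucD(1)[OF Suc.prems] Suc.IH[OF Ck_SucD(2)[OF Suc.prems]]])
qed

lemma Ck_const: "Ck k (\<lambda>_. c)"
proof (induction k arbitrary: c)
  case (Suc k) show ?case by (rule Ck_SucI[where D="\<lambda>x h. 0"]) (use Suc in auto)
qed simp

lemma Ck_linear: "bounded_linear f \<Longrightarrow> Ck k f"
proof (cases k)
  case 0
  assume "bounded_linear f"
  then show ?thesis using 0 by (simp add: linear_continuous_on)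
next
  case (Suc j)
  assume "bounded_linear f"
  then show ?thesis unfolding Suc
    by (intro Ck_SucI[where D="\<lambda>x. f"] Ck_const bounded_linear_imp_has_derivative)
qed

lemma Ck_add: "Ck k f \<Longrightarrow> Ck k g \<Longrightarrow> Ck k (\<lambda>x. f x + g x)"
proof (induction k arbitrary: f g)
  case 0 then show ?case by (auto intro: continuous_intros)
next
  case (Suc k)
  show ?case
    by (rule Ck_SucI[OF has_derivative_add[OF Ck_SucD(1)[OF Suc.prems(1)] Ck_SucD(1)[OF Suc.prems(2)]]])
       (intro Suc.IH Ck_SucD(2)[OF Suc.prems(1)] Ck_SucD(2)[OF Suc.prems(2)])
qed

lemma Ck_mult: "Ck k f \<Longrightarrow> Ck k g \<Longrightarrow> Ck k (\<lambda>x. f x * g x)"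
proof (induction k arbitrary: f g)
  case 0 then show ?case by (auto intro: continuous_intros)
next
  case (Suc k)
  note f = Suc.prems(1) and g = Suc.prems(2)
  show ?case
    by (rule Ck_SucI[OF has_derivative_mult[OF Ck_SucD(1)[OF f] Ck_SucD(1)[OF g]]])
       (intro Ck_add Suc.IH Ck_SucD(2)[OF f] Ck_SucD(2)[OF g] Ck_Suc_imp[OF f] Ck_Suc_imp[OF g])
qed

lemma Ck_inverse: "Ck k f \<Longrightarrow> (\<And>x. f x \<noteq> 0) \<Longrightarrow> Ck k (\<lambda>x. inverse (f x))"
proof (induction k arbitrary: f)
  case 0 then show ?case by (auto intro: continuous_intros)
next
  case (Suc k)
  note f = Suc.prems(1)
  have "Ck k (\<lambda>x. (-1) * (inverse (f x) * pd b f x * inverse (f x)))" if "b \<in> Basis" for b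
    using that by (intro Ck_mult Ck_const Suc.IH Ck_SucD(2)[OF f] Ck_Suc_imp[OF f] Suc.prems(2))
  then show ?case
    by (intro Ck_SucI[OF Deriv.has_derivative_inverse[OF Suc.prems(2) Ck_SucD(1)[OF f]]]) simp
qed

lemma Ck_compose:
  fixes f :: "real \<Rightarrow> real"
  shows "Ck k f \<Longrightarrow> Ck k p \<Longrightarrow> Ck k (\<lambda>x. f (p x))"
proof (induction k arbitrary: f p)
  case 0 then show ?case by (auto intro: continuous_on_compose2)
next
  case (Suc k)
  note f = Suc.prems(1) and p = Suc.prems(2)
  have eq: "frechet_derivative f (at y) h = h * pd 1 f y" for y h
  proof -
    have "frechet_derivative f (at y) (h *\<^sub>R 1) = h *\<^sub>R frechet_derivative f (at y) 1"
      using has_derivative_bounded_linear[OF Ck_SucD(1)[OF f]] by (intro linear_cmul bounded_linear.linear)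
    then show ?thesis by simp
  qed
  have "Ck k (\<lambda>x. pd b p x * pd 1 f (p x))" if "b \<in> Basis" for b
    by (rule Ck_mult[OF Ck_SucD(2)[OF p that] Suc.IH[OF Ck_SucD(2)[OF f] Ck_Suc_imp[OF p]]]) simp
  then show ?case
    by (intro Ck_SucI[OF has_derivative_compose[OF Ck_SucD(1)[OF p] Ck_SucD(1)[OF f]]]) (simp only: eq[of "p x'" "pd b' p x'" for x' b'])
qed

lemma Ck_translate: "Ck k f \<Longrightarrow> Ck k (\<lambda>x. f (x + c))"
proof (induction k arbitrary: f)
  case 0 then show ?case by (auto intro!: continuous_intros elim: continuous_on_compose2)
next
  case (Suc k)
  note f = Suc.prems
  have d: "((\<lambda>x. x + c) has_derivative (\<lambda>h. h)) (at x)" for x by (auto intro!: derivative_eq_intros)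
  show ?case
    by (rule Ck_SucI[OF has_derivative_compose[OF d Ck_SucD(1)[OF f]]]) (intro Suc.IH Ck_SucD(2)[OF f])
qed

lemma pd_translate:
  assumes "\<And>x. f differentiable (at x)"
  shows "pd b (\<lambda>x. f (x + c)) = (\<lambda>x. pd b f (x + c))"
proof -
  have d: "((\<lambda>x. x + c) has_derivative (\<lambda>h. h)) (at x)" for x by (auto intro!: derivative_eq_intros)
  show ?thesis
    by (rule pd_eqI[OF has_derivative_compose[OF d]]) (use assms in \<open>simp add: frechet_derivative_works\<close>)
qed

text \<open>An average along a line rather than over a ball: it can be integrated by parts in one
  coordinate direction, while derivatives in the other directions pass through to
  \<open>g\<close>.\<close>

definition smear :: "real \<Rightarrow> real \<Rightarrow> (real \<Rightarrow> real) \<Rightarrow> 'a \<Rightarrow> ('a::euclidean_space \<Rightarrow> real) \<Rightarrow> 'a \<Rightarrow> real" where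
  "smear l u \<kappa> v g x = integral {l..u} (\<lambda>t. \<kappa> t * g (x + t *\<^sub>R v))"

lemma smear_continuous:
  assumes \<kappa>: "continuous_on UNIV \<kappa>" and g: "continuous_on UNIV g"
  shows "continuous_on UNIV (smear l u \<kappa> v g)"
proof -
  have "continuous_on (UNIV \<times> cbox l u) (\<lambda>(x, t). \<kappa> t * g (x + t *\<^sub>R v))"
    unfolding split_beta
    by (intro continuous_intros continuous_on_compose2[OF \<kappa>] continuous_on_compose2[OF g]) auto
  from integral_continuous_on_param[OF this] show ?thesis by (simp add: smear_def[abs_def])
qed

lemma smear_derivative:
  fixes g :: "'a::euclidean_space \<Rightarrow> real"
  assumes \<kappa>: "continuous_on UNIV \<kappa>" and g: "Ck (Suc 0) g"
  shows "(smear l u \<kappa> v g has_derivative (\<lambda>h. \<Sum>b\<in>Basis. (h \<bullet> b) * smear l u \<kappa> v (pd b g) x)) (at x)"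
proof -
  \<comment> \<open>The derivative of the integrand as a bounded linear map, the form in which the
    Leibniz rule for parameter integrals takes it.\<close>
  define G where "G x t = (\<Sum>b\<in>Basis. (\<kappa> t * pd b g (x + t *\<^sub>R v)) *\<^sub>R blinfun_inner_left b)" for x t
  have cg: "continuous_on UNIV (pd b g)" if "b \<in> Basis" for b using Ck_SucD(2)[OF g that] by simp
  have c1: "continuous_on UNIV (\<lambda>p::'a \<times> real. \<kappa> (snd p) * pd b g (fst p + snd p *\<^sub>R v))" if "b \<in> Basis" for b
    by (intro continuous_intros continuous_on_compose2[OF \<kappa>] continuous_on_compose2[OF cg[OF that]]) auto
  have Gd: "((\<lambda>x. \<kappa> t * g (x + t *\<^sub>R v)) has_derivative blinfun_apply (G x t)) (at x within UNIV)" for x t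
  proof -
    have d: "((\<lambda>x. x + t *\<^sub>R v) has_derivative (\<lambda>h. h)) (at x)" by (auto intro!: derivative_eq_intros)
    have lin: "frechet_derivative g (at y) h = (\<Sum>b\<in>Basis. (h \<bullet> b) * pd b g y)" for y h
    proof -
      have l: "linear (frechet_derivative g (at y))"
        using has_derivative_bounded_linear[OF Ck_SucD(1)[OF g]] by (rule bounded_linear.linear)
      have "frechet_derivative g (at y) h = frechet_derivative g (at y) (\<Sum>b\<in>Basis. (h \<bullet> b) *\<^sub>R b)"
        by (simp add: euclidean_representation)
      then show ?thesis by (simp add: linear_sum[OF l] linear_cmul[OF l])
    qed
    have "((\<lambda>x. \<kappa> t * g (x + t *\<^sub>R v)) has_derivative (\<lambda>h. \<kappa> t * frechet_derivative g (at (x + t *\<^sub>R v)) h)) (at x)"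
      by (intro has_derivative_mult_right has_derivative_compose[OF d Ck_SucD(1)[OF g]])
    moreover have "(\<lambda>h. \<kappa> t * frechet_derivative g (at (x + t *\<^sub>R v)) h) = blinfun_apply (G x t)"
    proof
      fix h
      have "\<kappa> t * frechet_derivative g (at (x + t *\<^sub>R v)) h = (\<Sum>b\<in>Basis. \<kappa> t * ((h \<bullet> b) * pd b g (x + t *\<^sub>R v)))"
        by (subst lin) (rule sum_distrib_left)
      then show "\<kappa> t * frechet_derivative g (at (x + t *\<^sub>R v)) h = blinfun_apply (G x t) h"
        by (simp add: G_def blinfun.sum_left blinfun.scaleR_left mult_ac inner_commute)
    qed
    ultimately show ?thesis by simp
  qed
  have Gc: "continuous_on (UNIV \<times> cbox l u) (\<lambda>(x, t). G x t)"
    unfolding G_def split_beta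
    by (intro continuous_on_sum continuous_on_scaleR continuous_on_const continuous_on_subset[OF c1]) auto
  have gi: "(\<lambda>t. \<kappa> t * g (x + t *\<^sub>R v)) integrable_on cbox l u" for x
    by (intro integrable_continuous continuous_intros continuous_on_compose2[OF Ck_imp_continuous[OF g]]
        continuous_on_subset[OF \<kappa>]) auto
  have "((\<lambda>x. integral (cbox l u) (\<lambda>t. \<kappa> t * g (x + t *\<^sub>R v))) has_derivative integral (cbox l u) (G x)) (at x within UNIV)"
    by (rule leibniz_rule[OF Gd gi Gc]) auto
  moreover have "blinfun_apply (integral (cbox l u) (G x)) = (\<lambda>h. \<Sum>b\<in>Basis. (h \<bullet> b) * smear l u \<kappa> v (pd b g) x)"
  proof
    fix h
    have ib: "(\<lambda>t. \<kappa> t * pd b g (x + t *\<^sub>R v)) integrable_on cbox l u" if "b \<in> Basis" for b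
      by (intro integrable_continuous continuous_intros continuous_on_compose2[OF cg[OF that]] continuous_on_subset[OF \<kappa>]) auto
    have Gi: "G x integrable_on cbox l u"
      unfolding G_def by (intro integrable_sum integrable_on_scaleR_left ib) auto
    have "blinfun_apply (integral (cbox l u) (G x)) h = integral (cbox l u) (\<lambda>t. blinfun_apply (G x t) h)"
      by (rule blinfun_apply_integral[OF Gi])
    also have "\<dots> = integral (cbox l u) (\<lambda>t. \<Sum>b\<in>Basis. (h \<bullet> b) * (\<kappa> t * pd b g (x + t *\<^sub>R v)))"
      by (simp add: G_def blinfun.sum_left blinfun.scaleR_left mult_ac inner_commute)
    also have "\<dots> = (\<Sum>b\<in>Basis. (h \<bullet> b) * smear l u \<kappa> v (pd b g) x)"
      by (subst integral_sum) (auto simp: smear_def intro!: integrable_on_mult_right ib[simplified])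
    finally show "blinfun_apply (integral (cbox l u) (G x)) h = (\<Sum>b\<in>Basis. (h \<bullet> b) * smear l u \<kappa> v (pd b g) x)" .
  qed
  ultimately show ?thesis by (simp add: smear_def[abs_def])
qed

lemma pd_smear:
  fixes g :: "'a::euclidean_space \<Rightarrow> real"
  assumes \<kappa>: "continuous_on UNIV \<kappa>" and g: "Ck (Suc 0) g" and b: "b \<in> Basis"
  shows "pd b (smear l u \<kappa> v g) = smear l u \<kappa> v (pd b g)"
proof -
  have "(\<Sum>c\<in>Basis. (b \<bullet> c) * f c) = f b" for f :: "'a \<Rightarrow> real"
    using b by (simp add: inner_Basis if_distrib[of "\<lambda>x. x * _"] sum.delta' cong: if_cong)
  then show ?thesis using pd_eqI[OF smear_derivative[OF \<kappa> g], of l u v b] by simp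
qed

lemma Ck_smear:
  fixes g :: "'a::euclidean_space \<Rightarrow> real"
  assumes \<kappa>: "continuous_on UNIV \<kappa>"
  shows "Ck k g \<Longrightarrow> Ck k (smear l u \<kappa> v g)"
proof (induction k arbitrary: g)
  case 0 then show ?case using smear_continuous[OF \<kappa>] by simp
next
  case (Suc k)
  have g1: "Ck (Suc 0) g"
    using Suc.prems by (induction k) (auto dest: Ck_Suc_imp simp del: Ck.simps)
  have "Ck k (pd b (smear l u \<kappa> v g))" if "b \<in> Basis" for b
    unfolding pd_smear[OF \<kappa> g1 that] by (rule Suc.IH[OF Ck_SucD(2)[OF Suc.prems that]])
  moreover have "smear l u \<kappa> v g differentiable (at x)" for x
    using smear_derivative[OF \<kappa> g1, of l u v x] unfolding differentiable_def by blast
  ultimately show ?case by simp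
qed

text \<open>A smooth transition from 1 on \<open>{..0}\<close> to 0 on \<open>{1..}\<close>, built from \<open>exp (-1/x)\<close>; the
  powers of \<open>x\<close> make the family closed under differentiation.\<close>

definition flat :: "nat \<Rightarrow> real \<Rightarrow> real" where
  "flat m x = (if x \<le> 0 then 0 else exp (- (1 / x)) / x ^ m)"

lemma flat_derivative: "(flat m has_real_derivative (flat (m + 2) x - real m * flat (m + 1) x)) (at x)"
proof -
  \<comment> \<open>Under \<open>y = 1/x\<close> this is the decay of \<open>y ^ k / exp y\<close>
    at infinity.\<close>
  have lim: "(flat k \<longlongrightarrow> 0) (at 0)" for k
  proof -
    have "((\<lambda>x::real. x ^ k / exp x) \<longlongrightarrow> 0) at_top" by (rule tendsto_power_div_exp_0)
    from filterlim_compose[OF this filterlim_inverse_at_top_right]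
    have r: "((\<lambda>x::real. inverse x ^ k / exp (inverse x)) \<longlongrightarrow> 0) (at_right 0)" .
    have "(flat k \<longlongrightarrow> 0) (at_right 0)"
    proof (rule Lim_transform_eventually[OF r])
      show "\<forall>\<^sub>F x in at_right 0. inverse x ^ k / exp (inverse x) = flat k x"
        unfolding eventually_at_right_field
        by (intro exI[of _ 1]) (auto simp: flat_def exp_minus field_simps power_inverse)
    qed
    moreover have "(flat k \<longlongrightarrow> 0) (at_left 0)"
    proof (rule Lim_transform_eventually[OF tendsto_const])
      show "\<forall>\<^sub>F x in at_left 0. 0 = flat k x"
        unfolding eventually_at_left_field by (intro exI[of _ "-1"]) (auto simp: flat_def)
    qed
    ultimately show ?thesis by (simp add: filterlim_split_at)
  qed
  consider "x > 0" | "x < 0" | "x = 0" by linarith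
  then show ?thesis
  proof cases
    case 1
    have "((\<lambda>x. exp (- (1 / x)) / x ^ m) has_real_derivative (flat (m + 2) x - real m * flat (m + 1) x)) (at x)"
      using 1 by (auto intro!: derivative_eq_intros simp: flat_def divide_simps power2_eq_square)
        (cases m, auto simp: field_simps)
    then show ?thesis
      by (rule has_field_derivative_transform_within_open[where S="{0<..}"]) (use 1 in \<open>auto simp: flat_def\<close>)
  next
    case 2
    have "((\<lambda>x. 0) has_real_derivative (flat (m + 2) x - real m * flat (m + 1) x)) (at x)"
      using 2 by (auto simp: flat_def)
    then show ?thesis
      by (rule has_field_derivative_transform_within_open[where S="{..<0}"]) (use 2 in \<open>auto simp: flat_def\<close>)
  next
    case 3
    \<comment> \<open>At 0 the difference quotient of \<open>flat m\<close> is
      \<open>flat (Suc m)\<close>, which tends to 0 as well.\<close>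
    have "((\<lambda>h. (flat m (0 + h) - flat m 0) / h) \<longlongrightarrow> 0) (at 0)"
      by (rule Lim_transform_eventually[OF lim[of "Suc m"]])
         (auto simp: flat_def eventually_at_filter divide_simps)
    then show ?thesis using 3 by (simp add: has_field_derivative_iff flat_def)
  qed
qed

lemma Ck_flat: "Ck k (flat m)"
proof (induction k arbitrary: m)
  case 0
  have "continuous_on UNIV (flat m)" by (rule DERIV_continuous_on[OF flat_derivative])
  then show ?case by simp
next
  case (Suc k)
  have "Ck k (\<lambda>x. flat (m + 2) x + (- real m) * flat (m + 1) x)"
    by (intro Ck_add Ck_mult Ck_const Suc.IH)
  then show ?case
    by (intro Ck_SucI[OF flat_derivative[unfolded has_field_derivative_def]]) simp
qed

definition ramp :: "real \<Rightarrow> real" where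
  "ramp t = flat 0 (1 - t) * inverse (flat 0 (1 - t) + flat 0 t)"

lemma flat_nonneg: "0 \<le> flat m x" and flat_pos: "x > 0 \<Longrightarrow> 0 < flat m x"
  by (auto simp: flat_def)

lemma ramp_denominator: "flat 0 (1 - t) + flat 0 t \<noteq> 0"
  using flat_pos[of t 0] flat_pos[of "1 - t" 0] flat_nonneg[of 0 t] flat_nonneg[of 0 "1 - t"]
  by (cases "t > 0") (force, force)

lemma Ck_ramp: "Ck k ramp"
proof -
  have l: "Ck k (\<lambda>t::real. 1 - t)"
    using Ck_add[OF Ck_const[where c=1] Ck_linear[OF bounded_linear_minus[OF bounded_linear_ident]]] by simp
  have "Ck k (\<lambda>t. flat 0 (1 - t) + flat 0 t)" by (intro Ck_add Ck_flat Ck_compose[OF Ck_flat l])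
  from Ck_mult[OF Ck_compose[OF Ck_flat l] Ck_inverse[OF this ramp_denominator]]
  show ?thesis by (simp add: ramp_def[abs_def])
qed

lemma ramp: "t \<le> 0 \<Longrightarrow> ramp t = 1" "1 \<le> t \<Longrightarrow> ramp t = 0" "0 \<le> ramp t" "ramp t \<le> 1"
proof -
  show "ramp t = 1" if "t \<le> 0" using that ramp_denominator[of t] by (simp add: ramp_def flat_def)
  show "ramp t = 0" if "1 \<le> t" using that by (simp add: ramp_def flat_def)
  have pos: "0 < flat 0 (1 - t) + flat 0 t"
    using ramp_denominator[of t] flat_nonneg[of 0 t] flat_nonneg[of 0 "1 - t"] by linarith
  show "0 \<le> ramp t" unfolding ramp_def using pos flat_nonneg by (intro mult_nonneg_nonneg) auto
  show "ramp t \<le> 1" unfolding ramp_def using pos flat_nonneg[of 0 t]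
    by (simp add: divide_inverse[symmetric])
qed

section \<open>Square-integrable functions and averages along lines\<close>

definition L2 :: "('a::euclidean_space \<Rightarrow> real) \<Rightarrow> bool" where
  "L2 F \<longleftrightarrow> F \<in> borel_measurable borel \<and> integrable lborel (\<lambda>x. (F x)\<^sup>2)"

text \<open>The square of the norm; the triangle inequality therefore appears below with factors
  2.\<close>

definition nrm2 :: "('a::euclidean_space \<Rightarrow> real) \<Rightarrow> real" where
  "nrm2 F = (\<integral>x. (F x)\<^sup>2 \<partial>lborel)"

lemma nrm2_nonneg: "0 \<le> nrm2 F" by (simp add: nrm2_def)

lemma L2_measurable [measurable_dest]: "L2 F \<Longrightarrow> F \<in> borel_measurable borel"
  by (simp add: L2_def)

lemma L2I_bound:
  assumes F: "F \<in> borel_measurable borel" and G: "integrable lborel G" and le: "\<And>x. (F x)\<^sup>2 \<le> G x"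
  shows "L2 F" "nrm2 F \<le> (\<integral>x. G x \<partial>lborel)"
proof -
  show L: "L2 F" unfolding L2_def
    using F le by (auto intro!: Bochner_Integration.integrable_bound[OF G] simp: order_trans[OF _ abs_ge_self])
  show "nrm2 F \<le> (\<integral>x. G x \<partial>lborel)"
    unfolding nrm2_def using L G le by (intro integral_mono) (auto simp: L2_def)
qed

lemma abs_mult_le_squares: "\<bar>a * b\<bar> \<le> a\<^sup>2 + (b::real)\<^sup>2"
proof -
  have "2 * (\<bar>a\<bar> * \<bar>b\<bar>) \<le> a\<^sup>2 + b\<^sup>2" using sum_squares_bound[of "\<bar>a\<bar>" "\<bar>b\<bar>"] by simp
  moreover have "0 \<le> \<bar>a\<bar> * \<bar>b\<bar>" by simp
  ultimately show ?thesis unfolding abs_mult by linarith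
qed

lemma L2_mult_integrable: "L2 F \<Longrightarrow> L2 G \<Longrightarrow> integrable lborel (\<lambda>x. F x * G x)"
proof -
  assume F: "L2 F" and G: "L2 G"
  have "integrable lborel (\<lambda>x. (F x)\<^sup>2 + (G x)\<^sup>2)" using F G by (auto simp: L2_def)
  then show ?thesis
  proof (rule Bochner_Integration.integrable_bound)
    show "(\<lambda>x. F x * G x) \<in> borel_measurable lborel" using F G by (auto simp: L2_def)
    have "\<bar>F x * G x\<bar> \<le> (F x)\<^sup>2 + (G x)\<^sup>2" for x
      by (rule abs_mult_le_squares)
    then show "AE x in lborel. norm (F x * G x) \<le> norm ((F x)\<^sup>2 + (G x)\<^sup>2)" by simp
  qed
qed

lemma L2_add:
  assumes "L2 F" "L2 G"
  shows "L2 (\<lambda>x. F x + G x)" "nrm2 (\<lambda>x. F x + G x) \<le> 2 * nrm2 F + 2 * nrm2 G"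
proof -
  have i: "integrable lborel (\<lambda>x. 2 * (F x)\<^sup>2 + 2 * (G x)\<^sup>2)" using assms by (auto simp: L2_def)
  have m: "(\<lambda>x. F x + G x) \<in> borel_measurable borel" using assms by (auto simp: L2_def)
  have le: "(F x + G x)\<^sup>2 \<le> 2 * (F x)\<^sup>2 + 2 * (G x)\<^sup>2" for x
    using sum_squares_bound[of "F x" "G x"] by (simp add: power2_sum)
  show "L2 (\<lambda>x. F x + G x)" using L2I_bound(1)[OF m i le] .
  show "nrm2 (\<lambda>x. F x + G x) \<le> 2 * nrm2 F + 2 * nrm2 G"
    using L2I_bound(2)[OF m i le] assms by (simp add: nrm2_def L2_def)
qed

lemma L2_minus: "L2 F \<Longrightarrow> L2 (\<lambda>x. - F x)" "nrm2 (\<lambda>x. - F x) = nrm2 F"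
  by (auto simp: L2_def nrm2_def)

lemma L2_diff:
  assumes "L2 F" "L2 G"
  shows "L2 (\<lambda>x. F x - G x)" "nrm2 (\<lambda>x. F x - G x) \<le> 2 * nrm2 F + 2 * nrm2 G"
  using L2_add[OF assms(1) L2_minus(1)[OF assms(2)]] L2_minus(2)[of G] by simp_all

lemma L2_translate:
  fixes F :: "'a::euclidean_space \<Rightarrow> real"
  assumes "L2 F" shows "L2 (\<lambda>x. F (x + c))" "nrm2 (\<lambda>x. F (x + c)) = nrm2 F"
proof -
  have [measurable]: "F \<in> borel_measurable borel" using assms by (simp add: L2_def)
  have "integrable (distr lborel borel ((+) c)) (\<lambda>x. (F x)\<^sup>2)" using assms by (simp add: lborel_distr_plus L2_def)
  then have "integrable lborel (\<lambda>x. (F (c + x))\<^sup>2)" by (subst (asm) integrable_distr_eq) auto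
  then show "L2 (\<lambda>x. F (x + c))" by (simp add: L2_def add.commute)
  have "(\<integral>x. (F x)\<^sup>2 \<partial>distr lborel borel ((+) c)) = (\<integral>x. (F (c + x))\<^sup>2 \<partial>lborel)"
    by (subst integral_distr) auto
  then show "nrm2 (\<lambda>x. F (x + c)) = nrm2 F" by (simp add: lborel_distr_plus nrm2_def add.commute)
qed

lemma integral_translate:
  fixes F :: "'a::euclidean_space \<Rightarrow> real"
  assumes [measurable]: "F \<in> borel_measurable borel"
  shows "(\<integral>x. F (x + c) \<partial>lborel) = (\<integral>x. F x \<partial>lborel)"
proof -
  have "(\<integral>x. F x \<partial>distr lborel borel ((+) c)) = (\<integral>x. F (c + x) \<partial>lborel)"
    by (subst integral_distr) auto
  then show ?thesis by (simp add: lborel_distr_plus add.commute)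
qed

text \<open>Cauchy-Schwarz by the discriminant: the polynomial in \<open>q\<close> is nonnegative,
  in particular at its minimizer \<open>a = - ?I / nrm2 F\<close>. If \<open>nrm2 F = 0\<close> it
  is affine and would take the value -1 unless the integral vanishes.\<close>

lemma L2_inner_bound: 
  assumes "L2 F" "L2 G"
  shows "(\<integral>x. F x * G x \<partial>lborel)\<^sup>2 \<le> nrm2 F * nrm2 G"
proof -
  let ?I = "\<integral>x. F x * G x \<partial>lborel"
  have q: "0 \<le> a\<^sup>2 * nrm2 F + 2 * a * ?I + nrm2 G" for a
  proof -
    have "0 \<le> (\<integral>x. (a * F x + G x)\<^sup>2 \<partial>lborel)" by simp
    also have "\<dots> = (\<integral>x. a\<^sup>2 * (F x)\<^sup>2 + 2 * a * (F x * G x) + (G x)\<^sup>2 \<partial>lborel)"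
      by (rule Bochner_Integration.integral_cong) (auto simp: power2_eq_square algebra_simps)
    also have "\<dots> = a\<^sup>2 * nrm2 F + 2 * a * ?I + nrm2 G"
      using assms L2_mult_integrable[OF assms] by (simp add: nrm2_def L2_def)
    finally show ?thesis .
  qed
  show ?thesis
  proof (cases "nrm2 F = 0")
    case True
    have "?I = 0"
    proof (rule ccontr)
      assume "?I \<noteq> 0"
      then show False using q[of "- (nrm2 G + 1) / (2 * ?I)"] True by (simp add: field_simps)
    qed
    then show ?thesis using True by simp
  next
    case False
    then have p: "nrm2 F > 0" using nrm2_nonneg[of F] by simp
    have "0 \<le> (?I / nrm2 F)\<^sup>2 * nrm2 F - 2 * (?I / nrm2 F) * ?I + nrm2 G" using q[of "- (?I / nrm2 F)"] by simp
    also have "\<dots> = nrm2 G - ?I\<^sup>2 / nrm2 F" using p by (simp add: field_simps power2_eq_square)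
    finally show ?thesis using p by (simp add: field_simps)
  qed
qed

text \<open>The counterpart of \<open>smear\<close> for merely measurable functions, hence a
  Lebesgue integral. Test functions are averaged by \<open>smear\<close>, fields by
  \<open>avg\<close>.\<close>

definition avg :: "real \<Rightarrow> real \<Rightarrow> (real \<Rightarrow> real) \<Rightarrow> 'a \<Rightarrow> ('a::euclidean_space \<Rightarrow> real) \<Rightarrow> 'a \<Rightarrow> real" where
  "avg l u \<kappa> v F x = (\<integral>t. indicator {l..u} t * \<kappa> t * F (x + t *\<^sub>R v) \<partial>lborel)"

lemma avg_eq_smear:
  assumes "continuous_on UNIV \<kappa>" "continuous_on UNIV g"
  shows "avg l u \<kappa> v g = smear l u \<kappa> v g"
proof
  fix x
  have "continuous_on {l..u} (\<lambda>t. \<kappa> t * g (x + t *\<^sub>R v))"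
    by (intro continuous_intros continuous_on_compose2[OF assms(2)] continuous_on_subset[OF assms(1)]) auto
  then have "set_integrable lborel {l..u} (\<lambda>t. \<kappa> t * g (x + t *\<^sub>R v))"
    by (rule borel_integrable_atLeastAtMost')
  from set_borel_integral_eq_integral(2)[OF this]
  show "avg l u \<kappa> v g x = smear l u \<kappa> v g x"
    by (simp add: avg_def smear_def set_lebesgue_integral_def mult.assoc)
qed

lemma avg_measurable:
  assumes [measurable]: "\<kappa> \<in> borel_measurable borel" "F \<in> borel_measurable borel"
  shows "avg l u \<kappa> v F \<in> borel_measurable borel"
  unfolding avg_def[abs_def] by measurable

lemma nn_shift:
  fixes F :: "'a::euclidean_space \<Rightarrow> real"
  assumes [measurable]: "F \<in> borel_measurable borel"
  shows "(\<integral>\<^sup>+x. ennreal ((F (x + c))\<^sup>2) \<partial>lborel) = (\<integral>\<^sup>+x. ennreal ((F x)\<^sup>2) \<partial>lborel)"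
proof -
  have "(\<integral>\<^sup>+x. ennreal ((F x)\<^sup>2) \<partial>distr lborel borel ((+) c)) = (\<integral>\<^sup>+x. ennreal ((F (c + x))\<^sup>2) \<partial>lborel)"
    by (subst nn_integral_distr) auto
  then show ?thesis by (simp add: lborel_distr_plus add.commute)
qed

text \<open>A form of Young's inequality: Cauchy-Schwarz in \<open>t\<close> at each point, Tonelli,
  and translation invariance. The bound does not depend on the direction \<open>v\<close>.\<close>

lemma L2_avg:
  fixes F :: "'a::euclidean_space \<Rightarrow> real"
  assumes F: "L2 F" and \<kappa>[measurable]: "\<kappa> \<in> borel_measurable borel"
    and B: "\<And>t. t \<in> {l..u} \<Longrightarrow> \<bar>\<kappa> t\<bar> \<le> B" and lu: "l \<le> u"
  shows "L2 (avg l u \<kappa> v F)" "nrm2 (avg l u \<kappa> v F) \<le> (B * (u - l))\<^sup>2 * nrm2 F"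
proof -
  have [measurable]: "F \<in> borel_measurable borel" using F by (simp add: L2_def)
  have B0: "0 \<le> B" using B[of l] lu by (auto intro: order_trans[OF abs_ge_zero])
  have NF: "(\<integral>\<^sup>+x. ennreal ((F x)\<^sup>2) \<partial>lborel) = ennreal (nrm2 F)"
    using F unfolding nrm2_def L2_def by (intro nn_integral_eq_integral) auto
  have pt: "ennreal ((avg l u \<kappa> v F x)\<^sup>2)
      \<le> ennreal (B\<^sup>2 * (u - l)) * (\<integral>\<^sup>+t. indicator {l..u} t * ennreal ((F (x + t *\<^sub>R v))\<^sup>2) \<partial>lborel)" for x
  proof -
    have "ennreal \<bar>avg l u \<kappa> v F x\<bar> \<le> (\<integral>\<^sup>+t. ennreal \<bar>indicator {l..u} t * \<kappa> t * F (x + t *\<^sub>R v)\<bar> \<partial>lborel)"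
      unfolding avg_def using integral_norm_bound_ennreal[of lborel "\<lambda>t. indicator {l..u} t * \<kappa> t * F (x + t *\<^sub>R v)"]
      by (cases "integrable lborel (\<lambda>t. indicator {l..u} t * \<kappa> t * F (x + t *\<^sub>R v))")
         (auto simp: not_integrable_integral_eq)
    also have "\<dots> \<le> (\<integral>\<^sup>+t. (ennreal B * indicator {l..u} t) * (indicator {l..u} t * ennreal \<bar>F (x + t *\<^sub>R v)\<bar>) \<partial>lborel)"
      using B B0 by (intro nn_integral_mono) (auto simp: indicator_def abs_mult ennreal_mult[symmetric] intro!: ennreal_leI mult_right_mono)
    finally have "(ennreal \<bar>avg l u \<kappa> v F x\<bar>)\<^sup>2 \<le> (\<integral>\<^sup>+t. (ennreal B * indicator {l..u} t) * (indicator {l..u} t * ennreal \<bar>F (x + t *\<^sub>R v)\<bar>) \<partial>lborel)\<^sup>2"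
      by (rule power_mono) simp
    also have "\<dots> \<le> (\<integral>\<^sup>+t. (ennreal B * indicator {l..u} t)\<^sup>2 \<partial>lborel) * (\<integral>\<^sup>+t. (indicator {l..u} t * ennreal \<bar>F (x + t *\<^sub>R v)\<bar>)\<^sup>2 \<partial>lborel)"
      by (rule Cauchy_Schwarz_nn_integral) auto
    also have "(\<integral>\<^sup>+t. (ennreal B * indicator {l..u} t)\<^sup>2 \<partial>lborel) = ennreal (B\<^sup>2 * (u - l))"
    proof -
      have "(\<integral>\<^sup>+t. (ennreal B * indicator {l..u} t)\<^sup>2 \<partial>lborel) = (\<integral>\<^sup>+t. ennreal (B\<^sup>2) * indicator {l..u} t \<partial>lborel)"
        using B0 by (intro nn_integral_cong) (auto simp: indicator_def ennreal_power)
      also have "\<dots> = ennreal (B\<^sup>2) * ennreal (u - l)" using lu by (simp add: nn_integral_cmult_indicator)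
      finally show ?thesis using lu by (simp add: ennreal_mult)
    qed
    also have "(\<integral>\<^sup>+t. (indicator {l..u} t * ennreal \<bar>F (x + t *\<^sub>R v)\<bar>)\<^sup>2 \<partial>lborel)
        = (\<integral>\<^sup>+t. indicator {l..u} t * ennreal ((F (x + t *\<^sub>R v))\<^sup>2) \<partial>lborel)"
      by (intro nn_integral_cong) (auto simp: indicator_def ennreal_power)
    finally show ?thesis by (simp add: ennreal_power)
  qed
  have "(\<integral>\<^sup>+x. ennreal ((avg l u \<kappa> v F x)\<^sup>2) \<partial>lborel)
     \<le> (\<integral>\<^sup>+x. ennreal (B\<^sup>2 * (u - l)) * (\<integral>\<^sup>+t. indicator {l..u} t * ennreal ((F (x + t *\<^sub>R v))\<^sup>2) \<partial>lborel) \<partial>lborel)"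
    by (intro nn_integral_mono pt)
  also have "\<dots> = ennreal (B\<^sup>2 * (u - l)) * (\<integral>\<^sup>+x. \<integral>\<^sup>+t. indicator {l..u} t * ennreal ((F (x + t *\<^sub>R v))\<^sup>2) \<partial>lborel \<partial>lborel)"
    by (rule nn_integral_cmult) measurable
  also have "(\<integral>\<^sup>+x. \<integral>\<^sup>+t. indicator {l..u} t * ennreal ((F (x + t *\<^sub>R v))\<^sup>2) \<partial>lborel \<partial>lborel)
     = (\<integral>\<^sup>+t. \<integral>\<^sup>+x. indicator {l..u} t * ennreal ((F (x + t *\<^sub>R v))\<^sup>2) \<partial>lborel \<partial>lborel)"
    by (rule lborel_pair.Fubini'[symmetric]) measurable
  also have "\<dots> = (\<integral>\<^sup>+t. ennreal (nrm2 F) * indicator {l..u} t \<partial>lborel)"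
    by (intro nn_integral_cong) (simp add: nn_integral_cmult nn_shift NF mult.commute)
  also have "\<dots> = ennreal (nrm2 F) * ennreal (u - l)" using lu by (simp add: nn_integral_cmult_indicator)
  also have "ennreal (B\<^sup>2 * (u - l)) * \<dots> = ennreal ((B * (u - l))\<^sup>2 * nrm2 F)"
  proof -
    have "(B * (u - l))\<^sup>2 * nrm2 F = (B\<^sup>2 * (u - l)) * (nrm2 F * (u - l))" by (simp add: power2_eq_square)
    then show ?thesis using lu nrm2_nonneg[of F] by (simp only: ennreal_mult) (simp add: ennreal_mult)
  qed
  finally have le: "(\<integral>\<^sup>+x. ennreal ((avg l u \<kappa> v F x)\<^sup>2) \<partial>lborel) \<le> ennreal ((B * (u - l))\<^sup>2 * nrm2 F)" .
  have m: "avg l u \<kappa> v F \<in> borel_measurable borel" by (rule avg_measurable) auto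
  show L: "L2 (avg l u \<kappa> v F)"
    unfolding L2_def
  proof (intro conjI m integrableI_nonneg)
    show "(\<integral>\<^sup>+x. ennreal ((avg l u \<kappa> v F x)\<^sup>2) \<partial>lborel) < \<infinity>"
      using le by (rule le_less_trans) simp
  qed (use m in auto)
  have "ennreal (nrm2 (avg l u \<kappa> v F)) \<le> ennreal ((B * (u - l))\<^sup>2 * nrm2 F)"
    using le L unfolding nrm2_def[of "avg l u \<kappa> v F"] L2_def by (subst nn_integral_eq_integral[symmetric]) auto
  then show "nrm2 (avg l u \<kappa> v F) \<le> (B * (u - l))\<^sup>2 * nrm2 F"
    using nrm2_nonneg[of F] by (subst (asm) ennreal_le_iff) auto
qed

text \<open>Substituting \<open>x - t v\<close> for \<open>x\<close> in the double integral reverses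
  the direction of averaging. Fubini applies because
  \<open>\<bar>a * b\<bar> \<le> a\<^sup>2 + b\<^sup>2\<close> bounds the integrand by translates of
  integrable functions. This turns operations on test functions into operations on fields.\<close>

lemma avg_adjoint:
  fixes F g :: "'a::euclidean_space \<Rightarrow> real"
  assumes F: "L2 F" and g: "L2 g" and \<kappa>[measurable]: "\<kappa> \<in> borel_measurable borel"
    and B: "\<And>t. t \<in> {l..u} \<Longrightarrow> \<bar>\<kappa> t\<bar> \<le> B" and lu: "l \<le> u"
  shows "(\<integral>x. F x * avg l u \<kappa> v g x \<partial>lborel) = (\<integral>x. avg l u \<kappa> (- v) F x * g x \<partial>lborel)"
proof -
  have [measurable]: "F \<in> borel_measurable borel" "g \<in> borel_measurable borel" using F g by (auto simp: L2_def)
  have B0: "0 \<le> B" using B[of l] lu by (auto intro: order_trans[OF abs_ge_zero])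
  have NF: "(\<integral>\<^sup>+x. ennreal ((f x)\<^sup>2) \<partial>lborel) = ennreal (nrm2 f)" if "L2 f" for f :: "'a \<Rightarrow> real"
    using that unfolding nrm2_def L2_def by (intro nn_integral_eq_integral) auto
  define \<Psi> where "\<Psi> = (\<lambda>(x, t). indicator {l..u} t * \<kappa> t * F x * g (x + t *\<^sub>R v))"
  have [measurable]: "\<Psi> \<in> borel_measurable (lborel \<Otimes>\<^sub>M lborel)" unfolding \<Psi>_def split_beta by measurable
  have int: "integrable (lborel \<Otimes>\<^sub>M lborel) \<Psi>"
  proof (rule integrableI_bounded)
    have "(\<integral>\<^sup>+p. ennreal (norm (\<Psi> p)) \<partial>(lborel \<Otimes>\<^sub>M lborel)) = (\<integral>\<^sup>+t. \<integral>\<^sup>+x. ennreal (norm (\<Psi> (x, t))) \<partial>lborel \<partial>lborel)"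
      by (subst lborel_pair.nn_integral_snd[symmetric]) auto
    also have "\<dots> \<le> (\<integral>\<^sup>+t. \<integral>\<^sup>+x. ennreal B * indicator {l..u} t * (ennreal ((F x)\<^sup>2) + ennreal ((g (x + t *\<^sub>R v))\<^sup>2)) \<partial>lborel \<partial>lborel)"
    proof (intro nn_integral_mono)
      fix t :: real and x :: 'a
      have "\<bar>F x * g (x + t *\<^sub>R v)\<bar> \<le> (F x)\<^sup>2 + (g (x + t *\<^sub>R v))\<^sup>2"
        by (rule abs_mult_le_squares)
      then have "t \<in> {l..u} \<Longrightarrow> \<bar>\<kappa> t\<bar> * \<bar>F x * g (x + t *\<^sub>R v)\<bar> \<le> B * ((F x)\<^sup>2 + (g (x + t *\<^sub>R v))\<^sup>2)"
        using B B0 by (intro mult_mono) auto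
      then show "ennreal (norm (\<Psi> (x, t))) \<le> ennreal B * indicator {l..u} t * (ennreal ((F x)\<^sup>2) + ennreal ((g (x + t *\<^sub>R v))\<^sup>2))"
        using B0 by (auto simp: \<Psi>_def indicator_def abs_mult ennreal_mult[symmetric] ennreal_plus[symmetric] mult.assoc simp del: ennreal_plus intro!: ennreal_leI)
    qed
    also have "\<dots> = (\<integral>\<^sup>+t. ennreal B * (ennreal (nrm2 F) + ennreal (nrm2 g)) * indicator {l..u} t \<partial>lborel)"
      by (intro nn_integral_cong) (simp add: nn_integral_cmult nn_integral_add nn_shift NF F g mult_ac)
    also have "\<dots> < \<infinity>" using lu by (simp add: nn_integral_cmult_indicator ennreal_mult_less_top)
    finally show "(\<integral>\<^sup>+p. ennreal (norm (\<Psi> p)) \<partial>(lborel \<Otimes>\<^sub>M lborel)) < \<infinity>" .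
  qed measurable
  have "(\<integral>x. F x * avg l u \<kappa> v g x \<partial>lborel) = (\<integral>x. \<integral>t. \<Psi> (x, t) \<partial>lborel \<partial>lborel)"
    unfolding avg_def \<Psi>_def integral_mult_right_zero[symmetric]
    by (simp add: mult_ac)
  also have "\<dots> = (\<integral>t. \<integral>x. \<Psi> (x, t) \<partial>lborel \<partial>lborel)"
    using lborel_pair.Fubini_integral[of "\<lambda>x t. \<Psi> (x, t)"] int by simp
  also have "\<dots> = (\<integral>t. \<integral>x. \<Psi> (x + t *\<^sub>R (- v), t) \<partial>lborel \<partial>lborel)"
  proof (rule Bochner_Integration.integral_cong[OF refl])
    fix t :: real
    show "(\<integral>x. \<Psi> (x, t) \<partial>lborel) = (\<integral>x. \<Psi> (x + t *\<^sub>R (- v), t) \<partial>lborel)"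
      by (rule integral_translate[where F="\<lambda>x. \<Psi> (x, t)", symmetric]) measurable
  qed
  also have "\<dots> = (\<integral>x. \<integral>t. \<Psi> (x + t *\<^sub>R (- v), t) \<partial>lborel \<partial>lborel)"
  proof -
    have "integrable (lborel \<Otimes>\<^sub>M lborel) (\<lambda>(x, t). \<Psi> (x + t *\<^sub>R (- v), t))"
    proof (rule integrableI_bounded)
      have "(\<integral>\<^sup>+p. ennreal (norm (case p of (x, t) \<Rightarrow> \<Psi> (x + t *\<^sub>R (- v), t))) \<partial>(lborel \<Otimes>\<^sub>M lborel))
         = (\<integral>\<^sup>+t. \<integral>\<^sup>+x. ennreal (norm (\<Psi> (x + t *\<^sub>R (- v), t))) \<partial>lborel \<partial>lborel)"
        by (subst lborel_pair.nn_integral_snd[symmetric]) auto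
      also have "\<dots> = (\<integral>\<^sup>+t. \<integral>\<^sup>+x. ennreal (norm (\<Psi> (x, t))) \<partial>lborel \<partial>lborel)"
      proof (rule nn_integral_cong)
        fix t :: real
        have "(\<integral>\<^sup>+x. ennreal (norm (\<Psi> (x, t))) \<partial>distr lborel borel ((+) (t *\<^sub>R (- v)))) = (\<integral>\<^sup>+x. ennreal (norm (\<Psi> (t *\<^sub>R (- v) + x, t))) \<partial>lborel)"
          by (subst nn_integral_distr) auto
        then show "(\<integral>\<^sup>+x. ennreal (norm (\<Psi> (x + t *\<^sub>R (- v), t))) \<partial>lborel) = (\<integral>\<^sup>+x. ennreal (norm (\<Psi> (x, t))) \<partial>lborel)"
          by (simp only: lborel_distr_plus add.commute)
      qed
      also have "\<dots> = (\<integral>\<^sup>+p. ennreal (norm (\<Psi> p)) \<partial>(lborel \<Otimes>\<^sub>M lborel))"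
        by (subst lborel_pair.nn_integral_snd[symmetric]) auto
      also have "\<dots> < \<infinity>" using int by (simp add: integrable_iff_bounded)
      finally show "(\<integral>\<^sup>+p. ennreal (norm (case p of (x, t) \<Rightarrow> \<Psi> (x + t *\<^sub>R (- v), t))) \<partial>(lborel \<Otimes>\<^sub>M lborel)) < \<infinity>" .
    qed measurable
    from lborel_pair.Fubini_integral[OF this] show ?thesis by simp
  qed
  also have "\<dots> = (\<integral>x. avg l u \<kappa> (- v) F x * g x \<partial>lborel)"
    unfolding avg_def \<Psi>_def integral_mult_left_zero[symmetric]
    by (simp add: mult_ac)
  finally show ?thesis .
qed

section \<open>Potentials on annuli\<close>

lemma smooth_smear: "continuous_on UNIV \<kappa> \<Longrightarrow> smooth g \<Longrightarrow> smooth (smear l u \<kappa> v g)"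
  by (simp add: smooth_def Ck_smear)

lemma smooth_pd: "smooth g \<Longrightarrow> b \<in> Basis \<Longrightarrow> smooth (pd b g)"
  unfolding smooth_def using Ck_SucD(2) by blast

lemma smooth_continuous: "smooth g \<Longrightarrow> continuous_on UNIV g"
  unfolding smooth_def using Ck_imp_continuous by blast

lemma smooth_mult: "smooth f \<Longrightarrow> smooth g \<Longrightarrow> smooth (\<lambda>x. f x * g x)"
  by (simp add: smooth_def Ck_mult)

lemma smooth_add: "smooth f \<Longrightarrow> smooth g \<Longrightarrow> smooth (\<lambda>x. f x + g x)"
  by (simp add: smooth_def Ck_add)

lemma smooth_has_derivative: "smooth g \<Longrightarrow> (g has_derivative frechet_derivative g (at x)) (at x)"
  unfolding smooth_def using Ck_SucD(1) by blast

lemma pd_smear_smooth: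
  "continuous_on UNIV \<kappa> \<Longrightarrow> smooth g \<Longrightarrow> b \<in> Basis \<Longrightarrow> pd b (smear l u \<kappa> v g) = smear l u \<kappa> v (pd b g)"
  by (rule pd_smear) (auto simp: smooth_def simp del: Ck.simps)

lemma frechet_derivative_local:
  assumes "open U" "x \<in> U" "\<And>y. y \<in> U \<Longrightarrow> f y = g y"
  shows "frechet_derivative f (at x) = frechet_derivative g (at x)"
proof -
  have "(f has_derivative D) (at x) \<longleftrightarrow> (g has_derivative D) (at x)" for D
    using has_derivative_transform_within_open[OF _ assms(1,2), of f D UNIV g]
      has_derivative_transform_within_open[OF _ assms(1,2), of g D UNIV f] assms(3) by auto
  then show ?thesis unfolding frechet_derivative_def by simp
qed

text \<open>Integration by parts along the segment. The factor \<open>s\<close> is the speed at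
  which the segment is traversed: \<open>s = 1\<close> serves the mollifiers, \<open>s = h\<close>
  the shifts, whatever the sign of \<open>h\<close>.\<close>

lemma smear_parts:
  fixes g :: "'a::euclidean_space \<Rightarrow> real"
  assumes \<kappa>: "\<And>t. (\<kappa> has_real_derivative \<kappa>' t) (at t)" and \<kappa>': "continuous_on UNIV \<kappa>'"
    and g: "smooth g" and b: "b \<in> Basis" and lu: "l \<le> u"
  shows "s * smear l u \<kappa> (s *\<^sub>R b) (pd b g) x
    = \<kappa> u * g (x + (u * s) *\<^sub>R b) - \<kappa> l * g (x + (l * s) *\<^sub>R b) - smear l u \<kappa>' (s *\<^sub>R b) g x"
proof -
  have c\<kappa>: "continuous_on UNIV \<kappa>" by (rule DERIV_continuous_on[OF \<kappa>])
  have cg: "continuous_on UNIV g" "continuous_on UNIV (pd b g)"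
    using g b by (auto intro: smooth_continuous smooth_pd)
  have d: "((\<lambda>t. \<kappa> t * g (x + (t * s) *\<^sub>R b)) has_real_derivative
      (\<kappa>' t * g (x + (t * s) *\<^sub>R b) + s * (\<kappa> t * pd b g (x + (t * s) *\<^sub>R b)))) (at t)" for t
  proof -
    have "((\<lambda>t. x + (t * s) *\<^sub>R b) has_derivative (\<lambda>h. (h * s) *\<^sub>R b)) (at t)"
      by (auto intro!: derivative_eq_intros)
    from has_derivative_compose[OF this smooth_has_derivative[OF g]]
    have 1: "((\<lambda>t. g (x + (t * s) *\<^sub>R b)) has_derivative (\<lambda>h. frechet_derivative g (at (x + (t * s) *\<^sub>R b)) ((h * s) *\<^sub>R b))) (at t)" .
    have lin: "linear (frechet_derivative g (at y))" for y
      using has_derivative_bounded_linear[OF smooth_has_derivative[OF g]] by (rule bounded_linear.linear)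
    have "((\<lambda>t. g (x + (t * s) *\<^sub>R b)) has_real_derivative (s * pd b g (x + (t * s) *\<^sub>R b))) (at t)"
      by (rule has_derivative_imp_has_field_derivative[OF 1]) (simp add: linear_cmul[OF lin] mult_ac)
    from DERIV_mult[OF \<kappa>[of t] this] show ?thesis by (simp add: mult_ac add.commute)
  qed
  have "((\<lambda>t. \<kappa>' t * g (x + (t * s) *\<^sub>R b) + s * (\<kappa> t * pd b g (x + (t * s) *\<^sub>R b))) has_integral
     (\<kappa> u * g (x + (u * s) *\<^sub>R b) - \<kappa> l * g (x + (l * s) *\<^sub>R b))) {l..u}"
    by (rule fundamental_theorem_of_calculus[OF lu])
       (auto intro: has_field_derivative_at_within d simp: has_real_derivative_iff_has_vector_derivative[symmetric])
  moreover have i1: "(\<lambda>t. \<kappa>' t * g (x + (t * s) *\<^sub>R b)) integrable_on {l..u}"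
    by (intro integrable_continuous_interval continuous_intros continuous_on_compose2[OF cg(1)] continuous_on_subset[OF \<kappa>']) auto
  moreover have i2: "(\<lambda>t. \<kappa> t * pd b g (x + (t * s) *\<^sub>R b)) integrable_on {l..u}"
    by (intro integrable_continuous_interval continuous_intros continuous_on_compose2[OF cg(2)] continuous_on_subset[OF c\<kappa>]) auto
  ultimately have "integral {l..u} (\<lambda>t. \<kappa>' t * g (x + (t * s) *\<^sub>R b)) + s * integral {l..u} (\<lambda>t. \<kappa> t * pd b g (x + (t * s) *\<^sub>R b))
     = \<kappa> u * g (x + (u * s) *\<^sub>R b) - \<kappa> l * g (x + (l * s) *\<^sub>R b)"
    by (subst (asm) has_integral_integrable_integral)
       (simp add: Henstock_Kurzweil_Integration.integral_add integrable_on_mult_right)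
  then show ?thesis by (simp add: smear_def)
qed

text \<open>With a negative \<open>r1\<close> the lower bound is void, so that functions supported
  in a disk are covered too; this is used for kernels and for functions multiplied by a
  cutoff.\<close>

definition annular :: "'a::euclidean_space \<Rightarrow> real \<Rightarrow> real \<Rightarrow> ('a \<Rightarrow> real) set" where
  "annular c r1 r2 = {g. smooth g \<and> (\<forall>x. g x \<noteq> 0 \<longrightarrow> r1 \<le> norm (x - c) \<and> norm (x - c) \<le> r2)}"

lemma annular_smooth: "g \<in> annular c r1 r2 \<Longrightarrow> smooth g" by (simp add: annular_def)

lemma annular_mono: "g \<in> annular c r1 r2 \<Longrightarrow> s1 \<le> r1 \<Longrightarrow> r2 \<le> s2 \<Longrightarrow> g \<in> annular c s1 s2"
  by (force simp: annular_def)

lemma smear_nonzero: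
  assumes "smear l u \<kappa> v g x \<noteq> 0"
  obtains t where "t \<in> {l..u}" "g (x + t *\<^sub>R v) \<noteq> 0"
proof -
  have "\<exists>t\<in>{l..u}. g (x + t *\<^sub>R v) \<noteq> 0"
  proof (rule ccontr)
    assume "\<not> ?thesis"
    then have "smear l u \<kappa> v g x = integral {l..u} (\<lambda>t. 0)"
      unfolding smear_def by (intro Henstock_Kurzweil_Integration.integral_cong) auto
    then show False using assms by simp
  qed
  then show thesis using that by blast
qed

lemma annular_smear:
  assumes "continuous_on UNIV \<kappa>" and g: "g \<in> annular c r1 r2" and d: "\<And>t. t \<in> {l..u} \<Longrightarrow> norm (t *\<^sub>R v) \<le> d"
  shows "smear l u \<kappa> v g \<in> annular c (r1 - d) (r2 + d)"
  unfolding annular_def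
proof (safe)
  show "smooth (smear l u \<kappa> v g)" using assms annular_smooth smooth_smear by blast
  fix x assume "smear l u \<kappa> v g x \<noteq> 0"
  then obtain t where t: "t \<in> {l..u}" "g (x + t *\<^sub>R v) \<noteq> 0" by (rule smear_nonzero)
  then have "r1 \<le> norm (x + t *\<^sub>R v - c)" "norm (x + t *\<^sub>R v - c) \<le> r2" using g by (auto simp: annular_def)
  moreover have "norm (x + t *\<^sub>R v - c) \<le> norm (x - c) + norm (t *\<^sub>R v)"
    using norm_triangle_ineq[of "x - c" "t *\<^sub>R v"] by (simp add: algebra_simps)
  moreover have "norm (x - c) \<le> norm (x + t *\<^sub>R v - c) + norm (t *\<^sub>R v)"
    using norm_triangle_ineq4[of "x + t *\<^sub>R v - c" "t *\<^sub>R v"] by (simp add: algebra_simps)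
  ultimately show "r1 - d \<le> norm (x - c)" "norm (x - c) \<le> r2 + d" using d[OF t(1)] by linarith+
qed

lemma annular_pd:
  assumes g: "g \<in> annular c r1 r2" and b: "b \<in> Basis"
  shows "pd b g \<in> annular c r1 r2"
  unfolding annular_def
proof (safe)
  show "smooth (pd b g)" using g b annular_smooth smooth_pd by blast
  fix x assume nz: "pd b g x \<noteq> 0"
  have "r1 \<le> norm (x - c) \<and> norm (x - c) \<le> r2"
  proof (rule ccontr)
    assume out: "\<not> ?thesis"
    have "open ({x. norm (x - c) < r1} \<union> {x. r2 < norm (x - c)})"
      by (intro open_Un open_Collect_less continuous_intros)
    then have "frechet_derivative g (at x) = frechet_derivative (\<lambda>_. 0) (at x)"
      by (rule frechet_derivative_local) (use g out in \<open>force simp: annular_def\<close>)+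
    then show False using nz by simp
  qed
  then show "r1 \<le> norm (x - c)" "norm (x - c) \<le> r2" by auto
qed

lemma compact_support_integrable:
  fixes g :: "'a::euclidean_space \<Rightarrow> real"
  assumes "continuous_on UNIV g" "compact S" "\<And>x. g x \<noteq> 0 \<Longrightarrow> x \<in> S"
  shows "integrable lborel g"
proof -
  have "integrable lborel (\<lambda>x. indicator S x *\<^sub>R g x)"
    using assms by (intro borel_integrable_compact) (auto intro: continuous_on_subset)
  moreover have "(\<lambda>x. indicator S x *\<^sub>R g x) = g" using assms(3) by (auto simp: indicator_def fun_eq_iff)
  ultimately show ?thesis by simp
qed

lemma compact_support_L2:
  fixes g :: "'a::euclidean_space \<Rightarrow> real"
  assumes "continuous_on UNIV g" "compact S" "\<And>x. g x \<noteq> 0 \<Longrightarrow> x \<in> S"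
  shows "L2 g"
proof -
  have "integrable lborel (\<lambda>x. (g x)\<^sup>2)"
    by (rule compact_support_integrable[where S=S]) (use assms in \<open>auto intro!: continuous_intros\<close>)
  then show ?thesis using borel_measurable_continuous_onI[OF assms(1)] by (simp add: L2_def)
qed

lemma annular_L2: "g \<in> annular c r1 r2 \<Longrightarrow> L2 g"
  by (rule compact_support_L2[where S="cball c r2"])
     (auto simp: annular_def dist_norm norm_minus_commute intro: smooth_continuous)

lemma annular_integrable: "g \<in> annular c r1 r2 \<Longrightarrow> integrable lborel g"
  by (rule compact_support_integrable[where S="cball c r2"])
     (auto simp: annular_def dist_norm norm_minus_commute intro: smooth_continuous)

lemma smear_adjoint:
  assumes F: "L2 F" and g: "g \<in> annular c r1 r2" and \<kappa>: "continuous_on UNIV \<kappa>" and lu: "l \<le> u"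
  shows "(\<integral>x. F x * smear l u \<kappa> v g x \<partial>lborel) = (\<integral>x. avg l u \<kappa> (- v) F x * g x \<partial>lborel)"
proof -
  have "bounded (\<kappa> ` {l..u})"
    by (intro compact_imp_bounded compact_continuous_image continuous_on_subset[OF \<kappa>]) auto
  then obtain B where "\<forall>t\<in>{l..u}. \<bar>\<kappa> t\<bar> \<le> B" unfolding bounded_iff by auto
  from avg_adjoint[OF F annular_L2[OF g] borel_measurable_continuous_onI[OF \<kappa>] this[rule_format] lu, of v]
  show ?thesis using avg_eq_smear[OF \<kappa> smooth_continuous[OF annular_smooth[OF g]]] by simp
qed

text \<open>Oscillation at scale \<open>\<eta>\<close> controls the global oscillation on a compact
  connected set. The point is that \<open>N\<close> depends on \<open>S\<close> and
  \<open>\<eta>\<close> only and not on \<open>f\<close> or \<open>C\<close>.\<close>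

lemma chain_bound:
  fixes S :: "'a::metric_space set"
  assumes S: "compact S" "connected S" and \<eta>: "\<eta> > 0"
  shows "\<exists>N::nat. \<forall>f C y y'. (\<forall>y\<in>S. \<forall>y'\<in>S. dist y y' < \<eta> \<longrightarrow> \<bar>f y - f y'\<bar> \<le> (C::real)) \<and> y \<in> S \<and> y' \<in> S \<longrightarrow> \<bar>f y - f y'\<bar> \<le> real N * C"
proof (cases "S = {}")
  case False
  then obtain y0 where y0: "y0 \<in> S" by blast
  \<comment> \<open>Points reachable from \<open>y0\<close> by at most \<open>k\<close> jumps
    shorter than \<open>\<eta>\<close>. Their union is open and closed in \<open>S\<close>, hence
    all of \<open>S\<close>.\<close>
  define R where "R = rec_nat {y0} (\<lambda>_ A. {y\<in>S. \<exists>z\<in>A. dist y z < \<eta>})"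
  have R0: "R 0 = {y0}" and RS: "R (Suc k) = {y\<in>S. \<exists>z\<in>R k. dist y z < \<eta>}" for k
    by (simp_all add: R_def)
  have sub: "R k \<subseteq> S" for k using y0 by (cases k) (auto simp: R0 RS)
  have inc: "R k \<subseteq> R (Suc k)" for k
  proof
    fix y assume "y \<in> R k"
    then show "y \<in> R (Suc k)" using sub[of k] \<eta> by (auto simp: RS intro!: bexI[of _ y])
  qed
  have mono: "R i \<subseteq> R j" if "i \<le> j" for i j using lift_Suc_mono_le[of R, OF inc that] .
  define U where "U = (\<Union>k. R k)"
  have nb: "ball y \<eta> \<inter> S \<subseteq> R (Suc k)" if "y \<in> R k" for y k
    using that by (auto simp: RS dist_commute)
  have "openin (top_of_set S) U"
    unfolding openin_contains_ball
  proof (intro conjI ballI)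
    show "U \<subseteq> S" using sub by (auto simp: U_def)
    fix y assume "y \<in> U"
    then obtain k where "y \<in> R k" by (auto simp: U_def)
    then show "\<exists>e>0. ball y e \<inter> S \<subseteq> U" using nb \<eta> unfolding U_def by blast
  qed
  moreover have "openin (top_of_set S) (S - U)"
    unfolding openin_contains_ball
  proof (intro conjI ballI)
    show "S - U \<subseteq> S" by auto
    fix y assume y: "y \<in> S - U"
    have "ball y \<eta> \<inter> S \<subseteq> S - U"
    proof
      fix z assume z: "z \<in> ball y \<eta> \<inter> S"
      show "z \<in> S - U"
      proof (rule ccontr)
        assume "z \<notin> S - U"
        then obtain k where "z \<in> R k" using z by (auto simp: U_def)
        then have "y \<in> R (Suc k)" using z y by (auto simp: RS)
        then show False using y by (auto simp: U_def)
      qed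
    qed
    then show "\<exists>e>0. ball y e \<inter> S \<subseteq> S - U" using \<eta> by blast
  qed
  then have "closedin (top_of_set S) U"
    using \<open>openin (top_of_set S) U\<close> by (simp add: closedin_def openin_subset[of "top_of_set S" U, simplified])
  ultimately have "U = {} \<or> U = S" using S(2) unfolding connected_clopen by blast
  then have US: "U = S" using y0 R0 by (auto simp: U_def)
  \<comment> \<open>Compactness makes the number of jumps uniform over \<open>S\<close>.\<close>
  have "\<exists>N. S \<subseteq> (\<Union>y\<in>R N. ball y \<eta>)"
  proof -
    have "S \<subseteq> (\<Union>k\<in>UNIV. \<Union>y\<in>R k. ball y \<eta>)" using US \<eta> by (force simp: U_def)
    then obtain K where K: "finite K" "S \<subseteq> (\<Union>k\<in>K. \<Union>y\<in>R k. ball y \<eta>)"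
      using compactE_image[OF S(1), of UNIV "\<lambda>k. \<Union>y\<in>R k. ball y \<eta>"] by (metis open_UN open_ball)
    have "S \<subseteq> (\<Union>y\<in>R (Max K). ball y \<eta>)"
    proof
      fix z assume "z \<in> S"
      then obtain k y where k: "k \<in> K" "y \<in> R k" "z \<in> ball y \<eta>" using K(2) by blast
      have "R k \<subseteq> R (Max K)" by (rule mono) (simp add: K(1) k(1))
      then show "z \<in> (\<Union>y\<in>R (Max K). ball y \<eta>)" using k by blast
    qed
    then show ?thesis by (rule exI)
  qed
  then obtain N where N: "S \<subseteq> (\<Union>y\<in>R N. ball y \<eta>)" by blast
  show ?thesis
  \<comment> \<open>Each of the two points is joined to \<open>y0\<close> by \<open>Suc N\<close>
    jumps.\<close>
  proof (intro exI[of _ "2 * Suc N"] allI impI, elim conjE)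
    fix f :: "'a \<Rightarrow> real" and C y y'
    assume f: "\<forall>y\<in>S. \<forall>y'\<in>S. dist y y' < \<eta> \<longrightarrow> \<bar>f y - f y'\<bar> \<le> C" and y: "y \<in> S" "y' \<in> S"
    have k: "\<bar>f z - f y0\<bar> \<le> real k * C" if "z \<in> R k" for z k using that
    proof (induction k arbitrary: z)
      case 0 then show ?case by (simp add: R0)
    next
      case (Suc k)
      then obtain w where w: "w \<in> R k" "dist z w < \<eta>" "z \<in> S" by (auto simp: RS)
      then have "\<bar>f z - f w\<bar> \<le> C" using f sub by blast
      then show ?case using Suc.IH[OF w(1)] by (simp add: algebra_simps)
    qed
    have "z \<in> R (Suc N)" if "z \<in> S" for z using N that by (fastforce simp: RS dist_commute)
    from k[OF this[OF y(1)]] k[OF this[OF y(2)]]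
    show "\<bar>f y - f y'\<bar> \<le> real (2 * Suc N) * C" by (simp add: algebra_simps)
  qed
qed auto

text \<open>Splits planar Lebesgue measure along the axes, so that a mollification in each
  coordinate becomes one planar integral against a kernel.\<close>

lemma lborel_plane: "distr (lborel \<Otimes>\<^sub>M lborel) borel (\<lambda>(s, t). s *\<^sub>R e1 + t *\<^sub>R e2) = (lborel :: (real^2) measure)"
proof (rule lborel_eqI[symmetric])
  fix l u :: "real^2" assume "\<And>b. b \<in> Basis \<Longrightarrow> l \<bullet> b \<le> u \<bullet> b"
  from this[of e1] this[of e2] have le: "l $ 1 \<le> u $ 1" "l $ 2 \<le> u $ 2"
    by (auto simp: axis_in_Basis_iff inner_axis)
  have pre: "(\<lambda>(s, t). s *\<^sub>R e1 + t *\<^sub>R e2) -` box l u = {l $ 1<..<u $ 1} \<times> {l $ 2<..<u $ 2}"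
    by (auto simp: mem_box_cart forall_2 axis_def)
  have "emeasure (distr (lborel \<Otimes>\<^sub>M lborel) borel (\<lambda>(s, t). s *\<^sub>R e1 + t *\<^sub>R e2)) (box l u)
     = emeasure (lborel \<Otimes>\<^sub>M lborel) ({l $ 1<..<u $ 1} \<times> {l $ 2<..<u $ 2})"
    by (subst emeasure_distr) (auto simp: pre space_pair_measure)
  also have "\<dots> = ennreal ((u $ 1 - l $ 1) * (u $ 2 - l $ 2))"
    using le by (subst lborel.emeasure_pair_measure_Times) (auto simp: ennreal_mult)
  also have "(u $ 1 - l $ 1) * (u $ 2 - l $ 2) = (\<Prod>b\<in>Basis. (u - l) \<bullet> b)"
  proof -
    have B: "(Basis :: (real^2) set) = {e1, e2}" by (auto simp: Basis_vec_def UNIV_2)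
    have "e1 \<noteq> (e2 :: real^2)" by (simp add: axis_eq_axis)
    then show ?thesis unfolding B by (simp add: inner_axis)
  qed
  finally show "emeasure (distr (lborel \<Otimes>\<^sub>M lborel) borel (\<lambda>(s, t). s *\<^sub>R e1 + t *\<^sub>R e2)) (box l u)
     = ennreal (\<Prod>b\<in>Basis. (u - l) \<bullet> b)" .
qed simp

lemma e_basis [simp]: "(e1 :: real^2) \<in> Basis" "(e2 :: real^2) \<in> Basis"
  by (simp_all add: axis_in_Basis_iff)

lemma vec_nth_borel [measurable]: "(\<lambda>x::real^2. x $ i) \<in> borel_measurable borel"
  by (intro borel_measurable_continuous_onI continuous_intros)

lemma smooth_has_real_derivative:
  assumes "smooth (f :: real \<Rightarrow> real)" shows "(f has_real_derivative pd 1 f t) (at t)"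
proof -
  have l: "linear (frechet_derivative f (at t))"
    using has_derivative_bounded_linear[OF smooth_has_derivative[OF assms]] by (rule bounded_linear.linear)
  have "pd 1 f t * h = frechet_derivative f (at t) h" for h
    using linear_cmul[OF l, of h 1] by (metis mult.commute mult.right_neutral real_scaleR_def)
  then show ?thesis
    by (intro has_derivative_imp_has_field_derivative[OF smooth_has_derivative[OF assms]]) (metis mult.commute)
qed

section \<open>One-sided mollifiers and shifts along an axis\<close>

definition stepr :: "real \<Rightarrow> real \<Rightarrow> real" where "stepr \<rho> t = ramp (t / \<rho>)"
text \<open>A mollifier of unit mass supported in \<open>[0, \<rho>]\<close>. Starting from its
  primitive \<open>stepr\<close> makes the mollification error an exact derivative, see
  \<open>pd_K\<close>.\<close>

definition bump :: "real \<Rightarrow> real \<Rightarrow> real" where "bump \<rho> t = - pd 1 (stepr \<rho>) t"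

lemma smooth_stepr: "smooth (stepr \<rho>)"
proof -
  have "bounded_linear (\<lambda>t::real. t / \<rho>)" by (rule bounded_linear_divide)
  then show ?thesis
    unfolding smooth_def stepr_def[abs_def] by (intro allI Ck_compose[OF Ck_ramp Ck_linear])
qed

lemma smooth_bump: "smooth (bump \<rho>)"
proof -
  have "smooth (\<lambda>t. (-1) * pd 1 (stepr \<rho>) t)"
    by (intro smooth_mult smooth_pd smooth_stepr) (auto simp: smooth_def Ck_const)
  then show ?thesis by (simp add: bump_def[abs_def])
qed

lemma stepr: "\<rho> > 0 \<Longrightarrow> t \<le> 0 \<Longrightarrow> stepr \<rho> t = 1" "\<rho> > 0 \<Longrightarrow> \<rho> \<le> t \<Longrightarrow> stepr \<rho> t = 0"
  "0 \<le> stepr \<rho> t" "stepr \<rho> t \<le> 1"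
  by (auto simp: stepr_def ramp divide_le_0_iff)

lemma stepr_derivative: "(stepr \<rho> has_real_derivative - bump \<rho> t) (at t)"
  using smooth_has_real_derivative[OF smooth_stepr] by (simp add: bump_def)

lemma bump_zero:
  assumes \<rho>: "\<rho> > 0" and t: "t \<le> 0 \<or> \<rho> \<le> t"
  shows "bump \<rho> t = 0"
proof -
  have 1: "bump \<rho> t = 0" if "t \<in> {..<0}" for t
    using frechet_derivative_local[of "{..<0}" t "stepr \<rho>" "\<lambda>_. 1"] that stepr(1)[OF \<rho>] by (simp add: bump_def)
  have 2: "bump \<rho> t = 0" if "t \<in> {\<rho><..}" for t
    using frechet_derivative_local[of "{\<rho><..}" t "stepr \<rho>" "\<lambda>_. 0"] that stepr(2)[OF \<rho>] by (simp add: bump_def)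
  have c: "continuous_on S (bump \<rho>)" for S
    using smooth_continuous[OF smooth_bump] by (rule continuous_on_subset) simp
  show ?thesis
    using t
  proof
    assume "t \<le> 0"
    then have "t \<in> closure {..<0}" by simp
    then show ?thesis using continuous_constant_on_closure[of "{..<0}" "bump \<rho>" 0 t] c 1 by blast
  next
    assume "\<rho> \<le> t"
    then have "t \<in> closure {\<rho><..}" by simp
    then show ?thesis using continuous_constant_on_closure[of "{\<rho><..}" "bump \<rho>" 0 t] c 2 by blast
  qed
qed

text \<open>Mollifying along \<open>b\<close> changes \<open>g\<close> by a
  \<open>b\<close>-derivative, and an error of this form can be inserted into a curl condition. The
  weight \<open>stepr \<rho>\<close> has mass at most \<open>\<rho>\<close>, which makes the error
  small.\<close>

lemma pd_K:
  assumes \<rho>: "\<rho> > 0" and g: "smooth g" and b: "b \<in> Basis"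
  shows "pd b (smear 0 \<rho> (stepr \<rho>) b g) x = smear 0 \<rho> (bump \<rho>) b g x - g x"
proof -
  have c: "continuous_on UNIV (\<lambda>t. - bump \<rho> t)"
    by (intro continuous_intros smooth_continuous smooth_bump)
  have "smear 0 \<rho> (\<lambda>t. - bump \<rho> t) b g x = - smear 0 \<rho> (bump \<rho>) b g x" by (simp add: smear_def)
  then show ?thesis
    using smear_parts[OF stepr_derivative c g b, of 0 \<rho> 1 x] \<rho> stepr(1,2)[OF \<rho>]
    by (simp add: fun_cong[OF pd_smear_smooth[OF smooth_continuous[OF smooth_stepr] g b]])
qed

text \<open>After mollification the derivative falls on the kernel instead of on \<open>g\<close>,
  at the price of a constant that depends on \<open>\<rho>\<close>.\<close>

lemma pd_M:
  assumes \<rho>: "\<rho> > 0" and g: "smooth g" and b: "b \<in> Basis"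
  shows "pd b (smear 0 \<rho> (bump \<rho>) b g) x = - smear 0 \<rho> (pd 1 (bump \<rho>)) b g x"
proof -
  have c: "continuous_on UNIV (pd 1 (bump \<rho>))"
    by (intro smooth_continuous smooth_pd smooth_bump) simp
  show ?thesis
    using smear_parts[OF smooth_has_real_derivative[OF smooth_bump] c g b, of 0 \<rho> 1 x] \<rho> bump_zero[OF \<rho>]
    by (simp add: fun_cong[OF pd_smear_smooth[OF smooth_continuous[OF smooth_bump] g b]])
qed

text \<open>The integral of \<open>g\<close> along the segment from \<open>x\<close> to
  \<open>x + h b\<close>, parametrized over \<open>[0, 1]\<close> so that negative \<open>h\<close>
  needs no separate treatment. Its \<open>b\<close>-derivative is the increment of \<open>g\<close>
  over the step \<open>h\<close>.\<close>

definition shifts :: "'a \<Rightarrow> real \<Rightarrow> ('a::euclidean_space \<Rightarrow> real) \<Rightarrow> 'a \<Rightarrow> real" where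
  "shifts b h = smear 0 1 (\<lambda>_. h) (h *\<^sub>R b)"

lemma pd_shifts:
  assumes g: "smooth g" and b: "b \<in> Basis"
  shows "pd b (shifts b h g) x = g (x + h *\<^sub>R b) - g x"
proof -
  have "h * smear 0 1 (\<lambda>_. 1) (h *\<^sub>R b) (pd b g) x = 1 * g (x + (1 * h) *\<^sub>R b) - 1 * g (x + (0 * h) *\<^sub>R b) - smear 0 1 (\<lambda>_. 0) (h *\<^sub>R b) g x"
    by (rule smear_parts) (use g b in \<open>auto intro!: derivative_eq_intros\<close>)
  moreover have "smear 0 1 (\<lambda>_. h) (h *\<^sub>R b) (pd b g) x = h * smear 0 1 (\<lambda>_. 1) (h *\<^sub>R b) (pd b g) x"
    by (simp add: smear_def)
  moreover have "smear 0 1 (\<lambda>_. 0) (h *\<^sub>R b) g x = 0" by (simp add: smear_def)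
  ultimately show ?thesis by (simp add: shifts_def fun_cong[OF pd_smear_smooth[OF continuous_on_const g b]])
qed

lemma pd_shifts': "smooth g \<Longrightarrow> d \<in> Basis \<Longrightarrow> pd d (shifts b h g) = shifts b h (pd d g)"
  unfolding shifts_def by (rule pd_smear_smooth) auto

lemma annular_shifts:
  assumes g: "g \<in> annular c r1 r2" and b: "b \<in> Basis" and h: "\<bar>h\<bar> \<le> D"
  shows "shifts b h g \<in> annular c (r1 - D) (r2 + D)"
  unfolding shifts_def
proof (rule annular_smear[OF continuous_on_const g])
  fix t :: real assume "t \<in> {0..1}"
  then have "\<bar>t\<bar> * \<bar>h\<bar> \<le> 1 * \<bar>h\<bar>" by (intro mult_right_mono) auto
  then show "norm (t *\<^sub>R h *\<^sub>R b) \<le> D" using b h by (simp add: abs_mult)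
qed

lemma annular_smear_axis:
  assumes g: "g \<in> annular c r1 r2" and b: "b \<in> Basis" and \<kappa>: "continuous_on UNIV \<kappa>" and h: "\<rho> \<le> D"
  shows "smear 0 \<rho> \<kappa> b g \<in> annular c (r1 - D) (r2 + D)"
  by (rule annular_smear[OF \<kappa> g]) (use b h in auto)

text \<open>The kernel of mollifying in both coordinates, as \<open>kern_repr\<close> shows. For
  fixed \<open>y\<close> it is itself a test function of \<open>x\<close>, concentrated near
  \<open>y\<close>, so curl conditions can be tested with it.\<close>

definition kern :: "real \<Rightarrow> real^2 \<Rightarrow> real^2 \<Rightarrow> real" where
  "kern \<rho> y x = bump \<rho> (y $ 1 - x $ 1) * bump \<rho> (y $ 2 - x $ 2)"

lemma bump_borel [measurable]: "bump \<rho> \<in> borel_measurable borel"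
  by (intro borel_measurable_continuous_onI smooth_continuous smooth_bump)

lemma kern_measurable [measurable]: "(\<lambda>(y, x). kern \<rho> y x) \<in> borel_measurable (borel \<Otimes>\<^sub>M borel)"
  unfolding kern_def split_beta by measurable

lemma kern_near:
  assumes \<rho>: "\<rho> > 0" and nz: "kern \<rho> y x \<noteq> 0"
  shows "norm (x - y) \<le> 2 * \<rho>"
proof -
  have "0 < y $ 1 - x $ 1" "y $ 1 - x $ 1 < \<rho>" "0 < y $ 2 - x $ 2" "y $ 2 - x $ 2 < \<rho>"
    using nz bump_zero[OF \<rho>] unfolding kern_def by (metis mult_eq_0_iff not_le)+
  then have "(\<Sum>i\<in>UNIV. \<bar>(x - y) $ i\<bar>) \<le> 2 * \<rho>" by (simp add: UNIV_2)
  then show ?thesis using norm_le_l1_cart[of "x - y"] by linarith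
qed

lemma smooth_kern: "smooth (kern \<rho> y)"
proof -
  have l: "smooth (\<lambda>x::real^2. y $ i - x $ i)" for i
  proof -
    have "bounded_linear (\<lambda>x::real^2. - (x $ i))" by (intro bounded_linear_minus bounded_linear_vec_nth)
    from Ck_add[OF Ck_const[where c="y $ i"] Ck_linear[OF this]] show ?thesis by (simp add: smooth_def)
  qed
  have "smooth (\<lambda>x::real^2. bump \<rho> (y $ i - x $ i))" for i
    using Ck_compose[of _ "bump \<rho>" "\<lambda>x::real^2. y $ i - x $ i"] smooth_bump[of \<rho>] l[of i] by (simp add: smooth_def)
  then show ?thesis unfolding kern_def[abs_def] by (intro smooth_mult)
qed

lemma bump_bounded: "\<rho> > 0 \<Longrightarrow> \<exists>B\<ge>0. \<forall>t. \<bar>bump \<rho> t\<bar> \<le> B"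
proof -
  assume \<rho>: "\<rho> > 0"
  have "bounded (bump \<rho> ` {0..\<rho>})"
    by (intro compact_imp_bounded compact_continuous_image continuous_on_subset[OF smooth_continuous[OF smooth_bump]]) auto
  then obtain B where B: "\<forall>t\<in>{0..\<rho>}. \<bar>bump \<rho> t\<bar> \<le> B" unfolding bounded_iff by auto
  have "\<bar>bump \<rho> t\<bar> \<le> \<bar>B\<bar>" for t using B bump_zero[OF \<rho>, of t] by (cases "t \<in> {0..\<rho>}") force+
  then show ?thesis by (intro exI[of _ "\<bar>B\<bar>"]) auto
qed

lemma dbump_bounded: "\<rho> > 0 \<Longrightarrow> \<exists>B\<ge>0. \<forall>t. \<bar>pd 1 (bump \<rho>) t\<bar> \<le> B"
proof -
  assume \<rho>: "\<rho> > 0"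
  have "continuous_on UNIV (pd 1 (bump \<rho>))" by (intro smooth_continuous smooth_pd smooth_bump) simp
  then have "bounded (pd 1 (bump \<rho>) ` {0..\<rho>})"
    by (intro compact_imp_bounded compact_continuous_image) (auto intro: continuous_on_subset)
  then obtain B where B: "\<forall>t\<in>{0..\<rho>}. \<bar>pd 1 (bump \<rho>) t\<bar> \<le> B" unfolding bounded_iff by auto
  have out: "pd 1 (bump \<rho>) t = 0" if "t < 0 \<or> \<rho> < t" for t
  proof -
    have "open ({..<0} \<union> {\<rho><..} :: real set)" by auto
    then have "frechet_derivative (bump \<rho>) (at t) = frechet_derivative (\<lambda>_. 0) (at t)"
      by (rule frechet_derivative_local) (use that bump_zero[OF \<rho>] in auto)
    then show ?thesis by simp
  qed
  have "\<bar>pd 1 (bump \<rho>) t\<bar> \<le> \<bar>B\<bar>" for t using B out[of t] by (cases "t \<in> {0..\<rho>}") force+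
  then show ?thesis by (intro exI[of _ "\<bar>B\<bar>"]) auto
qed

lemma kern_repr:
  fixes g :: "real^2 \<Rightarrow> real"
  assumes \<rho>: "\<rho> > 0" and g: "g \<in> annular c r1 r2"
  shows "smear 0 \<rho> (bump \<rho>) e1 (smear 0 \<rho> (bump \<rho>) e2 g) x = (\<integral>y. kern \<rho> y x * g y \<partial>lborel)"
proof -
  have cb: "continuous_on UNIV (bump \<rho>)" by (rule smooth_continuous[OF smooth_bump])
  have cg: "continuous_on UNIV g" using g by (intro smooth_continuous annular_smooth)
  have [measurable]: "g \<in> borel_measurable borel" by (rule borel_measurable_continuous_onI[OF cg])
  have ind: "indicator {0..\<rho>} t * bump \<rho> t = bump \<rho> t" for t
    using bump_zero[OF \<rho>, of t] by (cases "t \<le> 0 \<or> \<rho> \<le> t") (auto simp: indicator_def)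
  have ckern: "continuous_on UNIV (\<lambda>y. kern \<rho> y x)"
    unfolding kern_def by (intro continuous_intros continuous_on_compose2[OF cb]) auto
  define G where "G y = kern \<rho> y x * g y" for y
  have iG: "integrable lborel G"
    by (rule compact_support_integrable[where S="cball c r2"])
       (use g in \<open>auto simp: G_def annular_def dist_norm norm_minus_commute intro!: continuous_intros ckern cg\<close>)
  have mG[measurable]: "G \<in> borel_measurable borel"
    unfolding G_def by (intro borel_measurable_continuous_onI continuous_intros ckern cg)
  have "smear 0 \<rho> (bump \<rho>) e1 (smear 0 \<rho> (bump \<rho>) e2 g) x
      = (\<integral>s. bump \<rho> s * (\<integral>t. bump \<rho> t * g (x + s *\<^sub>R e1 + t *\<^sub>R e2) \<partial>lborel) \<partial>lborel)"
    using avg_eq_smear[OF cb smear_continuous[OF cb cg, of 0 \<rho> e2], of 0 \<rho> e1]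
      avg_eq_smear[OF cb cg, of 0 \<rho> e2]
    by (simp add: avg_def[abs_def] ind fun_eq_iff)
  also have "\<dots> = (\<integral>s. \<integral>t. G (x + (s *\<^sub>R e1 + t *\<^sub>R e2)) \<partial>lborel \<partial>lborel)"
    unfolding integral_mult_right_zero[symmetric]
    by (intro Bochner_Integration.integral_cong refl) (simp add: G_def kern_def axis_def mult_ac add_ac)
  also have "\<dots> = (\<integral>p. G (x + (fst p *\<^sub>R e1 + snd p *\<^sub>R e2)) \<partial>(lborel \<Otimes>\<^sub>M lborel))"
  proof -
    have "integrable lborel (\<lambda>y. G (x + y))"
    proof -
      have "integrable (distr lborel borel ((+) x)) G" using iG by (simp add: lborel_distr_plus)
      then show ?thesis by (subst (asm) integrable_distr_eq) auto
    qed
    then have "integrable (distr (lborel \<Otimes>\<^sub>M lborel) borel (\<lambda>(s, t). s *\<^sub>R e1 + t *\<^sub>R e2)) (\<lambda>y. G (x + y))"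
      by (simp add: lborel_plane)
    then have "integrable (lborel \<Otimes>\<^sub>M lborel) (\<lambda>(s, t). G (x + (s *\<^sub>R e1 + t *\<^sub>R e2)))"
      by (subst (asm) integrable_distr_eq) (simp_all add: case_prod_beta')
    from lborel_pair.integral_fst[OF this] show ?thesis by (simp add: case_prod_beta')
  qed
  also have "\<dots> = (\<integral>y. G (x + y) \<partial>distr (lborel \<Otimes>\<^sub>M lborel) borel (\<lambda>(s, t). s *\<^sub>R e1 + t *\<^sub>R e2))"
    by (subst integral_distr) (simp_all add: case_prod_beta')
  also have "\<dots> = (\<integral>y. G (y + x) \<partial>lborel)" by (simp add: lborel_plane add.commute)
  also have "\<dots> = (\<integral>y. G y \<partial>lborel)" by (rule integral_translate) measurable
  finally show ?thesis by (simp add: G_def)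
qed

lemma kern_fubini:
  fixes g p :: "real^2 \<Rightarrow> real"
  assumes \<rho>: "\<rho> > 0" and g: "g \<in> annular c r1 r2" and p: "L2 p"
  shows "(\<integral>x. p x * (\<integral>y. kern \<rho> y x * g y \<partial>lborel) \<partial>lborel) = (\<integral>y. (\<integral>x. p x * kern \<rho> y x \<partial>lborel) * g y \<partial>lborel)"
proof -
  have cg: "continuous_on UNIV g" using g by (intro smooth_continuous annular_smooth)
  have [measurable]: "g \<in> borel_measurable borel" by (rule borel_measurable_continuous_onI[OF cg])
  have [measurable]: "p \<in> borel_measurable borel" using p by (simp add: L2_def)
  have [measurable]: "(\<lambda>(x, y). kern \<rho> y x) \<in> borel_measurable (borel \<Otimes>\<^sub>M borel)"
    unfolding kern_def split_beta by measurable
  obtain B where B: "B \<ge> 0" "\<And>t. \<bar>bump \<rho> t\<bar> \<le> B" using bump_bounded[OF \<rho>] by blast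
  define R where "R = r2 + 2 * \<rho>"
  \<comment> \<open>Only the values of \<open>p\<close> where \<open>kern \<rho> y x * g y\<close>
    can be nonzero matter; they lie in a ball, on which the square-integrable \<open>p\<close> is
    integrable.\<close>
  define q where "q x = indicator (cball c R) x * p x" for x
  have [measurable]: "q \<in> borel_measurable borel"
    unfolding q_def[abs_def] using p by (intro borel_measurable_times borel_measurable_indicator) (auto simp: L2_def)
  have "(\<lambda>x. (indicator (cball c R) x)\<^sup>2) = (indicator (cball c R) :: real^2 \<Rightarrow> real)"
    by (auto simp: indicator_def fun_eq_iff)
  moreover have "integrable lborel (indicator (cball c R) :: real^2 \<Rightarrow> real)"
    by (intro integrable_real_indicator emeasure_bounded_finite) auto
  ultimately have "L2 (indicator (cball c R) :: real^2 \<Rightarrow> real)" by (simp add: L2_def)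
  from L2_mult_integrable[OF this p] have iq: "integrable lborel q" by (simp add: q_def[abs_def])
  have ig: "integrable lborel g" using g by (rule annular_integrable)
  define J where "J = (\<lambda>(x, y). p x * kern \<rho> y x * g y)"
  have [measurable]: "J \<in> borel_measurable (lborel \<Otimes>\<^sub>M lborel)" unfolding J_def split_beta by measurable
  have bound: "norm (J (x, y)) \<le> norm (B * B * (q x * g y))" for x y
  proof (cases "kern \<rho> y x = 0 \<or> g y = 0")
    case False
    have "norm (y - c) \<le> r2" using False g by (auto simp: annular_def)
    moreover have "norm (x - y) \<le> 2 * \<rho>" using kern_near[OF \<rho>] False by blast
    ultimately have "norm (x - c) \<le> R" unfolding R_def using norm_triangle_ineq[of "x - y" "y - c"] by simp
    then have "q x = p x" by (simp add: q_def dist_norm norm_minus_commute)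
    moreover have "\<bar>kern \<rho> y x\<bar> \<le> B * B" unfolding kern_def abs_mult using B by (intro mult_mono) auto
    ultimately have "\<bar>kern \<rho> y x\<bar> * (\<bar>p x\<bar> * \<bar>g y\<bar>) \<le> (B * B) * (\<bar>q x\<bar> * \<bar>g y\<bar>)"
      by (intro mult_mono) auto
    then show ?thesis using B unfolding J_def by (simp add: abs_mult mult_ac)
  qed (auto simp: J_def)
  have int: "integrable (lborel \<Otimes>\<^sub>M lborel) J"
  proof (rule lborel_pair.Fubini_integrable)
    show "AE x in lborel. integrable lborel (\<lambda>y. J (x, y))"
    proof (intro AE_I2)
      fix x
      have "integrable lborel (\<lambda>y. B * B * (q x * g y))" using ig by simp
      then show "integrable lborel (\<lambda>y. J (x, y))"
        by (rule Bochner_Integration.integrable_bound) (use bound in auto)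
    qed
    have "integrable lborel (\<lambda>x. B * B * (\<bar>q x\<bar> * (\<integral>y. \<bar>g y\<bar> \<partial>lborel)))" using iq by simp
    then show "integrable lborel (\<lambda>x. \<integral>y. norm (J (x, y)) \<partial>lborel)"
    proof (rule Bochner_Integration.integrable_bound)
      show "AE x in lborel. norm (\<integral>y. norm (J (x, y)) \<partial>lborel) \<le> norm (B * B * (\<bar>q x\<bar> * (\<integral>y. \<bar>g y\<bar> \<partial>lborel)))"
      proof (intro AE_I2)
        fix x
        have i: "integrable lborel (\<lambda>y. norm (B * B * (q x * g y)))" using ig by simp
        have "(\<integral>y. norm (J (x, y)) \<partial>lborel) \<le> (\<integral>y. norm (B * B * (q x * g y)) \<partial>lborel)"
          by (rule integral_mono'[OF i]) (use bound in auto)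
        then show "norm (\<integral>y. norm (J (x, y)) \<partial>lborel) \<le> norm (B * B * (\<bar>q x\<bar> * (\<integral>y. \<bar>g y\<bar> \<partial>lborel)))"
          using B by (simp add: abs_mult mult_ac)
      qed
    qed measurable
  qed measurable
  have "(\<integral>x. p x * (\<integral>y. kern \<rho> y x * g y \<partial>lborel) \<partial>lborel) = (\<integral>x. \<integral>y. J (x, y) \<partial>lborel \<partial>lborel)"
    unfolding integral_mult_right_zero[symmetric]
    by (intro Bochner_Integration.integral_cong refl) (simp add: J_def mult_ac)
  also have "\<dots> = (\<integral>y. \<integral>x. J (x, y) \<partial>lborel \<partial>lborel)"
    using lborel_pair.Fubini_integral[of "\<lambda>x y. J (x, y)"] int by simp
  also have "\<dots> = (\<integral>y. (\<integral>x. p x * kern \<rho> y x \<partial>lborel) * g y \<partial>lborel)"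
    by (simp add: J_def)
  finally show ?thesis .
qed

text \<open>For the rows \<open>p = \<nabla>u\<^sub>1\<close> and
  \<open>q = \<nabla>u\<^sub>2\<close> both derivatives of
  \<open>p2 = \<partial>\<^sub>2u\<^sub>1\<close> are combinations of derivatives of strain entries:
  \<open>\<partial>\<^sub>1p2 = \<partial>\<^sub>2p1\<close> and \<open>\<partial>\<^sub>2p2 =
  \<partial>\<^sub>2(p2 + q1) - \<partial>\<^sub>1q2\<close>. After mollification the outer
  derivatives fall on the kernel, so the gradient of the mollified \<open>p2\<close> is bounded by
  the strain, and on a connected annulus the function is constant up to the strain.\<close>

lemma mollified_almost_constant:
  fixes c :: "real^2"
  assumes D: "D > 0" and \<rho>: "0 < \<rho>" "\<rho> \<le> D" and s: "0 < s1" "s1 \<le> s2" "a0 \<le> s1 - 5 * D" "s2 + 5 * D \<le> b0"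
  obtains C where "C \<ge> 0" and "\<And>p1 p2 q1 q2. L2 p1 \<Longrightarrow> L2 p2 \<Longrightarrow> L2 q1 \<Longrightarrow> L2 q2 \<Longrightarrow>
    (\<And>\<zeta>. \<zeta> \<in> annular c a0 b0 \<Longrightarrow> (\<integral>x. p2 x * pd e1 \<zeta> x \<partial>lborel) = (\<integral>x. p1 x * pd e2 \<zeta> x \<partial>lborel)) \<Longrightarrow>
    (\<And>\<zeta>. \<zeta> \<in> annular c a0 b0 \<Longrightarrow> (\<integral>x. q2 x * pd e1 \<zeta> x \<partial>lborel) = (\<integral>x. q1 x * pd e2 \<zeta> x \<partial>lborel)) \<Longrightarrow>
    \<exists>w k. L2 w \<and> nrm2 w \<le> C * (nrm2 p1 + nrm2 q2 + nrm2 (\<lambda>x. p2 x + q1 x)) \<and>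
      (\<forall>g\<in>annular c s1 s2. (\<integral>x. p2 x * smear 0 \<rho> (bump \<rho>) e1 (smear 0 \<rho> (bump \<rho>) e2 g) x \<partial>lborel)
         = (\<integral>x. w x * g x \<partial>lborel) + k * (\<integral>x. g x \<partial>lborel))"
proof -
  define S where "S = {x. s1 \<le> norm (x - c) \<and> norm (x - c) \<le> s2}"
  have "S = cball c s2 \<inter> - ball c s1" by (auto simp: S_def dist_norm norm_minus_commute)
  then have cS: "compact S" by (simp add: compact_Int_closed closed_Compl)
  have conS: "connected S" unfolding S_def by (rule connected_annulus) simp
  obtain N :: nat where N: "\<And>f C y y'. (\<forall>y\<in>S. \<forall>y'\<in>S. dist y y' < D \<longrightarrow> \<bar>f y - f y'\<bar> \<le> (C::real)) \<Longrightarrow> y \<in> S \<Longrightarrow> y' \<in> S \<Longrightarrow> \<bar>f y - f y'\<bar> \<le> real N * C"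
    using chain_bound[OF cS conS D] by metis
  \<comment> \<open>Controls the kernel gradients at all centres \<open>y\<close>, since
    \<open>kern \<rho> y\<close> is a translate of \<open>kern \<rho> 0\<close>.\<close>
  define Q where "Q = nrm2 (pd e1 (kern \<rho> 0)) + nrm2 (pd e2 (kern \<rho> 0))"
  have Q0: "0 \<le> Q" unfolding Q_def by (intro add_nonneg_nonneg nrm2_nonneg)
  have kern0: "kern \<rho> 0 \<in> annular 0 (-1) (2 * \<rho>)"
    using kern_near[OF \<rho>(1), of 0] by (auto simp: annular_def smooth_kern intro: order_trans[OF _ norm_ge_zero])
  have kern_tr: "kern \<rho> y = (\<lambda>x. kern \<rho> 0 (x + (- y)))" for y by (simp add: kern_def fun_eq_iff)
  have pdk: "L2 (pd b (kern \<rho> y))" "nrm2 (pd b (kern \<rho> y)) \<le> Q" if b: "b = e1 \<or> b = e2" for b y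
  proof -
    have "pd b (kern \<rho> y) = (\<lambda>x. pd b (kern \<rho> 0) (x + (- y)))"
      unfolding kern_tr[of y] by (rule pd_translate) (use smooth_has_derivative[OF smooth_kern] in \<open>auto simp: differentiable_def\<close>)
    moreover have "L2 (pd b (kern \<rho> 0))" using annular_L2[OF annular_pd[OF kern0]] b by auto
    ultimately show "L2 (pd b (kern \<rho> y))" "nrm2 (pd b (kern \<rho> y)) \<le> Q"
      using L2_translate[of "pd b (kern \<rho> 0)" "- y"] b nrm2_nonneg[of "pd e1 (kern \<rho> 0)"] nrm2_nonneg[of "pd e2 (kern \<rho> 0)"]
      by (auto simp: Q_def)
  qed
  have shiftb: "L2 (shifts b h G)" "nrm2 (shifts b h G) \<le> D\<^sup>2 * Q"
    if "\<bar>h\<bar> \<le> D" "L2 G" "nrm2 G \<le> Q" "continuous_on UNIV G" for b :: "real^2" and h G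
  proof -
    have eq: "shifts b h G = avg 0 1 (\<lambda>_. h) (h *\<^sub>R b) G"
      unfolding shifts_def using that(4) by (intro avg_eq_smear[symmetric]) auto
    have "h\<^sup>2 \<le> D\<^sup>2" using that(1) D by (simp add: abs_le_square_iff[symmetric])
    then have "h\<^sup>2 * nrm2 G \<le> D\<^sup>2 * Q" using that(3) nrm2_nonneg[of G] by (intro mult_mono) auto
    then show "L2 (shifts b h G)" "nrm2 (shifts b h G) \<le> D\<^sup>2 * Q"
      using L2_avg[OF that(2), of "\<lambda>_. h" 0 1 "\<bar>h\<bar>" "h *\<^sub>R b"] unfolding eq by auto
  qed
  define A where "A = measure lborel S"
  \<comment> \<open>A jump changes \<open>P\<close> by at most \<open>3 * E\<close> with
    \<open>E\<^sup>2 = D\<^sup>2 * Q * e\<close>, there are \<open>N\<close> jumps, and the squared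
    deviation is integrated over \<open>S\<close>.\<close>
  define C where "C = (3 * real N)\<^sup>2 * (D\<^sup>2 * Q) * A"
  have iS: "integrable lborel (indicator S :: _ \<Rightarrow> real)"
    by (intro integrable_real_indicator emeasure_bounded_finite compact_imp_bounded cS) (use cS in \<open>auto simp: borel_compact\<close>)
  have A: "(\<integral>x. indicator S x \<partial>lborel) = A" using cS by (simp add: A_def borel_compact)
  show thesis
  proof (rule that[of C])
    show "0 \<le> C" using Q0 by (simp add: C_def A_def)
    fix p1 p2 q1 q2 :: "real^2 \<Rightarrow> real"
    assume L: "L2 p1" "L2 p2" "L2 q1" "L2 q2"
      and pc: "\<And>\<zeta>. \<zeta> \<in> annular c a0 b0 \<Longrightarrow> (\<integral>x. p2 x * pd e1 \<zeta> x \<partial>lborel) = (\<integral>x. p1 x * pd e2 \<zeta> x \<partial>lborel)"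
      and qc: "\<And>\<zeta>. \<zeta> \<in> annular c a0 b0 \<Longrightarrow> (\<integral>x. q2 x * pd e1 \<zeta> x \<partial>lborel) = (\<integral>x. q1 x * pd e2 \<zeta> x \<partial>lborel)"
    define e where "e = nrm2 p1 + nrm2 q2 + nrm2 (\<lambda>x. p2 x + q1 x)"
    have e: "nrm2 p1 \<le> e" "nrm2 q2 \<le> e" "nrm2 (\<lambda>x. p2 x + q1 x) \<le> e" "0 \<le> e"
      using nrm2_nonneg[of p1] nrm2_nonneg[of q2] nrm2_nonneg[of "\<lambda>x. p2 x + q1 x"] by (auto simp: e_def)
    define P where "P y = (\<integral>x. p2 x * kern \<rho> y x \<partial>lborel)" for y
    define E where "E = sqrt (D\<^sup>2 * Q * e)"
    have E0: "0 \<le> E" using Q0 e(4) by (simp add: E_def)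
    have bound: "\<bar>\<integral>x. f x * G x \<partial>lborel\<bar> \<le> E" if "L2 f" "nrm2 f \<le> e" "L2 G" "nrm2 G \<le> D\<^sup>2 * Q" for f G :: "real^2 \<Rightarrow> real"
    proof -
      have "(\<integral>x. f x * G x \<partial>lborel)\<^sup>2 \<le> nrm2 f * nrm2 G" by (rule L2_inner_bound[OF that(1,3)])
      also have "\<dots> \<le> e * (D\<^sup>2 * Q)" using that(2,4) nrm2_nonneg e(4) by (intro mult_mono) auto
      finally have "sqrt ((\<integral>x. f x * G x \<partial>lborel)\<^sup>2) \<le> E" unfolding E_def by (intro real_sqrt_le_mono) (simp add: mult_ac)
      then show ?thesis by simp
    qed
    have kL: "L2 (kern \<rho> y)" for y
      unfolding kern_tr[of y] by (rule L2_translate(1)[OF annular_L2[OF kern0]])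
    \<comment> \<open>The points \<open>y\<close> are taken from an annulus larger than
      \<open>S\<close> by \<open>D\<close>, because the corner between two points of
      \<open>S\<close> may leave \<open>S\<close>.\<close>
    have move: "\<bar>P (y + \<sigma> *\<^sub>R b) - P y\<bar> \<le> (if b = e1 then E else 2 * E)"
      if b: "b = e1 \<or> b = e2" and \<sigma>: "\<bar>\<sigma>\<bar> \<le> D" and y: "s1 - D \<le> norm (y - c)" "norm (y - c) \<le> s2 + D" for y \<sigma> b
    proof -
      define \<zeta> where "\<zeta> = shifts b (- \<sigma>) (kern \<rho> y)"
      have bB: "b \<in> Basis" using b by auto
      have ky: "kern \<rho> y \<in> annular c (s1 - D - 2 * \<rho>) (s2 + D + 2 * \<rho>)"
        unfolding annular_def
      proof safe
        fix x assume "kern \<rho> y x \<noteq> 0"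
        then have "norm (x - y) \<le> 2 * \<rho>" by (rule kern_near[OF \<rho>(1)])
        then show "s1 - D - 2 * \<rho> \<le> norm (x - c)" "norm (x - c) \<le> s2 + D + 2 * \<rho>"
          using y norm_triangle_ineq[of "x - y" "y - c"] norm_triangle_ineq4[of "x - c" "x - y"] by simp_all
      qed (rule smooth_kern)
      then have "\<zeta> \<in> annular c (s1 - D - 2 * \<rho> - D) (s2 + D + 2 * \<rho> + D)"
        unfolding \<zeta>_def by (rule annular_shifts[OF _ bB]) (use \<sigma> in simp)
      \<comment> \<open>The support has spread by \<open>D\<close> for the position of
        \<open>y\<close>, by \<open>2 * \<rho>\<close> for the kernel and by \<open>D\<close> for
        the shift, hence by at most \<open>4 * D\<close>.\<close>
      then have \<zeta>: "\<zeta> \<in> annular c a0 b0" by (rule annular_mono) (use s \<rho> in linarith)+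
      have diff: "kern \<rho> (y + \<sigma> *\<^sub>R b) x - kern \<rho> y x = pd b \<zeta> x" for x
      proof -
        have "kern \<rho> (y + \<sigma> *\<^sub>R b) x = kern \<rho> y (x + (- \<sigma>) *\<^sub>R b)"
          using b by (auto simp: kern_def algebra_simps)
        then show ?thesis unfolding \<zeta>_def by (simp add: pd_shifts[OF smooth_kern bB])
      qed
      have pdL: "L2 (pd e1 \<zeta>)" "L2 (pd e2 \<zeta>)" using annular_L2[OF annular_pd[OF \<zeta>]] by auto
      have pdN: "nrm2 (pd d \<zeta>) \<le> D\<^sup>2 * Q" if d: "d = e1 \<or> d = e2" for d
      proof -
        have dB: "d \<in> Basis" using d by auto
        have "pd d \<zeta> = shifts b (- \<sigma>) (pd d (kern \<rho> y))" unfolding \<zeta>_def by (rule pd_shifts'[OF smooth_kern dB])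
        then show ?thesis
          using shiftb(2)[of "- \<sigma>" "pd d (kern \<rho> y)" b] \<sigma> pdk[OF d] smooth_continuous[OF smooth_pd[OF smooth_kern dB]] by simp
      qed
      have "P (y + \<sigma> *\<^sub>R b) - P y = (\<integral>x. p2 x * kern \<rho> (y + \<sigma> *\<^sub>R b) x - p2 x * kern \<rho> y x \<partial>lborel)"
        unfolding P_def using L2_mult_integrable[OF L(2) kL] by (subst Bochner_Integration.integral_diff) auto
      also have "\<dots> = (\<integral>x. p2 x * pd b \<zeta> x \<partial>lborel)"
        by (simp add: right_diff_distrib[symmetric] diff)
      finally have eq: "P (y + \<sigma> *\<^sub>R b) - P y = (\<integral>x. p2 x * pd b \<zeta> x \<partial>lborel)" .
      show ?thesis
      proof (cases "b = e1")
        case True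
        then show ?thesis using eq pc[OF \<zeta>] bound[OF L(1) e(1) pdL(2) pdN] by simp
      next
        case False
        \<comment> \<open>For a vertical move \<open>p2\<close> is written as the strain entry
          \<open>p2 + q1\<close> minus \<open>q1\<close>, and the second curl condition replaces
          \<open>\<partial>\<^sub>2q1\<close> by \<open>\<partial>\<^sub>1q2\<close>. Two terms
          arise, hence \<open>2 * E\<close>.\<close>
        then have b2: "b = e2" using b by simp
        have "(\<integral>x. (p2 x + q1 x) * pd e2 \<zeta> x \<partial>lborel) = (\<integral>x. p2 x * pd e2 \<zeta> x \<partial>lborel) + (\<integral>x. q1 x * pd e2 \<zeta> x \<partial>lborel)"
          using L2_mult_integrable[OF L(2) pdL(2)] L2_mult_integrable[OF L(3) pdL(2)]
          by (simp add: distrib_right)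
        then have "P (y + \<sigma> *\<^sub>R b) - P y = (\<integral>x. (p2 x + q1 x) * pd e2 \<zeta> x \<partial>lborel) - (\<integral>x. q2 x * pd e1 \<zeta> x \<partial>lborel)"
          using eq qc[OF \<zeta>] b2 by simp
        moreover have "\<bar>\<integral>x. (p2 x + q1 x) * pd e2 \<zeta> x \<partial>lborel\<bar> \<le> E"
          by (rule bound[OF L2_add(1)[OF L(2,3)] e(3) pdL(2) pdN]) simp
        moreover have "\<bar>\<integral>x. q2 x * pd e1 \<zeta> x \<partial>lborel\<bar> \<le> E"
          by (rule bound[OF L(4) e(2) pdL(1) pdN]) simp
        ultimately show ?thesis using False by simp
      qed
    qed
    have local: "\<bar>P y - P y'\<bar> \<le> 3 * E" if y: "y \<in> S" "y' \<in> S" "dist y y' < D" for y y'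
    proof -
      \<comment> \<open>The corner of the path that runs horizontally from \<open>y\<close> and
        vertically to \<open>y'\<close>.\<close>
      define z where "z = y + (y' $ 1 - y $ 1) *\<^sub>R e1"
      have y': "y' = z + (y' $ 2 - y $ 2) *\<^sub>R e2"
        by (simp add: z_def vec_eq_iff forall_2 axis_def)
      have cmp: "\<bar>y' $ i - y $ i\<bar> \<le> D" for i
        using component_le_norm_cart[of "y' - y" i] y(3) by (simp add: dist_norm norm_minus_commute)
      have zy: "norm (z - y) \<le> D" using cmp[of 1] by (simp add: z_def)
      have "\<bar>P z - P y\<bar> \<le> E" using move[of e1 "y' $ 1 - y $ 1" y] cmp y D by (simp add: z_def S_def)
      moreover have "\<bar>P y' - P z\<bar> \<le> 2 * E"
      proof -
        have "e2 \<noteq> (e1 :: real^2)" by (simp add: axis_eq_axis)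
        moreover have "s1 - D \<le> norm (z - c)" "norm (z - c) \<le> s2 + D"
          using y(1) zy norm_triangle_ineq[of "z - y" "y - c"] norm_triangle_ineq4[of "z - c" "z - y"] by (auto simp: S_def)
        ultimately show ?thesis using move[of e2 "y' $ 2 - y $ 2" z] cmp[of 2] y' by simp
      qed
      ultimately show ?thesis by linarith
    qed
    \<comment> \<open>Any point of the annulus serves as reference: \<open>P y0\<close> becomes the
      constant \<open>k\<close>, and \<open>w\<close> is the deviation from it.\<close>
    define y0 where "y0 = c + s1 *\<^sub>R e1"
    have y0: "y0 \<in> S" using s by (simp add: y0_def S_def)
    have near: "\<bar>P y - P y0\<bar> \<le> real N * (3 * E)" if "y \<in> S" for y
      using N[of P "3 * E" y y0] local that y0 by blast
    have [measurable]: "p2 \<in> borel_measurable borel" using L by (simp add: L2_def)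
    have mP: "P \<in> borel_measurable borel" unfolding P_def[abs_def] by measurable
    have mS: "S \<in> sets borel" using cS by (rule borel_compact)
    define w where "w y = indicator S y * (P y - P y0)" for y
    have mw: "w \<in> borel_measurable borel" unfolding w_def[abs_def] using mP mS by measurable
    have sq: "(w y)\<^sup>2 \<le> (3 * real N)\<^sup>2 * (D\<^sup>2 * Q * e) * indicator S y" for y
    proof (cases "y \<in> S")
      case True
      have "(P y - P y0)\<^sup>2 \<le> (real N * (3 * E))\<^sup>2" using near[OF True] E0 by (simp add: abs_le_square_iff[symmetric])
      also have "\<dots> = (3 * real N)\<^sup>2 * (D\<^sup>2 * Q * e)" using Q0 e(4) by (simp add: E_def power_mult_distrib)
      finally show ?thesis using True by (simp add: w_def)
    qed (simp add: w_def)
    have iw: "integrable lborel (\<lambda>y. (3 * real N)\<^sup>2 * (D\<^sup>2 * Q * e) * indicator S y)" using iS by simp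
    have Lw: "L2 w" "nrm2 w \<le> C * e" using L2I_bound[OF mw iw sq] A by (simp_all add: C_def mult_ac)
    have "(\<integral>x. p2 x * smear 0 \<rho> (bump \<rho>) e1 (smear 0 \<rho> (bump \<rho>) e2 g) x \<partial>lborel)
         = (\<integral>x. w x * g x \<partial>lborel) + P y0 * (\<integral>x. g x \<partial>lborel)" if g: "g \<in> annular c s1 s2" for g
    proof -
      have "(\<integral>x. p2 x * smear 0 \<rho> (bump \<rho>) e1 (smear 0 \<rho> (bump \<rho>) e2 g) x \<partial>lborel) = (\<integral>y. P y * g y \<partial>lborel)"
        unfolding kern_repr[OF \<rho>(1) g] P_def by (rule kern_fubini[OF \<rho>(1) g L(2)])
      also have "\<dots> = (\<integral>y. w y * g y + P y0 * g y \<partial>lborel)"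
      proof (rule Bochner_Integration.integral_cong[OF refl])
        fix y show "P y * g y = w y * g y + P y0 * g y"
          using g by (cases "y \<in> S") (auto simp: w_def S_def annular_def algebra_simps)
      qed
      also have "\<dots> = (\<integral>x. w x * g x \<partial>lborel) + P y0 * (\<integral>x. g x \<partial>lborel)"
        using L2_mult_integrable[OF Lw(1) annular_L2[OF g]] annular_integrable[OF g] by simp
      finally show ?thesis .
    qed
    then show "\<exists>w k. L2 w \<and> nrm2 w \<le> C * (nrm2 p1 + nrm2 q2 + nrm2 (\<lambda>x. p2 x + q1 x)) \<and>
      (\<forall>g\<in>annular c s1 s2. (\<integral>x. p2 x * smear 0 \<rho> (bump \<rho>) e1 (smear 0 \<rho> (bump \<rho>) e2 g) x \<partial>lborel)
         = (\<integral>x. w x * g x \<partial>lborel) + k * (\<integral>x. g x \<partial>lborel))"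
      using Lw unfolding e_def by blast
  qed
qed

text \<open>The weak gradient of \<open>u(\<cdot> + h e\<^sub>1) - u\<close> is controlled by the strain of \<open>u\<close> although \<open>\<nabla>u\<close> is
  not: up to a small error the horizontal difference of \<open>u\<^sub>2\<close> can be averaged vertically, where
  \<open>\<partial>\<^sub>1u\<^sub>2\<close> may be traded for \<open>- \<partial>\<^sub>2u\<^sub>1\<close>, and the mollified \<open>\<partial>\<^sub>2u\<^sub>1\<close> is constant up to the strain.\<close>

lemma annulus_potential:
  fixes c :: "real^2"
  assumes r: "0 < a0" "a0 < a1" "a1 \<le> b1" "b1 < b0" and \<kappa>: "\<kappa> > 0"
  obtains h0 where "h0 > 0" and "\<And>h p1 p2 q1 q2. \<bar>h\<bar> < h0 \<Longrightarrow> L2 p1 \<Longrightarrow> L2 p2 \<Longrightarrow> L2 q1 \<Longrightarrow> L2 q2 \<Longrightarrow>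
    (\<And>\<zeta>. \<zeta> \<in> annular c a0 b0 \<Longrightarrow> (\<integral>x. p2 x * pd e1 \<zeta> x \<partial>lborel) = (\<integral>x. p1 x * pd e2 \<zeta> x \<partial>lborel)) \<Longrightarrow>
    (\<And>\<zeta>. \<zeta> \<in> annular c a0 b0 \<Longrightarrow> (\<integral>x. q2 x * pd e1 \<zeta> x \<partial>lborel) = (\<integral>x. q1 x * pd e2 \<zeta> x \<partial>lborel)) \<Longrightarrow>
    \<exists>w k. L2 w \<and> nrm2 w \<le> \<kappa> * (nrm2 p1 + nrm2 q2 + nrm2 (\<lambda>x. p2 x + q1 x)) \<and>
      (\<forall>g\<in>annular c a1 b1. (\<integral>x. w x * g x \<partial>lborel)
         = (\<integral>x. q1 x * shifts e1 h g x \<partial>lborel) - k * (\<integral>x. g x \<partial>lborel))"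
proof -
  \<comment> \<open>Each averaging enlarges a support by at most \<open>D\<close>; eight such layers
    fit on either side of the inner annulus.\<close>
  define D where "D = min (a1 - a0) (b0 - b1) / 8"
  have D: "D > 0" "a0 \<le> a1 - 8 * D" "b1 + 8 * D \<le> b0" using r by (auto simp: D_def)
  \<comment> \<open>The piece \<open>T1\<close> is of order \<open>\<rho>\<close> without any gain
    from \<open>h\<close>, so \<open>\<rho>\<close> has to be fixed before \<open>h0\<close>: the
    choice gives \<open>16 * \<rho>\<^sup>2 \<le> \<kappa> / 2\<close>, one half of the allowed
    bound.\<close>
  define \<rho> where "\<rho> = min D (sqrt (\<kappa> / 32))"
  have \<rho>: "0 < \<rho>" "\<rho> \<le> D" using D \<kappa> by (auto simp: \<rho>_def)
  have "\<rho>\<^sup>2 \<le> (sqrt (\<kappa> / 32))\<^sup>2" using \<rho>(1) by (intro power_mono) (auto simp: \<rho>_def)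
  then have \<rho>2: "16 * \<rho>\<^sup>2 \<le> \<kappa> / 2" using \<kappa> by simp
  obtain B where B: "B \<ge> 0" "\<And>t. \<bar>bump \<rho> t\<bar> \<le> B" using bump_bounded[OF \<rho>(1)] by blast
  obtain B' where B': "B' \<ge> 0" "\<And>t. \<bar>pd 1 (bump \<rho>) t\<bar> \<le> B'" using dbump_bounded[OF \<rho>(1)] by blast
  have s: "0 < a1 - D" "a1 - D \<le> b1 + D" "a0 \<le> (a1 - D) - 5 * D" "(b1 + D) + 5 * D \<le> b0"
    using D r by linarith+
  obtain C4 where C4: "C4 \<ge> 0" and mol: "\<And>p1 p2 q1 q2. L2 p1 \<Longrightarrow> L2 p2 \<Longrightarrow> L2 q1 \<Longrightarrow> L2 q2 \<Longrightarrow>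
    (\<And>\<zeta>. \<zeta> \<in> annular c a0 b0 \<Longrightarrow> (\<integral>x. p2 x * pd e1 \<zeta> x \<partial>lborel) = (\<integral>x. p1 x * pd e2 \<zeta> x \<partial>lborel)) \<Longrightarrow>
    (\<And>\<zeta>. \<zeta> \<in> annular c a0 b0 \<Longrightarrow> (\<integral>x. q2 x * pd e1 \<zeta> x \<partial>lborel) = (\<integral>x. q1 x * pd e2 \<zeta> x \<partial>lborel)) \<Longrightarrow>
    \<exists>w k. L2 w \<and> nrm2 w \<le> C4 * (nrm2 p1 + nrm2 q2 + nrm2 (\<lambda>x. p2 x + q1 x)) \<and>
      (\<forall>g\<in>annular c (a1 - D) (b1 + D). (\<integral>x. p2 x * smear 0 \<rho> (bump \<rho>) e1 (smear 0 \<rho> (bump \<rho>) e2 g) x \<partial>lborel)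
         = (\<integral>x. w x * g x \<partial>lborel) + k * (\<integral>x. g x \<partial>lborel))"
    by (rule mollified_almost_constant[OF D(1) \<rho> s, of c]) blast
  define C where "C = (B * \<rho>)\<^sup>2 + (B' * \<rho>)\<^sup>2 * \<rho>\<^sup>2 + C4"
  have C0: "C \<ge> 0" using C4 by (simp add: C_def)
  \<comment> \<open>The constants of \<open>T2\<close>, \<open>T3\<close> and \<open>T4\<close>
    depend on \<open>\<rho>\<close> but carry a factor \<open>h\<^sup>2\<close>; this threshold
    makes \<open>4 * h\<^sup>2 * C\<close> at most the other half.\<close>
  define h0 where "h0 = min D (sqrt (\<kappa> / (8 * (C + 1))))"
  show thesis
  proof (rule that[of h0])
    show "h0 > 0" using D \<kappa> C0 by (simp add: h0_def)
    fix h and p1 p2 q1 q2 :: "real^2 \<Rightarrow> real"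
    assume h: "\<bar>h\<bar> < h0" and L: "L2 p1" "L2 p2" "L2 q1" "L2 q2"
      and pc: "\<And>\<zeta>. \<zeta> \<in> annular c a0 b0 \<Longrightarrow> (\<integral>x. p2 x * pd e1 \<zeta> x \<partial>lborel) = (\<integral>x. p1 x * pd e2 \<zeta> x \<partial>lborel)"
      and qc: "\<And>\<zeta>. \<zeta> \<in> annular c a0 b0 \<Longrightarrow> (\<integral>x. q2 x * pd e1 \<zeta> x \<partial>lborel) = (\<integral>x. q1 x * pd e2 \<zeta> x \<partial>lborel)"
    define e where "e = nrm2 p1 + nrm2 q2 + nrm2 (\<lambda>x. p2 x + q1 x)"
    have e: "nrm2 p1 \<le> e" "nrm2 q2 \<le> e" "nrm2 (\<lambda>x. p2 x + q1 x) \<le> e" "0 \<le> e"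
      using nrm2_nonneg[of p1] nrm2_nonneg[of q2] nrm2_nonneg[of "\<lambda>x. p2 x + q1 x"] by (auto simp: e_def)
    have hD: "\<bar>h\<bar> \<le> D" using h by (simp add: h0_def)
    have "\<bar>h\<bar>\<^sup>2 \<le> (sqrt (\<kappa> / (8 * (C + 1))))\<^sup>2"
      using h by (intro power_mono) (auto simp: h0_def)
    then have "h\<^sup>2 \<le> \<kappa> / (8 * (C + 1))" unfolding power2_abs using \<kappa> C0 by simp
    then have "h\<^sup>2 * (8 * (C + 1)) \<le> \<kappa>" using C0 by (simp add: pos_le_divide_eq)
    then have "8 * h\<^sup>2 + 8 * (h\<^sup>2 * C) \<le> \<kappa>" by (simp add: algebra_simps)
    moreover have "0 \<le> h\<^sup>2" by simp
    ultimately have "8 * (h\<^sup>2 * C) \<le> \<kappa>" by linarith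
    then have h2: "4 * h\<^sup>2 * C \<le> \<kappa> / 2" by simp
    obtain w4 k where w4: "L2 w4" "nrm2 w4 \<le> C4 * e"
      "\<And>g. g \<in> annular c (a1 - D) (b1 + D) \<Longrightarrow>
        (\<integral>x. p2 x * smear 0 \<rho> (bump \<rho>) e1 (smear 0 \<rho> (bump \<rho>) e2 g) x \<partial>lborel)
         = (\<integral>x. w4 x * g x \<partial>lborel) + k * (\<integral>x. g x \<partial>lborel)"
      using mol[OF L pc qc] unfolding e_def by blast
    have cb: "continuous_on UNIV (bump \<rho>)" by (rule smooth_continuous[OF smooth_bump])
    have cs: "continuous_on UNIV (stepr \<rho>)" by (rule smooth_continuous[OF smooth_stepr])
    have cd: "continuous_on UNIV (pd 1 (bump \<rho>))" by (intro smooth_continuous smooth_pd smooth_bump) simp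
    note mb = borel_measurable_continuous_onI[OF cb] borel_measurable_continuous_onI[OF cs] borel_measurable_continuous_onI[OF cd]
    have L2b: "L2 (avg 0 \<rho> (bump \<rho>) v F)" "nrm2 (avg 0 \<rho> (bump \<rho>) v F) \<le> (B * \<rho>)\<^sup>2 * nrm2 F" if "L2 F" for v :: "real^2" and F
      using L2_avg[OF that mb(1), of 0 \<rho> B v] B \<rho> by auto
    have L2s: "L2 (avg 0 \<rho> (stepr \<rho>) v F)" "nrm2 (avg 0 \<rho> (stepr \<rho>) v F) \<le> \<rho>\<^sup>2 * nrm2 F" if "L2 F" for v :: "real^2" and F
      using L2_avg[OF that mb(2), of 0 \<rho> 1 v] stepr(3,4)[of \<rho>] \<rho> by auto
    have L2d: "L2 (avg 0 \<rho> (pd 1 (bump \<rho>)) v F)" "nrm2 (avg 0 \<rho> (pd 1 (bump \<rho>)) v F) \<le> (B' * \<rho>)\<^sup>2 * nrm2 F" if "L2 F" for v :: "real^2" and F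
      using L2_avg[OF that mb(3), of 0 \<rho> B' v] B' \<rho> by auto
    have L2h: "L2 (avg 0 1 (\<lambda>_. h) v F)" "nrm2 (avg 0 1 (\<lambda>_. h) v F) \<le> h\<^sup>2 * nrm2 F" if "L2 F" for v :: "real^2" and F
      using L2_avg[OF that, of "\<lambda>_. h" 0 1 "\<bar>h\<bar>" v] by auto
    \<comment> \<open>The adjoint of \<open>shifts e1 h\<close>.\<close>
    define Ah where "Ah = avg 0 1 (\<lambda>_. h) (- (h *\<^sub>R (e1::real^2)))"
    \<comment> \<open>The potential is the sum of four errors: \<open>T1\<close> from mollifying the
      shifted test function vertically, \<open>T2\<close> from exchanging \<open>q1\<close> for
      \<open>- p2\<close>, which costs the strain entry \<open>p2 + q1\<close>, \<open>T3\<close>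
      from mollifying horizontally as well, and \<open>T4\<close> from replacing the mollified
      \<open>p2\<close> by a constant.\<close>
    define q2' where "q2' = avg 0 \<rho> (stepr \<rho>) (- e2) q2"
    define T1 where "T1 x = - (q2' (x + (- h) *\<^sub>R e1) - q2' x)" for x
    define T2 where "T2 = Ah (avg 0 \<rho> (bump \<rho>) (- e2) (\<lambda>x. p2 x + q1 x))"
    define T3 where "T3 x = - Ah (avg 0 \<rho> (pd 1 (bump \<rho>)) (- e2) (avg 0 \<rho> (stepr \<rho>) (- e1) p1)) x" for x
    define T4 where "T4 x = - Ah w4 x" for x
    have Lq: "L2 q2'" "nrm2 q2' \<le> \<rho>\<^sup>2 * e"
    proof -
      show "L2 q2'" using L2s[OF L(4)] by (simp add: q2'_def)
      have "nrm2 q2' \<le> \<rho>\<^sup>2 * nrm2 q2" using L2s[OF L(4)] by (simp add: q2'_def)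
      also have "\<dots> \<le> \<rho>\<^sup>2 * e" using e by (intro mult_left_mono) auto
      finally show "nrm2 q2' \<le> \<rho>\<^sup>2 * e" .
    qed
    have LT1: "L2 T1" "nrm2 T1 \<le> 4 * \<rho>\<^sup>2 * e"
    proof -
      note d = L2_diff[OF L2_translate(1)[OF Lq(1), of "(- h) *\<^sub>R e1"] Lq(1)]
      show "L2 T1" unfolding T1_def[abs_def] by (rule L2_minus(1)[OF d(1)])
      have "nrm2 T1 \<le> 2 * nrm2 q2' + 2 * nrm2 q2'"
        unfolding T1_def[abs_def] L2_minus(2) using d(2) L2_translate(2)[OF Lq(1), of "(- h) *\<^sub>R e1"] by simp
      then show "nrm2 T1 \<le> 4 * \<rho>\<^sup>2 * e" using Lq(2) by simp
    qed
    have LT2: "L2 T2" "nrm2 T2 \<le> h\<^sup>2 * ((B * \<rho>)\<^sup>2 * e)"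
    proof -
      note a = L2b[OF L2_add(1)[OF L(2,3)], of "- e2"]
      show "L2 T2" unfolding T2_def Ah_def by (rule L2h(1)[OF a(1)])
      have "nrm2 T2 \<le> h\<^sup>2 * nrm2 (avg 0 \<rho> (bump \<rho>) (- e2) (\<lambda>x. p2 x + q1 x))"
        unfolding T2_def Ah_def by (rule L2h(2)[OF a(1)])
      also have "\<dots> \<le> h\<^sup>2 * ((B * \<rho>)\<^sup>2 * e)"
        by (intro mult_left_mono order_trans[OF a(2)] e) auto
      finally show "nrm2 T2 \<le> h\<^sup>2 * ((B * \<rho>)\<^sup>2 * e)" .
    qed
    have LT3: "L2 T3" "nrm2 T3 \<le> h\<^sup>2 * ((B' * \<rho>)\<^sup>2 * (\<rho>\<^sup>2 * e))"
    proof -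
      note a = L2s[OF L(1), of "- e1"]
      note b = L2d[OF a(1), of "- e2"]
      show "L2 T3" unfolding T3_def[abs_def] Ah_def by (rule L2_minus(1)[OF L2h(1)[OF b(1)]])
      have "nrm2 T3 \<le> h\<^sup>2 * nrm2 (avg 0 \<rho> (pd 1 (bump \<rho>)) (- e2) (avg 0 \<rho> (stepr \<rho>) (- e1) p1))"
        unfolding T3_def[abs_def] Ah_def L2_minus(2) by (rule L2h(2)[OF b(1)])
      also have "\<dots> \<le> h\<^sup>2 * ((B' * \<rho>)\<^sup>2 * nrm2 (avg 0 \<rho> (stepr \<rho>) (- e1) p1))"
        by (intro mult_left_mono b(2)) auto
      also have "\<dots> \<le> h\<^sup>2 * ((B' * \<rho>)\<^sup>2 * (\<rho>\<^sup>2 * e))"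
        by (intro mult_left_mono order_trans[OF a(2)] e) auto
      finally show "nrm2 T3 \<le> h\<^sup>2 * ((B' * \<rho>)\<^sup>2 * (\<rho>\<^sup>2 * e))" .
    qed
    have LT4: "L2 T4" "nrm2 T4 \<le> h\<^sup>2 * (C4 * e)"
    proof -
      show "L2 T4" unfolding T4_def[abs_def] Ah_def by (rule L2_minus(1)[OF L2h(1)[OF w4(1)]])
      have "nrm2 T4 \<le> h\<^sup>2 * nrm2 w4"
        unfolding T4_def[abs_def] Ah_def L2_minus(2) by (rule L2h(2)[OF w4(1)])
      also have "\<dots> \<le> h\<^sup>2 * (C4 * e)" by (intro mult_left_mono w4(2)) auto
      finally show "nrm2 T4 \<le> h\<^sup>2 * (C4 * e)" .
    qed
    define w where "w x = (T1 x + T2 x) + (T3 x + T4 x)" for x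
    note l12 = L2_add[OF LT1(1) LT2(1)] and l34 = L2_add[OF LT3(1) LT4(1)]
    have Lw: "L2 w" unfolding w_def[abs_def] by (rule L2_add(1)[OF l12(1) l34(1)])
    have "nrm2 w \<le> 2 * nrm2 (\<lambda>x. T1 x + T2 x) + 2 * nrm2 (\<lambda>x. T3 x + T4 x)"
      unfolding w_def[abs_def] by (rule L2_add(2)[OF l12(1) l34(1)])
    also have "\<dots> \<le> 4 * (nrm2 T1 + nrm2 T2 + nrm2 T3 + nrm2 T4)" using l12(2) l34(2) by simp
    also have "\<dots> \<le> 4 * (4 * \<rho>\<^sup>2 * e + h\<^sup>2 * ((B * \<rho>)\<^sup>2 * e) + h\<^sup>2 * ((B' * \<rho>)\<^sup>2 * (\<rho>\<^sup>2 * e)) + h\<^sup>2 * (C4 * e))"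
      by (intro mult_left_mono add_mono LT1 LT2 LT3 LT4) auto
    also have "\<dots> = (16 * \<rho>\<^sup>2 + 4 * h\<^sup>2 * C) * e" by (simp add: C_def algebra_simps)
    also have "\<dots> \<le> \<kappa> * e" using \<rho>2 h2 e(4) by (intro mult_right_mono) auto
    finally have Nw: "nrm2 w \<le> \<kappa> * e" .
    \<comment> \<open>The constant acquires the factor \<open>h\<close> because the shift operator
      multiplies integrals by \<open>h\<close>; its sign is that with which \<open>p2\<close>
      enters.\<close>
    have "(\<integral>x. w x * g x \<partial>lborel) = (\<integral>x. q1 x * shifts e1 h g x \<partial>lborel) - (- k * h) * (\<integral>x. g x \<partial>lborel)"
      if g: "g \<in> annular c a1 b1" for g
    proof -
      define Hg where "Hg = shifts e1 h g"
      have Hg: "Hg \<in> annular c (a1 - D) (b1 + D)"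
        unfolding Hg_def by (rule annular_shifts[OF g _ hD]) simp
      have sH: "smooth Hg" by (rule annular_smooth[OF Hg])
      define MH where "MH = smear 0 \<rho> (bump \<rho>) e2 Hg"
      have MH: "MH \<in> annular c (a1 - 2 * D) (b1 + 2 * D)"
        unfolding MH_def using annular_smear_axis[OF Hg e_basis(2) cb \<rho>(2)] by (simp add: algebra_simps)
      define K2 where "K2 = smear 0 \<rho> (stepr \<rho>) e2 Hg"
      have K2: "K2 \<in> annular c a0 b0"
        unfolding K2_def by (rule annular_mono[OF annular_smear_axis[OF Hg e_basis(2) cs \<rho>(2)]]) (use D in linarith)+
      define K1 where "K1 = smear 0 \<rho> (stepr \<rho>) e1 MH"
      have K1: "K1 \<in> annular c a0 b0"
        unfolding K1_def by (rule annular_mono[OF annular_smear_axis[OF MH e_basis(1) cs \<rho>(2)]]) (use D in linarith)+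
      note adj = smear_adjoint
      have LH: "L2 Hg" "L2 MH" using annular_L2 Hg MH by blast+
      have gL: "L2 g" by (rule annular_L2[OF g])
      have adjH: "(\<integral>x. F x * Hg x \<partial>lborel) = (\<integral>x. Ah F x * g x \<partial>lborel)" if "L2 F" for F
        unfolding Hg_def shifts_def Ah_def using smear_adjoint[OF that g continuous_on_const, of 0 1 h "h *\<^sub>R e1"] by simp
      have g': "(\<lambda>x. g (x + h *\<^sub>R e1) - g x) = pd e1 Hg"
        unfolding Hg_def using pd_shifts[OF annular_smooth[OF g] e_basis(1), of h] by (simp add: fun_eq_iff)
      have gann: "pd e1 Hg \<in> annular c (a1 - D) (b1 + D)" by (rule annular_pd[OF Hg]) simp
      \<comment> \<open>The error \<open>MH - Hg\<close> is \<open>\<partial>\<^sub>2K2\<close>, so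
        the curl condition turns \<open>q1\<close> into the strain entry \<open>q2\<close> and
        \<open>\<partial>\<^sub>2\<close> into \<open>\<partial>\<^sub>1\<close>. Applied to the
        shift integral \<open>Hg\<close>, \<open>\<partial>\<^sub>1\<close> gives just an increment
        of \<open>g\<close>, so no derivative of \<open>g\<close> is left.\<close>
      have s1: "(\<integral>x. q1 x * Hg x \<partial>lborel) = (\<integral>x. q1 x * MH x \<partial>lborel) + (\<integral>x. T1 x * g x \<partial>lborel)"
      proof -
        have "pd e2 K2 = (\<lambda>x. MH x - Hg x)"
          unfolding K2_def MH_def using pd_K[OF \<rho>(1) sH e_basis(2)] by (simp add: fun_eq_iff)
        then have "(\<integral>x. q1 x * MH x \<partial>lborel) - (\<integral>x. q1 x * Hg x \<partial>lborel) = (\<integral>x. q1 x * pd e2 K2 x \<partial>lborel)"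
          using L2_mult_integrable[OF L(3) LH(1)] L2_mult_integrable[OF L(3) LH(2)]
          by (simp add: right_diff_distrib fun_eq_iff)
        also have "\<dots> = (\<integral>x. q2 x * pd e1 K2 x \<partial>lborel)" by (rule qc[OF K2, symmetric])
        also have "pd e1 K2 = smear 0 \<rho> (stepr \<rho>) e2 (pd e1 Hg)"
          unfolding K2_def by (rule pd_smear_smooth[OF cs sH]) simp
        also have "(\<integral>x. q2 x * smear 0 \<rho> (stepr \<rho>) e2 (pd e1 Hg) x \<partial>lborel) = (\<integral>x. q2' x * pd e1 Hg x \<partial>lborel)"
          unfolding q2'_def by (rule smear_adjoint[OF L(4) gann cs]) (use \<rho> in simp)
        also have "\<dots> = (\<integral>x. q2' x * g (x + h *\<^sub>R e1) - q2' x * g x \<partial>lborel)"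
          by (simp add: fun_cong[OF g', symmetric] right_diff_distrib)
        also have "\<dots> = (\<integral>x. q2' x * g (x + h *\<^sub>R e1) \<partial>lborel) - (\<integral>x. q2' x * g x \<partial>lborel)"
          by (intro Bochner_Integration.integral_diff L2_mult_integrable Lq gL L2_translate(1)[OF gL])
        also have "(\<integral>x. q2' x * g (x + h *\<^sub>R e1) \<partial>lborel) = (\<integral>x. q2' (x + (- h) *\<^sub>R e1) * g x \<partial>lborel)"
          using integral_translate[of "\<lambda>x. q2' (x + (- h) *\<^sub>R e1) * g x" "h *\<^sub>R e1"] L2_measurable[OF Lq(1)] L2_measurable[OF gL]
          by simp
        also have "\<dots> - (\<integral>x. q2' x * g x \<partial>lborel) = (\<integral>x. q2' (x + (- h) *\<^sub>R e1) * g x - q2' x * g x \<partial>lborel)"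
          by (intro Bochner_Integration.integral_diff[symmetric] L2_mult_integrable Lq gL L2_translate(1)[OF Lq(1)])
        also have "\<dots> = - (\<integral>x. T1 x * g x \<partial>lborel)"
          unfolding T1_def integral_minus[symmetric] by (simp add: algebra_simps)
        finally show ?thesis by simp
      qed
      have s2: "(\<integral>x. q1 x * MH x \<partial>lborel) = (\<integral>x. T2 x * g x \<partial>lborel) - (\<integral>x. p2 x * MH x \<partial>lborel)"
      proof -
        have "(\<integral>x. (p2 x + q1 x) * MH x \<partial>lborel) = (\<integral>x. avg 0 \<rho> (bump \<rho>) (- e2) (\<lambda>x. p2 x + q1 x) x * Hg x \<partial>lborel)"
          unfolding MH_def by (rule smear_adjoint[OF L2_add(1)[OF L(2,3)] Hg cb]) (use \<rho> in simp)
        also have "\<dots> = (\<integral>x. T2 x * g x \<partial>lborel)"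
          unfolding T2_def by (rule adjH[OF L2b(1)[OF L2_add(1)[OF L(2,3)]]])
        finally show ?thesis
          using L2_mult_integrable[OF L(2) LH(2)] L2_mult_integrable[OF L(3) LH(2)] by (simp add: distrib_right)
      qed
      \<comment> \<open>Here the curl condition of the first row turns \<open>p2\<close> into the
        strain entry \<open>p1\<close>; the resulting \<open>\<partial>\<^sub>2\<close> is absorbed
        by the vertical mollifier already present in \<open>MH\<close>.\<close>
      have s3: "(\<integral>x. p2 x * MH x \<partial>lborel) = (\<integral>x. p2 x * smear 0 \<rho> (bump \<rho>) e1 MH x \<partial>lborel) - (\<integral>x. T3 x * g x \<partial>lborel)"
      proof -
        have NL: "L2 (smear 0 \<rho> (bump \<rho>) e1 MH)"
          by (rule annular_L2[OF annular_smear_axis[OF MH e_basis(1) cb \<rho>(2)]])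
        have "pd e1 K1 = (\<lambda>x. smear 0 \<rho> (bump \<rho>) e1 MH x - MH x)"
          unfolding K1_def using pd_K[OF \<rho>(1) annular_smooth[OF MH] e_basis(1)] by (simp add: fun_eq_iff)
        then have "(\<integral>x. p2 x * smear 0 \<rho> (bump \<rho>) e1 MH x \<partial>lborel) - (\<integral>x. p2 x * MH x \<partial>lborel) = (\<integral>x. p2 x * pd e1 K1 x \<partial>lborel)"
          using L2_mult_integrable[OF L(2) LH(2)] L2_mult_integrable[OF L(2) NL]
          by (simp add: right_diff_distrib fun_eq_iff)
        also have "\<dots> = (\<integral>x. p1 x * pd e2 K1 x \<partial>lborel)" by (rule pc[OF K1])
        also have "pd e2 K1 = smear 0 \<rho> (stepr \<rho>) e1 (pd e2 MH)"
          unfolding K1_def by (rule pd_smear_smooth[OF cs annular_smooth[OF MH]]) simp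
        also have "(\<integral>x. p1 x * smear 0 \<rho> (stepr \<rho>) e1 (pd e2 MH) x \<partial>lborel) = (\<integral>x. avg 0 \<rho> (stepr \<rho>) (- e1) p1 x * pd e2 MH x \<partial>lborel)"
          by (rule smear_adjoint[OF L(1) annular_pd[OF MH] cs]) (use \<rho> in simp_all)
        also have "pd e2 MH = (\<lambda>x. - smear 0 \<rho> (pd 1 (bump \<rho>)) e2 Hg x)"
          unfolding MH_def using pd_M[OF \<rho>(1) sH e_basis(2)] by (simp add: fun_eq_iff)
        also have "(\<integral>x. avg 0 \<rho> (stepr \<rho>) (- e1) p1 x * (- smear 0 \<rho> (pd 1 (bump \<rho>)) e2 Hg x) \<partial>lborel)
           = - (\<integral>x. avg 0 \<rho> (stepr \<rho>) (- e1) p1 x * smear 0 \<rho> (pd 1 (bump \<rho>)) e2 Hg x \<partial>lborel)" by simp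
        also have "(\<integral>x. avg 0 \<rho> (stepr \<rho>) (- e1) p1 x * smear 0 \<rho> (pd 1 (bump \<rho>)) e2 Hg x \<partial>lborel)
           = (\<integral>x. avg 0 \<rho> (pd 1 (bump \<rho>)) (- e2) (avg 0 \<rho> (stepr \<rho>) (- e1) p1) x * Hg x \<partial>lborel)"
          by (rule smear_adjoint[OF L2s(1)[OF L(1)] Hg cd]) (use \<rho> in simp)
        also have "\<dots> = (\<integral>x. Ah (avg 0 \<rho> (pd 1 (bump \<rho>)) (- e2) (avg 0 \<rho> (stepr \<rho>) (- e1) p1)) x * g x \<partial>lborel)"
          by (rule adjH[OF L2d(1)[OF L2s(1)[OF L(1)]]])
        also have "- \<dots> = (\<integral>x. T3 x * g x \<partial>lborel)" by (simp add: T3_def)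
        finally show ?thesis by simp
      qed
      have s4: "(\<integral>x. p2 x * smear 0 \<rho> (bump \<rho>) e1 MH x \<partial>lborel) = - (\<integral>x. T4 x * g x \<partial>lborel) + k * (\<integral>x. Hg x \<partial>lborel)"
        using w4(3)[OF Hg] adjH[OF w4(1)] by (simp add: MH_def T4_def)
      have s5: "(\<integral>x. Hg x \<partial>lborel) = h * (\<integral>x. g x \<partial>lborel)"
      proof -
        define G where "G = {x. a1 - D \<le> norm (x - c) \<and> norm (x - c) \<le> b1 + D}"
        \<comment> \<open>The constant function 1 is not square integrable; the indicator of a disk
          large enough to contain all shifted supports takes its place in the adjoint
          formula.\<close>
        define U where "U = cball c (b1 + 2 * D)"
        have [measurable]: "U \<in> sets borel" by (simp add: U_def)
        have "L2 (indicator U :: real^2 \<Rightarrow> real)"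
        proof -
          have "(\<lambda>x. (indicator U x)\<^sup>2) = (indicator U :: real^2 \<Rightarrow> real)" by (auto simp: indicator_def fun_eq_iff)
          moreover have "integrable lborel (indicator U :: real^2 \<Rightarrow> real)"
            by (intro integrable_real_indicator emeasure_bounded_finite) (auto simp: U_def)
          ultimately show ?thesis by (simp add: L2_def)
        qed
        from adjH[OF this] have "(\<integral>x. indicator U x * Hg x \<partial>lborel) = (\<integral>x. Ah (indicator U) x * g x \<partial>lborel)" .
        moreover have "(\<lambda>x. indicator U x * Hg x) = Hg"
          using Hg D by (fastforce simp: annular_def U_def indicator_def dist_norm norm_minus_commute fun_eq_iff)
        moreover have "(\<lambda>x. Ah (indicator U) x * g x) = (\<lambda>x. h * g x)"
        proof
          fix x show "Ah (indicator U) x * g x = h * g x"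
          proof (cases "g x = 0")
            case False
            then have nx: "norm (x - c) \<le> b1" using g by (auto simp: annular_def)
            have "indicator {0..1} t * h * indicator U (x + t *\<^sub>R - (h *\<^sub>R e1)) = h * indicator {0..1} t" for t :: real
            proof (cases "t \<in> {0..1}")
              case True
              then have "\<bar>t\<bar> * \<bar>h\<bar> \<le> 1 * D" using hD by (intro mult_mono) auto
              then have "norm (t *\<^sub>R - (h *\<^sub>R (e1 :: real^2))) \<le> D" by (simp add: abs_mult)
              then have "norm (x + t *\<^sub>R - (h *\<^sub>R e1) - c) \<le> b1 + 2 * D"
                using nx norm_triangle_ineq[of "x - c" "t *\<^sub>R - (h *\<^sub>R e1)"] D(1) by (simp add: algebra_simps)
              then have "x + t *\<^sub>R - (h *\<^sub>R e1) \<in> U" unfolding U_def mem_cball dist_norm by (subst norm_minus_commute)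
              then show ?thesis by simp
            qed simp
            then have "Ah (indicator U) x = (\<integral>t. h * indicator {0..1::real} t \<partial>lborel)"
              unfolding Ah_def avg_def by (simp only:)
            also have "\<dots> = h" by simp
            finally show ?thesis by simp
          qed simp
        qed
        ultimately show ?thesis by simp
      qed
      have "(\<integral>x. w x * g x \<partial>lborel) = ((\<integral>x. T1 x * g x \<partial>lborel) + (\<integral>x. T2 x * g x \<partial>lborel)) + ((\<integral>x. T3 x * g x \<partial>lborel) + (\<integral>x. T4 x * g x \<partial>lborel))"
        unfolding w_def using LT1 LT2 LT3 LT4 gL by (simp add: distrib_right L2_mult_integrable)
      then show ?thesis using s1 s2 s3 s4 s5 unfolding Hg_def by simp
    qed
    then show "\<exists>w k. L2 w \<and> nrm2 w \<le> \<kappa> * (nrm2 p1 + nrm2 q2 + nrm2 (\<lambda>x. p2 x + q1 x)) \<and>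
      (\<forall>g\<in>annular c a1 b1. (\<integral>x. w x * g x \<partial>lborel)
         = (\<integral>x. q1 x * shifts e1 h g x \<partial>lborel) - k * (\<integral>x. g x \<partial>lborel))"
      using Lw Nw unfolding e_def by blast
  qed
qed

section \<open>Gluing curl-free fields\<close>

text \<open>Integrated over any segment in direction \<open>b\<close>, both sides become the
  \<open>d\<close>-derivative of the same increment. Their difference \<open>G\<close> therefore has
  vanishing integrals over all such segments, so it is constant along \<open>b\<close>, and a
  constant with vanishing mean is zero.\<close>

lemma mixed_partials:
  fixes \<phi> :: "'a::euclidean_space \<Rightarrow> real"
  assumes \<phi>: "smooth \<phi>" and b: "b \<in> Basis" "d \<in> Basis"
  shows "pd b (pd d \<phi>) = pd d (pd b \<phi>)"
proof
  fix x
  define G where "G y = pd b (pd d \<phi>) y - pd d (pd b \<phi>) y" for y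
  note s = smooth_pd[OF \<phi> b(1)] smooth_pd[OF \<phi> b(2)]
  have eq: "shifts b h (pd b (pd d \<phi>)) y = shifts b h (pd d (pd b \<phi>)) y" for h y
  proof -
    have "shifts b h (pd b (pd d \<phi>)) y = pd b (shifts b h (pd d \<phi>)) y"
      by (rule fun_cong[OF pd_shifts'[OF s(2) b(1), symmetric]])
    also have "\<dots> = pd d \<phi> (y + h *\<^sub>R b) - pd d \<phi> y" by (rule pd_shifts[OF s(2) b(1)])
    also have "\<dots> = pd d (\<lambda>y. \<phi> (y + h *\<^sub>R b) - \<phi> y) y"
    proof -
      have d: "((\<lambda>x. x + h *\<^sub>R b) has_derivative (\<lambda>h. h)) (at x)" for x by (auto intro!: derivative_eq_intros)
      have "((\<lambda>y. \<phi> (y + h *\<^sub>R b) - \<phi> y) has_derivative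
        (\<lambda>k. frechet_derivative \<phi> (at (y + h *\<^sub>R b)) k - frechet_derivative \<phi> (at y) k)) (at y)" for y
        by (intro has_derivative_diff has_derivative_compose[OF d] smooth_has_derivative \<phi>)
      from fun_cong[OF pd_eqI[OF this]] show ?thesis by simp
    qed
    also have "(\<lambda>y. \<phi> (y + h *\<^sub>R b) - \<phi> y) = pd b (shifts b h \<phi>)"
      using pd_shifts[OF \<phi> b(1)] by (simp add: fun_eq_iff)
    also have "\<dots> = shifts b h (pd b \<phi>)" by (rule pd_shifts'[OF \<phi> b(1)])
    also have "pd d (shifts b h (pd b \<phi>)) y = shifts b h (pd d (pd b \<phi>)) y"
      by (rule fun_cong[OF pd_shifts'[OF s(1) b(2)]])
    finally show ?thesis .
  qed
  have cG: "continuous_on UNIV G"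
    unfolding G_def[abs_def] by (intro continuous_on_diff smooth_continuous smooth_pd s b)
  have H0: "shifts b h G y = 0" for h y
  proof -
    have c: "continuous_on {0..1} (\<lambda>t. h * F (y + t *\<^sub>R h *\<^sub>R b))" if "continuous_on UNIV F" for F :: "'a \<Rightarrow> real"
      by (intro continuous_intros continuous_on_compose2[OF that]) auto
    have "shifts b h G y = shifts b h (pd b (pd d \<phi>)) y - shifts b h (pd d (pd b \<phi>)) y"
      unfolding shifts_def smear_def G_def right_diff_distrib
      by (intro Henstock_Kurzweil_Integration.integral_diff integrable_continuous_interval c smooth_continuous smooth_pd s b)
    then show ?thesis using eq by simp
  qed
  have sG: "smooth G"
  proof -
    have "smooth (\<lambda>y. (-1) * pd d (pd b \<phi>) y)"
      by (intro smooth_mult smooth_pd s b) (simp add: smooth_def Ck_const)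
    from smooth_add[OF smooth_pd[OF s(2) b(1)] this] show ?thesis by (simp add: G_def[abs_def])
  qed
  have Gc: "G (x + h *\<^sub>R b) = G x" for h
  proof -
    have "shifts b h G = (\<lambda>_. 0)" using H0 by (simp add: fun_eq_iff)
    then show ?thesis using pd_shifts[OF sG b(1), of h x] by simp
  qed
  have "G x = shifts b 1 G x" using Gc by (simp add: shifts_def smear_def)
  then show "pd b (pd d \<phi>) x = pd d (pd b \<phi>) x" using H0[of 1 x] by (simp add: G_def)
qed

text \<open>The increment of \<open>g\<close> over a unit step integrates to zero by translation
  invariance. It is the average of \<open>pd b g\<close> over unit segments, and averaging with unit
  weight preserves the integral.\<close>

lemma integral_pd_zero:
  assumes g: "smooth g" "compact C" "\<And>x. g x \<noteq> 0 \<Longrightarrow> x \<in> C" and b: "b \<in> Basis"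
  shows "(\<integral>x. pd b g x \<partial>(lborel :: 'a::euclidean_space measure)) = 0"
proof -
  have ig: "integrable lborel g" by (rule compact_support_integrable[OF smooth_continuous[OF g(1)] g(2,3)])
  have mg: "g \<in> borel_measurable borel" by (rule borel_measurable_continuous_onI[OF smooth_continuous[OF g(1)]])
  have pd0: "pd b g x = 0" if "x \<notin> C" for x
  proof -
    have "frechet_derivative g (at x) = frechet_derivative (\<lambda>_. 0) (at x)"
      by (rule frechet_derivative_local[of "- C"]) (use that g in \<open>auto simp: compact_imp_closed open_Compl\<close>)
    then show ?thesis by simp
  qed
  have L: "L2 (pd b g)"
    by (rule compact_support_L2[OF smooth_continuous[OF smooth_pd[OF g(1) b]] g(2)]) (use pd0 in blast)
  obtain c R where R: "C \<subseteq> cball c R" using compact_imp_bounded[OF g(2)] bounded_subset_cball by metis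
  define U where "U = cball c (R + 1)"
  have LU: "L2 (indicator U :: 'a \<Rightarrow> real)"
  proof -
    have "(\<lambda>x. (indicator U x)\<^sup>2) = (indicator U :: 'a \<Rightarrow> real)" by (auto simp: indicator_def fun_eq_iff)
    moreover have "integrable lborel (indicator U :: 'a \<Rightarrow> real)"
      by (intro integrable_real_indicator emeasure_bounded_finite) (auto simp: U_def)
    moreover have "U \<in> sets borel" by (simp add: U_def)
    ultimately show ?thesis by (simp add: L2_def)
  qed
  have an: "pd b g \<in> annular c (- 1) R"
    unfolding annular_def
    using smooth_pd[OF g(1) b] pd0 R by (auto simp: dist_norm norm_minus_commute subset_iff intro: order_trans[OF _ norm_ge_zero])
  have "0 = (\<integral>x. g (x + 1 *\<^sub>R b) - g x \<partial>lborel)"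
  proof -
    have "integrable (distr lborel borel ((+) b)) g" using ig by (simp add: lborel_distr_plus)
    then have "integrable lborel (\<lambda>x. g (x + b))" using mg by (subst (asm) integrable_distr_eq) (auto simp: add.commute)
    then show ?thesis using integral_translate[OF mg, of b] ig by simp
  qed
  also have "\<dots> = (\<integral>x. shifts b 1 (pd b g) x \<partial>lborel)"
    using pd_shifts[OF g(1) b, of 1] fun_cong[OF pd_shifts'[OF g(1) b, of b 1]] by simp
  also have "\<dots> = (\<integral>x. indicator U x * shifts b 1 (pd b g) x \<partial>lborel)"
  proof (rule Bochner_Integration.integral_cong[OF refl])
    fix x
    have "shifts b 1 (pd b g) \<in> annular c (- 1 - 1) (R + 1)" by (rule annular_shifts[OF an b]) simp
    then show "shifts b 1 (pd b g) x = indicator U x * shifts b 1 (pd b g) x"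
      by (auto simp: annular_def U_def indicator_def dist_norm norm_minus_commute)
  qed
  also have "\<dots> = (\<integral>x. avg 0 1 (\<lambda>_. 1) (- b) (indicator U) x * pd b g x \<partial>lborel)"
    unfolding shifts_def using smear_adjoint[OF LU an continuous_on_const, of 0 1 1 b] by simp
  also have "\<dots> = (\<integral>x. pd b g x \<partial>lborel)"
  proof (rule Bochner_Integration.integral_cong[OF refl])
    fix x
    show "avg 0 1 (\<lambda>_. 1) (- b) (indicator U) x * pd b g x = pd b g x"
    proof (cases "pd b g x = 0")
      case False
      then have nx: "norm (x - c) \<le> R" using an by (auto simp: annular_def)
      have "indicator {0..1} t * 1 * indicator U (x + t *\<^sub>R - b) = (indicator {0..1} t :: real)" for t :: real
      proof (cases "t \<in> {0..1}")
        case True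
        then have "norm (t *\<^sub>R - b) \<le> 1" using b by simp
        then have "norm (x + t *\<^sub>R - b - c) \<le> R + 1"
          using nx norm_triangle_ineq[of "x - c" "t *\<^sub>R - b"] by (simp add: algebra_simps)
        then have "x + t *\<^sub>R - b \<in> U" unfolding U_def mem_cball dist_norm by (subst norm_minus_commute)
        then show ?thesis by simp
      qed simp
      then have "avg 0 1 (\<lambda>_. 1) (- b) (indicator U) x = (\<integral>t. indicator {0..1::real} t \<partial>lborel)"
        unfolding avg_def by (simp only:)
      also have "\<dots> = 1" by simp
      finally show ?thesis by simp
    qed simp
  qed
  finally show ?thesis by simp
qed

text \<open>One component of \<open>curl_pairing\<close>. Rows are extended by zero outside the
  perforated domain, so the integral may run over the whole plane.\<close>

definition curl_pair :: "(real^2 \<Rightarrow> real) \<Rightarrow> (real^2 \<Rightarrow> real) \<Rightarrow> (real^2 \<Rightarrow> real) \<Rightarrow> real" where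
  "curl_pair p1 p2 \<phi> = (\<integral>x. p2 x * pd e1 \<phi> x - p1 x * pd e2 \<phi> x \<partial>lborel)"

text \<open>Built on the squared distance, which unlike the distance is smooth at
  \<open>c\<close>.\<close>

definition cutoff :: "real^2 \<Rightarrow> real \<Rightarrow> real \<Rightarrow> real^2 \<Rightarrow> real" where
  "cutoff c a b x = ramp (((norm (x - c))\<^sup>2 - a\<^sup>2) / (b\<^sup>2 - a\<^sup>2))"

lemma smooth_cutoff: "smooth (cutoff c a b)"
proof -
  have lin: "smooth (\<lambda>x::real^2. x $ i - c $ i)" for i
    using Ck_add[OF Ck_linear[OF bounded_linear_vec_nth[of i]] Ck_const[where c="- (c $ i)"]] by (simp add: smooth_def)
  have n: "(norm (x - c))\<^sup>2 = (x $ 1 - c $ 1) * (x $ 1 - c $ 1) + (x $ 2 - c $ 2) * (x $ 2 - c $ 2)" for x :: "real^2"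
    unfolding power2_norm_eq_inner by (simp add: inner_vec_def sum_2)
  have "smooth (\<lambda>x. ((norm (x - c))\<^sup>2 + (- a\<^sup>2)) * (1 / (b\<^sup>2 - a\<^sup>2)))"
    unfolding n by (intro smooth_mult smooth_add lin) (auto simp: smooth_def Ck_const)
  then have "Ck k (\<lambda>x. ((norm (x - c))\<^sup>2 - a\<^sup>2) / (b\<^sup>2 - a\<^sup>2))" for k by (simp add: smooth_def)
  from Ck_compose[OF Ck_ramp this] show ?thesis unfolding smooth_def cutoff_def[abs_def] by blast
qed

lemma cutoff:
  assumes "0 \<le> a" "a < b"
  shows "norm (x - c) \<le> a \<Longrightarrow> cutoff c a b x = 1" "b \<le> norm (x - c) \<Longrightarrow> cutoff c a b x = 0"
    "0 \<le> cutoff c a b x" "cutoff c a b x \<le> 1"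
proof -
  have p: "b\<^sup>2 - a\<^sup>2 > 0" using assms by (simp add: power_strict_mono)
  show "cutoff c a b x = 1" if "norm (x - c) \<le> a"
    unfolding cutoff_def by (rule ramp(1)) (use p power_mono[OF that, of 2] in \<open>simp add: divide_le_0_iff\<close>)
  show "cutoff c a b x = 0" if "b \<le> norm (x - c)"
    unfolding cutoff_def by (rule ramp(2)) (use p power_mono[OF that, of 2] assms in simp)
qed (simp_all add: cutoff_def ramp)

lemma pd_cutoff_annular:
  assumes ab: "0 \<le> a" "a < b" and d: "d \<in> Basis"
  shows "pd d (cutoff c a b) \<in> annular c a b"
  unfolding annular_def
proof safe
  show "smooth (pd d (cutoff c a b))" by (rule smooth_pd[OF smooth_cutoff d])
  fix x assume nz: "pd d (cutoff c a b) x \<noteq> 0"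
  show "a \<le> norm (x - c)"
  proof (rule ccontr)
    assume "\<not> ?thesis"
    then have "frechet_derivative (cutoff c a b) (at x) = frechet_derivative (\<lambda>_. 1) (at x)"
      by (intro frechet_derivative_local[of "ball c a"]) (auto simp: dist_norm norm_minus_commute cutoff(1)[OF ab])
    then show False using nz by simp
  qed
  show "norm (x - c) \<le> b"
  proof (rule ccontr)
    assume "\<not> ?thesis"
    then have "frechet_derivative (cutoff c a b) (at x) = frechet_derivative (\<lambda>_. 0) (at x)"
      by (intro frechet_derivative_local[of "- cball c b"]) (auto simp: dist_norm norm_minus_commute cutoff(2)[OF ab])
    then show False using nz by simp
  qed
qed

lemma annular_bounded:
  assumes g: "g \<in> annular c r1 r2"
  shows "\<exists>B\<ge>0. \<forall>x. \<bar>g x\<bar> \<le> B"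
proof -
  have "bounded (g ` cball c r2)"
    using g by (intro compact_imp_bounded compact_continuous_image continuous_on_subset[OF smooth_continuous[OF annular_smooth[OF g]]]) auto
  then obtain B where B: "\<forall>x\<in>cball c r2. \<bar>g x\<bar> \<le> B" unfolding bounded_iff by auto
  have "\<bar>g x\<bar> \<le> \<bar>B\<bar>" for x
  proof (cases "g x = 0")
    case False
    then have "x \<in> cball c r2" using g by (auto simp: annular_def dist_norm norm_minus_commute)
    then show ?thesis using B by force
  qed simp
  then show ?thesis by (intro exI[of _ "\<bar>B\<bar>"]) auto
qed

lemma L2_bounded_mult:
  assumes F: "L2 F" and g: "g \<in> borel_measurable borel" "\<And>x. \<bar>g x\<bar> \<le> B"
  shows "L2 (\<lambda>x. g x * F x)" "nrm2 (\<lambda>x. g x * F x) \<le> B\<^sup>2 * nrm2 F"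
proof -
  have i: "integrable lborel (\<lambda>x. B\<^sup>2 * (F x)\<^sup>2)" using F by (auto simp: L2_def)
  have m: "(\<lambda>x. g x * F x) \<in> borel_measurable borel" using F g by (auto simp: L2_def)
  have le: "(g x * F x)\<^sup>2 \<le> B\<^sup>2 * (F x)\<^sup>2" for x
  proof -
    have "\<bar>g x\<bar>\<^sup>2 \<le> B\<^sup>2" by (intro power_mono g) auto
    then show ?thesis by (simp add: power_mult_distrib mult_right_mono)
  qed
  show "L2 (\<lambda>x. g x * F x)" using L2I_bound(1)[OF m i le] .
  show "nrm2 (\<lambda>x. g x * F x) \<le> B\<^sup>2 * nrm2 F" using L2I_bound(2)[OF m i le] by (simp add: nrm2_def)
qed

text \<open>If \<open>p(\<cdot> - h e\<^sub>1) - p = \<partial>\<^sub>d w\<close> on the annulus where \<open>\<eta>\<close> is not constant, then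
  \<open>glue \<eta> h w d p\<close> is \<open>p + \<partial>\<^sub>d(\<eta> w)\<close> there: gluing preserves curl-freeness and circulations.\<close>

definition glue :: "(real^2 \<Rightarrow> real) \<Rightarrow> real \<Rightarrow> (real^2 \<Rightarrow> real) \<Rightarrow> real^2 \<Rightarrow> (real^2 \<Rightarrow> real) \<Rightarrow> real^2 \<Rightarrow> real" where
  "glue \<eta> h w d p x = (1 - \<eta> x) * p x + \<eta> x * p (x + (- h) *\<^sub>R e1) + w x * pd d \<eta> x"

text \<open>Gluing fields is dual to deforming test functions: the deformed function is
  \<open>\<phi>\<close> where \<open>\<eta>\<close> vanishes nearby and
  \<open>\<phi>(\<cdot> + h e\<^sub>1)\<close> where \<open>\<eta>\<close> is 1 nearby. This single
  identity yields both the curl and the circulation statements.\<close>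

lemma glue_curl:
  fixes c :: "real^2"
  assumes ab: "0 \<le> a" "a < b" and L: "L2 p1" "L2 p2" "L2 w"
    and w: "\<And>g. g \<in> annular c a b \<Longrightarrow> (\<integral>x. w x * g x \<partial>lborel) = - (\<integral>x. p1 x * shifts e1 h g x \<partial>lborel) - k * (\<integral>x. g x \<partial>lborel)"
    and \<phi>: "smooth \<phi>" "compact C" "\<And>x. \<phi> x \<noteq> 0 \<Longrightarrow> x \<in> C"
  defines "\<eta> \<equiv> cutoff c a b"
  shows "curl_pair (glue \<eta> h w e1 p1) (glue \<eta> h w e2 p2) \<phi>
     = curl_pair p1 p2 (\<lambda>x. \<phi> x + shifts e1 h (\<lambda>x. \<eta> x * pd e1 \<phi> x) x)"
proof -
  have s\<eta>: "smooth \<eta>" unfolding \<eta>_def by (rule smooth_cutoff)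
  have \<eta>0: "\<eta> x = 0" if "b \<le> norm (x - c)" for x unfolding \<eta>_def by (rule cutoff(2)[OF ab that])
  \<comment> \<open>The field \<open>(Y1, Y2)\<close> is \<open>\<eta>\<close> times the rotated
    gradient of \<open>\<phi>\<close>. Since that gradient is divergence free, the divergence
    \<open>g\<close> of the field contains only derivatives of \<open>\<eta>\<close> and lives on
    the annulus.\<close>
  define Y1 where "Y1 x = - (\<eta> x * pd e2 \<phi> x)" for x
  define Y2 where "Y2 x = \<eta> x * pd e1 \<phi> x" for x
  have sY2: "smooth Y2" unfolding Y2_def[abs_def] by (intro smooth_mult smooth_pd s\<eta> \<phi>) simp
  have sY1: "smooth Y1"
  proof -
    have "smooth (\<lambda>x. (-1) * (\<eta> x * pd e2 \<phi> x))"
      by (intro smooth_mult smooth_pd s\<eta> \<phi>) (auto simp: smooth_def Ck_const)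
    then show ?thesis by (simp add: Y1_def[abs_def])
  qed
  have aY: "Y1 \<in> annular c (-1) b" "Y2 \<in> annular c (-1) b"
  proof -
    have "\<eta> x \<noteq> 0 \<Longrightarrow> - 1 \<le> norm (x - c) \<and> norm (x - c) \<le> b" for x
      using \<eta>0[of x] norm_ge_zero[of "x - c"] by linarith
    then show "Y1 \<in> annular c (-1) b" "Y2 \<in> annular c (-1) b"
      using sY1 sY2 by (auto simp: annular_def Y1_def Y2_def)
  qed
  have LY: "L2 Y1" "L2 Y2" using annular_L2 aY by blast+
  have LYt: "L2 (\<lambda>x. Y1 (x + h *\<^sub>R e1))" "L2 (\<lambda>x. Y2 (x + h *\<^sub>R e1))" using L2_translate(1) LY by blast+
  have pd\<phi>: "L2 (pd d \<phi>)" if "d \<in> Basis" for d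
  proof (rule compact_support_L2[OF smooth_continuous[OF smooth_pd[OF \<phi>(1) that]] \<phi>(2)])
    fix x assume nz: "pd d \<phi> x \<noteq> 0"
    show "x \<in> C"
    proof (rule ccontr)
      assume "x \<notin> C"
      then have "frechet_derivative \<phi> (at x) = frechet_derivative (\<lambda>_. 0) (at x)"
        by (intro frechet_derivative_local[of "- C"]) (use \<phi> in \<open>auto simp: compact_imp_closed open_Compl\<close>)
      then show False using nz by simp
    qed
  qed
  define g where "g x = pd e2 \<eta> x * pd e1 \<phi> x - pd e1 \<eta> x * pd e2 \<phi> x" for x
  have prod: "pd d (\<lambda>x. \<eta> x * F x) x = \<eta> x * pd d F x + pd d \<eta> x * F x" if "smooth F" for F d x
    using fun_cong[OF pd_eqI[OF has_derivative_mult[OF smooth_has_derivative[OF s\<eta>] smooth_has_derivative[OF that]]], of x d]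
    by simp
  have gdiv: "g x = pd e2 Y2 x + pd e1 Y1 x" for x
  proof -
    have s: "smooth (pd e1 \<phi>)" "smooth (pd e2 \<phi>)" using smooth_pd[OF \<phi>(1)] by simp_all
    have "pd e1 Y1 x = - pd e1 (\<lambda>x. \<eta> x * pd e2 \<phi> x) x"
      unfolding Y1_def[abs_def]
      using fun_cong[OF pd_eqI[OF has_derivative_minus[OF smooth_has_derivative[OF smooth_mult[OF s\<eta> s(2)]]]], of x e1] by simp
    then show ?thesis
      unfolding Y2_def[abs_def] g_def prod[OF s(1)] prod[OF s(2)]
      using fun_cong[OF mixed_partials[OF \<phi>(1) e_basis], of x] by simp
  qed
  have ga: "g \<in> annular c a b"
  proof -
    have "smooth (\<lambda>x. pd e2 Y2 x + pd e1 Y1 x)" by (intro smooth_add smooth_pd sY1 sY2) simp_all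
    then have "smooth g" using gdiv by (simp add: gdiv[abs_def])
    moreover have "a \<le> norm (x - c) \<and> norm (x - c) \<le> b" if "g x \<noteq> 0" for x
    proof -
      have "pd e2 \<eta> x \<noteq> 0 \<or> pd e1 \<eta> x \<noteq> 0" using that by (auto simp: g_def)
      then show ?thesis using pd_cutoff_annular[OF ab e_basis(1), of c] pd_cutoff_annular[OF ab e_basis(2), of c]
        unfolding \<eta>_def annular_def by blast
    qed
    ultimately show ?thesis by (simp add: annular_def)
  qed
  have pY: "integrable lborel (pd e2 Y2)" "integrable lborel (pd e1 Y1)"
    using annular_integrable[OF annular_pd[OF aY(2)]] annular_integrable[OF annular_pd[OF aY(1)]] by simp_all
  \<comment> \<open>The constant \<open>k\<close> of the potential drops out because
    \<open>g\<close>, a divergence with compact support, has integral zero.\<close>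
  have int0: "(\<integral>x. g x \<partial>lborel) = 0"
  proof -
    have "(\<integral>x. pd d Y x \<partial>lborel) = 0" if "Y \<in> annular c (-1) b" "d \<in> Basis" for Y d
      by (rule integral_pd_zero[OF annular_smooth[OF that(1)] compact_cball _ that(2), of c b])
         (use that(1) in \<open>auto simp: annular_def dist_norm norm_minus_commute\<close>)
    then show ?thesis unfolding gdiv using pY aY by simp
  qed
  define HY where "HY = shifts e1 h Y2"
  have HYa: "HY \<in> annular c (-1 - \<bar>h\<bar>) (b + \<bar>h\<bar>)" unfolding HY_def by (rule annular_shifts[OF aY(2)]) auto
  have sHY: "smooth HY" by (rule annular_smooth[OF HYa])
  have LHY: "L2 (pd d HY)" if "d \<in> Basis" for d using annular_L2[OF annular_pd[OF HYa that]] .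
  have Hg: "shifts e1 h g x = pd e2 HY x + Y1 (x + h *\<^sub>R e1) - Y1 x" for x
  proof -
    have c: "continuous_on {0..1} (\<lambda>t. h * F (x + t *\<^sub>R h *\<^sub>R e1))" if "continuous_on UNIV F" for F :: "real^2 \<Rightarrow> real"
      by (intro continuous_intros continuous_on_compose2[OF that]) auto
    have "shifts e1 h g x = shifts e1 h (pd e2 Y2) x + shifts e1 h (pd e1 Y1) x"
      unfolding shifts_def smear_def gdiv distrib_left
      by (intro Henstock_Kurzweil_Integration.integral_add integrable_continuous_interval c smooth_continuous smooth_pd sY1 sY2 e_basis)
    also have "shifts e1 h (pd e2 Y2) x = pd e2 HY x"
      unfolding HY_def by (rule fun_cong[OF pd_shifts'[OF sY2 e_basis(2), symmetric]])
    also have "shifts e1 h (pd e1 Y1) x = Y1 (x + h *\<^sub>R e1) - Y1 x"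
      using pd_shifts[OF sY1 e_basis(1)] fun_cong[OF pd_shifts'[OF sY1 e_basis(1), of e1 h]] by simp
    finally show ?thesis by simp
  qed
  have HYd: "pd e1 HY x = Y2 (x + h *\<^sub>R e1) - Y2 x" for x
    unfolding HY_def by (rule pd_shifts[OF sY2 e_basis(1)])
  note I = L2_mult_integrable
  have Lt: "L2 (\<lambda>x. p1 (x + (- h) *\<^sub>R e1))" "L2 (\<lambda>x. p2 (x + (- h) *\<^sub>R e1))" using L2_translate(1) L by blast+
  have tr: "(\<integral>x. p (x + (- h) *\<^sub>R e1) * Y x \<partial>lborel) = (\<integral>x. p x * Y (x + h *\<^sub>R e1) \<partial>lborel)" if "L2 p" "L2 Y" for p Y :: "real^2 \<Rightarrow> real"
    using integral_translate[of "\<lambda>x. p (x + (- h) *\<^sub>R e1) * Y x" "h *\<^sub>R e1"] L2_measurable[OF that(1)] L2_measurable[OF that(2)]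
    by simp
  have Lp: "L2 (pd e1 \<phi>)" "L2 (pd e2 \<phi>)" using pd\<phi> by simp_all
  have Lg: "L2 g" by (rule annular_L2[OF ga])
  have Lh: "L2 (pd e1 HY)" "L2 (pd e2 HY)" using LHY by simp_all
  have "curl_pair (glue \<eta> h w e1 p1) (glue \<eta> h w e2 p2) \<phi>
     = (\<integral>x. (p2 x * pd e1 \<phi> x - p1 x * pd e2 \<phi> x) - (p2 x * Y2 x + p1 x * Y1 x)
          + (p2 (x + (- h) *\<^sub>R e1) * Y2 x + p1 (x + (- h) *\<^sub>R e1) * Y1 x) + w x * g x \<partial>lborel)"
    unfolding curl_pair_def glue_def Y1_def Y2_def g_def
    by (rule Bochner_Integration.integral_cong[OF refl]) (simp add: algebra_simps)
  also have "\<dots> = ((\<integral>x. p2 x * pd e1 \<phi> x \<partial>lborel) - (\<integral>x. p1 x * pd e2 \<phi> x \<partial>lborel)) - ((\<integral>x. p2 x * Y2 x \<partial>lborel) + (\<integral>x. p1 x * Y1 x \<partial>lborel))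
      + ((\<integral>x. p2 x * Y2 (x + h *\<^sub>R e1) \<partial>lborel) + (\<integral>x. p1 x * Y1 (x + h *\<^sub>R e1) \<partial>lborel)) + (\<integral>x. w x * g x \<partial>lborel)"
    unfolding tr[OF L(2) LY(2), symmetric] tr[OF L(1) LY(1), symmetric]
    by (simp add: I L Lp LY Lt Lg del: scaleR_minus_left)
  also have "(\<integral>x. w x * g x \<partial>lborel) = - (\<integral>x. p1 x * pd e2 HY x + p1 x * Y1 (x + h *\<^sub>R e1) - p1 x * Y1 x \<partial>lborel)"
    unfolding w[OF ga] int0 Hg by (simp add: algebra_simps)
  also have "(\<integral>x. p1 x * pd e2 HY x + p1 x * Y1 (x + h *\<^sub>R e1) - p1 x * Y1 x \<partial>lborel)
    = (\<integral>x. p1 x * pd e2 HY x \<partial>lborel) + (\<integral>x. p1 x * Y1 (x + h *\<^sub>R e1) \<partial>lborel) - (\<integral>x. p1 x * Y1 x \<partial>lborel)"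
    by (simp add: I L LY LYt Lh)
  finally have lhs: "curl_pair (glue \<eta> h w e1 p1) (glue \<eta> h w e2 p2) \<phi>
    = (\<integral>x. p2 x * pd e1 \<phi> x \<partial>lborel) - (\<integral>x. p1 x * pd e2 \<phi> x \<partial>lborel)
      + ((\<integral>x. p2 x * Y2 (x + h *\<^sub>R e1) \<partial>lborel) - (\<integral>x. p2 x * Y2 x \<partial>lborel)) - (\<integral>x. p1 x * pd e2 HY x \<partial>lborel)"
    by simp
  have sum: "pd d (\<lambda>x. \<phi> x + HY x) x = pd d \<phi> x + pd d HY x" for d x
    using fun_cong[OF pd_eqI[OF has_derivative_add[OF smooth_has_derivative[OF \<phi>(1)] smooth_has_derivative[OF sHY]]], of x d] by simp
  have "curl_pair p1 p2 (\<lambda>x. \<phi> x + HY x)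
     = (\<integral>x. p2 x * pd e1 \<phi> x + (p2 x * Y2 (x + h *\<^sub>R e1) - p2 x * Y2 x) - (p1 x * pd e2 \<phi> x + p1 x * pd e2 HY x) \<partial>lborel)"
    unfolding curl_pair_def sum HYd by (simp add: algebra_simps)
  also have "\<dots> = (\<integral>x. p2 x * pd e1 \<phi> x \<partial>lborel) + ((\<integral>x. p2 x * Y2 (x + h *\<^sub>R e1) \<partial>lborel) - (\<integral>x. p2 x * Y2 x \<partial>lborel))
      - ((\<integral>x. p1 x * pd e2 \<phi> x \<partial>lborel) + (\<integral>x. p1 x * pd e2 HY x \<partial>lborel))"
    by (simp add: I L LY LYt Lp Lh)
  finally show ?thesis using lhs unfolding HY_def Y2_def[abs_def] by simp
qed

lemma test_functions_smooth:
  "\<phi> \<in> test_functions U \<longleftrightarrow> smooth \<phi> \<and> (\<exists>C. compact C \<and> C \<subseteq> U \<and> (\<forall>x. x \<notin> C \<longrightarrow> \<phi> x = 0))"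
  by (simp add: test_functions_def smooth_def)

definition holes :: "real \<Rightarrow> (real^2) set \<Rightarrow> (real^2) set" where
  "holes \<epsilon> S = (\<Union>z\<in>S. cball z \<epsilon>)"

text \<open>A strain is handled as the pair of its rows \<open>(p\<^sub>1, p\<^sub>2)\<close> and \<open>(q\<^sub>1, q\<^sub>2)\<close>, each a curl-free
  field on the perforated domain; the first row has circulation \<open>s\<close> around every hole, the second 0.\<close>

definition row_admissible :: "(real^2) set \<Rightarrow> real \<Rightarrow> (real^2) set \<Rightarrow> real \<Rightarrow> (real^2 \<Rightarrow> real) \<Rightarrow> (real^2 \<Rightarrow> real) \<Rightarrow> bool" where
  "row_admissible \<Omega> \<epsilon> S s p1 p2 \<longleftrightarrow> L2 p1 \<and> L2 p2 \<and>
     (\<forall>x. x \<notin> \<Omega> - holes \<epsilon> S \<longrightarrow> p1 x = 0 \<and> p2 x = 0) \<and>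
     (\<forall>\<phi>\<in>test_functions (\<Omega> - holes \<epsilon> S). curl_pair p1 p2 \<phi> = 0) \<and>
     (\<forall>z\<in>S. \<forall>\<phi>\<in>test_functions \<Omega>.
        (\<exists>V. open V \<and> cball z \<epsilon> \<subseteq> V \<and> (\<forall>x\<in>V. \<phi> x = 1)) \<and>
        (\<exists>V. open V \<and> \<Omega> - (\<Omega> - holes \<epsilon> S) - cball z \<epsilon> \<subseteq> V \<and> (\<forall>x\<in>V. \<phi> x = 0)) \<longrightarrow>
        - curl_pair p1 p2 \<phi> = s)"

lemma L2_glue:
  assumes ab: "0 \<le> a" "a < b" and L: "L2 p" "L2 w" and d: "d \<in> Basis"
  shows "L2 (glue (cutoff c a b) h w d p)"
proof -
  have m: "cutoff c a b \<in> borel_measurable borel"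
    by (rule borel_measurable_continuous_onI[OF smooth_continuous[OF smooth_cutoff]])
  obtain B where B: "\<forall>x. \<bar>pd d (cutoff c a b) x\<bar> \<le> B"
    using annular_bounded[OF pd_cutoff_annular[OF ab d]] by blast
  have md: "pd d (cutoff c a b) \<in> borel_measurable borel"
    by (rule borel_measurable_continuous_onI[OF smooth_continuous[OF smooth_pd[OF smooth_cutoff d]]])
  have 1: "L2 (\<lambda>x. (1 - cutoff c a b x) * p x)"
    by (rule L2_bounded_mult(1)[OF L(1), of _ 1]) (use m cutoff(3,4)[OF ab] in auto)
  have 2: "L2 (\<lambda>x. cutoff c a b x * p (x + (- h) *\<^sub>R e1))"
    by (rule L2_bounded_mult(1)[OF L2_translate(1)[OF L(1)], of _ 1]) (use m cutoff(3,4)[OF ab] in auto)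
  have 3: "L2 (\<lambda>x. pd d (cutoff c a b) x * w x)"
    by (rule L2_bounded_mult(1)[OF L(2) md]) (use B in blast)
  show ?thesis
    unfolding glue_def[abs_def] using L2_add(1)[OF L2_add(1)[OF 1 2] 3] by (simp add: mult.commute)
qed

text \<open>By \<open>glue_curl\<close> the glued row is tested by testing the original row with
  \<open>\<Psi> \<phi>\<close>. It remains to see that \<open>\<Psi>\<close> carries test functions
  for the new holes to test functions for the old ones: beyond the annulus it is the identity,
  inside it translates by \<open>h\<close>, and no hole meets the annulus in between.\<close>

lemma glue_row:
  fixes c z :: "real^2"
  assumes r: "0 \<le> e0" "e0 < a - \<bar>h\<bar>" "a < b" "b + \<bar>h\<bar> < b0" and cb: "cball c b0 \<subseteq> \<Omega>"
    and S: "finite S" "z \<in> S" and z: "cball z \<epsilon> \<subseteq> cball c e0" "cball (z + h *\<^sub>R e1) \<epsilon> \<subseteq> cball c e0"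
    and sep: "\<And>z'. z' \<in> S - {z} \<Longrightarrow> cball z' \<epsilon> \<inter> cball c b0 = {}"
    and p: "row_admissible \<Omega> \<epsilon> S s p1 p2" and Lw: "L2 w"
    and w: "\<And>g. g \<in> annular c a b \<Longrightarrow> (\<integral>x. w x * g x \<partial>lborel) = - (\<integral>x. p1 x * shifts e1 h g x \<partial>lborel) - k * (\<integral>x. g x \<partial>lborel)"
  shows "row_admissible \<Omega> \<epsilon> (insert (z + h *\<^sub>R e1) (S - {z})) s
           (glue (cutoff c a b) h w e1 p1) (glue (cutoff c a b) h w e2 p2)"
proof -
  define \<eta> where "\<eta> = cutoff c a b"
  have ab: "0 \<le> a" "a < b" using r by auto
  have \<eta>1: "\<eta> x = 1" if "norm (x - c) \<le> a" for x unfolding \<eta>_def by (rule cutoff(1)[OF ab that])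
  have \<eta>0: "\<eta> x = 0" if "b \<le> norm (x - c)" for x unfolding \<eta>_def by (rule cutoff(2)[OF ab that])
  have d\<eta>: "pd d \<eta> x = 0" if "norm (x - c) < a \<or> b < norm (x - c)" "d \<in> Basis" for x d
    using pd_cutoff_annular[OF ab that(2), of c] that(1) unfolding \<eta>_def annular_def by (auto simp: not_le[symmetric])
  let ?S' = "insert (z + h *\<^sub>R e1) (S - {z})"
  define H0 where "H0 = holes \<epsilon> (S - {z})"
  have HS: "holes \<epsilon> S = H0 \<union> cball z \<epsilon>" "holes \<epsilon> ?S' = H0 \<union> cball (z + h *\<^sub>R e1) \<epsilon>"
    using S(2) by (auto simp: holes_def H0_def)
  have H0: "b0 < norm (x - c)" if "x \<in> H0" for x
    using that sep unfolding H0_def holes_def by (force simp: dist_norm norm_minus_commute disjoint_iff)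
  have inz: "norm (x - c) \<le> e0" if "x \<in> cball z \<epsilon> \<or> x \<in> cball (z + h *\<^sub>R e1) \<epsilon>" for x
    using that z by (auto simp: dist_norm norm_minus_commute subset_iff)
  have big: "x \<in> \<Omega>" if "norm (x - c) \<le> b0" for x
    using that cb by (auto simp: dist_norm norm_minus_commute subset_iff)
  have trz: "x + h *\<^sub>R e1 \<in> cball (z + h *\<^sub>R e1) \<epsilon> \<longleftrightarrow> x \<in> cball z \<epsilon>" for x by (simp add: dist_norm)
  have nsh: "norm (x + t *\<^sub>R h *\<^sub>R e1 - c) \<le> norm (x - c) + \<bar>h\<bar>" "norm (x - c) \<le> norm (x + t *\<^sub>R h *\<^sub>R e1 - c) + \<bar>h\<bar>"
    if "t \<in> {0..1}" for x :: "real^2" and t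
  proof -
    have "\<bar>t\<bar> * \<bar>h\<bar> \<le> 1 * \<bar>h\<bar>" using that by (intro mult_right_mono) auto
    then have n: "norm (t *\<^sub>R h *\<^sub>R (e1::real^2)) \<le> \<bar>h\<bar>" by (simp add: abs_mult)
    show "norm (x + t *\<^sub>R h *\<^sub>R e1 - c) \<le> norm (x - c) + \<bar>h\<bar>"
      using n norm_triangle_ineq[of "x - c" "t *\<^sub>R h *\<^sub>R e1"] by (simp add: algebra_simps)
    show "norm (x - c) \<le> norm (x + t *\<^sub>R h *\<^sub>R e1 - c) + \<bar>h\<bar>"
      using n norm_triangle_ineq4[of "x + t *\<^sub>R h *\<^sub>R e1 - c" "t *\<^sub>R h *\<^sub>R e1"] by (simp add: algebra_simps)
  qed
  define \<Psi> where "\<Psi> \<phi> x = \<phi> x + shifts e1 h (\<lambda>x. \<eta> x * pd e1 \<phi> x) x" for \<phi> x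
  have s\<Psi>: "smooth (\<Psi> \<phi>)" if "smooth \<phi>" for \<phi>
    unfolding \<Psi>_def[abs_def] shifts_def \<eta>_def
    by (intro smooth_add that smooth_smear continuous_on_const smooth_mult smooth_cutoff smooth_pd) simp
  have \<Psi>out: "\<Psi> \<phi> x = \<phi> x" if "b + \<bar>h\<bar> \<le> norm (x - c)" for \<phi> x
  proof -
    have "shifts e1 h (\<lambda>x. \<eta> x * pd e1 \<phi> x) x = 0"
    proof (rule ccontr)
      assume "shifts e1 h (\<lambda>x. \<eta> x * pd e1 \<phi> x) x \<noteq> 0"
      then obtain t where "t \<in> {0..1}" "\<eta> (x + t *\<^sub>R h *\<^sub>R e1) * pd e1 \<phi> (x + t *\<^sub>R h *\<^sub>R e1) \<noteq> 0"
        unfolding shifts_def by (rule smear_nonzero)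
      then show False using \<eta>0[of "x + t *\<^sub>R h *\<^sub>R e1"] nsh(2)[of t x] that by auto
    qed
    then show ?thesis by (simp add: \<Psi>_def)
  qed
  have \<Psi>in: "\<Psi> \<phi> x = \<phi> (x + h *\<^sub>R e1)" if "norm (x - c) \<le> a - \<bar>h\<bar>" "smooth \<phi>" for \<phi> x
  proof -
    have "shifts e1 h (\<lambda>x. \<eta> x * pd e1 \<phi> x) x = shifts e1 h (pd e1 \<phi>) x"
      unfolding shifts_def smear_def
    proof (rule Henstock_Kurzweil_Integration.integral_cong)
      fix t :: real assume "t \<in> {0..1}"
      then have "\<eta> (x + t *\<^sub>R h *\<^sub>R e1) = 1" using nsh(1)[of t x] that(1) by (intro \<eta>1) auto
      then show "h * (\<eta> (x + t *\<^sub>R h *\<^sub>R e1) * pd e1 \<phi> (x + t *\<^sub>R h *\<^sub>R e1)) = h * pd e1 \<phi> (x + t *\<^sub>R h *\<^sub>R e1)" by simp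
    qed
    also have "\<dots> = \<phi> (x + h *\<^sub>R e1) - \<phi> x"
      using pd_shifts[OF that(2) e_basis(1), of h x] fun_cong[OF pd_shifts'[OF that(2) e_basis(1), of e1 h]] by simp
    finally show ?thesis by (simp add: \<Psi>_def)
  qed
  have L: "L2 p1" "L2 p2" and p0: "\<And>x. x \<notin> \<Omega> - holes \<epsilon> S \<Longrightarrow> p1 x = 0 \<and> p2 x = 0"
    and pc: "\<And>\<phi>. \<phi> \<in> test_functions (\<Omega> - holes \<epsilon> S) \<Longrightarrow> curl_pair p1 p2 \<phi> = 0"
    and pt: "\<And>z \<phi>. z \<in> S \<Longrightarrow> \<phi> \<in> test_functions \<Omega> \<Longrightarrow>
        (\<exists>V. open V \<and> cball z \<epsilon> \<subseteq> V \<and> (\<forall>x\<in>V. \<phi> x = 1)) \<Longrightarrow>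
        (\<exists>V. open V \<and> \<Omega> - (\<Omega> - holes \<epsilon> S) - cball z \<epsilon> \<subseteq> V \<and> (\<forall>x\<in>V. \<phi> x = 0)) \<Longrightarrow>
        - curl_pair p1 p2 \<phi> = s"
    using p unfolding row_admissible_def by blast+
  have key: "curl_pair (glue \<eta> h w e1 p1) (glue \<eta> h w e2 p2) \<phi> = curl_pair p1 p2 (\<Psi> \<phi>)" if \<phi>: "\<phi> \<in> test_functions W" for \<phi> W
  proof -
    obtain C where C: "smooth \<phi>" "compact C" "\<And>x. \<phi> x \<noteq> 0 \<Longrightarrow> x \<in> C"
      using \<phi> unfolding test_functions_smooth by blast
    show ?thesis unfolding \<eta>_def \<Psi>_def[abs_def] by (rule glue_curl[OF ab L Lw w C])
  qed
  have opn: "open ((\<lambda>x. x + h *\<^sub>R e1) -` V)" if "open V" for V :: "(real^2) set"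
    using that by (intro continuous_open_vimage[rule_format] continuous_intros)
  have opn2: "open {x::real^2. b + \<bar>h\<bar> < norm (x - c)}" "open {x::real^2. norm (x - c) < a - \<bar>h\<bar>}"
    by (intro open_Collect_less continuous_intros)+
  have test\<Omega>: "\<Psi> \<phi> \<in> test_functions \<Omega>" if \<phi>: "\<phi> \<in> test_functions \<Omega>" for \<phi>
  proof -
    obtain C where C: "smooth \<phi>" "compact C" "C \<subseteq> \<Omega>" "\<And>x. x \<notin> C \<Longrightarrow> \<phi> x = 0"
      using \<phi> unfolding test_functions_smooth by blast
    have "compact (C \<union> cball c b0)" "C \<union> cball c b0 \<subseteq> \<Omega>" using C cb by auto
    moreover have "\<Psi> \<phi> x = 0" if "x \<notin> C \<union> cball c b0" for x
    proof -
      have "b + \<bar>h\<bar> \<le> norm (x - c)" using that r by (auto simp: dist_norm norm_minus_commute)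
      then show ?thesis using \<Psi>out that C(4) by simp
    qed
    ultimately show ?thesis unfolding test_functions_smooth using s\<Psi>[OF C(1)] by blast
  qed
  show ?thesis
    unfolding row_admissible_def \<eta>_def[symmetric]
  proof (intro conjI allI impI ballI)
    show "L2 (glue \<eta> h w e1 p1)" "L2 (glue \<eta> h w e2 p2)"
      unfolding \<eta>_def by (intro L2_glue ab L Lw e_basis)+
    fix x assume x: "x \<notin> \<Omega> - holes \<epsilon> ?S'"
    have "glue \<eta> h w d p x = 0" if dd: "d \<in> Basis" "\<And>x. x \<notin> \<Omega> - holes \<epsilon> S \<Longrightarrow> p x = 0" for d p
    proof (cases "x \<in> cball (z + h *\<^sub>R e1) \<epsilon>")
      case True
      then have "norm (x - c) \<le> e0" using inz by blast
      then have n: "norm (x - c) < a" using r by linarith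
      have "x + (- h) *\<^sub>R e1 \<in> cball z \<epsilon>" using trz[of "x + (- h) *\<^sub>R e1"] True by simp
      then have "p (x + (- h) *\<^sub>R e1) = 0" using dd(2) HS(1) by blast
      then show ?thesis using n \<eta>1[of x] d\<eta>[of x d] dd(1) by (simp add: glue_def)
    next
      case False
      then have cs: "x \<notin> \<Omega> \<or> x \<in> H0" using x HS(2) by blast
      then have "b0 < norm (x - c)" using H0[of x] big[of x] by (meson not_le)
      then have n: "b < norm (x - c)" using r by linarith
      have "p x = 0" using cs dd(2) HS(1) by blast
      then show ?thesis using n \<eta>0[of x] d\<eta>[of x d] dd(1) by (simp add: glue_def)
    qed
    then show "glue \<eta> h w e1 p1 x = 0" "glue \<eta> h w e2 p2 x = 0" using p0 by simp_all
  next
    fix \<phi> assume \<phi>: "\<phi> \<in> test_functions (\<Omega> - holes \<epsilon> ?S')"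
    then obtain C where C: "smooth \<phi>" "compact C" "C \<subseteq> \<Omega> - holes \<epsilon> ?S'" "\<And>x. x \<notin> C \<Longrightarrow> \<phi> x = 0"
      unfolding test_functions_smooth by blast
    \<comment> \<open>A compact set outside which \<open>\<Psi> \<phi>\<close> vanishes:
      \<open>C\<close> itself far out, the translate of \<open>C\<close> near the moved hole, and
      the whole transition annulus, where nothing has to be known about \<open>\<Psi> \<phi>\<close>
      because there are no holes.\<close>
    define C' where "C' = (C \<inter> {x. b + \<bar>h\<bar> \<le> norm (x - c)}) \<union> (cball c (b + \<bar>h\<bar>) \<inter> {x. a - \<bar>h\<bar> \<le> norm (x - c)})
       \<union> (cball c (a - \<bar>h\<bar>) \<inter> (\<lambda>x. x + (- h) *\<^sub>R e1) ` C)"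
    have cl: "closed {x::real^2. t \<le> norm (x - c)}" for t
      by (intro closed_Collect_le continuous_intros)
    have "compact C'" unfolding C'_def
      by (intro compact_Un compact_Int_closed[OF C(2) cl] compact_Int_closed[OF compact_cball cl] compact_Int compact_cball
          compact_continuous_image C(2) continuous_intros)
    moreover have "C' \<subseteq> \<Omega> - holes \<epsilon> S"
    proof
      fix x assume "x \<in> C'"
      then consider "x \<in> C" "b + \<bar>h\<bar> \<le> norm (x - c)" | "norm (x - c) \<le> b + \<bar>h\<bar>" "a - \<bar>h\<bar> \<le> norm (x - c)"
        | "norm (x - c) \<le> a - \<bar>h\<bar>" "x + h *\<^sub>R e1 \<in> C"
        unfolding C'_def by (auto simp: dist_norm norm_minus_commute)
      then show "x \<in> \<Omega> - holes \<epsilon> S"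
      proof cases
        case 1
        then have "x \<notin> cball z \<epsilon>" using inz[of x] r by force
        then show ?thesis using 1 C(3) HS by blast
      next
        case 2
        then have "x \<notin> cball z \<epsilon>" "x \<notin> H0" "x \<in> \<Omega>" using inz[of x] H0[of x] big[of x] r by force+
        then show ?thesis using HS by blast
      next
        case 3
        then have "x \<notin> H0" "x \<in> \<Omega>" using H0[of x] big[of x] r by force+
        moreover have "x \<notin> cball z \<epsilon>" using 3(2) C(3) HS(2) trz[of x] by blast
        ultimately show ?thesis using HS by blast
      qed
    qed
    moreover have "\<Psi> \<phi> x = 0" if x: "x \<notin> C'" for x
    proof -
      consider "b + \<bar>h\<bar> \<le> norm (x - c)" | "norm (x - c) \<le> a - \<bar>h\<bar>" | "norm (x - c) < b + \<bar>h\<bar>" "a - \<bar>h\<bar> < norm (x - c)" by linarith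
      then show ?thesis
      proof cases
        case 1 then show ?thesis using x \<Psi>out[OF 1] C(4)[of x] by (auto simp: C'_def)
      next
        case 2
        have "x + h *\<^sub>R e1 \<notin> C"
        proof
          assume "x + h *\<^sub>R e1 \<in> C"
          then have "x \<in> (\<lambda>x. x + (- h) *\<^sub>R e1) ` C" by (intro image_eqI[of _ _ "x + h *\<^sub>R e1"]) auto
          then show False using x 2 by (auto simp: C'_def dist_norm norm_minus_commute)
        qed
        then show ?thesis using \<Psi>in[OF 2 C(1)] C(4) by simp
      next
        case 3 then show ?thesis using x by (auto simp: C'_def dist_norm norm_minus_commute)
      qed
    qed
    ultimately have "\<Psi> \<phi> \<in> test_functions (\<Omega> - holes \<epsilon> S)"
      unfolding test_functions_smooth using s\<Psi>[OF C(1)] by blast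
    then show "curl_pair (glue \<eta> h w e1 p1) (glue \<eta> h w e2 p2) \<phi> = 0" using key[OF \<phi>] pc by simp
  next
    fix z' \<phi>
    assume z': "z' \<in> ?S'" and \<phi>: "\<phi> \<in> test_functions \<Omega>"
      and VW: "(\<exists>V. open V \<and> cball z' \<epsilon> \<subseteq> V \<and> (\<forall>x\<in>V. \<phi> x = 1)) \<and>
        (\<exists>V. open V \<and> \<Omega> - (\<Omega> - holes \<epsilon> ?S') - cball z' \<epsilon> \<subseteq> V \<and> (\<forall>x\<in>V. \<phi> x = 0))"
    obtain V where V: "open V" "cball z' \<epsilon> \<subseteq> V" "\<And>x. x \<in> V \<Longrightarrow> \<phi> x = 1" using VW by blast
    obtain W where W: "open W" "\<Omega> - (\<Omega> - holes \<epsilon> ?S') - cball z' \<epsilon> \<subseteq> W" "\<And>x. x \<in> W \<Longrightarrow> \<phi> x = 0" using VW by blast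
    have s\<phi>: "smooth \<phi>" using \<phi> by (simp add: test_functions_smooth)
    have far: "b + \<bar>h\<bar> < norm (x - c)" if "x \<in> H0" for x using H0[OF that] r by linarith
    have close: "norm (x - c) < a - \<bar>h\<bar>" if "x \<in> cball z \<epsilon> \<or> x \<in> cball (z + h *\<^sub>R e1) \<epsilon>" for x using inz[OF that] r by linarith
    have sub\<Omega>: "x \<in> \<Omega>" if "x \<in> cball z \<epsilon> \<or> x \<in> cball (z + h *\<^sub>R e1) \<epsilon>" for x using inz[OF that] r by (intro big) linarith
    have dj: "x \<notin> H0" if "x \<in> cball z \<epsilon> \<or> x \<in> cball (z + h *\<^sub>R e1) \<epsilon>" for x using inz[OF that] H0[of x] r by force
    show "- curl_pair (glue \<eta> h w e1 p1) (glue \<eta> h w e2 p2) \<phi> = s"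
      unfolding key[OF \<phi>]
    proof (cases "z' = z + h *\<^sub>R e1")
      case True
      \<comment> \<open>For the moved hole, the value 1 near the new position is pulled back by the
        translation to a neighbourhood of the old position.\<close>
      define V1 where "V1 = ((\<lambda>x. x + h *\<^sub>R e1) -` V) \<inter> {x. norm (x - c) < a - \<bar>h\<bar>}"
      define W1 where "W1 = W \<inter> {x. b + \<bar>h\<bar> < norm (x - c)}"
      show "- curl_pair p1 p2 (\<Psi> \<phi>) = s"
      proof (rule pt[OF S(2) test\<Omega>[OF \<phi>]])
        show "\<exists>V. open V \<and> cball z \<epsilon> \<subseteq> V \<and> (\<forall>x\<in>V. \<Psi> \<phi> x = 1)"
        proof (intro exI[of _ V1] conjI ballI)
          show "open V1" unfolding V1_def by (intro open_Int opn V opn2)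
          show "cball z \<epsilon> \<subseteq> V1"
          proof
            fix x assume x: "x \<in> cball z \<epsilon>"
            then have "x + h *\<^sub>R e1 \<in> V" using trz[of x] V(2) True by blast
            then show "x \<in> V1" using close x by (simp add: V1_def)
          qed
          show "\<Psi> \<phi> x = 1" if "x \<in> V1" for x using that \<Psi>in[OF _ s\<phi>, of x] V(3) by (simp add: V1_def)
        qed
        show "\<exists>V. open V \<and> \<Omega> - (\<Omega> - holes \<epsilon> S) - cball z \<epsilon> \<subseteq> V \<and> (\<forall>x\<in>V. \<Psi> \<phi> x = 0)"
        proof (intro exI[of _ W1] conjI ballI)
          show "open W1" unfolding W1_def by (intro open_Int W opn2)
          show "\<Omega> - (\<Omega> - holes \<epsilon> S) - cball z \<epsilon> \<subseteq> W1"
          proof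
            fix x assume x: "x \<in> \<Omega> - (\<Omega> - holes \<epsilon> S) - cball z \<epsilon>"
            then have "x \<in> H0" "x \<in> \<Omega>" using HS(1) by auto
            moreover then have "x \<notin> cball z' \<epsilon>" using dj True by blast
            ultimately have "x \<in> W" using W(2) HS(2) by blast
            then show "x \<in> W1" using far[OF \<open>x \<in> H0\<close>] by (simp add: W1_def)
          qed
          show "\<Psi> \<phi> x = 0" if "x \<in> W1" for x using that \<Psi>out[of x \<phi>] W(3) by (simp add: W1_def)
        qed
      qed
    next
      case False
      then have zS: "z' \<in> S" "z' \<noteq> z" using z' by auto
      have zH: "cball z' \<epsilon> \<subseteq> H0" using zS by (auto simp: H0_def holes_def)
      define V1 where "V1 = V \<inter> {x. b + \<bar>h\<bar> < norm (x - c)}"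
      \<comment> \<open>For another hole, \<open>\<Psi> \<phi>\<close> has to vanish near the old
        position of the moved hole as well; this comes from the vanishing of \<open>\<phi>\<close>
        near the new position.\<close>
      define W1 where "W1 = (W \<inter> {x. b + \<bar>h\<bar> < norm (x - c)}) \<union> (((\<lambda>x. x + h *\<^sub>R e1) -` W) \<inter> {x. norm (x - c) < a - \<bar>h\<bar>})"
      show "- curl_pair p1 p2 (\<Psi> \<phi>) = s"
      proof (rule pt[OF zS(1) test\<Omega>[OF \<phi>]])
        show "\<exists>V. open V \<and> cball z' \<epsilon> \<subseteq> V \<and> (\<forall>x\<in>V. \<Psi> \<phi> x = 1)"
        proof (intro exI[of _ V1] conjI ballI)
          show "open V1" unfolding V1_def by (intro open_Int V opn2)
          show "cball z' \<epsilon> \<subseteq> V1" using V(2) zH far by (auto simp: V1_def)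
          show "\<Psi> \<phi> x = 1" if "x \<in> V1" for x using that \<Psi>out[of x \<phi>] V(3) by (simp add: V1_def)
        qed
        show "\<exists>V. open V \<and> \<Omega> - (\<Omega> - holes \<epsilon> S) - cball z' \<epsilon> \<subseteq> V \<and> (\<forall>x\<in>V. \<Psi> \<phi> x = 0)"
        proof (intro exI[of _ W1] conjI ballI)
          show "open W1" unfolding W1_def by (intro open_Un open_Int W opn opn2)
          show "\<Omega> - (\<Omega> - holes \<epsilon> S) - cball z' \<epsilon> \<subseteq> W1"
          proof
            fix x assume x: "x \<in> \<Omega> - (\<Omega> - holes \<epsilon> S) - cball z' \<epsilon>"
            show "x \<in> W1"
            proof (cases "x \<in> cball z \<epsilon>")
              case True
              then have t: "x + h *\<^sub>R e1 \<in> cball (z + h *\<^sub>R e1) \<epsilon>" using trz by blast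
              then have "x + h *\<^sub>R e1 \<notin> cball z' \<epsilon>" using dj zH by blast
              then have "x + h *\<^sub>R e1 \<in> W" using t sub\<Omega> W(2) HS(2) by blast
              then show ?thesis using close True by (simp add: W1_def)
            next
              case False
              then have "x \<in> H0" using x HS(1) by blast
              then have "x \<in> W" using x W(2) HS(2) by blast
              then show ?thesis using far[OF \<open>x \<in> H0\<close>] by (simp add: W1_def)
            qed
          qed
          show "\<Psi> \<phi> x = 0" if "x \<in> W1" for x
            using that \<Psi>out[of x \<phi>] \<Psi>in[OF _ s\<phi>, of x] W(3) by (auto simp: W1_def)
        qed
      qed
    qed
  qed
qed

text \<open>\<open>\<bbbC>F : F\<close> for \<open>x = F\<^sub>1\<^sub>1\<close>, \<open>y = F\<^sub>2\<^sub>2\<close>, \<open>s = F\<^sub>1\<^sub>2 + F\<^sub>2\<^sub>1\<close>, as a combination of squares with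
  positive coefficients.\<close>

definition strain_form :: "real \<Rightarrow> real \<Rightarrow> real \<Rightarrow> real \<Rightarrow> real \<Rightarrow> real" where
  "strain_form lam sh x y s = (lam + sh) * (x + y)\<^sup>2 + sh * (x - y)\<^sup>2 + sh * s\<^sup>2"

definition strain_energy :: "real \<Rightarrow> real \<Rightarrow> (real^2 \<Rightarrow> real) \<Rightarrow> (real^2 \<Rightarrow> real) \<Rightarrow> (real^2 \<Rightarrow> real) \<Rightarrow> (real^2 \<Rightarrow> real) \<Rightarrow> real" where
  "strain_energy lam sh p1 p2 q1 q2 = (\<integral>x. strain_form lam sh (p1 x) (q2 x) (p2 x + q1 x) \<partial>lborel)"

section \<open>The elastic energy of a glued strain\<close>

lemma square_add_le:
  fixes u v \<theta> :: real
  assumes "\<theta> > 0" shows "(u + v)\<^sup>2 \<le> (1 + \<theta>) * u\<^sup>2 + (1 + 1 / \<theta>) * v\<^sup>2"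
proof -
  have "0 \<le> (\<theta> * u - v)\<^sup>2 / \<theta>" using assms by simp
  also have "(\<theta> * u - v)\<^sup>2 / \<theta> = \<theta> * u\<^sup>2 + v\<^sup>2 / \<theta> - 2 * u * v"
    using assms by (simp add: power2_eq_square field_simps)
  finally show ?thesis by (simp add: power2_sum algebra_simps)
qed

lemma square_convex:
  fixes u v t :: real
  assumes "0 \<le> t" "t \<le> 1" shows "((1 - t) * u + t * v)\<^sup>2 \<le> (1 - t) * u\<^sup>2 + t * v\<^sup>2"
proof -
  have "0 \<le> t * (1 - t) * (u - v)\<^sup>2" using assms by simp
  also have "t * (1 - t) * (u - v)\<^sup>2 = (1 - t) * u\<^sup>2 + t * v\<^sup>2 - ((1 - t) * u + t * v)\<^sup>2"
    by (simp add: power2_eq_square algebra_simps)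
  finally show ?thesis by simp
qed

context
  fixes lam sh :: real
  assumes sh: "sh > 0" and lam: "lam + sh > 0"
begin

lemma strain_form_nonneg: "0 \<le> strain_form lam sh x y s"
  using sh lam by (simp add: strain_form_def)

lemma strain_form_add:
  assumes "\<theta> > 0"
  shows "strain_form lam sh (x + x') (y + y') (s + s')
    \<le> (1 + \<theta>) * strain_form lam sh x y s + (1 + 1 / \<theta>) * strain_form lam sh x' y' s'"
proof -
  have 1: "((x + x') + (y + y'))\<^sup>2 \<le> (1 + \<theta>) * (x + y)\<^sup>2 + (1 + 1 / \<theta>) * (x' + y')\<^sup>2"
    using square_add_le[OF assms, of "x + y" "x' + y'"] by (simp add: algebra_simps)
  have 2: "((x + x') - (y + y'))\<^sup>2 \<le> (1 + \<theta>) * (x - y)\<^sup>2 + (1 + 1 / \<theta>) * (x' - y')\<^sup>2"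
    using square_add_le[OF assms, of "x - y" "x' - y'"] by (simp add: algebra_simps)
  have "strain_form lam sh (x + x') (y + y') (s + s')
    \<le> (lam + sh) * ((1 + \<theta>) * (x + y)\<^sup>2 + (1 + 1 / \<theta>) * (x' + y')\<^sup>2)
      + sh * ((1 + \<theta>) * (x - y)\<^sup>2 + (1 + 1 / \<theta>) * (x' - y')\<^sup>2) + sh * ((1 + \<theta>) * s\<^sup>2 + (1 + 1 / \<theta>) * s'\<^sup>2)"
    unfolding strain_form_def
    by (intro add_mono mult_left_mono 1 2 square_add_le assms) (use sh lam in simp_all)
  also have "\<dots> = (1 + \<theta>) * strain_form lam sh x y s + (1 + 1 / \<theta>) * strain_form lam sh x' y' s'"
    by (simp add: strain_form_def distrib_left mult_ac)
  finally show ?thesis .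
qed

lemma strain_form_convex:
  assumes t: "0 \<le> t" "t \<le> 1"
  shows "strain_form lam sh ((1 - t) * x + t * x') ((1 - t) * y + t * y') ((1 - t) * s + t * s')
    \<le> (1 - t) * strain_form lam sh x y s + t * strain_form lam sh x' y' s'"
proof -
  have 1: "(((1 - t) * x + t * x') + ((1 - t) * y + t * y'))\<^sup>2 \<le> (1 - t) * (x + y)\<^sup>2 + t * (x' + y')\<^sup>2"
    using square_convex[OF t, of "x + y" "x' + y'"] by (simp add: algebra_simps)
  have 2: "(((1 - t) * x + t * x') - ((1 - t) * y + t * y'))\<^sup>2 \<le> (1 - t) * (x - y)\<^sup>2 + t * (x' - y')\<^sup>2"
    using square_convex[OF t, of "x - y" "x' - y'"] by (simp add: algebra_simps)
  have "strain_form lam sh ((1 - t) * x + t * x') ((1 - t) * y + t * y') ((1 - t) * s + t * s')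
    \<le> (lam + sh) * ((1 - t) * (x + y)\<^sup>2 + t * (x' + y')\<^sup>2)
      + sh * ((1 - t) * (x - y)\<^sup>2 + t * (x' - y')\<^sup>2) + sh * ((1 - t) * s\<^sup>2 + t * s'\<^sup>2)"
    unfolding strain_form_def
    by (intro add_mono mult_left_mono 1 2 square_convex t) (use sh lam in simp_all)
  also have "\<dots> = (1 - t) * strain_form lam sh x y s + t * strain_form lam sh x' y' s'"
    unfolding strain_form_def by algebra
  finally show ?thesis .
qed

lemma strain_form_upper:
  "strain_form lam sh x y s \<le> (2 * (lam + sh) + 2 * sh) * (x\<^sup>2 + y\<^sup>2 + s\<^sup>2)"
proof -
  have "(x + y)\<^sup>2 \<le> 2 * (x\<^sup>2 + y\<^sup>2)" "(x - y)\<^sup>2 \<le> 2 * (x\<^sup>2 + y\<^sup>2)"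
    using sum_squares_bound[of x y] sum_squares_bound[of x "-y"] by (simp_all add: power2_sum power2_diff)
  then have "strain_form lam sh x y s \<le> (lam + sh) * (2 * (x\<^sup>2 + y\<^sup>2)) + sh * (2 * (x\<^sup>2 + y\<^sup>2)) + sh * s\<^sup>2"
    unfolding strain_form_def using sh lam by (intro add_mono mult_left_mono) auto
  also have "\<dots> \<le> (2 * (lam + sh) + 2 * sh) * (x\<^sup>2 + y\<^sup>2 + s\<^sup>2)"
  proof -
    have "0 \<le> (2 * (lam + sh) + sh) * s\<^sup>2" using sh lam by simp
    then show ?thesis by (simp add: algebra_simps)
  qed
  finally show ?thesis .
qed

lemma strain_form_lower: "min (lam + sh) sh * (x\<^sup>2 + y\<^sup>2 + s\<^sup>2) \<le> strain_form lam sh x y s"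
proof -
  let ?m = "min (lam + sh) sh"
  have m: "0 \<le> ?m" using sh lam by simp
  have "?m * (x\<^sup>2 + y\<^sup>2 + s\<^sup>2) \<le> ?m * ((x + y)\<^sup>2 + (x - y)\<^sup>2 + s\<^sup>2)"
    using m by (intro mult_left_mono) (simp_all add: power2_sum power2_diff)
  also have "\<dots> \<le> strain_form lam sh x y s"
    unfolding strain_form_def distrib_left by (intro add_mono mult_right_mono) auto
  finally show ?thesis .
qed

lemma strain_form_integrable:
  assumes "L2 p1" "L2 p2" "L2 q1" "L2 q2"
  shows "integrable lborel (\<lambda>x. strain_form lam sh (p1 x) (q2 x) (p2 x + q1 x))"
proof -
  have n: "L2 (\<lambda>x. - q2 x)" by (rule L2_minus(1)[OF assms(4)])
  have "integrable lborel (\<lambda>x. (p1 x + q2 x)\<^sup>2)" "integrable lborel (\<lambda>x. (p1 x - q2 x)\<^sup>2)" "integrable lborel (\<lambda>x. (p2 x + q1 x)\<^sup>2)"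
    using L2_add(1)[OF assms(1,4)] L2_add(1)[OF assms(1) n] L2_add(1)[OF assms(2,3)] by (simp_all add: L2_def)
  then show ?thesis unfolding strain_form_def by simp
qed

lemma strain_energy_nonneg: "0 \<le> strain_energy lam sh p1 p2 q1 q2"
  unfolding strain_energy_def using strain_form_nonneg by simp

lemma strain_energy_lower:
  assumes L: "L2 p1" "L2 p2" "L2 q1" "L2 q2"
  shows "min (lam + sh) sh * (nrm2 p1 + nrm2 q2 + nrm2 (\<lambda>x. p2 x + q1 x)) \<le> strain_energy lam sh p1 p2 q1 q2"
proof -
  have i: "integrable lborel (\<lambda>x. (p1 x)\<^sup>2)" "integrable lborel (\<lambda>x. (q2 x)\<^sup>2)" "integrable lborel (\<lambda>x. (p2 x + q1 x)\<^sup>2)"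
    using L L2_add(1)[OF L(2,3)] by (simp_all add: L2_def)
  have "min (lam + sh) sh * (nrm2 p1 + nrm2 q2 + nrm2 (\<lambda>x. p2 x + q1 x))
    = (\<integral>x. min (lam + sh) sh * ((p1 x)\<^sup>2 + (q2 x)\<^sup>2 + (p2 x + q1 x)\<^sup>2) \<partial>lborel)"
    using i by (simp add: nrm2_def)
  also have "\<dots> \<le> strain_energy lam sh p1 p2 q1 q2"
    unfolding strain_energy_def
    by (intro integral_mono strain_form_integrable L strain_form_lower) (use i in simp)
  finally show ?thesis .
qed

text \<open>The glued strain is a convex combination of the strain and its translate plus the
  products of the potentials with derivatives of \<open>\<eta>\<close>. Translating back, the convex
  part has the weight \<open>1 - \<eta>(x) + \<eta>(x + h e\<^sub>1)\<close>, at most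
  \<open>1 + \<bar>h\<bar> * B\<close>; the products are separated off by Young's inequality with
  parameter \<open>\<theta>\<close>.\<close>

lemma glue_energy:
  assumes ab: "0 \<le> a" "a < b" and L: "L2 p1" "L2 p2" "L2 q1" "L2 q2" "L2 w1" "L2 w2" and \<theta>: "\<theta> > 0"
    and B: "\<And>x. \<bar>pd e1 (cutoff c a b) x\<bar> \<le> B" "\<And>x. \<bar>pd e2 (cutoff c a b) x\<bar> \<le> B"
  defines "\<eta> \<equiv> cutoff c a b"
  shows "strain_energy lam sh (glue \<eta> h w1 e1 p1) (glue \<eta> h w1 e2 p2) (glue \<eta> h w2 e1 q1) (glue \<eta> h w2 e2 q2)
     \<le> (1 + \<theta>) * (1 + \<bar>h\<bar> * B) * strain_energy lam sh p1 p2 q1 q2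
       + (1 + 1 / \<theta>) * ((2 * (lam + sh) + 2 * sh) * (3 * B\<^sup>2)) * (nrm2 w1 + nrm2 w2)"
proof -
  let ?q = "strain_form lam sh"
  define T :: "real^2" where "T = (- h) *\<^sub>R e1"
  define Q where "Q x = ?q (p1 x) (q2 x) (p2 x + q1 x)" for x
  define K where "K = (2 * (lam + sh) + 2 * sh) * (3 * B\<^sup>2)"
  have K0: "0 \<le> 2 * (lam + sh) + 2 * sh" using sh lam by simp
  have \<eta>: "0 \<le> \<eta> x" "\<eta> x \<le> 1" for x unfolding \<eta>_def by (rule cutoff(3,4)[OF ab])+
  have m\<eta>[measurable]: "\<eta> \<in> borel_measurable borel"
    unfolding \<eta>_def by (rule borel_measurable_continuous_onI[OF smooth_continuous[OF smooth_cutoff]])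
  have iQ: "integrable lborel Q" unfolding Q_def[abs_def] by (rule strain_form_integrable[OF L(1-4)])
  have mQ[measurable]: "Q \<in> borel_measurable borel" using iQ by simp
  have iQt: "integrable lborel (\<lambda>x. Q (x + T))"
  proof -
    have "integrable (distr lborel borel ((+) T)) Q" using iQ by (simp add: lborel_distr_plus)
    then show ?thesis by (subst (asm) integrable_distr_eq) (auto simp: add.commute)
  qed
  have iw: "integrable lborel (\<lambda>x. (w1 x)\<^sup>2 + (w2 x)\<^sup>2)" using L by (simp add: L2_def)
  have iA: "integrable lborel (\<lambda>x. (1 - \<eta> x) * Q x)"
    by (rule Bochner_Integration.integrable_bound[OF iQ]) (use \<eta> in \<open>auto simp: abs_mult mult_left_le_one_le\<close>)
  have iB: "integrable lborel (\<lambda>x. \<eta> x * Q (x + T))"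
    by (rule Bochner_Integration.integrable_bound[OF iQt]) (use \<eta> in \<open>auto simp: abs_mult mult_left_le_one_le\<close>)
  have mC[measurable]: "(\<lambda>x. \<eta> (x + h *\<^sub>R e1)) \<in> borel_measurable borel" by measurable
  have iC: "integrable lborel (\<lambda>x. \<eta> (x + h *\<^sub>R e1) * Q x)"
    by (rule Bochner_Integration.integrable_bound[OF iQ]) (use \<eta> in \<open>auto simp: abs_mult mult_left_le_one_le\<close>)
  have pt: "?q (glue \<eta> h w1 e1 p1 x) (glue \<eta> h w2 e2 q2 x) (glue \<eta> h w1 e2 p2 x + glue \<eta> h w2 e1 q1 x)
     \<le> (1 + \<theta>) * ((1 - \<eta> x) * Q x + \<eta> x * Q (x + T)) + (1 + 1 / \<theta>) * (K * ((w1 x)\<^sup>2 + (w2 x)\<^sup>2))" for x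
  proof -
    define t where "t = \<eta> x"
    have t: "0 \<le> t" "t \<le> 1" using \<eta> by (auto simp: t_def)
    let ?x = "(1 - t) * p1 x + t * p1 (x + T)" and ?y = "(1 - t) * q2 x + t * q2 (x + T)"
    let ?s = "(1 - t) * (p2 x + q1 x) + t * (p2 (x + T) + q1 (x + T))"
    let ?a = "pd e1 \<eta> x" and ?b = "pd e2 \<eta> x"
    have "?q (glue \<eta> h w1 e1 p1 x) (glue \<eta> h w2 e2 q2 x) (glue \<eta> h w1 e2 p2 x + glue \<eta> h w2 e1 q1 x)
       = ?q (?x + w1 x * ?a) (?y + w2 x * ?b) (?s + (w1 x * ?b + w2 x * ?a))"
      by (simp add: glue_def t_def T_def algebra_simps)
    also have "\<dots> \<le> (1 + \<theta>) * ?q ?x ?y ?s + (1 + 1 / \<theta>) * ?q (w1 x * ?a) (w2 x * ?b) (w1 x * ?b + w2 x * ?a)"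
      by (rule strain_form_add[OF \<theta>])
    also have "\<dots> \<le> (1 + \<theta>) * ((1 - t) * Q x + t * Q (x + T)) + (1 + 1 / \<theta>) * (K * ((w1 x)\<^sup>2 + (w2 x)\<^sup>2))"
    proof (intro add_mono mult_left_mono)
      show "?q ?x ?y ?s \<le> (1 - t) * Q x + t * Q (x + T)"
        unfolding Q_def by (rule strain_form_convex[OF t])
      have ab2: "?a\<^sup>2 \<le> B\<^sup>2" "?b\<^sup>2 \<le> B\<^sup>2"
        using power_mono[OF B(1)[of x], of 2] power_mono[OF B(2)[of x], of 2] by (simp_all add: \<eta>_def)
      have m: "(w1 x * ?a)\<^sup>2 \<le> (w1 x)\<^sup>2 * B\<^sup>2" "(w2 x * ?b)\<^sup>2 \<le> (w2 x)\<^sup>2 * B\<^sup>2" "(w1 x * ?b)\<^sup>2 \<le> (w1 x)\<^sup>2 * B\<^sup>2" "(w2 x * ?a)\<^sup>2 \<le> (w2 x)\<^sup>2 * B\<^sup>2"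
        unfolding power_mult_distrib by (intro mult_left_mono ab2 zero_le_power2)+
      have s: "(w1 x * ?b + w2 x * ?a)\<^sup>2 \<le> 2 * (w1 x * ?b)\<^sup>2 + 2 * (w2 x * ?a)\<^sup>2"
        using sum_squares_bound[of "w1 x * ?b" "w2 x * ?a"] by (simp add: power2_sum)
      have "?q (w1 x * ?a) (w2 x * ?b) (w1 x * ?b + w2 x * ?a)
         \<le> (2 * (lam + sh) + 2 * sh) * ((w1 x * ?a)\<^sup>2 + (w2 x * ?b)\<^sup>2 + (w1 x * ?b + w2 x * ?a)\<^sup>2)"
        by (rule strain_form_upper)
      also have "\<dots> \<le> (2 * (lam + sh) + 2 * sh) * (3 * B\<^sup>2 * ((w1 x)\<^sup>2 + (w2 x)\<^sup>2))"
        using m s K0 by (intro mult_left_mono) (simp_all add: algebra_simps)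
      finally show "?q (w1 x * ?a) (w2 x * ?b) (w1 x * ?b + w2 x * ?a) \<le> K * ((w1 x)\<^sup>2 + (w2 x)\<^sup>2)"
        by (simp add: K_def mult_ac)
    qed (use \<theta> in auto)
    finally show ?thesis by (simp add: t_def)
  qed
  have "strain_energy lam sh (glue \<eta> h w1 e1 p1) (glue \<eta> h w1 e2 p2) (glue \<eta> h w2 e1 q1) (glue \<eta> h w2 e2 q2)
     \<le> (\<integral>x. (1 + \<theta>) * ((1 - \<eta> x) * Q x + \<eta> x * Q (x + T)) + (1 + 1 / \<theta>) * (K * ((w1 x)\<^sup>2 + (w2 x)\<^sup>2)) \<partial>lborel)"
    unfolding strain_energy_def
  proof (rule integral_mono[OF _ _ pt])
    show "integrable lborel (\<lambda>x. ?q (glue \<eta> h w1 e1 p1 x) (glue \<eta> h w2 e2 q2 x) (glue \<eta> h w1 e2 p2 x + glue \<eta> h w2 e1 q1 x))"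
      unfolding \<eta>_def by (intro strain_form_integrable L2_glue ab L e_basis)
    show "integrable lborel (\<lambda>x. (1 + \<theta>) * ((1 - \<eta> x) * Q x + \<eta> x * Q (x + T)) + (1 + 1 / \<theta>) * (K * ((w1 x)\<^sup>2 + (w2 x)\<^sup>2)))"
      using iA iB iw by simp
  qed
  also have "\<dots> = (1 + \<theta>) * ((\<integral>x. (1 - \<eta> x) * Q x \<partial>lborel) + (\<integral>x. \<eta> x * Q (x + T) \<partial>lborel)) + (1 + 1 / \<theta>) * K * (nrm2 w1 + nrm2 w2)"
    using iA iB iw L by (simp add: nrm2_def L2_def)
  also have "(\<integral>x. \<eta> x * Q (x + T) \<partial>lborel) = (\<integral>x. \<eta> (x + h *\<^sub>R e1) * Q x \<partial>lborel)"
    using integral_translate[of "\<lambda>x. \<eta> x * Q (x + T)" "h *\<^sub>R e1"] by (simp add: T_def)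
  also have "(\<integral>x. (1 - \<eta> x) * Q x \<partial>lborel) + (\<integral>x. \<eta> (x + h *\<^sub>R e1) * Q x \<partial>lborel)
     = (\<integral>x. (1 - \<eta> x) * Q x + \<eta> (x + h *\<^sub>R e1) * Q x \<partial>lborel)" using iA iC by simp
  also have "\<dots> \<le> (\<integral>x. (1 + \<bar>h\<bar> * B) * Q x \<partial>lborel)"
  proof (rule integral_mono)
    fix x
    have Q0: "0 \<le> Q x" unfolding Q_def by (rule strain_form_nonneg)
    have "\<eta> (x + h *\<^sub>R e1) - \<eta> x = shifts e1 h (pd e1 \<eta>) x"
      unfolding \<eta>_def using pd_shifts[OF smooth_cutoff e_basis(1), of h c a b x] fun_cong[OF pd_shifts'[OF smooth_cutoff e_basis(1), of e1 h c a b], of x] by simp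
    also have "\<dots> \<le> \<bar>h\<bar> * B * (1 - 0)"
    proof -
      have c: "continuous_on {0..1} (\<lambda>t. h * pd e1 \<eta> (x + t *\<^sub>R h *\<^sub>R e1))"
        unfolding \<eta>_def
        by (intro continuous_intros continuous_on_compose2[OF smooth_continuous[OF smooth_pd[OF smooth_cutoff e_basis(1)]]]) auto
      have "norm (integral {0..1} (\<lambda>t. h * pd e1 \<eta> (x + t *\<^sub>R h *\<^sub>R e1))) \<le> \<bar>h\<bar> * B * (1 - 0)"
        by (rule integral_bound[OF _ c]) (use B in \<open>auto simp: \<eta>_def abs_mult intro!: mult_left_mono\<close>)
      then show ?thesis unfolding shifts_def smear_def by simp
    qed
    finally have "(1 - \<eta> x + \<eta> (x + h *\<^sub>R e1)) * Q x \<le> (1 + \<bar>h\<bar> * B) * Q x"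
      using Q0 by (intro mult_right_mono) auto
    then show "(1 - \<eta> x) * Q x + \<eta> (x + h *\<^sub>R e1) * Q x \<le> (1 + \<bar>h\<bar> * B) * Q x" by (simp add: distrib_right)
  qed (use iA iC iQ in auto)
  also have "\<dots> = (1 + \<bar>h\<bar> * B) * strain_energy lam sh p1 p2 q1 q2"
    by (simp add: strain_energy_def Q_def)
  finally show ?thesis using \<theta> by (simp add: K_def mult_ac)
qed

text \<open>One \<open>h0\<close> serves all strains and all hole patterns that avoid the annulus.
  The centre \<open>c\<close> need not be the hole, so a hole can be moved onto a fixed target with
  a threshold depending on the target only.\<close>

theorem hole_move:
  fixes c :: "real^2"
  assumes r: "0 < e0" "e0 < b0" and cb: "cball c b0 \<subseteq> \<Omega>" and \<kappa>: "\<kappa> > 0"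
  obtains h0 where "h0 > 0" and
    "\<And>h S z \<epsilon> s1 s2 p1 p2 q1 q2. \<bar>h\<bar> < h0 \<Longrightarrow> finite S \<Longrightarrow> z \<in> S \<Longrightarrow> cball z \<epsilon> \<subseteq> cball c e0 \<Longrightarrow>
      cball (z + h *\<^sub>R e1) \<epsilon> \<subseteq> cball c e0 \<Longrightarrow> (\<And>z'. z' \<in> S - {z} \<Longrightarrow> cball z' \<epsilon> \<inter> cball c b0 = {}) \<Longrightarrow>
      row_admissible \<Omega> \<epsilon> S s1 p1 p2 \<Longrightarrow> row_admissible \<Omega> \<epsilon> S s2 q1 q2 \<Longrightarrow>
      \<exists>P1 P2 Q1 Q2. row_admissible \<Omega> \<epsilon> (insert (z + h *\<^sub>R e1) (S - {z})) s1 P1 P2 \<and>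
        row_admissible \<Omega> \<epsilon> (insert (z + h *\<^sub>R e1) (S - {z})) s2 Q1 Q2 \<and>
        strain_energy lam sh P1 P2 Q1 Q2 \<le> (1 + \<kappa>) * strain_energy lam sh p1 p2 q1 q2"
proof -
  \<comment> \<open>Five layers between \<open>e0\<close> and \<open>b0\<close>: gluing takes place
    in the third, the curl conditions are used on the three middle ones, and the outermost layers
    keep the holes away.\<close>
  define D where "D = (b0 - e0) / 5"
  have D: "D > 0" using r by (simp add: D_def)
  define a where "a = e0 + 2 * D"
  define b where "b = e0 + 3 * D"
  have b0: "b0 = e0 + 5 * D" by (simp add: D_def field_simps)
  have ab: "0 \<le> a" "a < b" using r D by (auto simp: a_def b_def)
  obtain B1 where B1: "B1 \<ge> 0" "\<And>x. \<bar>pd e1 (cutoff c a b) x\<bar> \<le> B1"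
    using annular_bounded[OF pd_cutoff_annular[OF ab e_basis(1), of c]] by blast
  obtain B2 where B2: "B2 \<ge> 0" "\<And>x. \<bar>pd e2 (cutoff c a b) x\<bar> \<le> B2"
    using annular_bounded[OF pd_cutoff_annular[OF ab e_basis(2), of c]] by blast
  define B where "B = B1 + B2"
  have B: "B \<ge> 0" "\<And>x. \<bar>pd e1 (cutoff c a b) x\<bar> \<le> B" "\<And>x. \<bar>pd e2 (cutoff c a b) x\<bar> \<le> B"
    using B1(1) B2(1) add_increasing2[OF B2(1) B1(2)] add_increasing[OF B1(1) B2(2)] unfolding B_def by auto
  \<comment> \<open>Budget for the factor \<open>1 + \<kappa>\<close>:
    \<open>(1 + \<theta>) * (1 + \<theta>) \<le> 1 + 3 * \<theta>\<close> spends three quarters of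
    \<open>\<kappa>\<close>, and the potentials with \<open>M * (2 * \<kappa>')\<close> the last
    quarter.\<close>
  define \<theta> where "\<theta> = min \<kappa> 1 / 4"
  have \<theta>: "0 < \<theta>" "\<theta> \<le> 1/4" "4 * \<theta> \<le> \<kappa>" using \<kappa> by (auto simp: \<theta>_def)
  define m where "m = min (lam + sh) sh"
  have m: "m > 0" using sh lam by (simp add: m_def)
  \<comment> \<open>Includes the division by \<open>m\<close>, which converts the bound of the
    potentials by strain entries into one by the energy.\<close>
  define M where "M = (1 + 1 / \<theta>) * ((2 * (lam + sh) + 2 * sh) * (3 * B\<^sup>2)) / m"
  have M: "M \<ge> 0" using \<theta> sh lam m by (auto simp: M_def)
  define \<kappa>' where "\<kappa>' = \<kappa> / (8 * (M + 1))"
  have \<kappa>': "\<kappa>' > 0" "M * (2 * \<kappa>') \<le> \<kappa> / 4" using \<kappa> M by (auto simp: \<kappa>'_def field_simps)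
  have rr: "0 < e0 + D" "e0 + D < a" "a \<le> b" "b < e0 + 4 * D" using r D by (auto simp: a_def b_def)
  obtain h1 where h1: "h1 > 0" and pot: "\<And>h p1 p2 q1 q2. \<bar>h\<bar> < h1 \<Longrightarrow> L2 p1 \<Longrightarrow> L2 p2 \<Longrightarrow> L2 q1 \<Longrightarrow> L2 q2 \<Longrightarrow>
    (\<And>\<zeta>. \<zeta> \<in> annular c (e0 + D) (e0 + 4 * D) \<Longrightarrow> (\<integral>x. p2 x * pd e1 \<zeta> x \<partial>lborel) = (\<integral>x. p1 x * pd e2 \<zeta> x \<partial>lborel)) \<Longrightarrow>
    (\<And>\<zeta>. \<zeta> \<in> annular c (e0 + D) (e0 + 4 * D) \<Longrightarrow> (\<integral>x. q2 x * pd e1 \<zeta> x \<partial>lborel) = (\<integral>x. q1 x * pd e2 \<zeta> x \<partial>lborel)) \<Longrightarrow>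
    \<exists>w k. L2 w \<and> nrm2 w \<le> \<kappa>' * (nrm2 p1 + nrm2 q2 + nrm2 (\<lambda>x. p2 x + q1 x)) \<and>
      (\<forall>g\<in>annular c a b. (\<integral>x. w x * g x \<partial>lborel)
         = (\<integral>x. q1 x * shifts e1 h g x \<partial>lborel) - k * (\<integral>x. g x \<partial>lborel))"
    by (rule annulus_potential[OF rr \<kappa>'(1), of c]) blast
  \<comment> \<open>The four restrictions are for the potential of the second row, for the geometry,
    for \<open>\<bar>h\<bar> * B \<le> \<theta>\<close>, and for the potential of the first row,
    which is of size \<open>h\<close>.\<close>
  define h0 where "h0 = min (min h1 (D / 2)) (min (\<theta> / (B + 1)) (sqrt \<kappa>'))"
  show thesis
  proof (rule that[of h0])
    show "h0 > 0" using h1 D \<theta> B \<kappa>' by (simp add: h0_def)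
    fix h S z \<epsilon> s1 s2 p1 p2 q1 q2
    assume h: "\<bar>h\<bar> < h0" and S: "finite S" "z \<in> S" and z: "cball z \<epsilon> \<subseteq> cball c e0" "cball (z + h *\<^sub>R e1) \<epsilon> \<subseteq> cball c e0"
      and sep: "\<And>z'. z' \<in> S - {z} \<Longrightarrow> cball z' \<epsilon> \<inter> cball c b0 = {}"
      and p: "row_admissible \<Omega> \<epsilon> S s1 p1 p2" and q: "row_admissible \<Omega> \<epsilon> S s2 q1 q2"
    have L: "L2 p1" "L2 p2" "L2 q1" "L2 q2" using p q by (auto simp: row_admissible_def)
    have hh: "\<bar>h\<bar> < h1" "\<bar>h\<bar> < D / 2" "\<bar>h\<bar> < \<theta> / (B + 1)" "\<bar>h\<bar> < sqrt \<kappa>'" using h by (auto simp: h0_def)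
    have hB: "\<bar>h\<bar> * B \<le> \<theta>"
    proof -
      have "\<bar>h\<bar> * (B + 1) \<le> \<theta>" using hh(3) B(1) by (simp add: pos_less_divide_eq)
      then show ?thesis by (simp add: distrib_left)
    qed
    have h2: "h\<^sup>2 \<le> \<kappa>'"
    proof -
      have "\<bar>h\<bar>\<^sup>2 \<le> (sqrt \<kappa>')\<^sup>2" using hh(4) by (intro power_mono) auto
      then show ?thesis using \<kappa>' by simp
    qed
    have test: "\<zeta> \<in> test_functions (\<Omega> - holes \<epsilon> S)" if \<zeta>: "\<zeta> \<in> annular c (e0 + D) (e0 + 4 * D)" for \<zeta>
    proof -
      define C where "C = cball c (e0 + 4 * D) \<inter> {x. e0 + D \<le> norm (x - c)}"
      have "compact C" unfolding C_def by (intro compact_Int_closed compact_cball closed_Collect_le continuous_intros)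
      moreover have "C \<subseteq> \<Omega> - holes \<epsilon> S"
      proof
        fix x assume "x \<in> C"
        then have x: "norm (x - c) \<le> e0 + 4 * D" "e0 + D \<le> norm (x - c)" by (auto simp: C_def dist_norm norm_minus_commute)
        then have xb: "x \<in> cball c b0" using D by (simp add: b0 dist_norm norm_minus_commute)
        have "x \<notin> cball z \<epsilon>" using z(1) x D by (auto simp: dist_norm norm_minus_commute subset_iff)
        moreover have "x \<notin> cball z' \<epsilon>" if "z' \<in> S - {z}" for z' using sep[OF that] xb by blast
        ultimately show "x \<in> \<Omega> - holes \<epsilon> S" using xb cb unfolding holes_def by blast
      qed
      moreover have "\<zeta> x = 0" if "x \<notin> C" for x
        using that \<zeta> by (auto simp: C_def annular_def dist_norm norm_minus_commute)
      ultimately show ?thesis using annular_smooth[OF \<zeta>] unfolding test_functions_smooth by blast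
    qed
    have curl: "(\<integral>x. r2 x * pd e1 \<zeta> x \<partial>lborel) = (\<integral>x. r1 x * pd e2 \<zeta> x \<partial>lborel)"
      if "row_admissible \<Omega> \<epsilon> S s r1 r2" "\<zeta> \<in> annular c (e0 + D) (e0 + 4 * D)" for s r1 r2 \<zeta>
    proof -
      have "curl_pair r1 r2 \<zeta> = 0" and Lr: "L2 r1" "L2 r2" using that(1) test[OF that(2)] by (auto simp: row_admissible_def)
      moreover have "L2 (pd e1 \<zeta>)" "L2 (pd e2 \<zeta>)" using annular_L2[OF annular_pd[OF that(2)]] by simp_all
      ultimately show ?thesis unfolding curl_pair_def by (simp add: L2_mult_integrable)
    qed
    define e where "e = nrm2 p1 + nrm2 q2 + nrm2 (\<lambda>x. p2 x + q1 x)"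
    have e: "nrm2 p1 \<le> e" "0 \<le> e"
      using nrm2_nonneg[of p1] nrm2_nonneg[of q2] nrm2_nonneg[of "\<lambda>x. p2 x + q1 x"] by (auto simp: e_def)
    obtain w k where w: "L2 w" "nrm2 w \<le> \<kappa>' * e"
      "\<And>g. g \<in> annular c a b \<Longrightarrow> (\<integral>x. w x * g x \<partial>lborel) = (\<integral>x. q1 x * shifts e1 h g x \<partial>lborel) - k * (\<integral>x. g x \<partial>lborel)"
      using pot[OF hh(1) L curl[OF p] curl[OF q]] unfolding e_def by blast
    \<comment> \<open>The sign changes because gluing needs the potential of the field shifted
      backwards minus the field.\<close>
    define w2 where "w2 x = - w x" for x
    have w2: "L2 w2" "nrm2 w2 \<le> \<kappa>' * e" using L2_minus[of w] w by (simp_all add: w2_def[abs_def])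
    have w2g: "(\<integral>x. w2 x * g x \<partial>lborel) = - (\<integral>x. q1 x * shifts e1 h g x \<partial>lborel) - (- k) * (\<integral>x. g x \<partial>lborel)"
      if "g \<in> annular c a b" for g using w(3)[OF that] by (simp add: w2_def)
    \<comment> \<open>For the first row the average of \<open>p1\<close> is itself a potential, and
      \<open>p1\<close> is a strain entry, so no mollification is required.\<close>
    define w1 where "w1 x = - avg 0 1 (\<lambda>_. h) (- (h *\<^sub>R e1)) p1 x" for x
    have av: "L2 (avg 0 1 (\<lambda>_. h) (- (h *\<^sub>R e1)) p1)" "nrm2 (avg 0 1 (\<lambda>_. h) (- (h *\<^sub>R e1)) p1) \<le> h\<^sup>2 * nrm2 p1"
      using L2_avg[OF L(1), of "\<lambda>_. h" 0 1 "\<bar>h\<bar>"] by auto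
    have w1: "L2 w1" "nrm2 w1 \<le> \<kappa>' * e"
    proof -
      show "L2 w1" unfolding w1_def[abs_def] by (rule L2_minus(1)[OF av(1)])
      have "nrm2 w1 \<le> h\<^sup>2 * nrm2 p1" unfolding w1_def[abs_def] L2_minus(2) by (rule av(2))
      also have "\<dots> \<le> \<kappa>' * e" using h2 e nrm2_nonneg[of p1] \<kappa>'(1) by (intro mult_mono) auto
      finally show "nrm2 w1 \<le> \<kappa>' * e" .
    qed
    have w1g: "(\<integral>x. w1 x * g x \<partial>lborel) = - (\<integral>x. p1 x * shifts e1 h g x \<partial>lborel) - 0 * (\<integral>x. g x \<partial>lborel)"
      if "g \<in> annular c a b" for g
      using smear_adjoint[OF L(1) that continuous_on_const, of 0 1 h "h *\<^sub>R e1"] by (simp add: w1_def shifts_def)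
    have geo: "0 \<le> e0" "e0 < a - \<bar>h\<bar>" "a < b" "b + \<bar>h\<bar> < b0"
      using r D hh(2) by (auto simp: a_def b_def b0)
    let ?S' = "insert (z + h *\<^sub>R e1) (S - {z})" and ?\<eta> = "cutoff c a b"
    have "row_admissible \<Omega> \<epsilon> ?S' s1 (glue ?\<eta> h w1 e1 p1) (glue ?\<eta> h w1 e2 p2)"
      by (rule glue_row[OF geo cb S z sep p w1(1) w1g])
    moreover have "row_admissible \<Omega> \<epsilon> ?S' s2 (glue ?\<eta> h w2 e1 q1) (glue ?\<eta> h w2 e2 q2)"
      by (rule glue_row[OF geo cb S z sep q w2(1) w2g])
    moreover have "strain_energy lam sh (glue ?\<eta> h w1 e1 p1) (glue ?\<eta> h w1 e2 p2) (glue ?\<eta> h w2 e1 q1) (glue ?\<eta> h w2 e2 q2)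
      \<le> (1 + \<kappa>) * strain_energy lam sh p1 p2 q1 q2"
    proof -
      define E where "E = strain_energy lam sh p1 p2 q1 q2"
      have E0: "0 \<le> E" unfolding E_def by (rule strain_energy_nonneg)
      have eE: "e \<le> E / m" using strain_energy_lower[OF L] m unfolding E_def e_def m_def by (simp add: field_simps)
      have "strain_energy lam sh (glue ?\<eta> h w1 e1 p1) (glue ?\<eta> h w1 e2 p2) (glue ?\<eta> h w2 e1 q1) (glue ?\<eta> h w2 e2 q2)
        \<le> (1 + \<theta>) * (1 + \<bar>h\<bar> * B) * E + (1 + 1 / \<theta>) * ((2 * (lam + sh) + 2 * sh) * (3 * B\<^sup>2)) * (nrm2 w1 + nrm2 w2)"
        unfolding E_def by (rule glue_energy[OF ab L w1(1) w2(1) \<theta>(1) B(2,3)])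
      also have "\<dots> \<le> (1 + \<theta>) * (1 + \<theta>) * E + (1 + 1 / \<theta>) * ((2 * (lam + sh) + 2 * sh) * (3 * B\<^sup>2)) * (2 * \<kappa>' * (E / m))"
      proof (intro add_mono mult_right_mono mult_left_mono)
        have "nrm2 w1 + nrm2 w2 \<le> 2 * \<kappa>' * e" using w1 w2 by simp
        also have "\<dots> \<le> 2 * \<kappa>' * (E / m)" using eE \<kappa>'(1) by (intro mult_left_mono) auto
        finally show "nrm2 w1 + nrm2 w2 \<le> 2 * \<kappa>' * (E / m)" .
      qed (use hB E0 \<theta> sh lam in auto)
      also have "\<dots> = ((1 + \<theta>) * (1 + \<theta>) + M * (2 * \<kappa>')) * E" by (simp add: M_def field_simps)
      also have "\<dots> \<le> (1 + \<kappa>) * E"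
      proof (rule mult_right_mono[OF _ E0])
        have "\<theta> * \<theta> \<le> \<theta>" using \<theta> by (simp add: mult_left_le)
        then have "(1 + \<theta>) * (1 + \<theta>) \<le> 1 + 3 * \<theta>" by (simp add: algebra_simps)
        then show "(1 + \<theta>) * (1 + \<theta>) + M * (2 * \<kappa>') \<le> 1 + \<kappa>" using \<kappa>'(2) \<theta>(3) by linarith
      qed
      finally show ?thesis unfolding E_def .
    qed
    ultimately show "\<exists>P1 P2 Q1 Q2. row_admissible \<Omega> \<epsilon> ?S' s1 P1 P2 \<and> row_admissible \<Omega> \<epsilon> ?S' s2 Q1 Q2 \<and>
        strain_energy lam sh P1 P2 Q1 Q2 \<le> (1 + \<kappa>) * strain_energy lam sh p1 p2 q1 q2"
      by blast
  qed
qed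

end

section \<open>Moving the holes\<close>

text \<open>Rests on the completeness of Lebesgue measure. Needed wherever a function is identified
  only almost everywhere, as for strains and for the power along a limit curve.\<close>

lemma lebesgue_measurable_AE_cong:
  fixes f g :: "'b::euclidean_space \<Rightarrow> 'c::topological_space"
  assumes g: "g \<in> borel_measurable lebesgue" and eq: "AE x in lebesgue. f x = g x"
  shows "f \<in> borel_measurable lebesgue"
proof -
  have c: "complete_measure (lebesgue :: 'b measure)" by unfold_locales
  show ?thesis
  proof (rule measurableI)
    fix A :: "'c set" assume A: "A \<in> sets borel"
    show "f -` A \<inter> space lebesgue \<in> sets lebesgue"
    proof (rule complete_measure.in_sets_AE[OF c])
      show "AE x in lebesgue. (x \<in> g -` A \<inter> space lebesgue) = (x \<in> f -` A \<inter> space lebesgue)"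
        using eq by eventually_elim auto
      show "g -` A \<inter> space lebesgue \<in> sets lebesgue" using measurable_sets[OF g A] .
    qed auto
  qed auto
qed

lemma strain_form_elasticity:
  "elasticity lam sh F \<bullet> F = strain_form lam sh (F $ 1 $ 1) (F $ 2 $ 2) (F $ 1 $ 2 + F $ 2 $ 1)"
  by (simp add: elasticity_def sym_part_def inner_vec_def sum_2 trace_def transpose_def mat_def
      strain_form_def power2_eq_square algebra_simps)

lemma perp_grad: "perp (grad \<phi> x) = vector [- pd e2 \<phi> x, pd e1 \<phi> x]"
  by (simp add: perp_def grad_def)

definition mat2 :: "real \<Rightarrow> real \<Rightarrow> real \<Rightarrow> real \<Rightarrow> real^2^2" where
  "mat2 a b c d = a *\<^sub>R tensor e1 e1 + b *\<^sub>R tensor e1 e2 + c *\<^sub>R tensor e2 e1 + d *\<^sub>R tensor e2 e2"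

lemma mat2_nth: "mat2 a b c d $ 1 $ 1 = a" "mat2 a b c d $ 1 $ 2 = b" "mat2 a b c d $ 2 $ 1 = c" "mat2 a b c d $ 2 $ 2 = d"
  by (simp_all add: mat2_def tensor_def axis_def)

lemma norm_mat2: "(norm (F :: real^2^2))\<^sup>2 = (F $ 1 $ 1)\<^sup>2 + (F $ 1 $ 2)\<^sup>2 + (F $ 2 $ 1)\<^sup>2 + (F $ 2 $ 2)\<^sup>2"
  unfolding power2_norm_eq_inner by (simp add: inner_vec_def sum_2 power2_eq_square)

lemma test_function_pd_L2:
  assumes "\<phi> \<in> test_functions W" "b \<in> Basis" shows "L2 (pd b \<phi>)"
proof -
  obtain C where \<phi>: "smooth \<phi>" "compact C" "\<And>x. x \<notin> C \<Longrightarrow> \<phi> x = 0"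
    using assms(1) unfolding test_functions_smooth by blast
  show ?thesis
  proof (rule compact_support_L2[OF smooth_continuous[OF smooth_pd[OF \<phi>(1) assms(2)]] \<phi>(2)])
    fix x assume nz: "pd b \<phi> x \<noteq> 0"
    show "x \<in> C"
    proof (rule ccontr)
      assume "x \<notin> C"
      then have "frechet_derivative \<phi> (at x) = frechet_derivative (\<lambda>_. 0) (at x)"
        by (intro frechet_derivative_local[of "- C"]) (use \<phi> in \<open>auto simp: compact_imp_closed open_Compl\<close>)
      then show False using nz by simp
    qed
  qed
qed

text \<open>Passes from a strain that is Lebesgue measurable on \<open>U\<close> to Borel
  representatives of its entries on the whole plane, zero off \<open>U\<close>, for which integrals
  can be taken with respect to \<open>lborel\<close>.\<close>

definition rows_of :: "(real^2) set \<Rightarrow> (real^2 \<Rightarrow> real^2^2) \<Rightarrow> (real^2 \<Rightarrow> real) \<Rightarrow> (real^2 \<Rightarrow> real) \<Rightarrow> (real^2 \<Rightarrow> real) \<Rightarrow> (real^2 \<Rightarrow> real) \<Rightarrow> bool" where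
  "rows_of U \<beta> p1 p2 q1 q2 \<longleftrightarrow> L2 p1 \<and> L2 p2 \<and> L2 q1 \<and> L2 q2 \<and>
     (\<forall>x. x \<notin> U \<longrightarrow> p1 x = 0 \<and> p2 x = 0 \<and> q1 x = 0 \<and> q2 x = 0) \<and>
     (AE x in lebesgue. x \<in> U \<longrightarrow> \<beta> x = mat2 (p1 x) (p2 x) (q1 x) (q2 x))"

lemma rows_curl_pairing:
  assumes r: "rows_of U \<beta> p1 p2 q1 q2" and \<phi>: "\<phi> \<in> test_functions W"
  shows "curl_pairing U \<beta> \<phi> $ 1 = curl_pair p1 p2 \<phi>" "curl_pairing U \<beta> \<phi> $ 2 = curl_pair q1 q2 \<phi>"
proof -
  have L: "L2 p1" "L2 p2" "L2 q1" "L2 q2" and z: "\<And>x. x \<notin> U \<Longrightarrow> p1 x = 0 \<and> p2 x = 0 \<and> q1 x = 0 \<and> q2 x = 0"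
    and ae: "AE x in lebesgue. x \<in> U \<longrightarrow> \<beta> x = mat2 (p1 x) (p2 x) (q1 x) (q2 x)"
    using r by (auto simp: rows_of_def)
  have D: "L2 (pd e1 \<phi>)" "L2 (pd e2 \<phi>)" using test_function_pd_L2[OF \<phi>] by simp_all
  define g1 where "g1 x = p2 x * pd e1 \<phi> x - p1 x * pd e2 \<phi> x" for x
  define g2 where "g2 x = q2 x * pd e1 \<phi> x - q1 x * pd e2 \<phi> x" for x
  define G :: "real^2 \<Rightarrow> real^2" where "G x = g1 x *\<^sub>R e1 + g2 x *\<^sub>R e2" for x
  have ig: "integrable lborel g1" "integrable lborel g2"
    unfolding g1_def[abs_def] g2_def[abs_def] by (intro Bochner_Integration.integrable_diff L2_mult_integrable L D)+
  have iG: "integrable lborel G" unfolding G_def[abs_def] using ig by simp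
  have mG: "G \<in> borel_measurable lborel" using iG by simp
  have eq: "AE x in lebesgue. indicator U x *\<^sub>R (\<beta> x *v perp (grad \<phi> x)) = G x"
    using ae
  proof eventually_elim
    case (elim x)
    then show ?case using z[of x]
      by (cases "x \<in> U") (simp_all add: vec_eq_iff forall_2 G_def g1_def g2_def perp_grad matrix_vector_mult_def sum_2 mat2_nth axis_def algebra_simps)
  qed
  have mGc: "G \<in> borel_measurable lebesgue" using mG by (rule measurable_completion)
  have "curl_pairing U \<beta> \<phi> = integral\<^sup>L lebesgue G"
    unfolding curl_pairing_def set_lebesgue_integral_def
    by (rule integral_cong_AE[OF lebesgue_measurable_AE_cong[OF mGc eq] mGc eq])
  also have "\<dots> = integral\<^sup>L lborel G" by (rule integral_completion[OF mG])
  also have "\<dots> = (\<integral>x. g1 x \<partial>lborel) *\<^sub>R e1 + (\<integral>x. g2 x \<partial>lborel) *\<^sub>R e2"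
    unfolding G_def using ig by simp
  finally show "curl_pairing U \<beta> \<phi> $ 1 = curl_pair p1 p2 \<phi>" "curl_pairing U \<beta> \<phi> $ 2 = curl_pair q1 q2 \<phi>"
    by (simp_all add: curl_pair_def g1_def g2_def axis_def)
qed

lemma rows_energy:
  assumes r: "rows_of U \<beta> p1 p2 q1 q2"
  shows "(LINT x:U|lebesgue. elasticity lam sh (\<beta> x) \<bullet> \<beta> x) = strain_energy lam sh p1 p2 q1 q2"
proof -
  have L: "L2 p1" "L2 p2" "L2 q1" "L2 q2" and z: "\<And>x. x \<notin> U \<Longrightarrow> p1 x = 0 \<and> p2 x = 0 \<and> q1 x = 0 \<and> q2 x = 0"
    and ae: "AE x in lebesgue. x \<in> U \<longrightarrow> \<beta> x = mat2 (p1 x) (p2 x) (q1 x) (q2 x)"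
    using r by (auto simp: rows_of_def)
  define G where "G x = strain_form lam sh (p1 x) (q2 x) (p2 x + q1 x)" for x
  have mG: "G \<in> borel_measurable lborel"
    unfolding G_def[abs_def] strain_form_def using L by (auto simp: L2_def)
  have mGc: "G \<in> borel_measurable lebesgue" using mG by (rule measurable_completion)
  have eq: "AE x in lebesgue. indicator U x *\<^sub>R (elasticity lam sh (\<beta> x) \<bullet> \<beta> x) = G x"
    using ae
  proof eventually_elim
    case (elim x)
    then show ?case using z[of x]
      by (cases "x \<in> U") (simp_all add: strain_form_elasticity G_def mat2_nth strain_form_def)
  qed
  have "(LINT x:U|lebesgue. elasticity lam sh (\<beta> x) \<bullet> \<beta> x) = integral\<^sup>L lebesgue G"
    unfolding set_lebesgue_integral_def
    by (rule integral_cong_AE[OF lebesgue_measurable_AE_cong[OF mGc eq] mGc eq])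
  also have "\<dots> = integral\<^sup>L lborel G" by (rule integral_completion[OF mG])
  finally show ?thesis by (simp add: strain_energy_def G_def[abs_def])
qed

lemma rows_exist:
  assumes \<Omega>: "open \<Omega>" and U: "open U" "U \<subseteq> \<Omega>"
    and m: "\<beta> \<in> borel_measurable (lebesgue_on \<Omega>)" and i: "integrable (lebesgue_on \<Omega>) (\<lambda>x. (norm (\<beta> x))\<^sup>2)"
  obtains p1 p2 q1 q2 where "rows_of U \<beta> p1 p2 q1 q2"
proof -
  have \<Omega>m: "\<Omega> \<in> sets lebesgue" using \<Omega> by auto
  define \<beta>0 where "\<beta>0 x = (if x \<in> \<Omega> then \<beta> x else 0)" for x
  have m0: "\<beta>0 \<in> borel_measurable lebesgue"
    unfolding \<beta>0_def[abs_def] using m \<Omega>m by (simp add: borel_measurable_if)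
  have i0: "integrable lebesgue (\<lambda>x. (norm (\<beta>0 x))\<^sup>2)"
  proof -
    have "integrable lebesgue (\<lambda>x. indicator \<Omega> x *\<^sub>R (norm (\<beta> x))\<^sup>2)"
      using i \<Omega>m by (subst (asm) integrable_restrict_space) auto
    moreover have "(\<lambda>x. indicator \<Omega> x *\<^sub>R (norm (\<beta> x))\<^sup>2) = (\<lambda>x. (norm (\<beta>0 x))\<^sup>2)"
      by (auto simp: \<beta>0_def fun_eq_iff)
    ultimately show ?thesis by simp
  qed
  have ex: "\<exists>f. L2 f \<and> (\<forall>x. x \<notin> U \<longrightarrow> f x = 0) \<and> (AE x in lebesgue. x \<in> U \<longrightarrow> \<beta> x $ k $ j = f x)" for k j
  proof -
    have "(\<lambda>F::real^2^2. F $ k $ j) \<in> borel_measurable borel"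
      by (intro borel_measurable_continuous_onI continuous_intros)
    from measurable_compose[OF m0 this] have "(\<lambda>x. \<beta>0 x $ k $ j) \<in> borel_measurable lebesgue" .
    from completion_ex_borel_measurable_real[OF this]
    obtain f where f: "f \<in> borel_measurable lborel" "AE x in lborel. \<beta>0 x $ k $ j = f x" by blast
    have aef: "AE x in lebesgue. \<beta>0 x $ k $ j = f x" using f(2) by (rule AE_completion)
    define g where "g x = indicator U x * f x" for x
    have mg: "g \<in> borel_measurable lborel" unfolding g_def[abs_def] using f(1) U(1) by simp
    have mg2: "(\<lambda>x. (g x)\<^sup>2) \<in> borel_measurable lborel" using mg by simp
    have "integrable lebesgue (\<lambda>x. (g x)\<^sup>2)"
    proof (rule Bochner_Integration.integrable_bound[OF i0])
      show "(\<lambda>x. (g x)\<^sup>2) \<in> borel_measurable lebesgue" using mg2 by (rule measurable_completion)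
      show "AE x in lebesgue. norm ((g x)\<^sup>2) \<le> norm ((norm (\<beta>0 x))\<^sup>2)"
        using aef
      proof eventually_elim
        case (elim x)
        have "(\<beta>0 x $ k $ j)\<^sup>2 \<le> (norm (\<beta>0 x))\<^sup>2"
          using exhaust_2[of k] exhaust_2[of j] unfolding norm_mat2 by auto
        moreover have "(g x)\<^sup>2 \<le> (f x)\<^sup>2" by (auto simp: g_def indicator_def)
        ultimately show ?case using elim by simp
      qed
    qed
    then have "integrable lborel (\<lambda>x. (g x)\<^sup>2)" by (simp add: integrable_completion[OF mg2])
    then have "L2 g" using mg by (simp add: L2_def)
    moreover have "AE x in lebesgue. x \<in> U \<longrightarrow> \<beta> x $ k $ j = g x"
      using aef by eventually_elim (use U(2) in \<open>auto simp: g_def \<beta>0_def\<close>)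
    ultimately show ?thesis by (intro exI[of _ g]) (auto simp: g_def)
  qed
  obtain p1 p2 q1 q2 where
    1: "L2 p1" "\<forall>x. x \<notin> U \<longrightarrow> p1 x = 0" "AE x in lebesgue. x \<in> U \<longrightarrow> \<beta> x $ 1 $ 1 = p1 x" and
    2: "L2 p2" "\<forall>x. x \<notin> U \<longrightarrow> p2 x = 0" "AE x in lebesgue. x \<in> U \<longrightarrow> \<beta> x $ 1 $ 2 = p2 x" and
    3: "L2 q1" "\<forall>x. x \<notin> U \<longrightarrow> q1 x = 0" "AE x in lebesgue. x \<in> U \<longrightarrow> \<beta> x $ 2 $ 1 = q1 x" and
    4: "L2 q2" "\<forall>x. x \<notin> U \<longrightarrow> q2 x = 0" "AE x in lebesgue. x \<in> U \<longrightarrow> \<beta> x $ 2 $ 2 = q2 x"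
    using ex[of 1 1] ex[of 1 2] ex[of 2 1] ex[of 2 2] by blast
  have "AE x in lebesgue. x \<in> U \<longrightarrow> \<beta> x = mat2 (p1 x) (p2 x) (q1 x) (q2 x)"
    using 1(3) 2(3) 3(3) 4(3)
  proof eventually_elim
    case (elim x) then show ?case by (simp add: vec_eq_iff forall_2 mat2_nth)
  qed
  then show thesis using that[of p1 p2 q1 q2] 1 2 3 4 unfolding rows_of_def by blast
qed

text \<open>The values are twice the elastic energies, the factor 1/2 being restored as
  \<open>E / 2\<close>. The set of values is kept, and not its infimum, because moving holes
  compares single strains and because emptiness encodes infinite energy.\<close>

definition strain_rows :: "(real^2) set \<Rightarrow> real \<Rightarrow> (real^2) set \<Rightarrow> real \<Rightarrow> real \<Rightarrow> real \<Rightarrow> real set" where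
  "strain_rows \<Omega> \<epsilon> S s lam sh = {strain_energy lam sh p1 p2 q1 q2 | p1 p2 q1 q2.
     row_admissible \<Omega> \<epsilon> S s p1 p2 \<and> row_admissible \<Omega> \<epsilon> S 0 q1 q2}"

lemma Omega_n_holes: "Omega_n \<Omega> \<epsilon> n \<mu> = \<Omega> - holes (\<epsilon> n) (atoms \<mu>)"
  by (simp add: Omega_n_def holes_def)

lemma open_minus_holes: "open \<Omega> \<Longrightarrow> finite S \<Longrightarrow> open (\<Omega> - holes \<epsilon> S)"
  unfolding holes_def by (intro open_Diff closed_UN) auto

text \<open>A strain and its Borel rows have the same curl pairings, circulations and energy, so
  admissible strains may be replaced by pairs of admissible rows.\<close>

lemma F_n_strain_rows:
  assumes \<Omega>: "open \<Omega>" and fin: "finite (atoms \<mu>)"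
  shows "F_n \<Omega> lam sh \<epsilon> n \<mu> = (INF E\<in>strain_rows \<Omega> (\<epsilon> n) (atoms \<mu>) (1 / real n) lam sh. ereal (E / 2))"
proof -
  define U where "U = \<Omega> - holes (\<epsilon> n) (atoms \<mu>)"
  have U: "open U" "U \<subseteq> \<Omega>" "Omega_n \<Omega> \<epsilon> n \<mu> = U"
    using open_minus_holes[OF \<Omega> fin] by (auto simp: U_def Omega_n_holes)
  have cmp: "(v :: real^2) = (1 / real n) *\<^sub>R e1 \<longleftrightarrow> v $ 1 = 1 / real n \<and> v $ 2 = 0" for v
    by (simp add: vec_eq_iff forall_2 axis_def)
  have cmp0: "(v :: real^2) = 0 \<longleftrightarrow> v $ 1 = 0 \<and> v $ 2 = 0" for v
    by (simp add: vec_eq_iff forall_2)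
  have equiv: "(curl_free U \<beta> \<and> (\<forall>z\<in>atoms \<mu>. trace_circulation \<Omega> U \<beta> z (\<epsilon> n) ((1 / real n) *\<^sub>R e1)))
     \<longleftrightarrow> row_admissible \<Omega> (\<epsilon> n) (atoms \<mu>) (1 / real n) p1 p2 \<and> row_admissible \<Omega> (\<epsilon> n) (atoms \<mu>) 0 q1 q2"
    if r: "rows_of U \<beta> p1 p2 q1 q2" for \<beta> p1 p2 q1 q2
  proof -
    have L: "L2 p1" "L2 p2" "L2 q1" "L2 q2" and z: "\<And>x. x \<notin> U \<Longrightarrow> p1 x = 0 \<and> p2 x = 0 \<and> q1 x = 0 \<and> q2 x = 0"
      using r by (auto simp: rows_of_def)
    have c: "curl_free U \<beta> \<longleftrightarrow> (\<forall>\<phi>\<in>test_functions U. curl_pair p1 p2 \<phi> = 0) \<and> (\<forall>\<phi>\<in>test_functions U. curl_pair q1 q2 \<phi> = 0)"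
      unfolding curl_free_def cmp0 using rows_curl_pairing[OF r] by auto
    have t: "- curl_pairing U \<beta> \<phi> = (1 / real n) *\<^sub>R e1 \<longleftrightarrow> - curl_pair p1 p2 \<phi> = 1 / real n \<and> - curl_pair q1 q2 \<phi> = 0"
      if "\<phi> \<in> test_functions \<Omega>" for \<phi>
      unfolding cmp using rows_curl_pairing[OF r that] by simp
    show ?thesis
      unfolding row_admissible_def c trace_circulation_def U_def[symmetric]
      using L z t by (smt (verit))
  qed
  show ?thesis
  proof (rule antisym)
    show "F_n \<Omega> lam sh \<epsilon> n \<mu> \<le> (INF E\<in>strain_rows \<Omega> (\<epsilon> n) (atoms \<mu>) (1 / real n) lam sh. ereal (E / 2))"
    proof (rule INF_greatest)
      fix E assume "E \<in> strain_rows \<Omega> (\<epsilon> n) (atoms \<mu>) (1 / real n) lam sh"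
      then obtain p1 p2 q1 q2 where E: "E = strain_energy lam sh p1 p2 q1 q2"
        and R: "row_admissible \<Omega> (\<epsilon> n) (atoms \<mu>) (1 / real n) p1 p2" "row_admissible \<Omega> (\<epsilon> n) (atoms \<mu>) 0 q1 q2"
        unfolding strain_rows_def by blast
      define \<beta> where "\<beta> x = mat2 (p1 x) (p2 x) (q1 x) (q2 x)" for x
      have L: "L2 p1" "L2 p2" "L2 q1" "L2 q2" and z: "\<And>x. x \<notin> U \<Longrightarrow> p1 x = 0 \<and> p2 x = 0 \<and> q1 x = 0 \<and> q2 x = 0"
        using R by (auto simp: row_admissible_def U_def)
      have r: "rows_of U \<beta> p1 p2 q1 q2" unfolding rows_of_def using L z by (auto simp: \<beta>_def)
      have mb: "\<beta> \<in> borel_measurable lborel" unfolding \<beta>_def[abs_def] mat2_def using L by (auto simp: L2_def)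
      have "\<beta> \<in> admissible \<Omega> \<epsilon> n \<mu>"
        unfolding admissible_def U(3)
      proof (intro CollectI conjI)
        show "\<beta> \<in> borel_measurable (lebesgue_on \<Omega>)"
          by (intro measurable_restrict_space1 measurable_completion mb)
        have sq: "(\<lambda>x. (norm (\<beta> x))\<^sup>2) = (\<lambda>x. (p1 x)\<^sup>2 + (p2 x)\<^sup>2 + (q1 x)\<^sup>2 + (q2 x)\<^sup>2)"
          by (simp add: norm_mat2 \<beta>_def mat2_nth fun_eq_iff)
        have "integrable lborel (\<lambda>x. (norm (\<beta> x))\<^sup>2)" unfolding sq using L by (simp add: L2_def)
        then have "integrable lebesgue (\<lambda>x. (norm (\<beta> x))\<^sup>2)" by (subst integrable_completion) auto
        then show "integrable (lebesgue_on \<Omega>) (\<lambda>x. (norm (\<beta> x))\<^sup>2)"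
          using \<Omega> integrable_mult_indicator[of \<Omega> lebesgue "\<lambda>x. (norm (\<beta> x))\<^sup>2"]
          by (subst integrable_restrict_space) auto
        show "AE x in lebesgue. x \<in> \<Omega> - U \<longrightarrow> \<beta> x = 0" using z by (auto simp: \<beta>_def mat2_def)
        show "curl_free U \<beta>" "\<forall>z\<in>atoms \<mu>. trace_circulation \<Omega> U \<beta> z (\<epsilon> n) ((1 / real n) *\<^sub>R e1)"
          using equiv[OF r] R by blast+
      qed
      moreover have "E_n \<Omega> lam sh \<epsilon> n \<mu> \<beta> = E / 2"
        unfolding E_n_def U(3) rows_energy[OF r] E by simp
      ultimately show "F_n \<Omega> lam sh \<epsilon> n \<mu> \<le> ereal (E / 2)"
        unfolding F_n_def by (metis INF_lower)
    qed
    show "(INF E\<in>strain_rows \<Omega> (\<epsilon> n) (atoms \<mu>) (1 / real n) lam sh. ereal (E / 2)) \<le> F_n \<Omega> lam sh \<epsilon> n \<mu>"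
      unfolding F_n_def
    proof (rule INF_greatest)
      fix \<beta> assume "\<beta> \<in> admissible \<Omega> \<epsilon> n \<mu>"
      then have b: "\<beta> \<in> borel_measurable (lebesgue_on \<Omega>)" "integrable (lebesgue_on \<Omega>) (\<lambda>x. (norm (\<beta> x))\<^sup>2)"
        "curl_free U \<beta> \<and> (\<forall>z\<in>atoms \<mu>. trace_circulation \<Omega> U \<beta> z (\<epsilon> n) ((1 / real n) *\<^sub>R e1))"
        unfolding admissible_def U(3) by auto
      obtain p1 p2 q1 q2 where r: "rows_of U \<beta> p1 p2 q1 q2" by (rule rows_exist[OF \<Omega> U(1,2) b(1,2)])
      have "strain_energy lam sh p1 p2 q1 q2 \<in> strain_rows \<Omega> (\<epsilon> n) (atoms \<mu>) (1 / real n) lam sh"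
        unfolding strain_rows_def using equiv[OF r] b(3) by blast
      moreover have "E_n \<Omega> lam sh \<epsilon> n \<mu> \<beta> = strain_energy lam sh p1 p2 q1 q2 / 2"
        unfolding E_n_def U(3) rows_energy[OF r] by simp
      ultimately show "(INF E\<in>strain_rows \<Omega> (\<epsilon> n) (atoms \<mu>) (1 / real n) lam sh. ereal (E / 2)) \<le> ereal (E_n \<Omega> lam sh \<epsilon> n \<mu> \<beta>)"
        by (metis INF_lower)
    qed
  qed
qed

text \<open>Holes are moved one after the other, each at the cost of a factor whose
  \<open>n\<close>-th power is \<open>1 + \<kappa>\<close>. All annuli are centred at the targets
  \<open>w i\<close>, so the thresholds do not depend on the configuration \<open>w'\<close> from
  which strains are transported.\<close>

lemma config_move:
  fixes w :: "nat \<Rightarrow> real^2"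
  assumes lame: "sh > 0" "lam + sh > 0" and \<epsilon>: "\<epsilon> > 0" and \<delta>: "\<delta> > 0"
    and cb: "\<And>i. i < n \<Longrightarrow> cball (w i) (\<epsilon> + \<delta>) \<subseteq> \<Omega>"
    and sep: "\<And>i j. i < n \<Longrightarrow> j < n \<Longrightarrow> i \<noteq> j \<Longrightarrow> norm (w i - w j) > 2 * \<epsilon> + 2 * \<delta>"
    and n: "n \<ge> 1" and \<kappa>: "\<kappa> > 0"
  obtains h0 where "h0 > 0" "\<And>w' E. (\<And>i. i < n \<Longrightarrow> w' i $ 2 = w i $ 2 \<and> norm (w' i - w i) < h0) \<Longrightarrow>
     E \<in> strain_rows \<Omega> \<epsilon> (w' ` {..<n}) s lam sh \<Longrightarrow>
     \<exists>E'\<in>strain_rows \<Omega> \<epsilon> (w ` {..<n}) s lam sh. E' \<le> (1 + \<kappa>) * E"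
proof -
  define \<kappa>' where "\<kappa>' = root n (1 + \<kappa>) - 1"
  have n0: "0 < n" using n by simp
  have \<kappa>': "\<kappa>' > 0" "(1 + \<kappa>') ^ n = 1 + \<kappa>" using n0 \<kappa> by (simp_all add: \<kappa>'_def)
  \<comment> \<open>A displacement below \<open>\<delta> / 3\<close> keeps the old and the new hole
    inside the disk of radius \<open>e0\<close> around the target.\<close>
  define e0 where "e0 = \<epsilon> + \<delta> / 3"
  have e0: "0 < e0" "e0 < \<epsilon> + \<delta>" using \<epsilon> \<delta> by (simp_all add: e0_def)
  \<comment> \<open>The conclusion of \<open>hole_move\<close> at the target \<open>w i\<close>,
    named so that thresholds for all \<open>i\<close> can be chosen at once.\<close>
  define good where "good i h0 \<longleftrightarrow> h0 > 0 \<and> (\<forall>h S z p1 p2 q1 q2. \<bar>h\<bar> < h0 \<and> finite S \<and> z \<in> S \<and> cball z \<epsilon> \<subseteq> cball (w i) e0 \<and>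
      cball (z + h *\<^sub>R e1) \<epsilon> \<subseteq> cball (w i) e0 \<and> (\<forall>z'. z' \<in> S - {z} \<longrightarrow> cball z' \<epsilon> \<inter> cball (w i) (\<epsilon> + \<delta>) = {}) \<and>
      row_admissible \<Omega> \<epsilon> S s p1 p2 \<and> row_admissible \<Omega> \<epsilon> S 0 q1 q2 \<longrightarrow>
      (\<exists>P1 P2 Q1 Q2. row_admissible \<Omega> \<epsilon> (insert (z + h *\<^sub>R e1) (S - {z})) s P1 P2 \<and>
        row_admissible \<Omega> \<epsilon> (insert (z + h *\<^sub>R e1) (S - {z})) 0 Q1 Q2 \<and>
        strain_energy lam sh P1 P2 Q1 Q2 \<le> (1 + \<kappa>') * strain_energy lam sh p1 p2 q1 q2))" for i h0
  have "\<exists>h0. good i h0" if i: "i < n" for i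
  proof -
    obtain h0 where "h0 > 0" and
      "\<And>h S z \<epsilon>' s1 s2 p1 p2 q1 q2. \<bar>h\<bar> < h0 \<Longrightarrow> finite S \<Longrightarrow> z \<in> S \<Longrightarrow> cball z \<epsilon>' \<subseteq> cball (w i) e0 \<Longrightarrow>
      cball (z + h *\<^sub>R e1) \<epsilon>' \<subseteq> cball (w i) e0 \<Longrightarrow> (\<And>z'. z' \<in> S - {z} \<Longrightarrow> cball z' \<epsilon>' \<inter> cball (w i) (\<epsilon> + \<delta>) = {}) \<Longrightarrow>
      row_admissible \<Omega> \<epsilon>' S s1 p1 p2 \<Longrightarrow> row_admissible \<Omega> \<epsilon>' S s2 q1 q2 \<Longrightarrow>
      \<exists>P1 P2 Q1 Q2. row_admissible \<Omega> \<epsilon>' (insert (z + h *\<^sub>R e1) (S - {z})) s1 P1 P2 \<and>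
        row_admissible \<Omega> \<epsilon>' (insert (z + h *\<^sub>R e1) (S - {z})) s2 Q1 Q2 \<and>
        strain_energy lam sh P1 P2 Q1 Q2 \<le> (1 + \<kappa>') * strain_energy lam sh p1 p2 q1 q2"
      by (rule hole_move[OF lame e0 cb[OF i] \<kappa>'(1)]) blast
    then show ?thesis unfolding good_def by (intro exI[of _ h0]) (simp only: simp_thms, blast)
  qed
  then obtain h1 where h1: "\<And>i. i < n \<Longrightarrow> good i (h1 i)" by metis
  define h0 where "h0 = min (\<delta> / 3) (Min (h1 ` {..<n}))"
  have fin: "finite (h1 ` {..<n})" "h1 ` {..<n} \<noteq> {}" using n0 by auto
  show thesis
  proof (rule that[of h0])
    have "0 < Min (h1 ` {..<n})" using fin h1 by (subst Min_gr_iff) (auto simp: good_def)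
    then show "h0 > 0" using \<delta> by (simp add: h0_def)
    fix w' :: "nat \<Rightarrow> real^2" and E
    assume w': "\<And>i. i < n \<Longrightarrow> w' i $ 2 = w i $ 2 \<and> norm (w' i - w i) < h0"
      and E: "E \<in> strain_rows \<Omega> \<epsilon> (w' ` {..<n}) s lam sh"
    \<comment> \<open>The intermediate configuration in which the first \<open>k\<close> holes have
      reached their targets.\<close>
    define H where "H k i = (if i < k then w i else w' i)" for k i
    have Hw: "norm (H k i - w i) < \<delta> / 3" if "i < n" for k i
      using w'[OF that] \<delta> by (auto simp: H_def h0_def)
    have far: "cball (H k j) \<epsilon> \<inter> cball (w i) (\<epsilon> + \<delta>) = {}" if "i < n" "j < n" "j \<noteq> i" for k i j
    proof (rule ccontr)
      assume "\<not> ?thesis"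
      then obtain x where x: "norm (H k j - x) \<le> \<epsilon>" "norm (w i - x) \<le> \<epsilon> + \<delta>" by (auto simp: dist_norm)
      have "norm (w j - w i) \<le> norm (w j - H k j) + norm (H k j - x) + norm (x - w i)"
        using norm_triangle_ineq[of "w j - H k j" "H k j - x"] norm_triangle_ineq[of "w j - x" "x - w i"] by simp
      then show False using Hw[OF that(2), of k] x sep[OF that(2,1,3)] \<delta> by (simp add: norm_minus_commute)
    qed
    have "\<exists>E'\<in>strain_rows \<Omega> \<epsilon> (H k ` {..<n}) s lam sh. E' \<le> (1 + \<kappa>') ^ k * E" if "k \<le> n" for k
      using that
    proof (induction k)
      case 0
      have "H 0 ` {..<n} = w' ` {..<n}" by (simp add: H_def)
      then show ?case using E by auto
    next
      case (Suc k)
      then have k: "k < n" by simp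
      from Suc obtain p1 p2 q1 q2 where p: "row_admissible \<Omega> \<epsilon> (H k ` {..<n}) s p1 p2" "row_admissible \<Omega> \<epsilon> (H k ` {..<n}) 0 q1 q2"
        and le: "strain_energy lam sh p1 p2 q1 q2 \<le> (1 + \<kappa>') ^ k * E" unfolding strain_rows_def by auto
      define z where "z = w' k"
      define h where "h = w k $ 1 - w' k $ 1"
      have zk: "z + h *\<^sub>R e1 = w k" using w'[OF k] by (simp add: z_def h_def vec_eq_iff forall_2 axis_def)
      have zH: "z = H k k" by (simp add: z_def H_def)
      have "\<bar>h\<bar> \<le> norm (w' k - w k)" using component_le_norm_cart[of "w' k - w k" 1] by (simp add: h_def)
      then have hh: "\<bar>h\<bar> < h0" using w'[OF k] by simp
      have "h0 \<le> h1 k" using k fin by (auto simp: h0_def min_le_iff_disj)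
      then have hk: "\<bar>h\<bar> < h1 k" using hh by linarith
      have b1: "cball z \<epsilon> \<subseteq> cball (w k) e0"
        using Hw[OF k, of k] zH by (subst cball_subset_cball_iff) (auto simp: e0_def dist_norm)
      have b2: "cball (z + h *\<^sub>R e1) \<epsilon> \<subseteq> cball (w k) e0" unfolding zk using \<delta> by (simp add: e0_def cball_subset_cball_iff)
      \<comment> \<open>Configurations enter as sets of points, so removing \<open>z\<close> must
        remove the label \<open>k\<close> only.\<close>
      have ne: "H k j \<noteq> z" if "j < n" "j \<noteq> k" for j
      proof
        assume "H k j = z"
        then have "z \<in> cball (H k j) \<epsilon>" using \<epsilon> by simp
        moreover have "z \<in> cball (w k) (\<epsilon> + \<delta>)"
          using Hw[OF k, of k] zH \<epsilon> \<delta> by (simp add: dist_norm norm_minus_commute)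
        ultimately show False using far[OF k that(1,2), of k] by blast
      qed
      have S': "insert (z + h *\<^sub>R e1) (H k ` {..<n} - {z}) = H (Suc k) ` {..<n}"
      proof -
        have 1: "H k ` {..<n} - {z} = H k ` ({..<n} - {k})" using ne zH k by (auto simp: image_iff)
        have 2: "H k ` ({..<n} - {k}) = H (Suc k) ` ({..<n} - {k})" by (intro image_cong) (auto simp: H_def)
        have 3: "H (Suc k) ` {..<n} = insert (H (Suc k) k) (H (Suc k) ` ({..<n} - {k}))" using k by auto
        have 4: "H (Suc k) k = w k" by (simp add: H_def)
        show ?thesis unfolding 1 2 zk 3 4 ..
      qed
      have sp: "\<forall>z'. z' \<in> H k ` {..<n} - {z} \<longrightarrow> cball z' \<epsilon> \<inter> cball (w k) (\<epsilon> + \<delta>) = {}"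
        using far[OF k] zH by auto
      have zin: "z \<in> H k ` {..<n}" using zH k by auto
      have fs: "finite (H k ` {..<n})" by simp
      have "\<exists>P1 P2 Q1 Q2. row_admissible \<Omega> \<epsilon> (insert (z + h *\<^sub>R e1) (H k ` {..<n} - {z})) s P1 P2 \<and>
        row_admissible \<Omega> \<epsilon> (insert (z + h *\<^sub>R e1) (H k ` {..<n} - {z})) 0 Q1 Q2 \<and>
        strain_energy lam sh P1 P2 Q1 Q2 \<le> (1 + \<kappa>') * strain_energy lam sh p1 p2 q1 q2"
        by (rule h1[OF k, unfolded good_def, THEN conjunct2, THEN spec[of _ h], THEN spec[of _ "H k ` {..<n}"],
              THEN spec[of _ z], THEN spec[of _ p1], THEN spec[of _ p2], THEN spec[of _ q1], THEN spec[of _ q2], THEN mp])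
           (intro conjI hk fs zin b1 b2 sp p)
      then obtain P1 P2 Q1 Q2 where P: "row_admissible \<Omega> \<epsilon> (H (Suc k) ` {..<n}) s P1 P2" "row_admissible \<Omega> \<epsilon> (H (Suc k) ` {..<n}) 0 Q1 Q2"
        "strain_energy lam sh P1 P2 Q1 Q2 \<le> (1 + \<kappa>') * strain_energy lam sh p1 p2 q1 q2"
        unfolding S' by blast
      have "(1 + \<kappa>') * strain_energy lam sh p1 p2 q1 q2 \<le> (1 + \<kappa>') * ((1 + \<kappa>') ^ k * E)"
        using le \<kappa>'(1) by (intro mult_left_mono) auto
      then have "strain_energy lam sh P1 P2 Q1 Q2 \<le> (1 + \<kappa>') ^ Suc k * E" using P(3) by simp
      then show ?case using P(1,2) unfolding strain_rows_def by blast
    qed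
    from this[of n] show "\<exists>E'\<in>strain_rows \<Omega> \<epsilon> (w ` {..<n}) s lam sh. E' \<le> (1 + \<kappa>) * E"
      using \<kappa>'(2) by (simp add: H_def)
  qed
qed

section \<open>Continuity of the self-energy of the singular strains\<close>

lemma Ck_ln: "Ck k f \<Longrightarrow> (\<And>x. f x > 0) \<Longrightarrow> Ck k (\<lambda>x. ln (f x))"
proof (cases k)
  case 0
  assume "Ck k f" "\<And>x. f x > 0"
  then show ?thesis using 0 by (auto intro!: continuous_intros simp: less_imp_neq[symmetric])
next
  case (Suc j)
  assume f: "Ck k f" and p: "\<And>x. f x > 0"
  have "Ck j (\<lambda>x. pd b f x * inverse (f x))" if "b \<in> Basis" for b
    using Ck_mult[OF Ck_SucD(2)[OF f[unfolded Suc] that] Ck_inverse[OF Ck_Suc_imp[OF f[unfolded Suc]]]] p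
    by (simp add: less_imp_neq[symmetric])
  moreover have "((\<lambda>x. ln (f x)) has_derivative (\<lambda>h. frechet_derivative f (at x) h * inverse (f x))) (at x)" for x
    using has_derivative_ln[OF p Ck_SucD(1)[OF f[unfolded Suc]]] by (simp add: divide_inverse)
  ultimately show ?thesis unfolding Suc by (intro Ck_SucI) auto
qed

lemma smooth_const: "smooth (\<lambda>_. c)" by (simp add: smooth_def Ck_const)

lemma smooth_nth: "smooth (\<lambda>x::real^2. x $ i)"
  by (simp add: smooth_def Ck_linear bounded_linear_vec_nth)

lemma jacobian_smooth:
  assumes U: "open U" and g: "smooth g1" "smooth g2" and y: "y \<in> U"
    and v: "\<And>y. y \<in> U \<Longrightarrow> v y = g1 y *\<^sub>R e1 + g2 y *\<^sub>R (e2 :: real^2)"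
  shows "jacobian v (at y) = mat2 (pd e1 g1 y) (pd e2 g1 y) (pd e1 g2 y) (pd e2 g2 y)"
proof -
  have "((\<lambda>y. g1 y *\<^sub>R e1 + g2 y *\<^sub>R (e2 :: real^2)) has_derivative
      (\<lambda>h. frechet_derivative g1 (at y) h *\<^sub>R e1 + frechet_derivative g2 (at y) h *\<^sub>R e2)) (at y)"
    by (intro has_derivative_add has_derivative_scaleR_left smooth_has_derivative g)
  then have "(v has_derivative (\<lambda>h. frechet_derivative g1 (at y) h *\<^sub>R e1 + frechet_derivative g2 (at y) h *\<^sub>R e2)) (at y)"
    by (rule has_derivative_transform_within_open[OF _ U y]) (use v in simp)
  from frechet_derivative_at[OF this, symmetric]
  show ?thesis
    unfolding jacobian_def by (simp add: vec_eq_iff forall_2 matrix_def mat2_nth axis_def)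
qed

definition strain_density :: "real \<Rightarrow> real \<Rightarrow> real \<Rightarrow> real^2 \<Rightarrow> real" where
  "strain_density lam sh \<epsilon> y = elasticity lam sh (Kn_strain lam sh \<epsilon> y 0) \<bullet> Kn_strain lam sh \<epsilon> y 0"

lemma strain_density_shift:
  "elasticity lam sh (Kn_strain lam sh \<epsilon> x z) \<bullet> Kn_strain lam sh \<epsilon> x z = strain_density lam sh \<epsilon> (x - z)"
  by (simp add: strain_density_def Kn_strain_def K_strain_def)

text \<open>Away from the origin the fields agree with globally smooth ones, obtained by replacing
  \<open>|y|\<^sup>2\<close> with a positive function.\<close>

lemma strain_density_continuous: "continuous_on (- {0}) (strain_density lam sh \<epsilon>)"
proof -
  have cont: "continuous_on {y. \<rho> < norm y} (strain_density lam sh \<epsilon>)" if \<rho>: "\<rho> > 0" for \<rho>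
  proof -
    define U where "U = {y::real^2. \<rho> < norm y}"
    have oU: "open U" unfolding U_def by (intro open_Collect_less continuous_intros)
    define N where "N y = y $ 1 * y $ 1 + y $ 2 * y $ 2 + cutoff 0 (\<rho> / 2) \<rho> y" for y :: "real^2"
    have n2: "(norm y)\<^sup>2 = y $ 1 * y $ 1 + y $ 2 * y $ 2" for y :: "real^2"
      unfolding power2_norm_eq_inner by (simp add: inner_vec_def sum_2)
    have sN: "smooth N" unfolding N_def[abs_def] by (intro smooth_add smooth_mult smooth_nth smooth_cutoff)
    have ab: "0 \<le> \<rho> / 2" "\<rho> / 2 < \<rho>" using \<rho> by auto
    have pN: "N y > 0" for y
    proof (cases "y = 0")
      case True then show ?thesis using cutoff(1)[OF ab, of 0 0] \<rho> by (simp add: N_def)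
    next
      case False
      then have "0 < (norm y)\<^sup>2" by simp
      then show ?thesis using cutoff(3)[OF ab, of 0 y] by (simp add: N_def n2)
    qed
    have NU: "N y = (norm y)\<^sup>2" if "y \<in> U" for y
      using cutoff(2)[OF ab, of y 0] that by (simp add: N_def n2 U_def)
    define I where "I y = inverse (N y)" for y
    have sI: "smooth I" unfolding smooth_def I_def[abs_def]
      using sN pN by (auto simp: smooth_def less_imp_neq[symmetric] intro!: Ck_inverse)
    have sL: "smooth (\<lambda>y. ln (N y))" unfolding smooth_def using sN pN by (auto simp: smooth_def intro!: Ck_ln)
    define A where "A = (lam + sh) / (4 * pi * (lam + 2 * sh))"
    define B where "B = sh / (2 * pi * (lam + 2 * sh))"
    \<comment> \<open>Components of the two displacement fields: \<open>(e1 \<bullet> perp y)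
      *\<^sub>R y + (e1 \<bullet> y) *\<^sub>R perp y\<close> has the entries
      \<open>- 2 y\<^sub>1y\<^sub>2\<close> and
      \<open>y\<^sub>1\<^sup>2 - y\<^sub>2\<^sup>2\<close>, and \<open>ln (N y)\<close> is twice the
      logarithm of the norm where \<open>N y\<close> is its square.\<close>
    define g1 where "g1 y = (2 * A) * (y $ 1 * y $ 2 * I y)" for y
    define g2 where "g2 y = (- B / 2) * ln (N y) + (- A) * ((y $ 1 * y $ 1 + (-1) * (y $ 2 * y $ 2)) * I y)" for y
    define h1 where "h1 y = (- 2 * A) * (y $ 1 * y $ 2 * (I y * I y))" for y
    define h2 where "h2 y = A * ((y $ 1 * y $ 1 + (-1) * (y $ 2 * y $ 2)) * (I y * I y))" for y
    have s: "smooth g1" "smooth g2" "smooth h1" "smooth h2"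
      unfolding g1_def[abs_def] g2_def[abs_def] h1_def[abs_def] h2_def[abs_def]
      by (intro smooth_add smooth_mult smooth_nth smooth_const sI sL)+
    have v0: "v0_field lam sh y = g1 y *\<^sub>R e1 + g2 y *\<^sub>R e2" if y: "y \<in> U" for y
    proof -
      have "\<rho> < norm y" using y by (simp add: U_def)
      then have y0: "norm y > 0" using \<rho> by linarith
      have l: "ln (N y) = 2 * ln (norm y)" using y0 by (simp add: NU[OF y] ln_realpow)
      have i: "I y = 1 / (norm y)\<^sup>2" by (simp add: I_def NU[OF y] divide_inverse)
      show ?thesis
        unfolding v0_field_def g1_def g2_def l i
        by (simp add: vec_eq_iff forall_2 axis_def perp_def inner_vec_def sum_2 A_def B_def divide_simps)
    qed
    have wf: "w_field lam sh y = h1 y *\<^sub>R e1 + h2 y *\<^sub>R e2" if y: "y \<in> U" for y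
    proof -
      have i: "I y * I y = 1 / (norm y)^4" by (simp add: I_def NU[OF y] divide_inverse power_mult_distrib power2_eq_square power4_eq_xxxx)
      show ?thesis
        unfolding w_field_def h1_def h2_def i
        by (simp add: vec_eq_iff forall_2 axis_def perp_def inner_vec_def sum_2 A_def divide_simps) (simp add: algebra_simps)
    qed
    define K where "K y = mat2 (- y $ 2 * I y / (2 * pi)) (y $ 1 * I y / (2 * pi)) 0 0
       + mat2 (pd e1 g1 y) (pd e2 g1 y) (pd e1 g2 y) (pd e2 g2 y)
       + \<epsilon>\<^sup>2 *\<^sub>R mat2 (pd e1 h1 y) (pd e2 h1 y) (pd e1 h2 y) (pd e2 h2 y)" for y
    have K: "Kn_strain lam sh \<epsilon> y 0 = K y" if y: "y \<in> U" for y
    proof -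
      have i: "I y = 1 / (norm y)\<^sup>2" by (simp only: I_def NU[OF y] divide_inverse mult_1)
      have "(1 / (2 * pi * (norm y)\<^sup>2)) *\<^sub>R tensor e1 (perp y) = mat2 (- y $ 2 * I y / (2 * pi)) (y $ 1 * I y / (2 * pi)) 0 0"
        unfolding i by (simp add: vec_eq_iff forall_2 mat2_nth tensor_def perp_def axis_def)
      moreover have "jacobian (v0_field lam sh) (at y) = mat2 (pd e1 g1 y) (pd e2 g1 y) (pd e1 g2 y) (pd e2 g2 y)"
        by (rule jacobian_smooth[OF oU s(1,2) y]) (rule v0)
      moreover have "jacobian (w_field lam sh) (at y) = mat2 (pd e1 h1 y) (pd e2 h1 y) (pd e1 h2 y) (pd e2 h2 y)"
        by (rule jacobian_smooth[OF oU s(3,4) y]) (rule wf)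
      ultimately show ?thesis
        unfolding Kn_strain_def K_strain_def K_def diff_zero by (simp only:)
    qed
    have cK: "continuous_on UNIV K"
      unfolding K_def[abs_def] mat2_def
      by (intro continuous_intros smooth_continuous smooth_pd s e_basis sI) simp_all
    have "continuous_on U (\<lambda>y. elasticity lam sh (K y) \<bullet> K y)"
      unfolding strain_form_elasticity strain_form_def
      by (intro continuous_intros continuous_on_subset[OF cK]) auto
    then have "continuous_on U (strain_density lam sh \<epsilon>)"
      by (rule continuous_on_eq) (simp add: strain_density_def K)
    then show ?thesis by (simp add: U_def)
  qed
  have "continuous (at y) (strain_density lam sh \<epsilon>)" if "y \<noteq> 0" for y
  proof -
    have o: "open {y'::real^2. norm y / 2 < norm y'}" by (intro open_Collect_less continuous_intros)
    have "continuous_on {y'. norm y / 2 < norm y'} (strain_density lam sh \<epsilon>)" using that by (intro cont) simp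
    then show ?thesis unfolding continuous_on_eq_continuous_at[OF o] using that by simp
  qed
  then show ?thesis by (simp add: continuous_at_imp_continuous_on)
qed

definition self_energy :: "real \<Rightarrow> real \<Rightarrow> real \<Rightarrow> (real^2) set \<Rightarrow> nat \<Rightarrow> (nat \<Rightarrow> real^2) \<Rightarrow> real" where
  "self_energy lam sh \<epsilon> \<Omega> n w =
     (\<Sum>i<n. LINT x:(\<Omega> - holes \<epsilon> (w ` {..<n}))|lebesgue. strain_density lam sh \<epsilon> (x - w i))"

text \<open>Dominated convergence. The excised disks keep \<open>x - W k i\<close> at distance more
  than \<open>\<epsilon>\<close> from the singularity, and the domain is bounded, so the integrands
  are uniformly bounded; they converge away from the limit circles, which are null sets.\<close>

lemma self_energy_continuous:
  assumes \<Omega>: "open \<Omega>" "bounded \<Omega>" and \<epsilon>: "\<epsilon> > 0"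
    and W\<Omega>: "\<And>k i. i < n \<Longrightarrow> W k i \<in> \<Omega>"
    and lim: "\<And>i. i < n \<Longrightarrow> (\<lambda>k::nat. W k i) \<longlonglongrightarrow> w i"
  shows "(\<lambda>k. self_energy lam sh \<epsilon> \<Omega> n (W k)) \<longlonglongrightarrow> self_energy lam sh \<epsilon> \<Omega> n w"
  unfolding self_energy_def
proof (rule tendsto_sum)
  fix i assume "i \<in> {..<n}"
  then have i: "i < n" by simp
  let ?\<Phi> = "strain_density lam sh \<epsilon>"
  define U where "U v = \<Omega> - holes \<epsilon> (v ` {..<n})" for v :: "nat \<Rightarrow> real^2"
  define f where "f v x = indicator (U v) x *\<^sub>R ?\<Phi> (x - v i)" for v x
  have oU: "open (U v)" for v unfolding U_def by (rule open_minus_holes[OF \<Omega>(1)]) simp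
  have out: "\<epsilon> < norm (x - v i)" if "x \<in> U v" for x v
    using that i by (auto simp: U_def holes_def dist_norm norm_minus_commute not_le)
  have c: "continuous_on (U v) (\<lambda>x. ?\<Phi> (x - v i))" for v
    by (intro continuous_on_compose2[OF strain_density_continuous] continuous_intros) (use out \<epsilon> in force)
  have m: "f v \<in> borel_measurable lebesgue" for v
  proof -
    have "f v \<in> borel_measurable lborel"
      unfolding f_def[abs_def] using borel_measurable_continuous_on_indicator[OF _ c] oU by simp
    then show ?thesis by (rule measurable_completion)
  qed
  obtain R where R: "\<And>x. x \<in> \<Omega> \<Longrightarrow> norm x \<le> R" using \<Omega>(2) unfolding bounded_iff by blast
  have "compact (cball 0 (2 * R) \<inter> {y::real^2. \<epsilon> \<le> norm y})"
    by (intro compact_Int_closed compact_cball closed_Collect_le continuous_intros)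
  then have "bounded (?\<Phi> ` (cball 0 (2 * R) \<inter> {y. \<epsilon> \<le> norm y}))"
    by (intro compact_imp_bounded compact_continuous_image continuous_on_subset[OF strain_density_continuous]) (use \<epsilon> in auto)
  then obtain C where "\<forall>y\<in>cball 0 (2 * R) \<inter> {y. \<epsilon> \<le> norm y}. \<bar>?\<Phi> y\<bar> \<le> C"
    unfolding bounded_iff by auto
  then have C: "\<bar>?\<Phi> y\<bar> \<le> C" if "norm y \<le> 2 * R" "\<epsilon> \<le> norm y" for y using that by simp
  have "(\<lambda>k. integral\<^sup>L lebesgue (f (W k))) \<longlonglongrightarrow> integral\<^sup>L lebesgue (f w)"
  proof (rule integral_dominated_convergence[OF m m])
    have "integrable lborel (\<lambda>x. indicator \<Omega> x *\<^sub>R \<bar>C\<bar>)"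
      using emeasure_bounded_finite[OF \<Omega>(2)] \<Omega>(1) by (simp add: less_top[symmetric])
    then show "integrable lebesgue (\<lambda>x. indicator \<Omega> x *\<^sub>R \<bar>C\<bar>)" by (subst integrable_completion) auto
    show "AE x in lebesgue. norm (f (W k) x) \<le> indicator \<Omega> x *\<^sub>R \<bar>C\<bar>" for k
    proof (intro AE_I2)
      fix x
      show "norm (f (W k) x) \<le> indicator \<Omega> x *\<^sub>R \<bar>C\<bar>"
      proof (cases "x \<in> U (W k)")
        case True
        then have x: "x \<in> \<Omega>" by (simp add: U_def)
        have "norm (x - W k i) \<le> 2 * R"
          using R[OF x] R[OF W\<Omega>[OF i, of k]] norm_triangle_ineq4[of x "W k i"] by linarith
        then have "\<bar>?\<Phi> (x - W k i)\<bar> \<le> C" using out[OF True] by (intro C) auto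
        then show ?thesis using True x by (simp add: f_def)
      qed (simp add: f_def indicator_def)
    qed
    have ne: "AE x in lebesgue. x \<notin> sphere (w j) \<epsilon>" for j
    proof (rule AE_completion)
      have "negligible (sphere (w j) \<epsilon>)" by (rule negligible_sphere)
      then have "sphere (w j) \<epsilon> \<in> null_sets lebesgue" by (simp add: negligible_iff_null_sets)
      then have "sphere (w j) \<epsilon> \<in> null_sets lborel" by (simp add: null_sets_completion_iff)
      then show "AE x in lborel. x \<notin> sphere (w j) \<epsilon>" by (rule AE_not_in)
    qed
    have "AE x in lebesgue. \<forall>j\<in>{..<n}. x \<notin> sphere (w j) \<epsilon>" using ne by (intro AE_finite_allI) auto
    then show "AE x in lebesgue. (\<lambda>k. f (W k) x) \<longlonglongrightarrow> f w x"
    proof eventually_elim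
      case (elim x)
      then have nx: "\<And>j. j < n \<Longrightarrow> norm (x - w j) \<noteq> \<epsilon>" by (auto simp: dist_norm norm_minus_commute)
      have lx: "(\<lambda>k. norm (x - W k j)) \<longlonglongrightarrow> norm (x - w j)" if "j < n" for j
        by (intro tendsto_intros lim that)
      show ?case
      proof (cases "x \<in> U w")
        case True
        have far: "\<epsilon> < norm (x - w j)" if "j < n" for j
          using True that by (auto simp: U_def holes_def dist_norm norm_minus_commute not_le)
        have "\<forall>\<^sub>F k in sequentially. \<forall>j\<in>{..<n}. \<epsilon> < norm (x - W k j)"
          using order_tendstoD(1)[OF lx far] by (intro eventually_ball_finite) auto
        then have "\<forall>\<^sub>F k in sequentially. f (W k) x = ?\<Phi> (x - W k i)"
          by eventually_elim (use True in \<open>auto simp: f_def U_def holes_def dist_norm norm_minus_commute not_le indicator_def\<close>)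
        moreover have "(\<lambda>k. ?\<Phi> (x - W k i)) \<longlonglongrightarrow> ?\<Phi> (x - w i)"
        proof (rule continuous_on_tendsto_compose[OF strain_density_continuous])
          show "(\<lambda>k. x - W k i) \<longlonglongrightarrow> x - w i" by (intro tendsto_intros lim i)
          show "x - w i \<in> - {0}" using far[OF i] \<epsilon> by auto
          have "\<forall>\<^sub>F k in sequentially. \<epsilon> < norm (x - W k i)" by (rule order_tendstoD(1)[OF lx[OF i] far[OF i]])
          then show "\<forall>\<^sub>F k in sequentially. x - W k i \<in> - {0}" by eventually_elim (use \<epsilon> in auto)
        qed
        ultimately show ?thesis
          using True by (auto simp: f_def elim: Lim_transform_eventually[OF _ eventually_mono])
      next
        case False
        have "\<forall>\<^sub>F k in sequentially. f (W k) x = 0"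
        proof (cases "x \<in> \<Omega>")
          case True
          then obtain j where j: "j < n" "norm (x - w j) \<le> \<epsilon>" using False by (auto simp: U_def holes_def dist_norm norm_minus_commute)
          then have "norm (x - w j) < \<epsilon>" using nx[OF j(1)] by simp
          then have "\<forall>\<^sub>F k in sequentially. norm (x - W k j) < \<epsilon>" by (rule order_tendstoD(2)[OF lx[OF j(1)]])
          then show ?thesis
            by eventually_elim (use j in \<open>auto simp: f_def U_def holes_def dist_norm norm_minus_commute indicator_def intro!: bexI[of _ j]\<close>)
        qed (auto simp: f_def U_def)
        then show ?thesis using False by (auto simp: f_def intro: tendsto_eventually)
      qed
    qed
  qed
  then show "(\<lambda>k. LINT x:(\<Omega> - holes \<epsilon> (W k ` {..<n}))|lebesgue. ?\<Phi> (x - W k i))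
      \<longlonglongrightarrow> (LINT x:(\<Omega> - holes \<epsilon> (w ` {..<n}))|lebesgue. ?\<Phi> (x - w i))"
    by (simp add: set_lebesgue_integral_def f_def[abs_def] U_def)
qed

section \<open>Rate-independent evolution on a compact space\<close>

text \<open>Tychonoff's theorem for the product over all times. This product is uncountable, so only
  a cluster point is obtained; it is approximated simultaneously at finitely many times, along
  indices that may depend on these times.\<close>

lemma product_cluster_point:
  fixes s :: "nat \<Rightarrow> 'i \<Rightarrow> 'b::metric_space"
  assumes K: "compact K" and s: "\<And>k t. s k t \<in> K"
  obtains x where "\<And>t. x t \<in> K"
    and "\<And>A e. finite A \<Longrightarrow> e > 0 \<Longrightarrow> \<exists>\<^sub>F k in sequentially. \<forall>t\<in>A. dist (s k t) (x t) < e"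
proof -
  have "compactin (product_topology (\<lambda>_. euclidean) UNIV) (PiE UNIV (\<lambda>_::'i. K))"
    using K by (simp add: compactin_PiE)
  then have "compact (PiE UNIV (\<lambda>_::'i. K))"
    by (simp add: euclidean_product_topology)
  then have cf: "\<exists>x\<in>PiE UNIV (\<lambda>_::'i. K). inf (nhds x) F \<noteq> bot"
    if "F \<noteq> bot" "eventually (\<lambda>x. x \<in> PiE UNIV (\<lambda>_::'i. K)) F" for F
    using that unfolding compact_filter by blast
  have ne: "filtermap s sequentially \<noteq> bot" by (simp add: filtermap_bot_iff)
  obtain x where x: "x \<in> PiE UNIV (\<lambda>_::'i. K)" and nb: "inf (nhds x) (filtermap s sequentially) \<noteq> bot"
    using cf[OF ne] s by (auto simp: eventually_filtermap PiE_iff)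
  show thesis
  proof
    show "x t \<in> K" for t using x by auto
    fix A :: "'i set" and e :: real
    assume A: "finite A" and e: "e > 0"
    define U where "U = PiE UNIV (\<lambda>t. if t \<in> A then ball (x t) e else UNIV)"
    have "open U"
      unfolding U_def using A by (intro open_PiE) (auto intro: finite_subset[of _ A])
    moreover have "x \<in> U" using e by (auto simp: U_def)
    ultimately have ev: "eventually (\<lambda>y. y \<in> U) (nhds x)" by (simp add: eventually_nhds_in_open)
    show "\<exists>\<^sub>F k in sequentially. \<forall>t\<in>A. dist (s k t) (x t) < e"
    proof (rule ccontr)
      assume "\<not> ?thesis"
      then have "\<forall>\<^sub>F k in sequentially. s k \<notin> U"
        unfolding not_frequently by eventually_elim (auto simp: U_def dist_commute PiE_iff split: if_splits)
      then have "eventually (\<lambda>y. y \<notin> U) (filtermap s sequentially)" by (simp add: eventually_filtermap)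
      with ev have "eventually (\<lambda>_. False) (inf (nhds x) (filtermap s sequentially))"
        unfolding eventually_inf by blast
      with nb show False by (simp add: eventually_False)
    qed
  qed
qed

lemma subseq_of_frequently:
  assumes "\<And>j. \<exists>\<^sub>F k in sequentially. Q j k"
  obtains r :: "nat \<Rightarrow> nat" where "strict_mono r" "\<And>j. Q j (r j)"
proof -
  have ex: "\<exists>k>k0. Q j k" for j k0
    using assms[of j] unfolding frequently_sequentially by (meson Suc_le_lessD)
  have "\<exists>f. \<forall>j. Q j (f j) \<and> f j < f (Suc j)"
  proof (rule dependent_nat_choice)
    show "\<exists>k. Q 0 k" using ex[of 0 0] by blast
    show "\<exists>k'. Q (Suc j) k' \<and> k < k'" if "Q j k" for k j using ex[of k "Suc j"] by blast
  qed
  then obtain f where "\<And>j. Q j (f j) \<and> f j < f (Suc j)" by blast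
  then show ?thesis using that[of f] by (simp add: strict_mono_Suc_iff)
qed

lemma AE_lebesgue_neq: "AE x in lebesgue. x \<noteq> (c::real)"
  by (rule AE_I'[of "{c}"]) (auto simp: null_sets_completionI)

lemma LINT_split:
  assumes "a \<le> b" "b \<le> c" and f: "set_integrable lebesgue {a..c} (f :: real \<Rightarrow> real)"
  shows "(LINT r:{a..c}|lebesgue. f r) = (LINT r:{a..b}|lebesgue. f r) + (LINT r:{b..c}|lebesgue. f r)"
proof -
  have *: "{a..c} = {a..b} \<union> {b..c}" using assms by auto
  have "set_integrable lebesgue {a..b} f" "set_integrable lebesgue {b..c} f"
    using assms by (auto intro: set_integrable_subset[OF f])
  then show ?thesis
    unfolding * by (intro set_integral_Un_AE) (use AE_lebesgue_neq[of b] in auto)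
qed

text \<open>Agreement is asked only inside the intervals, since the nodes are null sets;
  interpolants continuous from the left and from the right are covered alike.\<close>

lemma LINT_piecewise:
  fixes g :: "real \<Rightarrow> real"
  assumes \<tau>: "\<And>i. i < M \<Longrightarrow> \<tau> i \<le> \<tau> (Suc i)" and g: "set_integrable lebesgue {\<tau> 0..\<tau> M} g"
    and f: "\<And>i. i < M \<Longrightarrow> set_integrable lebesgue {\<tau> i..\<tau> (Suc i)} (f i)"
    and eq: "\<And>i s. i < M \<Longrightarrow> \<tau> i < s \<Longrightarrow> s < \<tau> (Suc i) \<Longrightarrow> g s = f i s"
  shows "(LINT s:{\<tau> 0..\<tau> M}|lebesgue. g s) = (\<Sum>i<M. LINT s:{\<tau> i..\<tau> (Suc i)}|lebesgue. f i s)"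
  using assms
proof (induction M)
  case 0
  have "AE s in lebesgue. s \<notin> {\<tau> 0..\<tau> 0}" using AE_lebesgue_neq[of "\<tau> 0"] by eventually_elim auto
  then have "(LINT s:{\<tau> 0..\<tau> 0}|lebesgue. g s) = 0"
    unfolding set_lebesgue_integral_def by (intro integral_eq_zero_AE) auto
  then show ?case by simp
next
  case (Suc M)
  have le: "\<tau> 0 \<le> \<tau> j" if "j \<le> Suc M" for j
    using that Suc.prems(1) by (induction j) (auto intro: order_trans)
  have l1: "\<tau> 0 \<le> \<tau> M" "\<tau> M \<le> \<tau> (Suc M)" using le[of M] Suc.prems(1)[of M] by auto
  have gi: "set_integrable lebesgue {\<tau> 0..\<tau> M} g" "set_integrable lebesgue {\<tau> M..\<tau> (Suc M)} g"
    by (rule set_integrable_subset[OF Suc.prems(2)]; use l1 in auto)+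
  have "(LINT s:{\<tau> M..\<tau> (Suc M)}|lebesgue. g s) = (LINT s:{\<tau> M..\<tau> (Suc M)}|lebesgue. f M s)"
    unfolding set_lebesgue_integral_def
  proof (rule integral_cong_AE)
    show "AE x in lebesgue. indicat_real {\<tau> M..\<tau> (Suc M)} x *\<^sub>R g x
                   = indicat_real {\<tau> M..\<tau> (Suc M)} x *\<^sub>R f M x"
      using AE_lebesgue_neq[of "\<tau> M"] AE_lebesgue_neq[of "\<tau> (Suc M)"]
      by eventually_elim (use Suc.prems(4)[of M] in \<open>auto simp: indicator_def\<close>)
  qed (use gi Suc.prems(3)[of M] in \<open>auto simp: set_integrable_def\<close>)
  moreover have "(LINT s:{\<tau> 0..\<tau> M}|lebesgue. g s) = (\<Sum>i<M. LINT s:{\<tau> i..\<tau> (Suc i)}|lebesgue. f i s)"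
    by (rule Suc.IH) (use Suc.prems gi in auto)
  ultimately show ?case using LINT_split[OF l1 Suc.prems(2)] by simp
qed

text \<open>\<open>d\<close> is only a pseudometric: permuting the labels of the points does not change the measure.\<close>

locale energetic_system =
  fixes P :: "'a::metric_space set" and F :: "'a \<Rightarrow> real" and d :: "'a \<Rightarrow> 'a \<Rightarrow> real"
    and L L' :: "real \<Rightarrow> 'a \<Rightarrow> real" and m :: "real \<Rightarrow> real" and T :: real and x0 :: 'a
  assumes T: "T > 0" and P: "compact P" and x0: "x0 \<in> P"
    and F_lsc: "\<And>u x e. (\<And>k::nat. u k \<in> P) \<Longrightarrow> x \<in> P \<Longrightarrow> u \<longlonglongrightarrow> x \<Longrightarrow> e > 0 \<Longrightarrow>
      \<forall>\<^sub>F k in sequentially. F x - e < F (u k)"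
    and d_nonneg: "\<And>x y. x \<in> P \<Longrightarrow> y \<in> P \<Longrightarrow> 0 \<le> d x y"
    and d_refl: "\<And>x. x \<in> P \<Longrightarrow> d x x = 0"
    and d_sym: "\<And>x y. x \<in> P \<Longrightarrow> y \<in> P \<Longrightarrow> d x y = d y x"
    and d_tri: "\<And>x y z. x \<in> P \<Longrightarrow> y \<in> P \<Longrightarrow> z \<in> P \<Longrightarrow> d x z \<le> d x y + d y z"
    and d_cont: "\<And>u x. (\<And>k::nat. u k \<in> P) \<Longrightarrow> x \<in> P \<Longrightarrow> u \<longlonglongrightarrow> x \<Longrightarrow> (\<lambda>k. d (u k) x) \<longlonglongrightarrow> 0"
    and F_inv: "\<And>x y. x \<in> P \<Longrightarrow> y \<in> P \<Longrightarrow> d x y = 0 \<Longrightarrow> F x = F y"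
    and L_inv: "\<And>t x y. t \<in> {0..T} \<Longrightarrow> x \<in> P \<Longrightarrow> y \<in> P \<Longrightarrow> d x y = 0 \<Longrightarrow> L t x = L t y"
    and L'_inv: "\<And>t x y. t \<in> {0..T} \<Longrightarrow> x \<in> P \<Longrightarrow> y \<in> P \<Longrightarrow> d x y = 0 \<Longrightarrow> L' t x = L' t y"
    and m_int: "set_integrable lebesgue {0..T} m"
    and L'_meas: "\<And>x. x \<in> P \<Longrightarrow> set_borel_measurable lebesgue {0..T} (\<lambda>s. L' s x)"
    and L'_bound: "\<And>s x. s \<in> {0..T} \<Longrightarrow> x \<in> P \<Longrightarrow> \<bar>L' s x\<bar> \<le> m s"
    and L'_cont: "\<And>s u x. s \<in> {0..T} \<Longrightarrow> (\<And>k::nat. u k \<in> P) \<Longrightarrow> x \<in> P \<Longrightarrow> u \<longlonglongrightarrow> x \<Longrightarrow>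
      (\<lambda>k. L' s (u k)) \<longlonglongrightarrow> L' s x"
    and L_cont: "\<And>s u x. s \<in> {0..T} \<Longrightarrow> (\<And>k::nat. u k \<in> P) \<Longrightarrow> x \<in> P \<Longrightarrow> u \<longlonglongrightarrow> x \<Longrightarrow>
      (\<lambda>k. L s (u k)) \<longlonglongrightarrow> L s x"
    and L_diff: "\<And>s t x. 0 \<le> s \<Longrightarrow> s \<le> t \<Longrightarrow> t \<le> T \<Longrightarrow> x \<in> P \<Longrightarrow>
      L t x - L s x = (LINT r:{s..t}|lebesgue. L' r x)"
    and stable0: "\<And>y. y \<in> P \<Longrightarrow> F x0 - L 0 x0 \<le> F y + d y x0 - L 0 y"
begin

text \<open>The direct method. The infimum is taken in \<open>ereal\<close> because boundedness from
  below is not known before a minimizer has been found.\<close>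

lemma F_attains_min:
  assumes g: "\<And>u x. (\<And>k::nat. u k \<in> P) \<Longrightarrow> x \<in> P \<Longrightarrow> u \<longlonglongrightarrow> x \<Longrightarrow> (\<lambda>k. g (u k)) \<longlonglongrightarrow> (g x :: real)"
  shows "\<exists>x\<in>P. \<forall>y\<in>P. F x + g x \<le> F y + g y"
proof -
  define I where "I = (INF y\<in>P. ereal (F y + g y))"
  have ne: "(\<lambda>y. ereal (F y + g y)) ` P \<noteq> {}" using x0 by auto
  obtain v where v: "range v \<subseteq> (\<lambda>y. ereal (F y + g y)) ` P" "v \<longlonglongrightarrow> I"
    using Inf_as_limit[OF ne] unfolding I_def by (auto simp: image_subset_iff)
  then have "\<forall>k. \<exists>y\<in>P. v k = ereal (F y + g y)" by (auto simp: subset_iff image_iff)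
  then obtain u where u: "\<And>k. u k \<in> P" "\<And>k. v k = ereal (F (u k) + g (u k))" by metis
  obtain x r where x: "x \<in> P" "strict_mono (r :: nat \<Rightarrow> nat)" "(u \<circ> r) \<longlonglongrightarrow> x"
    using P u(1) unfolding compact_def by blast
  have "ereal (F x + g x) \<le> I"
  proof (rule ereal_le_epsilon2)
    fix e :: real assume e: "0 < e"
    have 1: "\<forall>\<^sub>F k in sequentially. F x - e/2 < F (u (r k))"
      using F_lsc[of "u \<circ> r" x "e/2"] u x e by auto
    have 2: "\<forall>\<^sub>F k in sequentially. g x - e/2 < g (u (r k))"
      using g[of "u \<circ> r" x] u x e by (intro order_tendstoD(1)[where y="g x"]) auto
    have 3: "(v \<circ> r) \<longlonglongrightarrow> I" using v(2) x(2) LIMSEQ_subseq_LIMSEQ by blast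
    have "\<forall>\<^sub>F k in sequentially. ereal (F x + g x - e) \<le> (v \<circ> r) k"
      using 1 2 by eventually_elim (auto simp: u)
    then have "ereal (F x + g x - e) \<le> I"
      using 3 tendsto_lowerbound by fastforce
    then show "ereal (F x + g x) \<le> I + ereal e"
      by (cases I) auto
  qed
  then have "F x + g x \<le> F y + g y" if "y \<in> P" for y
    using order_trans[OF _ INF_lower[OF that], of "ereal (F x + g x)" "\<lambda>y. ereal (F y + g y)"]
    unfolding I_def by simp
  with x show ?thesis by blast
qed

text \<open>Transfers properties from convergence in the metric to convergence in the pseudometric
  \<open>d\<close>. A sequence violating \<open>Q\<close> has, by compactness, a subsequence
  converging in the metric to some \<open>y\<close> with \<open>d y x = 0\<close>, and
  \<open>Q\<close> does not distinguish such points.\<close>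

lemma d_conv:
  assumes u: "\<And>k::nat. u k \<in> P" and x: "x \<in> P" and d: "(\<lambda>k. d (u k) x) \<longlonglongrightarrow> 0"
    and g: "\<And>u x. (\<And>k::nat. u k \<in> P) \<Longrightarrow> x \<in> P \<Longrightarrow> u \<longlonglongrightarrow> x \<Longrightarrow> (\<forall>\<^sub>F k in sequentially. Q x (u k))"
    and inv: "\<And>x y z. x \<in> P \<Longrightarrow> y \<in> P \<Longrightarrow> d x y = 0 \<Longrightarrow> Q x z \<Longrightarrow> Q y z"
  shows "\<forall>\<^sub>F k in sequentially. Q x (u k)"
proof (rule ccontr)
  assume "\<not> ?thesis"
  then have "\<exists>\<^sub>F k in sequentially. \<not> Q x (u k)" by (simp add: not_eventually)
  then obtain r :: "nat \<Rightarrow> nat" where r: "strict_mono r" "\<And>j. \<not> Q x (u (r j))"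
    using subseq_of_frequently[of "\<lambda>_ k. \<not> Q x (u k)"] by metis
  have "\<forall>n. (u \<circ> r) n \<in> P" using u by auto
  then obtain y q where y: "y \<in> P" "strict_mono (q :: nat \<Rightarrow> nat)" "((u \<circ> r) \<circ> q) \<longlonglongrightarrow> y"
    using P unfolding compact_def by blast
  have 1: "(\<lambda>k. d (u (r (q k))) y) \<longlonglongrightarrow> 0"
    using d_cont[of "u \<circ> r \<circ> q" y] u y by (simp add: o_def)
  have 2: "(\<lambda>k. d (u (r (q k))) x) \<longlonglongrightarrow> 0"
    using LIMSEQ_subseq_LIMSEQ[OF d, of "r \<circ> q"] r(1) y(2) by (simp add: o_def strict_mono_def)
  have "d y x \<le> d (u (r (q k))) y + d (u (r (q k))) x" for k
    using d_tri[of y "u (r (q k))" x] d_sym[of y "u (r (q k))"] u x y by auto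
  then have "d y x \<le> 0 + 0"
    by (intro tendsto_lowerbound[OF tendsto_add[OF 1 2]]) auto
  then have d0: "d y x = 0" using d_nonneg[of y x] x y by linarith
  have "\<forall>\<^sub>F k in sequentially. Q y (u (r (q k)))"
    using g[of "u \<circ> r \<circ> q" y] u y by (auto simp: o_def)
  then have "\<forall>\<^sub>F k in sequentially. Q x (u (r (q k)))"
    by eventually_elim (use inv[OF y(1) x d0] in blast)
  then show False using r(2) by (auto simp: eventually_sequentially)
qed

lemma d_conv_tendsto:
  assumes u: "\<And>k::nat. u k \<in> P" and x: "x \<in> P" and d: "(\<lambda>k. d (u k) x) \<longlonglongrightarrow> 0"
    and g: "\<And>u x. (\<And>k::nat. u k \<in> P) \<Longrightarrow> x \<in> P \<Longrightarrow> u \<longlonglongrightarrow> x \<Longrightarrow> (\<lambda>k. g (u k)) \<longlonglongrightarrow> (g x :: real)"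
    and inv: "\<And>x y z. x \<in> P \<Longrightarrow> y \<in> P \<Longrightarrow> d x y = 0 \<Longrightarrow> g x = g y"
  shows "(\<lambda>k. g (u k)) \<longlonglongrightarrow> g x"
proof (rule tendstoI)
  fix e :: real assume "e > 0"
  show "\<forall>\<^sub>F k in sequentially. dist (g (u k)) (g x) < e"
  proof (rule d_conv[OF u x d, where Q="\<lambda>x y. dist (g y) (g x) < e"])
    show "\<forall>\<^sub>F k in sequentially. dist (g (u k)) (g x) < e"
      if "\<And>k. u k \<in> P" "x \<in> P" "u \<longlonglongrightarrow> x" for u x
      using g[OF that] \<open>e > 0\<close> by (auto simp: tendsto_iff)
  qed (use inv in auto)
qed

lemma L'_d_cont:
  assumes "s \<in> {0..T}" "\<And>k::nat. u k \<in> P" "x \<in> P" "(\<lambda>k. d (u k) x) \<longlonglongrightarrow> 0"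
  shows "(\<lambda>k. L' s (u k)) \<longlonglongrightarrow> L' s x"
  by (rule d_conv_tendsto[OF assms(2-4)]) (use assms(1) L'_cont L'_inv in auto)

lemma L_d_cont:
  assumes "s \<in> {0..T}" "\<And>k::nat. u k \<in> P" "x \<in> P" "(\<lambda>k. d (u k) x) \<longlonglongrightarrow> 0"
  shows "(\<lambda>k. L s (u k)) \<longlonglongrightarrow> L s x"
  by (rule d_conv_tendsto[OF assms(2-4)]) (use assms(1) L_cont L_inv in auto)

lemma F_d_lsc:
  assumes "e > 0" "\<And>k::nat. u k \<in> P" "x \<in> P" "(\<lambda>k. d (u k) x) \<longlonglongrightarrow> 0"
  shows "\<forall>\<^sub>F k in sequentially. F x - e < F (u k)"
  by (rule d_conv[OF assms(2-4), where Q="\<lambda>x y. F x - e < F y"])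
     (use assms(1) F_lsc F_inv in auto)

lemma L'_set_integrable:
  assumes A: "A \<in> sets lebesgue" "A \<subseteq> {0..T}" and x: "x \<in> P"
  shows "set_integrable lebesgue A (\<lambda>s. L' s x)"
proof -
  have "set_integrable lebesgue {0..T} (\<lambda>s. L' s x)"
    by (rule set_integrable_bound[OF m_int L'_meas[OF x]])
       (use L'_bound[OF _ x] in \<open>auto intro!: AE_I2 order_trans[OF _ abs_ge_self]\<close>)
  then show ?thesis using A set_integrable_subset by blast
qed


lemma d_cont_left:
  assumes "\<And>k::nat. u k \<in> P" "x \<in> P" "u \<longlonglongrightarrow> x" "y \<in> P"
  shows "(\<lambda>k. d (u k) y) \<longlonglongrightarrow> d x y"
proof -
  have "\<bar>d (u k) y - d x y\<bar> \<le> d (u k) x" for k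
    using d_tri[of "u k" x y] d_tri[of x "u k" y] d_sym[of x "u k"] assms by auto
  then have "(\<lambda>k. d (u k) y - d x y) \<longlonglongrightarrow> 0"
    by (intro Lim_null_comparison[OF _ d_cont[OF assms(1-3)]]) auto
  then show ?thesis by (simp add: LIM_zero_iff)
qed

section \<open>The time-incremental scheme\<close>

definition incr :: "real \<Rightarrow> 'a \<Rightarrow> 'a" where
  "incr t y = (SOME x. x \<in> P \<and> (\<forall>z\<in>P. F x + d x y - L t x \<le> F z + d z y - L t z))"

lemma incr:
  assumes "t \<in> {0..T}" "y \<in> P"
  shows "incr t y \<in> P" "\<And>z. z \<in> P \<Longrightarrow> F (incr t y) + d (incr t y) y - L t (incr t y) \<le> F z + d z y - L t z"
proof -
  have "\<exists>x\<in>P. \<forall>z\<in>P. F x + (d x y - L t x) \<le> F z + (d z y - L t z)"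
    using F_attains_min[of "\<lambda>x. d x y - L t x"] d_cont_left assms L_cont
    by (simp add: tendsto_diff)
  then have "\<exists>x. x \<in> P \<and> (\<forall>z\<in>P. F x + d x y - L t x \<le> F z + d z y - L t z)"
    by (auto simp: algebra_simps)
  from someI_ex[OF this] show "incr t y \<in> P"
    "\<And>z. z \<in> P \<Longrightarrow> F (incr t y) + d (incr t y) y - L t (incr t y) \<le> F z + d z y - L t z"
    unfolding incr_def by blast+
qed

text \<open>A uniform grid of \<open>Suc k\<close> steps; the cap at \<open>T\<close> keeps later
  nodes in the time interval, so the scheme can be iterated for every index.\<close>

definition node :: "nat \<Rightarrow> nat \<Rightarrow> real" where "node k j = min T (real j * T / real (Suc k))"

primrec scheme :: "nat \<Rightarrow> nat \<Rightarrow> 'a" where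
  "scheme k 0 = x0"
| "scheme k (Suc j) = incr (node k (Suc j)) (scheme k j)"

lemma node: "node k j \<in> {0..T}" "node k 0 = 0" "node k j \<le> node k (Suc j)"
proof -
  show "node k j \<in> {0..T}" "node k 0 = 0" using T by (auto simp: node_def)
  show "node k j \<le> node k (Suc j)"
    unfolding node_def using T by (intro min.mono order_refl divide_right_mono mult_right_mono) auto
qed

declare scheme.simps(2)[simp del]

lemma scheme_in: "scheme k j \<in> P"
  by (induction j) (use x0 incr(1) node in \<open>auto simp: scheme.simps(2)\<close>)

text \<open>By the triangle inequality, reaching \<open>y\<close> from the previous state costs at
  most the step just made plus the cost from the current state, so minimality implies stability. The
  initial state is stable by assumption.\<close>

lemma scheme_stable:
  assumes "y \<in> P"
  shows "F (scheme k j) - L (node k j) (scheme k j) \<le> F y + d y (scheme k j) - L (node k j) y"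
proof (cases j)
  case 0
  then show ?thesis using stable0 assms node(2) by simp
next
  case (Suc i)
  let ?x = "scheme k j"
  have "F ?x + d ?x (scheme k i) - L (node k j) ?x \<le> F y + d y (scheme k i) - L (node k j) y"
    using incr(2)[OF node(1) scheme_in assms, of k j k i] Suc by (simp add: scheme.simps(2))
  moreover have "d y (scheme k i) \<le> d y ?x + d ?x (scheme k i)"
    using d_tri assms scheme_in by blast
  ultimately show ?thesis by linarith
qed

definition idx :: "nat \<Rightarrow> real \<Rightarrow> nat" where "idx k t = nat \<lfloor>real (Suc k) * min T t / T\<rfloor>"
definition interp :: "nat \<Rightarrow> real \<Rightarrow> 'a" where "interp k t = scheme k (idx k t)"
text \<open>Followed together with the states in the limit: its limit is monotone and dominates the
  increments of the limit curve.\<close>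

definition spent :: "nat \<Rightarrow> real \<Rightarrow> real" where
  "spent k t = (\<Sum>i<idx k t. d (scheme k (Suc i)) (scheme k i))"

lemma interp_in: "interp k t \<in> P" by (simp add: interp_def scheme_in)

lemma idx_mono: "s \<le> t \<Longrightarrow> idx k s \<le> idx k t"
  using T unfolding idx_def by (intro nat_mono floor_mono divide_right_mono mult_left_mono) auto

lemma idx_node:
  assumes "t \<in> {0..T}"
  shows "node k (idx k t) \<le> t" "t - node k (idx k t) \<le> T / real (Suc k)"
proof -
  have nn: "0 \<le> real (Suc k) * t / T" using assms T by auto
  have "real (idx k t) = of_int \<lfloor>real (Suc k) * t / T\<rfloor>"
    using assms nn by (auto simp: idx_def min_def)
  then have a: "real (idx k t) \<le> real (Suc k) * t / T" "real (Suc k) * t / T < real (idx k t) + 1"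
    by linarith+
  then have b: "real (idx k t) * T / real (Suc k) \<le> t" using T by (simp add: field_simps)
  show "node k (idx k t) \<le> t" using b by (simp add: node_def)
  have "node k (idx k t) = real (idx k t) * T / real (Suc k)"
    using b assms by (simp add: node_def)
  then show "t - node k (idx k t) \<le> T / real (Suc k)" using a T by (simp add: field_simps)
qed

lemma idx_unique:
  assumes "node k j \<le> s" "s < node k (Suc j)"
  shows "idx k s = j"
proof -
  have s: "s < T" using assms node(1)[of k "Suc j"] by auto
  have "real j * T / real (Suc k) \<le> s" "s < real (Suc j) * T / real (Suc k)"
    using assms s by (auto simp: node_def min_def split: if_splits)
  then have "real j \<le> real (Suc k) * s / T" "real (Suc k) * s / T < real j + 1"
    using T by (auto simp: field_simps)
  then have "\<lfloor>real (Suc k) * s / T\<rfloor> = int j" by (intro floor_unique) auto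
  then show ?thesis using s by (simp add: idx_def min_def)
qed

lemma spent_mono: "s \<le> t \<Longrightarrow> spent k s \<le> spent k t"
  unfolding spent_def by (rule sum_mono2) (use idx_mono d_nonneg scheme_in in \<open>auto intro: less_le_trans\<close>)

lemma spent_dist:
  assumes "s \<le> t" shows "d (interp k t) (interp k s) \<le> spent k t - spent k s"
proof -
  have "d (scheme k (i + j)) (scheme k i) \<le> (\<Sum>l<i+j. d (scheme k (Suc l)) (scheme k l))
      - (\<Sum>l<i. d (scheme k (Suc l)) (scheme k l))" for i j
  proof (induction j)
    case 0 then show ?case using d_refl scheme_in by simp
  next
    case (Suc j)
    have "d (scheme k (i + Suc j)) (scheme k i)
       \<le> d (scheme k (Suc (i + j))) (scheme k (i + j)) + d (scheme k (i+j)) (scheme k i)"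
      using d_tri[of "scheme k (Suc (i + j))" "scheme k (i + j)" "scheme k i"] scheme_in by simp
    then show ?case using Suc by simp
  qed
  from this[of "idx k s" "idx k t - idx k s"] show ?thesis
    using idx_mono[OF assms, of k] by (simp add: spent_def interp_def)
qed

text \<open>The derivative of the load is measurable in time only for a fixed state, so the path may
  take countably many values, selected by a measurable index.\<close>

lemma L'_path_measurable:
  assumes y: "\<And>i::nat. y i \<in> P" and h: "h \<in> borel \<rightarrow>\<^sub>M count_space UNIV"
  shows "set_borel_measurable lebesgue {0..T} (\<lambda>s. L' s (y (h s)))"
proof -
  have h': "h \<in> lebesgue \<rightarrow>\<^sub>M count_space UNIV"
    using measurable_comp[OF measurable_completion[OF measurable_ident_sets[of lborel borel]] h] by (simp add: o_def)
  show ?thesis unfolding set_borel_measurable_def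
    by (rule measurable_compose_countable[OF _ h'])
       (use L'_meas y in \<open>auto simp: set_borel_measurable_def\<close>)
qed

lemma L'_path_integrable:
  assumes "\<And>s. s \<in> {0..T} \<Longrightarrow> z s \<in> P" "set_borel_measurable lebesgue {0..T} (\<lambda>s. L' s (z s))"
    and A: "A \<in> sets lebesgue" "A \<subseteq> {0..T}"
  shows "set_integrable lebesgue A (\<lambda>s. L' s (z s))"
proof -
  have "set_integrable lebesgue {0..T} (\<lambda>s. L' s (z s))"
    by (rule set_integrable_bound[OF m_int assms(2)])
       (use L'_bound assms(1) in \<open>auto intro!: AE_I2 order_trans[OF _ abs_ge_self]\<close>)
  then show ?thesis using A set_integrable_subset by blast
qed

lemma idx_measurable: "idx k \<in> borel \<rightarrow>\<^sub>M count_space UNIV"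
  unfolding idx_def by measurable

lemma interp_integrable:
  assumes "A \<in> sets lebesgue" "A \<subseteq> {0..T}"
  shows "set_integrable lebesgue A (\<lambda>s. L' s (interp k s))"
  unfolding interp_def
  by (rule L'_path_integrable[OF _ L'_path_measurable[OF _ idx_measurable]]) (use scheme_in assms in auto)

text \<open>Staying at the previous state is an admissible competitor in each step; summing the
  comparisons gives the discrete upper energy inequality.\<close>

lemma node_energy:
  "F (scheme k j) - L (node k j) (scheme k j) + (\<Sum>i<j. d (scheme k (Suc i)) (scheme k i))
     \<le> F x0 - L 0 x0 - (\<Sum>i<j. LINT s:{node k i..node k (Suc i)}|lebesgue. L' s (scheme k i))"
proof (induction j)
  case 0 then show ?case by (simp add: node)
next
  case (Suc j)
  have "F (scheme k (Suc j)) + d (scheme k (Suc j)) (scheme k j) - L (node k (Suc j)) (scheme k (Suc j))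
      \<le> F (scheme k j) - L (node k (Suc j)) (scheme k j)"
    using incr(2)[OF node(1) scheme_in scheme_in, of k "Suc j" k j k j] d_refl scheme_in by (simp add: scheme.simps(2))
  moreover have "L (node k (Suc j)) (scheme k j) - L (node k j) (scheme k j)
      = (LINT s:{node k j..node k (Suc j)}|lebesgue. L' s (scheme k j))"
    using L_diff[OF _ node(3) _ scheme_in] node(1) by auto
  ultimately show ?case using Suc by simp
qed

lemma upper_energy:
  assumes t: "t \<in> {0..T}"
  shows "F (interp k t) + spent k t - L t (interp k t)
     \<le> F x0 - L 0 x0 - (LINT s:{0..t}|lebesgue. L' s (interp k s))"
proof -
  let ?j = "idx k t"
  have nj: "0 \<le> node k ?j" "node k ?j \<le> t" using node(1)[of k ?j] idx_node[OF t, of k] by auto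
  have "(LINT s:{node k 0..node k ?j}|lebesgue. L' s (interp k s))
     = (\<Sum>i<?j. LINT s:{node k i..node k (Suc i)}|lebesgue. L' s (scheme k i))"
  proof (rule LINT_piecewise)
    show "node k i \<le> node k (Suc i)" for i by (rule node)
    show "set_integrable lebesgue {node k 0..node k ?j} (\<lambda>s. L' s (interp k s))"
      using node by (intro interp_integrable) (auto intro: order_trans)
    show "set_integrable lebesgue {node k i..node k (Suc i)} (\<lambda>s. L' s (scheme k i))" for i
      using node(1)[of k i] node(1)[of k "Suc i"] by (intro L'_set_integrable scheme_in) auto
    show "L' s (interp k s) = L' s (scheme k i)" if "node k i < s" "s < node k (Suc i)" for i s
      using idx_unique[of k i s] that by (simp add: interp_def)
  qed
  moreover have "(LINT s:{0..t}|lebesgue. L' s (interp k s)) =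
      (LINT s:{0..node k ?j}|lebesgue. L' s (interp k s)) + (LINT s:{node k ?j..t}|lebesgue. L' s (interp k s))"
    by (rule LINT_split[OF nj]) (use t in \<open>auto intro!: interp_integrable\<close>)
  moreover have "(LINT s:{node k ?j..t}|lebesgue. L' s (interp k s)) = L t (interp k t) - L (node k ?j) (interp k t)"
  proof -
    \<comment> \<open>Beyond the last node before \<open>t\<close> the interpolant does not change,
      so the remaining power is an increment of the load at a fixed state.\<close>
    have same: "idx k s = ?j" if "s \<in> {node k ?j..t}" for s
    proof -
      have "idx k s \<le> ?j" using that by (auto intro: idx_mono)
      moreover have "?j \<le> idx k s"
      proof (cases "?j = 0")
        case False
        have "real ?j \<le> real (Suc k) * min T t / T"
          using t T unfolding idx_def by (auto intro!: of_nat_floor)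
        then have "real ?j * T / real (Suc k) \<le> t" "real ?j * T / real (Suc k) \<le> T"
          using T t mult_mono[of t T "1 + real k" "1 + real k"] by (auto simp: field_simps)
        then have "node k ?j = real ?j * T / real (Suc k)" by (simp add: node_def)
        then have "real ?j * T / real (Suc k) \<le> min T s" using that t by auto
        moreover define v where "v = min T s"
        ultimately have "real ?j * T / real (Suc k) \<le> v" by simp
        then have "real ?j \<le> real (Suc k) * v / T" using T by (simp add: field_simps)
        then have "real ?j \<le> real (Suc k) * min T s / T" unfolding v_def .
        then show ?thesis unfolding idx_def[of k s] by (metis le_nat_floor)
      qed simp
      ultimately show ?thesis by simp
    qed
    have "(LINT s:{node k ?j..t}|lebesgue. L' s (interp k s)) = (LINT s:{node k ?j..t}|lebesgue. L' s (interp k t))"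
    proof (rule set_lebesgue_integral_cong)
      show "\<forall>s. s \<in> {node k ?j..t} \<longrightarrow> L' s (interp k s) = L' s (interp k t)"
        unfolding interp_def using same by metis
    qed auto
    then show ?thesis using L_diff[OF nj _ interp_in] t by simp
  qed
  ultimately show ?thesis using node_energy[of k ?j] by (simp add: spent_def interp_def node)
qed

text \<open>Stability is exact at the last node. Since then the load has changed by at most the
  integral of \<open>m\<close> at each of the two states, hence the factor 2.\<close>

lemma interp_almost_stable:
  assumes t: "t \<in> {0..T}" and y: "y \<in> P"
  shows "F (interp k t) - L t (interp k t)
     \<le> F y + d y (interp k t) - L t y + 2 * (LINT s:{node k (idx k t)..t}|lebesgue. m s)"
proof -
  let ?s = "node k (idx k t)"
  have s: "0 \<le> ?s" "?s \<le> t" using node(1)[of k "idx k t"] idx_node[OF t, of k] by auto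
  have "\<bar>L t z - L ?s z\<bar> \<le> (LINT s:{?s..t}|lebesgue. m s)" if z: "z \<in> P" for z
  proof -
    have "\<bar>L t z - L ?s z\<bar> = \<bar>LINT r:{?s..t}|lebesgue. L' r z\<bar>" using L_diff s z t by simp
    also have "\<dots> \<le> (LINT r:{?s..t}|lebesgue. m r)"
      unfolding set_lebesgue_integral_def
    proof (rule order_trans[OF integral_abs_bound integral_mono])
      have "set_integrable lebesgue {?s..t} m" using s t by (intro set_integrable_subset[OF m_int]) auto
      then show "integrable lebesgue (\<lambda>x. indicat_real {?s..t} x *\<^sub>R m x)" by (simp add: set_integrable_def)
      have "set_integrable lebesgue {?s..t} (\<lambda>r. L' r z)" using s t z by (intro L'_set_integrable) auto
      then show "integrable lebesgue (\<lambda>x. \<bar>indicat_real {?s..t} x *\<^sub>R L' x z\<bar>)" by (simp add: set_integrable_def)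
      show "\<bar>indicat_real {?s..t} x *\<^sub>R L' x z\<bar> \<le> indicat_real {?s..t} x *\<^sub>R m x" for x
        using L'_bound[of x z] s t z by (auto simp: indicator_def)
    qed
    finally show ?thesis .
  qed
  from this[OF y] this[OF interp_in, of k t] show ?thesis
    using scheme_stable[OF y, of k "idx k t"] unfolding interp_def by linarith
qed

lemma m_tail: "t \<in> {0..T} \<Longrightarrow> (\<lambda>k. LINT s:{node k (idx k t)..t}|lebesgue. m s) \<longlonglongrightarrow> 0"
proof -
  assume t: "t \<in> {0..T}"
  have "(\<lambda>k. integral\<^sup>L lebesgue (\<lambda>s. indicat_real {node k (idx k t)..t} s *\<^sub>R m s)) \<longlonglongrightarrow> integral\<^sup>L lebesgue (\<lambda>s::real. 0)"
  proof (rule integral_dominated_convergence[where w="\<lambda>s. indicat_real {0..T} s *\<^sub>R \<bar>m s\<bar>"])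
    have mi: "integrable lebesgue (\<lambda>s. indicat_real {0..T} s *\<^sub>R m s)" using m_int by (simp add: set_integrable_def)
    have "integrable lebesgue (\<lambda>s. norm (indicat_real {0..T} s *\<^sub>R m s))" by (rule integrable_norm[OF mi])
    then show "integrable lebesgue (\<lambda>s. indicat_real {0..T} s *\<^sub>R \<bar>m s\<bar>)" by (simp add: abs_mult)
    show "(\<lambda>s. indicat_real {node k (idx k t)..t} s *\<^sub>R m s) \<in> borel_measurable lebesgue" for k
    proof -
      have "set_integrable lebesgue {node k (idx k t)..t} m"
        using node(1)[of k "idx k t"] t by (intro set_integrable_subset[OF m_int]) auto
      then show ?thesis by (auto simp: set_integrable_def)
    qed
    show "AE x in lebesgue. norm (indicat_real {node k (idx k t)..t} x *\<^sub>R m x) \<le> indicat_real {0..T} x *\<^sub>R \<bar>m x\<bar>" for k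
      using node(1)[of k "idx k t"] t by (auto simp: indicator_def)
    show "AE x in lebesgue. (\<lambda>k. indicat_real {node k (idx k t)..t} x *\<^sub>R m x) \<longlonglongrightarrow> 0"
      using AE_lebesgue_neq[of t]
    proof eventually_elim
      case (elim s)
      have lim: "(\<lambda>k. t - T / real (Suc k)) \<longlonglongrightarrow> t - 0"
        by (intro tendsto_diff tendsto_const LIMSEQ_Suc lim_const_over_n)
      have "\<forall>\<^sub>F k in sequentially. indicat_real {node k (idx k t)..t} s *\<^sub>R m s = 0"
      proof (cases "s < t")
        case True
        then have "\<forall>\<^sub>F k in sequentially. s < t - T / real (Suc k)"
          using order_tendstoD(1)[OF lim, of s] by simp
        then show ?thesis 
        proof eventually_elim
          case (elim k)
          then have "s < node k (idx k t)" using idx_node(2)[OF t, of k] by linarith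
          then show ?case by (simp add: indicator_def)
        qed
      next
        case False then show ?thesis using elim by auto
      qed
      then show ?case by (rule tendsto_eventually)
    qed
  qed auto
  then show ?thesis by (simp add: set_lebesgue_integral_def)
qed

lemma spent_bounded: "\<exists>C. \<forall>k t. spent k t \<in> {0..C}"
proof -
  have "\<exists>x\<in>P. \<forall>y\<in>P. F x + - L T x \<le> F y + - L T y"
    by (rule F_attains_min) (use T in \<open>intro tendsto_minus L_cont, auto\<close>)
  then obtain z where z: "z \<in> P" "\<And>y. y \<in> P \<Longrightarrow> F z - L T z \<le> F y - L T y"
    by (metis diff_conv_add_uminus)
  \<comment> \<open>The upper energy inequality at \<open>T\<close>, with the energy bounded below
    by its minimum and the power by \<open>m\<close>.\<close>
  define C where "C = F x0 - L 0 x0 + (LINT s:{0..T}|lebesgue. m s) - (F z - L T z)"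
  have nn: "0 \<le> spent k t" for k t
    unfolding spent_def by (intro sum_nonneg d_nonneg scheme_in)
  have "spent k t \<le> C" for k t
  proof -
    have "spent k t \<le> spent k T"
      using spent_mono[of "min T t" T k] by (simp add: spent_def idx_def)
    moreover have "- (LINT s:{0..T}|lebesgue. L' s (interp k s)) \<le> (LINT s:{0..T}|lebesgue. m s)"
      unfolding set_lebesgue_integral_def integral_minus[symmetric]
    proof (rule integral_mono)
      show "integrable lebesgue (\<lambda>x. indicat_real {0..T} x *\<^sub>R m x)" using m_int by (simp add: set_integrable_def)
      have "set_integrable lebesgue {0..T} (\<lambda>s. L' s (interp k s))" by (rule interp_integrable) auto
      then show "integrable lebesgue (\<lambda>x. - (indicat_real {0..T} x *\<^sub>R L' x (interp k x)))"
        by (simp add: set_integrable_def)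
      show "- (indicat_real {0..T} x *\<^sub>R L' x (interp k x)) \<le> indicat_real {0..T} x *\<^sub>R m x" for x
        using L'_bound[of x "interp k x"] interp_in by (auto simp: indicator_def abs_le_iff)
    qed
    ultimately show ?thesis using upper_energy[of T k] z(2)[OF interp_in, of k T] T by (simp add: C_def)
  qed
  with nn show ?thesis by auto
qed

end

section \<open>The lower energy inequality\<close>

context energetic_system
begin

definition path_sums :: "(real \<Rightarrow> 'a) \<Rightarrow> real \<Rightarrow> real set" where
  "path_sums x t = {(\<Sum>i<M. d (x (\<tau> (Suc i))) (x (\<tau> i))) | (M::nat) \<tau>.
     \<tau> 0 = 0 \<and> \<tau> M = t \<and> (\<forall>i<M. \<tau> i < \<tau> (Suc i))}"

text \<open>Stability at each node of a partition, with the next state as competitor, bounds the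
  energy loss by the dissipated amount and by the power evaluated at right end points. Such sums
  converge to the power of the curve because \<open>x\<close> is continuous in \<open>d\<close>
  outside the countably many jumps of \<open>D\<close>.\<close>

lemma lower_energy:
  assumes xP: "\<And>t. t \<in> {0..T} \<Longrightarrow> x t \<in> P"
    and stab: "\<And>t y. t \<in> {0..T} \<Longrightarrow> y \<in> P \<Longrightarrow> F (x t) - L t (x t) \<le> F y + d y (x t) - L t y"
    and D: "mono D" "\<And>s t. s \<le> t \<Longrightarrow> s \<in> {0..T} \<Longrightarrow> t \<in> {0..T} \<Longrightarrow> d (x t) (x s) \<le> D t - D s"
    and t: "t \<in> {0..T}" and V: "\<And>v. v \<in> path_sums x t \<Longrightarrow> v \<le> V"
  shows "F (x 0) - L 0 (x 0) \<le> F (x t) - L t (x t) + V + (LINT s:{0..t}|lebesgue. L' s (x s))"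
proof (cases "t = 0")
  case True
  have "0 \<in> path_sums x t" using True by (auto simp: path_sums_def intro!: exI[of _ 0] exI[of _ "\<lambda>_. 0"])
  moreover have "AE s in lebesgue. s \<notin> {0..t}"
    using AE_lebesgue_neq[of 0] by eventually_elim (use True in auto)
  then have "(LINT s:{0..t}|lebesgue. L' s (x s)) = 0"
    unfolding set_lebesgue_integral_def by (intro integral_eq_zero_AE) auto
  ultimately show ?thesis using True V by force
next
  case False
  then have t0: "t > 0" using t by auto
  \<comment> \<open>Rounding up yields the right end point of the interval containing
    \<open>s\<close>: the competitor in the stability condition is the later state.\<close>
  define h where "h N s = nat \<lceil>real (Suc N) * s / t\<rceil>" for N s
  define \<tau> where "\<tau> N i = t * real i / real (Suc N)" for N i
  \<comment> \<open>The cap at \<open>t\<close> makes every index give a state in \<open>P\<close>,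
    also indices reached only for times beyond \<open>t\<close>.\<close>
  define y where "y N i = x (min t (\<tau> N i))" for N i
  have \<tau>: "\<tau> N i < \<tau> N (Suc i)" "\<tau> N 0 = 0" "\<tau> N (Suc N) = t" "0 \<le> \<tau> N i" for N i
    using t0 by (auto simp: \<tau>_def field_simps add_pos_nonneg)
  have \<tau>le: "\<tau> N i \<le> t" if "i \<le> Suc N" for N i
    using t0 that mult_left_mono[of "real i" "real (Suc N)" t] by (simp add: \<tau>_def pos_divide_le_eq)
  have yP: "y N i \<in> P" for N i using xP \<tau>(4)[of N i] t by (auto simp: y_def)
  have hm: "h N \<in> borel \<rightarrow>\<^sub>M count_space UNIV" for N unfolding h_def by measurable
  have meas: "set_borel_measurable lebesgue {0..T} (\<lambda>s. L' s (y N (h N s)))" for N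
    by (rule L'_path_measurable[OF yP hm])
  have int: "set_integrable lebesgue {0..t} (\<lambda>s. L' s (y N (h N s)))" for N
    by (rule L'_path_integrable[OF yP meas]) (use t in auto)
  have step: "F (x 0) - L 0 (x 0) \<le> F (x t) - L t (x t) + V + (LINT s:{0..t}|lebesgue. L' s (y N (h N s)))" for N
  proof -
    have tel: "F (x 0) - L 0 (x 0) \<le> F (x (\<tau> N j)) - L (\<tau> N j) (x (\<tau> N j))
       + (\<Sum>i<j. d (x (\<tau> N (Suc i))) (x (\<tau> N i))) + (\<Sum>i<j. LINT s:{\<tau> N i..\<tau> N (Suc i)}|lebesgue. L' s (y N (Suc i)))"
      if "j \<le> Suc N" for j using that
    proof (induction j)
      case 0 then show ?case by (simp add: \<tau>)
    next
      case (Suc j)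
      have in1: "\<tau> N j \<in> {0..T}" "\<tau> N (Suc j) \<in> {0..T}" using \<tau>(4)[of N] \<tau>le[of j N] \<tau>le[of "Suc j" N] t Suc.prems
        by (auto simp del: of_nat_Suc intro: order_trans)
      have yj: "y N (Suc j) = x (\<tau> N (Suc j))" using \<tau>le[OF Suc.prems] by (simp add: y_def)
      have "F (x (\<tau> N j)) - L (\<tau> N j) (x (\<tau> N j)) \<le> F (x (\<tau> N (Suc j)))
        + d (x (\<tau> N (Suc j))) (x (\<tau> N j)) - L (\<tau> N j) (x (\<tau> N (Suc j)))"
        using stab in1 xP by blast
      moreover have "L (\<tau> N (Suc j)) (x (\<tau> N (Suc j))) - L (\<tau> N j) (x (\<tau> N (Suc j)))
         = (LINT s:{\<tau> N j..\<tau> N (Suc j)}|lebesgue. L' s (y N (Suc j)))"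
        unfolding yj by (rule L_diff) (use in1 \<tau>(1)[of N j] xP in auto)
      ultimately show ?case using Suc by simp
    qed
    have "(\<Sum>i<Suc N. d (x (\<tau> N (Suc i))) (x (\<tau> N i))) \<in> path_sums x t"
      unfolding path_sums_def using \<tau> by blast
    then have "(\<Sum>i<Suc N. d (x (\<tau> N (Suc i))) (x (\<tau> N i))) \<le> V" by (rule V)
    moreover have "(LINT s:{\<tau> N 0..\<tau> N (Suc N)}|lebesgue. L' s (y N (h N s)))
      = (\<Sum>i<Suc N. LINT s:{\<tau> N i..\<tau> N (Suc i)}|lebesgue. L' s (y N (Suc i)))"
    proof (rule LINT_piecewise)
      show "\<tau> N i \<le> \<tau> N (Suc i)" for i using \<tau>(1)[of N i] by simp
      show "set_integrable lebesgue {\<tau> N 0..\<tau> N (Suc N)} (\<lambda>s. L' s (y N (h N s)))"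
        using int by (simp add: \<tau>)
      show "set_integrable lebesgue {\<tau> N i..\<tau> N (Suc i)} (\<lambda>s. L' s (y N (Suc i)))" if "i < Suc N" for i
        using \<tau>(4)[of N i] \<tau>le[of "Suc i" N] that t by (intro L'_set_integrable yP) auto
      show "L' s (y N (h N s)) = L' s (y N (Suc i))" if "\<tau> N i < s" "s < \<tau> N (Suc i)" for i s
      proof -
        have "real i < real (Suc N) * s / t" "real (Suc N) * s / t < real i + 1"
          using that t0 by (auto simp: \<tau>_def field_simps)
        then have "\<lceil>real (Suc N) * s / t\<rceil> = int i + 1" by (intro ceiling_unique) auto
        then have "h N s = Suc i" unfolding h_def by simp
        then show ?thesis by simp
      qed
    qed
    ultimately show ?thesis using tel[of "Suc N"] by (simp add: \<tau>)
  qed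
  have "(\<lambda>N. integral\<^sup>L lebesgue (\<lambda>s. indicat_real {0..t} s *\<^sub>R L' s (y N (h N s))))
      \<longlonglongrightarrow> integral\<^sup>L lebesgue (\<lambda>s. indicat_real {0..t} s *\<^sub>R L' s (x s))"
    and "integrable lebesgue (\<lambda>s. indicat_real {0..t} s *\<^sub>R L' s (x s))"
  proof -
    have cd: "countable {s. \<not> isCont D s}" by (rule mono_ctble_discont[OF D(1)])
    then have aec: "AE s in lebesgue. isCont D s"
      by (intro AE_I'[of "{s. \<not> isCont D s}"]) (auto simp: countable_imp_null_set_lborel null_sets_completionI)
    have conv: "(\<lambda>N. L' s (y N (h N s))) \<longlonglongrightarrow> L' s (x s)" if c: "isCont D s" and s: "s \<in> {0..t}" for s
    proof (rule L'_d_cont)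
      show "s \<in> {0..T}" "x s \<in> P" "\<And>N. y N (h N s) \<in> P" using s t xP yP by auto
      have r: "min t (\<tau> N (h N s)) \<in> {0..T}" "s \<le> min t (\<tau> N (h N s))"
        "min t (\<tau> N (h N s)) \<le> s + t / real (Suc N)" for N
      proof -
        have a: "real (h N s) = of_int \<lceil>real (Suc N) * s / t\<rceil>" using s t0 by (simp add: h_def)
        have b: "real (Suc N) * s / t \<le> real (h N s)" "real (h N s) \<le> real (Suc N) * s / t + 1"
          unfolding a by linarith+
        show "min t (\<tau> N (h N s)) \<in> {0..T}" using t \<tau>(4)[of N "h N s"] by auto
        show "s \<le> min t (\<tau> N (h N s))" using b(1) s t0 by (simp add: \<tau>_def field_simps)
        have "\<tau> N (h N s) \<le> s + t / real (Suc N)" 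
        proof -
          have "t * real (h N s) \<le> real (Suc N) * s + t" using b(2) t0 by (simp add: field_simps)
          then have "t * real (h N s) / real (Suc N) \<le> (real (Suc N) * s + t) / real (Suc N)"
            by (rule divide_right_mono) simp
          also have "\<dots> = s + t / real (Suc N)" by (simp add: add_divide_distrib)
          finally show ?thesis by (simp add: \<tau>_def)
        qed
        then show "min t (\<tau> N (h N s)) \<le> s + t / real (Suc N)" by linarith
      qed
      have l0: "(\<lambda>N. s + t / real (Suc N)) \<longlonglongrightarrow> s"
        using tendsto_add[OF tendsto_const LIMSEQ_Suc[OF lim_const_over_n[of t]], of s] by simp
      have "(\<lambda>N. min t (\<tau> N (h N s))) \<longlonglongrightarrow> s"
        by (rule tendsto_sandwich[OF _ _ tendsto_const l0]) (intro always_eventually allI r)+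
      then have "(\<lambda>N. D (min t (\<tau> N (h N s))) - D s) \<longlonglongrightarrow> D s - D s"
        by (intro tendsto_diff tendsto_const isCont_tendsto_compose[OF c])
      then have l: "(\<lambda>N. D (min t (\<tau> N (h N s))) - D s) \<longlonglongrightarrow> 0" by simp
      show "(\<lambda>N. d (y N (h N s)) (x s)) \<longlonglongrightarrow> 0"
      proof (rule tendsto_sandwich[OF _ _ tendsto_const l])
        show "\<forall>\<^sub>F N in sequentially. 0 \<le> d (y N (h N s)) (x s)"
          using d_nonneg yP xP s t by auto
        show "\<forall>\<^sub>F N in sequentially. d (y N (h N s)) (x s) \<le> D (min t (\<tau> N (h N s))) - D s"
        proof (intro always_eventually allI)
          have "s \<in> {0..T}" using s t by auto
          then show "d (y N (h N s)) (x s) \<le> D (min t (\<tau> N (h N s))) - D s" for N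
            unfolding y_def by (intro D(2) r)
        qed
      qed
    qed
    have mi: "integrable lebesgue (\<lambda>s. indicat_real {0..T} s *\<^sub>R m s)" using m_int by (simp add: set_integrable_def)
    have ae: "AE s in lebesgue. (\<lambda>N. indicat_real {0..t} s *\<^sub>R L' s (y N (h N s))) \<longlonglongrightarrow> indicat_real {0..t} s *\<^sub>R L' s (x s)"
      using aec
    proof eventually_elim
      case (elim s)
      then show ?case using conv[of s] by (cases "s \<in> {0..t}") auto
    qed
    have bd: "AE s in lebesgue. norm (indicat_real {0..t} s *\<^sub>R L' s (y N (h N s))) \<le> indicat_real {0..T} s *\<^sub>R m s" for N
      using L'_bound[OF _ yP] order_trans[OF abs_ge_zero L'_bound[OF _ x0]] t by (auto simp: indicator_def)
    have m1: "(\<lambda>s. indicat_real {0..t} s *\<^sub>R L' s (y N (h N s))) \<in> borel_measurable lebesgue" for N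
      using int[of N] by (auto simp: set_integrable_def)
    obtain g where g: "g \<in> borel_measurable lebesgue" "AE s in lebesgue. indicat_real {0..t} s *\<^sub>R L' s (x s) = g s"
    proof
      show "(\<lambda>s. lim (\<lambda>N. indicat_real {0..t} s *\<^sub>R L' s (y N (h N s)))) \<in> borel_measurable lebesgue"
        using m1 by (rule borel_measurable_lim_metric)
      show "AE s in lebesgue. indicat_real {0..t} s *\<^sub>R L' s (x s) = lim (\<lambda>N. indicat_real {0..t} s *\<^sub>R L' s (y N (h N s)))"
        using ae by eventually_elim (simp add: limI)
    qed
    \<comment> \<open>The limit curve has no measurability of its own; its power is measurable as an
      almost everywhere limit.\<close>
    have m2: "(\<lambda>s. indicat_real {0..t} s *\<^sub>R L' s (x s)) \<in> borel_measurable lebesgue"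
      by (rule lebesgue_measurable_AE_cong[OF g(1)]) (use g(2) in auto)
    show "(\<lambda>N. integral\<^sup>L lebesgue (\<lambda>s. indicat_real {0..t} s *\<^sub>R L' s (y N (h N s))))
      \<longlonglongrightarrow> integral\<^sup>L lebesgue (\<lambda>s. indicat_real {0..t} s *\<^sub>R L' s (x s))"
      by (rule integral_dominated_convergence[OF m2 m1 mi ae bd])
    show "integrable lebesgue (\<lambda>s. indicat_real {0..t} s *\<^sub>R L' s (x s))"
      by (rule integrable_dominated_convergence[OF m2 m1 mi ae bd])
  qed
  then have "(\<lambda>N. F (x t) - L t (x t) + V + (LINT s:{0..t}|lebesgue. L' s (y N (h N s))))
    \<longlonglongrightarrow> F (x t) - L t (x t) + V + (LINT s:{0..t}|lebesgue. L' s (x s))"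
    unfolding set_lebesgue_integral_def by (intro tendsto_add tendsto_const)
  then show ?thesis by (rule tendsto_lowerbound) (use step in auto)
qed

end

section \<open>Passage to the limit in the scheme\<close>

context energetic_system
begin

text \<open>A cluster point is taken of the pairs of state and spent dissipation. Its second
  component \<open>D\<close> is monotone, so one subsequence can be made to converge on a countable
  set of times, and everywhere else continuity of \<open>D\<close> squeezes the states, in the
  pseudometric. The upper inequality passes to this subsequence and the lower one is that of stable
  curves, so the supremum of the partition sums is determined exactly.\<close>

theorem energetic_solution_exists:
  obtains x where "\<And>t. x t \<in> P" "d (x 0) x0 = 0" "x 0 = x0"
    "\<And>t y. t \<in> {0..T} \<Longrightarrow> y \<in> P \<Longrightarrow> F (x t) - L t (x t) \<le> F y + d y (x t) - L t y"
    "set_integrable lebesgue {0..T} (\<lambda>s. L' s (x s))"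
    "\<And>t. t \<in> {0..T} \<Longrightarrow> Sup (ereal ` path_sums x t)
       = ereal (F x0 - L 0 x0 - F (x t) + L t (x t) - (LINT s:{0..t}|lebesgue. L' s (x s)))"
proof -
  obtain C where C: "\<And>k t. spent k t \<in> {0..C}" using spent_bounded by blast
  have cK: "compact (P \<times> {0..C})" by (intro compact_Times P compact_Icc)
  have "(interp k t, spent k t) \<in> P \<times> {0..C}" for k t using C interp_in by simp
  from product_cluster_point[of _ "\<lambda>k t. (interp k t, spent k t)", OF cK this]
  obtain X where X: "\<And>t. X t \<in> P \<times> {0..C}"
    and fr: "\<And>A e. finite A \<Longrightarrow> e > 0 \<Longrightarrow>
      \<exists>\<^sub>F k in sequentially. \<forall>t\<in>A. dist (interp k t, spent k t) (X t) < e"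
    by blast
  define x D where "x t = fst (X t)" and "D t = snd (X t)" for t
  have xP: "x t \<in> P" for t using X[of t] by (auto simp: x_def mem_Times_iff)
  have subseq: "\<exists>r :: nat \<Rightarrow> nat. strict_mono r \<and>
      (\<forall>t\<in>A. (\<lambda>j. interp (r j) t) \<longlonglongrightarrow> x t \<and> (\<lambda>j. spent (r j) t) \<longlonglongrightarrow> D t)"
    if A: "countable A" "A \<noteq> {}" for A
  proof -
    \<comment> \<open>A diagonal argument: the \<open>j\<close>-th choice controls the first
      \<open>Suc j\<close> times of an enumeration of \<open>A\<close> with accuracy
      \<open>1 / Suc j\<close>.\<close>
    define c where "c = from_nat_into A"
    have "\<exists>\<^sub>F k in sequentially. \<forall>t\<in>c ` {..j}. dist (interp k t, spent k t) (X t) < 1 / real (Suc j)" for j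
      by (rule fr) auto
    from subseq_of_frequently[of "\<lambda>j k. \<forall>t\<in>c ` {..j}. dist (interp k t, spent k t) (X t) < 1 / real (Suc j)", OF this]
    obtain r :: "nat \<Rightarrow> nat" where r: "strict_mono r"
      "\<And>j. \<forall>t\<in>c ` {..j}. dist (interp (r j) t, spent (r j) t) (X t) < 1 / real (Suc j)"
      by blast
    have cv: "(\<lambda>j. (interp (r j) t, spent (r j) t)) \<longlonglongrightarrow> X t" if tA: "t \<in> A" for t
    proof -
      obtain i where i: "t = c i" using from_nat_into_surj[OF A(1) tA] unfolding c_def by blast
      have "\<forall>\<^sub>F j in sequentially. dist (interp (r j) t, spent (r j) t) (X t) \<le> 1 / real (Suc j)"
        using eventually_ge_at_top[of i] 
      proof eventually_elim
        case (elim j)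
        then have "t \<in> c ` {..j}" using i by blast
        then show ?case using r(2)[of j] by (meson less_imp_le)
      qed
      then have "(\<lambda>j. dist (interp (r j) t, spent (r j) t) (X t)) \<longlonglongrightarrow> 0"
        by (rule tendsto_sandwich[OF always_eventually[OF allI, OF zero_le_dist] _ tendsto_const
              LIMSEQ_Suc[OF lim_const_over_n[of 1]]])
      then show ?thesis by (rule tendsto_dist_iff[THEN iffD2])
    qed
    have "(\<lambda>j. interp (r j) t) \<longlonglongrightarrow> x t" "(\<lambda>j. spent (r j) t) \<longlonglongrightarrow> D t" if "t \<in> A" for t
      using tendsto_fst[OF cv[OF that]] tendsto_snd[OF cv[OF that]] by (simp_all add: x_def D_def)
    then show ?thesis using r(1) by blast
  qed
  have xD: "D s \<le> D t \<and> d (x t) (x s) \<le> D t - D s" if "s \<le> t" for s t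
  proof -
    obtain r :: "nat \<Rightarrow> nat" where r: "strict_mono r" "(\<lambda>j. interp (r j) t) \<longlonglongrightarrow> x t" "(\<lambda>j. spent (r j) t) \<longlonglongrightarrow> D t"
      "(\<lambda>j. interp (r j) s) \<longlonglongrightarrow> x s" "(\<lambda>j. spent (r j) s) \<longlonglongrightarrow> D s"
      using subseq[of "{s,t}"] by auto
    have 1: "D s \<le> D t"
      by (rule LIMSEQ_le[OF r(5,3)]) (use spent_mono[OF that] in auto)
    have lim: "(\<lambda>j. d (interp (r j) t) (x t) + (spent (r j) t - spent (r j) s) + d (interp (r j) s) (x s))
       \<longlonglongrightarrow> 0 + (D t - D s) + 0"
      by (intro tendsto_add tendsto_diff r d_cont interp_in xP)
    have "d (x t) (x s) \<le> d (interp (r j) t) (x t) + (spent (r j) t - spent (r j) s) + d (interp (r j) s) (x s)" for j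
      using d_tri[OF xP interp_in xP, of t s "r j" t] d_tri[OF interp_in interp_in xP, of "r j" t s "r j" s]
        d_sym[OF xP interp_in, of t "r j" t] spent_dist[OF that, of "r j"] by linarith
    then have "d (x t) (x s) \<le> 0 + (D t - D s) + 0" by (intro tendsto_lowerbound[OF lim]) auto
    with 1 show ?thesis by simp
  qed
  have monoD: "mono D" using xD by (auto intro: monoI)
  have dn: "0 \<le> d (interp k t) (x t)" for k t by (intro d_nonneg interp_in xP)
  \<comment> \<open>At the jumps of \<open>D\<close> convergence cannot be inferred from
    neighbouring times and has to be imposed; there are only countably many of them.\<close>
  define C0 where "C0 = \<rat> \<union> {t. \<not> isCont D t}"
  have "countable C0" "C0 \<noteq> {}"
    using mono_ctble_discont[OF monoD] countable_rat by (auto simp: C0_def)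
  from subseq[OF this] obtain r :: "nat \<Rightarrow> nat" where r1: "strict_mono r"
    and r2: "\<forall>t\<in>C0. (\<lambda>j. interp (r j) t) \<longlonglongrightarrow> x t \<and> (\<lambda>j. spent (r j) t) \<longlonglongrightarrow> D t"
    by (elim exE conjE)
  have r: "strict_mono r" "\<And>t. t \<in> C0 \<Longrightarrow> (\<lambda>j. interp (r j) t) \<longlonglongrightarrow> x t"
    "\<And>t. t \<in> C0 \<Longrightarrow> (\<lambda>j. spent (r j) t) \<longlonglongrightarrow> D t"
    using r1 r2 by simp_all
  have conv: "(\<lambda>j. d (interp (r j) t) (x t)) \<longlonglongrightarrow> 0" for t
  proof (cases "t \<in> C0")
    case True
    then show ?thesis by (intro d_cont interp_in xP r)
  next
    case False
    then have cont: "isCont D t" by (auto simp: C0_def)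
    show ?thesis
    proof (rule tendstoI)
      fix e :: real assume e: "e > 0"
      obtain \<delta> where \<delta>: "\<delta> > 0" "\<And>s. \<bar>s - t\<bar> < \<delta> \<Longrightarrow> \<bar>D s - D t\<bar> < e/4"
        using cont[unfolded continuous_at_eps_delta, rule_format, of "e/4"] e by (auto simp: dist_real_def)
      \<comment> \<open>The distance at \<open>t\<close> is estimated through the earlier rational
        time \<open>q\<close>; the later one \<open>q'\<close> bounds the unknown
        \<open>spent (r j) t\<close> by monotonicity. In the limit the total is below
        \<open>3 * e / 4\<close>.\<close>
      obtain q where q: "q \<in> \<rat>" "t - \<delta> < q" "q < t" using Rats_dense_in_real[of "t - \<delta>" t] \<delta>(1) by auto
      obtain q' where q': "q' \<in> \<rat>" "t < q'" "q' < t + \<delta>" using Rats_dense_in_real[of t "t + \<delta>"] \<delta>(1) by auto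
      have D: "\<bar>D q - D t\<bar> < e/4" "\<bar>D q' - D t\<bar> < e/4" using \<delta>(2) q q' by auto
      have qC: "q \<in> C0" "q' \<in> C0" using q q' by (auto simp: C0_def)
      have lim: "(\<lambda>j. (spent (r j) q' - spent (r j) q) + d (interp (r j) q) (x q) + (D t - D q))
         \<longlonglongrightarrow> (D q' - D q) + 0 + (D t - D q)"
        by (intro tendsto_add tendsto_diff tendsto_const r qC d_cont interp_in xP)
      have "\<forall>\<^sub>F j in sequentially. (spent (r j) q' - spent (r j) q) + d (interp (r j) q) (x q) + (D t - D q) < e"
        by (rule order_tendstoD(2)[OF lim]) (use D in linarith)
      then show "\<forall>\<^sub>F j in sequentially. dist (d (interp (r j) t) (x t)) 0 < e"
      proof eventually_elim
        case (elim j)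
        have "d (interp (r j) t) (x t) \<le> d (interp (r j) t) (interp (r j) q) + d (interp (r j) q) (x q) + d (x q) (x t)"
          using d_tri[OF interp_in interp_in xP, of "r j" t t "r j" q] d_tri[OF interp_in xP xP, of "r j" q t q] by linarith
        also have "\<dots> \<le> (spent (r j) q' - spent (r j) q) + d (interp (r j) q) (x q) + (D t - D q)"
          using spent_dist[of q t "r j"] spent_mono[of t q' "r j"] xD[of q t] q q' d_sym[OF xP xP, of q t] by linarith
        finally show ?case using elim dn[of "r j" t] by (simp add: dist_real_def)
      qed
    qed
  qed
  have "(\<lambda>j. interp (r j) 0) \<longlonglongrightarrow> x 0" by (rule r) (simp add: C0_def)
  moreover have "interp k 0 = x0" for k using T by (simp add: interp_def idx_def)
  ultimately have x_0: "x 0 = x0" by (simp add: LIMSEQ_const_iff)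
  \<comment> \<open>The interpolants are almost stable; lower semicontinuity acts on the left-hand
    side only, while the competitor \<open>y\<close> is fixed, so no recovery sequence is
    needed.\<close>
  have stab: "F (x t) - L t (x t) \<le> F y + d y (x t) - L t y" if t: "t \<in> {0..T}" and y: "y \<in> P" for t y
  proof (rule field_le_epsilon)
    fix e :: real assume e: "e > 0"
    have "(\<lambda>j. L t (interp (r j) t)) \<longlonglongrightarrow> L t (x t)" by (rule L_d_cont[OF t interp_in xP conv])
    then have "\<forall>\<^sub>F j in sequentially. L t (interp (r j) t) < L t (x t) + e/4"
      using e by (intro order_tendstoD(2)) auto
    moreover have "\<forall>\<^sub>F j in sequentially. F (x t) - e/4 < F (interp (r j) t)"
      by (rule F_d_lsc[OF _ interp_in xP conv]) (use e in auto)
    moreover have "\<forall>\<^sub>F j in sequentially. d (interp (r j) t) (x t) < e/4"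
      using e by (intro order_tendstoD(2)[OF conv]) auto
    moreover have "(\<lambda>j. LINT s:{node (r j) (idx (r j) t)..t}|lebesgue. m s) \<longlonglongrightarrow> 0"
      using LIMSEQ_subseq_LIMSEQ[OF m_tail[OF t] r(1)] by (simp add: o_def)
    then have "\<forall>\<^sub>F j in sequentially. (LINT s:{node (r j) (idx (r j) t)..t}|lebesgue. m s) < e/8"
      using e by (intro order_tendstoD(2)) auto
    ultimately have "\<forall>\<^sub>F j in sequentially. F (x t) - L t (x t) \<le> F y + d y (x t) - L t y + e"
    proof eventually_elim
      case (elim j)
      then show ?case
        using interp_almost_stable[OF t y, of "r j"] d_tri[OF y xP interp_in, of "r j" t t]
          d_sym[OF xP interp_in, of t "r j" t] by linarith
    qed
    then show "F (x t) - L t (x t) \<le> F y + d y (x t) - L t y + e" by (simp only: eventually_const[OF sequentially_bot])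
  qed
  have mi: "integrable lebesgue (\<lambda>s. indicat_real {0..T} s *\<^sub>R m s)" using m_int by (simp add: set_integrable_def)
  have intm: "(\<lambda>s. indicat_real {0..t} s *\<^sub>R L' s (interp k s)) \<in> borel_measurable lebesgue" if "t \<in> {0..T}" for t k
    using interp_integrable[of "{0..t}" k] that by (auto simp: set_integrable_def)
  have intl: "AE s in lebesgue. (\<lambda>j. indicat_real {0..t} s *\<^sub>R L' s (interp (r j) s)) \<longlonglongrightarrow> indicat_real {0..t} s *\<^sub>R L' s (x s)"
    if "t \<in> {0..T}" for t
  proof (intro AE_I2)
    fix s :: real
    show "(\<lambda>j. indicat_real {0..t} s *\<^sub>R L' s (interp (r j) s)) \<longlonglongrightarrow> indicat_real {0..t} s *\<^sub>R L' s (x s)"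
      using L'_d_cont[OF _ interp_in xP conv, of s] that by (cases "s \<in> {0..t}") auto
  qed
  have intb: "AE s in lebesgue. norm (indicat_real {0..t} s *\<^sub>R L' s (interp k s)) \<le> indicat_real {0..T} s *\<^sub>R m s"
    if "t \<in> {0..T}" for t k
    using L'_bound[OF _ interp_in] order_trans[OF abs_ge_zero L'_bound[OF _ x0]] that by (auto simp: indicator_def)
  have limm: "(\<lambda>s. indicat_real {0..t} s *\<^sub>R L' s (x s)) \<in> borel_measurable lebesgue" if t: "t \<in> {0..T}" for t
  proof (rule lebesgue_measurable_AE_cong)
    show "(\<lambda>s. lim (\<lambda>j. indicat_real {0..t} s *\<^sub>R L' s (interp (r j) s))) \<in> borel_measurable lebesgue"
      using intm[OF t] by (rule borel_measurable_lim_metric)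
    show "AE s in lebesgue. indicat_real {0..t} s *\<^sub>R L' s (x s) = lim (\<lambda>j. indicat_real {0..t} s *\<^sub>R L' s (interp (r j) s))"
      using intl[OF t] by eventually_elim (simp add: limI)
  qed
  have lim: "(\<lambda>j. LINT s:{0..t}|lebesgue. L' s (interp (r j) s)) \<longlonglongrightarrow> (LINT s:{0..t}|lebesgue. L' s (x s))"
    if t: "t \<in> {0..T}" for t unfolding set_lebesgue_integral_def
    by (rule integral_dominated_convergence[OF limm[OF t] intm[OF t] mi intl[OF t] intb[OF t]])
  have "integrable lebesgue (\<lambda>s. indicat_real {0..T} s *\<^sub>R L' s (x s))"
    by (rule integrable_dominated_convergence[OF limm intm mi intl intb]) (use T in auto)
  then have xint: "set_integrable lebesgue {0..T} (\<lambda>s. L' s (x s))" by (simp add: set_integrable_def)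
  define B where "B t = F x0 - L 0 x0 - F (x t) + L t (x t) - (LINT s:{0..t}|lebesgue. L' s (x s))" for t
  have upper: "v \<le> B t" if t: "t \<in> {0..T}" and v: "v \<in> path_sums x t" for t v
  proof -
    obtain M \<tau> where M: "v = (\<Sum>i<M. d (x (\<tau> (Suc i))) (x (\<tau> i)))" "\<tau> 0 = 0" "\<tau> M = t" "\<And>i. i < M \<Longrightarrow> \<tau> i < \<tau> (Suc i)"
      using v unfolding path_sums_def by blast
    have le: "(\<Sum>i<M. d (interp k (\<tau> (Suc i))) (interp k (\<tau> i))) \<le> spent k t" for k
    proof -
      have "(\<Sum>i<M. d (interp k (\<tau> (Suc i))) (interp k (\<tau> i))) \<le> (\<Sum>i<M. spent k (\<tau> (Suc i)) - spent k (\<tau> i))"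
        by (intro sum_mono spent_dist less_imp_le M(4)) auto
      also have "\<dots> = spent k t - spent k 0" using M(2,3) sum_lessThan_telescope[of "\<lambda>i. spent k (\<tau> i)" M] by simp
      also have "\<dots> = spent k t" using T by (simp add: spent_def idx_def)
      finally show ?thesis .
    qed
    have near: "d (x s) (x q) \<le> d (interp k s) (interp k q) + d (interp k s) (x s) + d (interp k q) (x q)" for k s q
      using d_tri[OF xP interp_in xP, of s q k s] d_tri[OF interp_in interp_in xP, of k s q k q]
        d_sym[OF xP interp_in, of s k s] by linarith
    have "v \<le> B t"
    proof (rule field_le_epsilon)
      fix e :: real assume e: "e > 0"
      have "(\<lambda>j. \<Sum>i<M. d (interp (r j) (\<tau> (Suc i))) (x (\<tau> (Suc i))) + d (interp (r j) (\<tau> i)) (x (\<tau> i))) \<longlonglongrightarrow> (\<Sum>i<M. 0 + 0)"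
        by (intro tendsto_sum tendsto_add conv)
      then have "\<forall>\<^sub>F j in sequentially. (\<Sum>i<M. d (interp (r j) (\<tau> (Suc i))) (x (\<tau> (Suc i))) + d (interp (r j) (\<tau> i)) (x (\<tau> i))) < e/4"
        using e by (intro order_tendstoD(2)) auto
      moreover have "(\<lambda>j. L t (interp (r j) t)) \<longlonglongrightarrow> L t (x t)" by (rule L_d_cont[OF t interp_in xP conv])
      then have "\<forall>\<^sub>F j in sequentially. L t (interp (r j) t) < L t (x t) + e/4"
        using e by (intro order_tendstoD(2)) auto
      moreover have "\<forall>\<^sub>F j in sequentially. F (x t) - e/4 < F (interp (r j) t)"
        by (rule F_d_lsc[OF _ interp_in xP conv]) (use e in auto)
      moreover have "\<forall>\<^sub>F j in sequentially. (LINT s:{0..t}|lebesgue. L' s (interp (r j) s)) > (LINT s:{0..t}|lebesgue. L' s (x s)) - e/4"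
        using e by (intro order_tendstoD(1)[OF lim[OF t]]) auto
      ultimately have "\<forall>\<^sub>F j in sequentially. v \<le> B t + e"
      proof eventually_elim
        case (elim j)
        have "v \<le> (\<Sum>i<M. d (interp (r j) (\<tau> (Suc i))) (interp (r j) (\<tau> i))
            + (d (interp (r j) (\<tau> (Suc i))) (x (\<tau> (Suc i))) + d (interp (r j) (\<tau> i)) (x (\<tau> i))))"
          unfolding M(1) by (intro sum_mono) (use near in \<open>simp add: add.assoc\<close>)
        also have "\<dots> \<le> spent (r j) t + e/4" 
          using le[of "r j"] elim(1) by (simp add: sum.distrib)
        finally show ?case using upper_energy[OF t, of "r j"] elim unfolding B_def by linarith
      qed
      then show "v \<le> B t + e" by (simp only: eventually_const[OF sequentially_bot])
    qed
    then show ?thesis .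
  qed
  have sup: "Sup (ereal ` path_sums x t) = ereal (B t)" if t: "t \<in> {0..T}" for t
  proof (rule antisym)
    show "Sup (ereal ` path_sums x t) \<le> ereal (B t)" using upper[OF t] by (auto intro!: SUP_least)
    show "ereal (B t) \<le> Sup (ereal ` path_sums x t)"
    proof (rule dense_ge)
      \<comment> \<open>The lower inequality is stated for a real upper bound of the partition sums,
        hence the detour through bounds \<open>V'\<close> above their supremum.\<close>
      fix V' assume "Sup (ereal ` path_sums x t) < V'"
      then have lt: "\<And>v. v \<in> path_sums x t \<Longrightarrow> ereal v < V'" by (meson SUP_upper le_less_trans)
      show "ereal (B t) \<le> V'"
      proof (cases V')
        case (real V)
        then have "\<And>v. v \<in> path_sums x t \<Longrightarrow> v \<le> V" using lt by force
        from lower_energy[OF xP stab monoD _ t this] xD show ?thesis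
          using real x_0 by (force simp: B_def)
      next
        case MInf
        \<comment> \<open>At least one partition exists, so the supremum exceeds minus
          infinity.\<close>
        obtain v where "v \<in> path_sums x t"
        proof (cases "t = 0")
          case True then show ?thesis using that by (auto simp: path_sums_def intro!: exI[of _ 0] exI[of _ "\<lambda>_. 0"])
        next
          case False
          then show ?thesis using t that[of "\<Sum>i<1. d (x (real (Suc i) * t)) (x (real i * t))"]
            unfolding path_sums_def by (force intro!: exI[of _ 1] exI[of _ "\<lambda>i. real i * t"])
        qed
        then show ?thesis using lt MInf by fastforce
      qed simp
    qed
  qed
  show thesis
    by (rule that[of x]) (use xP x_0 d_refl x0 stab xint sup in \<open>auto simp: B_def\<close>)
qed

end

section \<open>Empirical measures and transport along slip lines\<close>

definition emp :: "(real^2) set \<Rightarrow> nat \<Rightarrow> (nat \<Rightarrow> real^2) \<Rightarrow> (real^2) measure" where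
  "emp \<Omega> n z = distr (uniform_count_measure {..<n}) (restrict_space borel \<Omega>) z"

text \<open>Couplings of two empirical measures written in labels: \<open>1 / n\<close> times a
  doubly stochastic matrix that joins only points of equal height.\<close>

definition plans :: "nat \<Rightarrow> (nat \<Rightarrow> real^2) \<Rightarrow> (nat \<Rightarrow> real^2) \<Rightarrow> (nat \<Rightarrow> nat \<Rightarrow> real) set" where
  "plans n z w = {a. (\<forall>i<n. \<forall>j<n. 0 \<le> a i j \<and> (a i j \<noteq> 0 \<longrightarrow> z i $ 2 = w j $ 2)) \<and>
     (\<forall>i<n. (\<Sum>j<n. a i j) = 1 / real n) \<and> (\<forall>j<n. (\<Sum>i<n. a i j) = 1 / real n)}"

definition plan_cost :: "nat \<Rightarrow> (nat \<Rightarrow> real^2) \<Rightarrow> (nat \<Rightarrow> real^2) \<Rightarrow> (nat \<Rightarrow> nat \<Rightarrow> real) \<Rightarrow> real" where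
  "plan_cost n z w a = (\<Sum>i<n. \<Sum>j<n. a i j * norm (z i - w j))"

definition slip_dist :: "nat \<Rightarrow> (nat \<Rightarrow> real^2) \<Rightarrow> (nat \<Rightarrow> real^2) \<Rightarrow> real" where
  "slip_dist n z w = (INF a\<in>plans n z w. plan_cost n z w a)"

lemma plan_cost_nonneg: "a \<in> plans n z w \<Longrightarrow> 0 \<le> plan_cost n z w a"
  unfolding plan_cost_def plans_def by (intro sum_nonneg mult_nonneg_nonneg) auto

lemma plan_cost_bdd: "bdd_below (plan_cost n z w ` plans n z w)"
  using plan_cost_nonneg by (intro bdd_belowI2[of _ 0]) auto

lemma slip_dist_le: "a \<in> plans n z w \<Longrightarrow> slip_dist n z w \<le> plan_cost n z w a"
  unfolding slip_dist_def by (rule cINF_lower[OF plan_cost_bdd])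

lemma plan_transpose:
  assumes "a \<in> plans n z w"
  shows "(\<lambda>i j. a j i) \<in> plans n w z" "plan_cost n w z (\<lambda>i j. a j i) = plan_cost n z w a"
proof -
  show "(\<lambda>i j. a j i) \<in> plans n w z" using assms by (auto simp: plans_def)
  show "plan_cost n w z (\<lambda>i j. a j i) = plan_cost n z w a"
    unfolding plan_cost_def by (subst sum.swap) (simp add: norm_minus_commute)
qed

text \<open>Gluing of couplings over the intermediate measure. Each of its labels carries the mass
  \<open>1 / n\<close>, and dividing by this mass produces the factor \<open>n\<close>.\<close>

lemma plan_compose:
  assumes n: "n \<ge> 1" and a: "a \<in> plans n z w" and b: "b \<in> plans n w v"
  defines "c \<equiv> (\<lambda>i k. real n * (\<Sum>j<n. a i j * b j k))"
  shows "c \<in> plans n z v" "plan_cost n z v c \<le> plan_cost n z w a + plan_cost n w v b"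
proof -
  have a0: "0 \<le> a i j" "a i j \<noteq> 0 \<Longrightarrow> z i $ 2 = w j $ 2" if "i < n" "j < n" for i j using a that by (auto simp: plans_def)
  have b0: "0 \<le> b i j" "b i j \<noteq> 0 \<Longrightarrow> w i $ 2 = v j $ 2" if "i < n" "j < n" for i j using b that by (auto simp: plans_def)
  have ar: "(\<Sum>j<n. a i j) = 1 / real n" "(\<Sum>i<n. a i j) = 1 / real n" if "i < n" "j < n" for i j
    using a that by (auto simp: plans_def)
  have br: "(\<Sum>j<n. b i j) = 1 / real n" "(\<Sum>i<n. b i j) = 1 / real n" if "i < n" "j < n" for i j
    using b that by (auto simp: plans_def)
  have bsum: "(\<Sum>k<n. b j k) = 1 / real n" if "j < n" for j using b that by (auto simp: plans_def)
  have asum: "(\<Sum>i<n. a i j) = 1 / real n" if "j < n" for j using a that by (auto simp: plans_def)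
  show "c \<in> plans n z v"
    unfolding plans_def
  proof (intro CollectI conjI allI impI)
    fix i k assume ik: "i < n" "k < n"
    show "0 \<le> c i k" unfolding c_def using a0 b0 ik by (intro mult_nonneg_nonneg sum_nonneg) auto
    assume "c i k \<noteq> 0"
    then have "(\<Sum>j<n. a i j * b j k) \<noteq> 0" by (auto simp: c_def)
    then obtain j where "j < n" "a i j * b j k \<noteq> 0" by (auto elim: sum.not_neutral_contains_not_neutral)
    then show "z i $ 2 = v k $ 2" using a0(2)[of i j] b0(2)[of j k] ik by auto
  next
    fix i assume i: "i < n"
    have "(\<Sum>k<n. c i k) = real n * (\<Sum>j<n. a i j * (\<Sum>k<n. b j k))"
      unfolding c_def sum_distrib_left[symmetric] by (subst sum.swap) (simp add: sum_distrib_left)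
    also have "(\<Sum>j<n. a i j * (\<Sum>k<n. b j k)) = (\<Sum>j<n. a i j * (1 / real n))"
      by (intro sum.cong refl) (simp add: bsum)
    finally show "(\<Sum>k<n. c i k) = 1 / real n"
      using ar(1)[OF i i] n by (simp add: sum_divide_distrib[symmetric])
  next
    fix k assume k: "k < n"
    have "(\<Sum>i<n. c i k) = real n * (\<Sum>j<n. (\<Sum>i<n. a i j) * b j k)"
      unfolding c_def sum_distrib_left[symmetric] by (subst sum.swap) (simp add: sum_distrib_right)
    also have "(\<Sum>j<n. (\<Sum>i<n. a i j) * b j k) = (\<Sum>j<n. (1 / real n) * b j k)"
      by (intro sum.cong refl) (simp add: asum)
    finally show "(\<Sum>i<n. c i k) = 1 / real n"
      using br(2)[OF k k] n by (simp add: sum_divide_distrib[symmetric])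
  qed
  have nn: "real n > 0" using n by simp
  have "plan_cost n z v c = (\<Sum>i<n. \<Sum>k<n. \<Sum>j<n. real n * (a i j * b j k * norm (z i - v k)))"
    unfolding plan_cost_def c_def by (simp add: sum_distrib_left sum_distrib_right mult_ac)
  also have "\<dots> \<le> (\<Sum>i<n. \<Sum>k<n. \<Sum>j<n. real n * (a i j * b j k * (norm (z i - w j) + norm (w j - v k))))"
  proof (intro sum_mono mult_left_mono)
    fix i k j assume "i \<in> {..<n}" "k \<in> {..<n}" "j \<in> {..<n}"
    then show "0 \<le> a i j * b j k" using a0 b0 by simp
    show "norm (z i - v k) \<le> norm (z i - w j) + norm (w j - v k)"
      using norm_triangle_ineq[of "z i - w j" "w j - v k"] by simp
  qed auto
  also have "\<dots> = (\<Sum>i<n. \<Sum>k<n. \<Sum>j<n. real n * (a i j * b j k * norm (z i - w j)))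
     + (\<Sum>i<n. \<Sum>k<n. \<Sum>j<n. real n * (a i j * b j k * norm (w j - v k)))"
    by (simp add: distrib_left sum.distrib)
  also have "(\<Sum>i<n. \<Sum>k<n. \<Sum>j<n. real n * (a i j * b j k * norm (z i - w j))) = plan_cost n z w a"
  proof -
    have "(\<Sum>i<n. \<Sum>k<n. \<Sum>j<n. real n * (a i j * b j k * norm (z i - w j)))
      = (\<Sum>i<n. \<Sum>j<n. real n * (a i j * norm (z i - w j)) * (\<Sum>k<n. b j k))"
      by (rule sum.cong[OF refl], rule trans[OF sum.swap]) (simp add: sum_distrib_left sum_distrib_right mult_ac)
    also have "\<dots> = plan_cost n z w a"
      unfolding plan_cost_def using nn by (intro sum.cong refl) (simp add: bsum)
    finally show ?thesis .
  qed
  also have "(\<Sum>i<n. \<Sum>k<n. \<Sum>j<n. real n * (a i j * b j k * norm (w j - v k))) = plan_cost n w v b"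
  proof -
    have "(\<Sum>i<n. \<Sum>k<n. \<Sum>j<n. real n * (a i j * b j k * norm (w j - v k)))
      = (\<Sum>k<n. \<Sum>j<n. \<Sum>i<n. real n * (a i j * b j k * norm (w j - v k)))"
      by (subst sum.swap, rule sum.cong[OF refl], rule sum.swap)
    also have "\<dots> = (\<Sum>k<n. \<Sum>j<n. real n * (\<Sum>i<n. a i j) * (b j k * norm (w j - v k)))"
      by (simp add: sum_distrib_left sum_distrib_right mult_ac)
    also have "\<dots> = (\<Sum>k<n. \<Sum>j<n. b j k * norm (w j - v k))"
      using nn by (intro sum.cong refl) (simp add: asum)
    also have "\<dots> = plan_cost n w v b" unfolding plan_cost_def by (rule sum.swap)
    finally show ?thesis .
  qed
  finally show "plan_cost n z v c \<le> plan_cost n z w a + plan_cost n w v b" .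
qed

text \<open>Asked label by label, so that the diagonal matrix is a plan and the infimum in
  \<open>slip_dist\<close> runs over a nonempty set.\<close>

definition same_heights :: "nat \<Rightarrow> (nat \<Rightarrow> real^2) \<Rightarrow> (nat \<Rightarrow> real^2) \<Rightarrow> bool" where
  "same_heights n z w \<longleftrightarrow> (\<forall>i<n. z i $ 2 = w i $ 2)"

lemma diagonal_plan:
  assumes "same_heights n z w"
  shows "(\<lambda>i j. if i = j then 1 / real n else 0) \<in> plans n z w"
    "plan_cost n z w (\<lambda>i j. if i = j then 1 / real n else 0) = (\<Sum>i<n. norm (z i - w i)) / real n"
  using assms by (auto simp: plans_def same_heights_def plan_cost_def sum.delta sum.delta' if_distrib[of "\<lambda>x. x * _"] sum_divide_distrib cong: if_cong)

lemma slip_dist_nonneg: "same_heights n z w \<Longrightarrow> 0 \<le> slip_dist n z w"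
  unfolding slip_dist_def by (rule cINF_greatest) (use diagonal_plan(1)[of n z w] plan_cost_nonneg in auto)

lemma slip_dist_upper: "same_heights n z w \<Longrightarrow> slip_dist n z w \<le> (\<Sum>i<n. norm (z i - w i)) / real n"
  using slip_dist_le[OF diagonal_plan(1), of n z w] diagonal_plan(2)[of n z w] by simp

lemma slip_dist_sym: "slip_dist n z w = slip_dist n w z"
proof -
  have "plan_cost n z w ` plans n z w \<subseteq> plan_cost n w z ` plans n w z" for z w :: "nat \<Rightarrow> real^2"
  proof
    fix c assume "c \<in> plan_cost n z w ` plans n z w"
    then obtain a where "a \<in> plans n z w" "c = plan_cost n z w a" by blast
    then show "c \<in> plan_cost n w z ` plans n w z"
      using plan_transpose[of a n z w] by (intro image_eqI[of _ _ "\<lambda>i j. a j i"]) auto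
  qed
  then show ?thesis unfolding slip_dist_def by (metis subset_antisym)
qed

lemma slip_dist_triangle:
  assumes n: "n \<ge> 1" and h: "same_heights n z w" "same_heights n w v"
  shows "slip_dist n z v \<le> slip_dist n z w + slip_dist n w v"
proof -
  have 1: "slip_dist n z v \<le> plan_cost n z w a + plan_cost n w v b" if "a \<in> plans n z w" "b \<in> plans n w v" for a b
    using slip_dist_le[OF plan_compose(1)[OF n that]] plan_compose(2)[OF n that] by linarith
  have "slip_dist n z v - plan_cost n z w a \<le> slip_dist n w v" if "a \<in> plans n z w" for a
    unfolding slip_dist_def[of n w v] using diagonal_plan(1)[OF h(2)] 1[OF that] by (intro cINF_greatest) force+
  then have "slip_dist n z v - slip_dist n w v \<le> slip_dist n z w"
    unfolding slip_dist_def[of n z w] using diagonal_plan(1)[OF h(1)] by (intro cINF_greatest) force+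
  then show ?thesis by linarith
qed

text \<open>The mean distance of the points \<open>z i\<close> to the set of all \<open>w j\<close>
  is a lower bound for the cost of every plan. This shows that it vanishes without producing an
  optimal plan.\<close>

lemma slip_dist_zero:
  assumes n: "n \<ge> 1" and h: "same_heights n z w" and zero: "slip_dist n z w = 0"
  shows "z ` {..<n} \<subseteq> w ` {..<n}"
proof -
  let ?g = "\<lambda>x. infdist x (w ` {..<n})"
  have ne: "w ` {..<n} \<noteq> {}" using n by (auto simp: lessThan_empty_iff)
  have le: "(\<Sum>i<n. ?g (z i)) / real n \<le> plan_cost n z w a" if a: "a \<in> plans n z w" for a
  proof -
    have "(\<Sum>i<n. ?g (z i)) / real n = (\<Sum>i<n. \<Sum>j<n. a i j * ?g (z i))"
      using a by (simp add: plans_def sum_distrib_right[symmetric] sum_divide_distrib)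
    also have "\<dots> \<le> plan_cost n z w a"
      unfolding plan_cost_def
    proof (intro sum_mono mult_left_mono)
      fix i j assume "i \<in> {..<n}" "j \<in> {..<n}"
      then show "0 \<le> a i j" "?g (z i) \<le> norm (z i - w j)" using a
        by (auto simp: plans_def dist_norm[symmetric] intro!: infdist_le)
    qed
    finally show ?thesis .
  qed
  have "(\<Sum>i<n. ?g (z i)) / real n \<le> slip_dist n z w"
    unfolding slip_dist_def using diagonal_plan(1)[OF h] le by (intro cINF_greatest) auto
  then have "(\<Sum>i<n. ?g (z i)) \<le> 0" using zero n by (simp add: divide_le_0_iff)
  then have "(\<Sum>i<n. ?g (z i)) = 0" using sum_nonneg[of "{..<n}" "\<lambda>i. ?g (z i)"] infdist_nonneg by (metis antisym)
  then have "\<forall>i\<in>{..<n}. ?g (z i) = 0" by (subst (asm) sum_nonneg_eq_0_iff) (auto simp: infdist_nonneg)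
  moreover have "closed (w ` {..<n})" by (simp add: finite_imp_closed)
  ultimately show ?thesis using in_closed_iff_infdist_zero[OF _ ne] by auto
qed

declare space_uniform_count_measure [simp] sets_uniform_count_measure [simp]

section \<open>Empirical measures and their couplings\<close>

lemma projections_measurable:
  fixes S :: "'a::second_countable_topology set"
  shows "fst \<in> restrict_space borel (S \<times> S) \<rightarrow>\<^sub>M restrict_space borel S"
    "snd \<in> restrict_space borel (S \<times> S) \<rightarrow>\<^sub>M restrict_space borel S"
  by (intro measurable_restrict_space3 borel_measurable_continuous_onI continuous_intros; auto)+

context
  fixes \<Omega> :: "(real^2) set" and n :: nat
  assumes n: "n \<ge> 1"
begin

abbreviation (input) "B\<Omega> \<equiv> restrict_space borel \<Omega>"

lemma emp_measurable: "(\<And>i. i < n \<Longrightarrow> z i \<in> \<Omega>) \<Longrightarrow> z \<in> uniform_count_measure {..<n} \<rightarrow>\<^sub>M B\<Omega>"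
  by (auto simp: measurable_def space_restrict_space)

lemma emp_sets: "sets (emp \<Omega> n z) = sets B\<Omega>" "space (emp \<Omega> n z) = \<Omega>"
  by (simp_all add: emp_def space_restrict_space)

lemma emp_emeasure:
  assumes "\<And>i. i < n \<Longrightarrow> z i \<in> \<Omega>" "A \<in> sets B\<Omega>"
  shows "emeasure (emp \<Omega> n z) A = ennreal (real (card {i. i < n \<and> z i \<in> A}) / real n)"
proof -
  have eq: "z -` A \<inter> {..<n} = {i. i < n \<and> z i \<in> A}" by auto
  have "{i. i < n \<and> z i \<in> A} \<subseteq> {..<n}" by auto
  then show ?thesis
    unfolding emp_def using emeasure_distr[OF emp_measurable[OF assms(1)] assms(2)] n
    by (simp add: eq emeasure_uniform_count_measure)
qed

lemma emp_prob: "(\<And>i. i < n \<Longrightarrow> z i \<in> \<Omega>) \<Longrightarrow> emp \<Omega> n z \<in> borel_prob \<Omega>"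
proof -
  assume z: "\<And>i. i < n \<Longrightarrow> z i \<in> \<Omega>"
  have "prob_space (uniform_count_measure {..<n})"
    using n by (intro prob_space_uniform_count_measure) (auto simp: lessThan_empty_iff)
  then have "prob_space (emp \<Omega> n z)" unfolding emp_def by (rule prob_space.prob_space_distr[OF _ emp_measurable[OF z]])
  then show ?thesis by (simp add: borel_prob_def emp_sets)
qed

lemma emp_integral:
  assumes z: "\<And>i. i < n \<Longrightarrow> z i \<in> \<Omega>" and f: "continuous_on \<Omega> f"
  shows "(\<integral>x. f x \<partial>emp \<Omega> n z) = (\<Sum>i<n. f (z i)) / real n"
proof -
  have "f \<in> borel_measurable B\<Omega>" by (rule borel_measurable_continuous_on_restrict[OF f])
  then show ?thesis unfolding emp_def
    by (simp add: integral_distr[OF emp_measurable[OF z]] integral_uniform_count_measure)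
qed

lemma emp_atoms:
  assumes z: "\<And>i. i < n \<Longrightarrow> z i \<in> \<Omega>"
  shows "atoms (emp \<Omega> n z) = z ` {..<n}"
proof -
  have "emeasure (emp \<Omega> n z) {x} \<noteq> 0 \<longleftrightarrow> x \<in> z ` {..<n}" if x: "x \<in> \<Omega>" for x
  proof -
    have "{x} \<in> sets B\<Omega>" using x by (auto simp: sets_restrict_space intro!: image_eqI[of _ _ "{x}"])
    then have "emeasure (emp \<Omega> n z) {x} = ennreal (real (card {i. i < n \<and> z i = x}) / real n)"
      using emp_emeasure[where z = z and A = "{x}"] z by simp
    then show ?thesis using n by (auto simp: divide_eq_0_iff)
  qed
  then show ?thesis using z unfolding atoms_def emp_sets by auto
qed

lemma Xn_emp:
  assumes R: "R \<subseteq> \<Omega>"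
  shows "\<mu> \<in> Xn \<Omega> R r n \<longleftrightarrow> (\<exists>z. (\<forall>i<n. z i \<in> R) \<and> (\<forall>i<n. \<forall>j<n. i \<noteq> j \<longrightarrow> r n \<le> norm (z i - z j)) \<and> \<mu> = emp \<Omega> n z)"
proof -
  have ret: "(\<Sum>i<n. emeasure (return B\<Omega> (z i)) A) / of_nat n = emeasure (emp \<Omega> n z) A"
    if z: "\<And>i. i < n \<Longrightarrow> z i \<in> \<Omega>" and A: "A \<in> sets B\<Omega>" for z A
  proof -
    have "(\<Sum>i<n. emeasure (return B\<Omega> (z i)) A) = (\<Sum>i<n. ennreal (indicator A (z i)))"
      using A by (intro sum.cong refl) (simp add: indicator_def)
    also have "\<dots> = ennreal (\<Sum>i<n. indicator A (z i))" by (rule sum_ennreal) simp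
    also have "(\<Sum>i<n. indicator A (z i)) = real (card {i. i < n \<and> z i \<in> A})"
    proof -
      have "{..<n} \<inter> {i. z i \<in> A} = {i. i < n \<and> z i \<in> A}" by auto
      then show ?thesis by (simp add: indicator_def sum.If_cases)
    qed
    finally show ?thesis
      using emp_emeasure[OF z A] n by (simp add: divide_ennreal ennreal_of_nat_eq_real_of_nat)
  qed
  show ?thesis
  proof
    assume "\<mu> \<in> Xn \<Omega> R r n"
    note X = this[unfolded Xn_def mem_Collect_eq]
    have \<mu>: "\<mu> \<in> borel_prob \<Omega>" by (rule conjunct1[OF X])
    obtain z where Z: "(\<forall>i<n. z i \<in> R) \<and> (\<forall>i<n. \<forall>j<n. i \<noteq> j \<longrightarrow> r n \<le> norm (z i - z j)) \<and>
      (\<forall>A\<in>sets \<mu>. emeasure \<mu> A = (\<Sum>i<n. emeasure (return B\<Omega> (z i)) A) / of_nat n)"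
      by (rule exE[OF conjunct2[OF X]])
    have z: "\<forall>i<n. z i \<in> R" "\<forall>i<n. \<forall>j<n. i \<noteq> j \<longrightarrow> r n \<le> norm (z i - z j)"
      by (rule conjunct1[OF Z], rule conjunct1[OF conjunct2[OF Z]])
    have e: "\<And>A. A \<in> sets \<mu> \<Longrightarrow> emeasure \<mu> A = (\<Sum>i<n. emeasure (return B\<Omega> (z i)) A) / of_nat n"
      by (rule bspec[OF conjunct2[OF conjunct2[OF Z]]])
    have z\<Omega>: "\<And>i. i < n \<Longrightarrow> z i \<in> \<Omega>" using z(1) R by blast
    have s: "sets \<mu> = sets B\<Omega>" using \<mu> by (simp add: borel_prob_def)
    have "\<mu> = emp \<Omega> n z"
    proof (rule measure_eqI)
      show "sets \<mu> = sets (emp \<Omega> n z)" by (simp add: s emp_sets)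
      fix A assume A: "A \<in> sets \<mu>"
      show "emeasure \<mu> A = emeasure (emp \<Omega> n z) A" unfolding e[OF A] by (rule ret[OF z\<Omega>]) (use A s in auto)
    qed
    then show "\<exists>z. (\<forall>i<n. z i \<in> R) \<and> (\<forall>i<n. \<forall>j<n. i \<noteq> j \<longrightarrow> r n \<le> norm (z i - z j)) \<and> \<mu> = emp \<Omega> n z" using z by blast
  next
    assume "\<exists>z. (\<forall>i<n. z i \<in> R) \<and> (\<forall>i<n. \<forall>j<n. i \<noteq> j \<longrightarrow> r n \<le> norm (z i - z j)) \<and> \<mu> = emp \<Omega> n z"
    then obtain z where z: "\<forall>i<n. z i \<in> R" "\<forall>i<n. \<forall>j<n. i \<noteq> j \<longrightarrow> r n \<le> norm (z i - z j)" "\<mu> = emp \<Omega> n z" by blast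
    have z\<Omega>: "\<And>i. i < n \<Longrightarrow> z i \<in> \<Omega>" using z(1) R by blast
    have "\<forall>A\<in>sets \<mu>. emeasure \<mu> A = (\<Sum>i<n. emeasure (return B\<Omega> (z i)) A) / of_nat n"
      using ret[OF z\<Omega>] by (simp add: z(3) emp_sets)
    then show "\<mu> \<in> Xn \<Omega> R r n"
      unfolding Xn_def using emp_prob[OF z\<Omega>] z by auto
  qed
qed

text \<open>The plan is a measure on pairs of labels; its image under the pair of labellings is the
  coupling. Repeated points do no harm in this direction.\<close>

lemma plan_coupling:
  assumes z: "\<And>i. i < n \<Longrightarrow> z i \<in> \<Omega>" and w: "\<And>i. i < n \<Longrightarrow> w i \<in> \<Omega>" and a: "a \<in> plans n z w"
  obtains \<sigma> where "\<sigma> \<in> couplings \<Omega> (emp \<Omega> n z) (emp \<Omega> n w)"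
    "(\<integral>\<^sup>+p. ennreal (norm (fst p - snd p)) \<partial>\<sigma>) = ennreal (plan_cost n z w a)"
proof -
  have a0: "0 \<le> a i j" "a i j \<noteq> 0 \<Longrightarrow> z i $ 2 = w j $ 2" if "i < n" "j < n" for i j using a that by (auto simp: plans_def)
  have ar: "(\<Sum>j<n. a i j) = 1 / real n" "(\<Sum>i<n. a i j) = 1 / real n" if "i < n" "j < n" for i j
    using a that by (auto simp: plans_def)
  define N where "N = {..<n} \<times> {..<n}"
  have fN: "finite N" by (simp add: N_def)
  define M where "M = point_measure N (\<lambda>(i, j). ennreal (a i j))"
  define g where "g = (\<lambda>(i, j). (z i, w j))"
  define BB :: "((real^2) \<times> (real^2)) measure" where "BB = restrict_space borel (\<Omega> \<times> \<Omega>)"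
  define \<sigma> where "\<sigma> = distr M BB g"
  have gM: "g \<in> M \<rightarrow>\<^sub>M BB" using z w by (auto simp: measurable_def M_def N_def g_def BB_def space_restrict_space space_point_measure sets_point_measure)
  have f1: "fst \<in> BB \<rightarrow>\<^sub>M B\<Omega>" "snd \<in> BB \<rightarrow>\<^sub>M B\<Omega>"
    unfolding BB_def by (rule projections_measurable)+
  have eM: "emeasure M X = ennreal (\<Sum>(i, j)\<in>X. a i j)" if "X \<subseteq> N" for X
  proof -
    have "emeasure M X = (\<Sum>x\<in>X. (\<lambda>(i, j). ennreal (a i j)) x)"
      unfolding M_def by (rule emeasure_point_measure_finite[OF fN that])
    also have "\<dots> = (\<Sum>x\<in>X. ennreal ((\<lambda>(i, j). a i j) x))" by (intro sum.cong refl) auto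
    also have "\<dots> = ennreal (\<Sum>x\<in>X. (\<lambda>(i, j). a i j) x)"
      using that a0 by (intro sum_ennreal) (auto simp: N_def)
    finally show ?thesis .
  qed
  have marg: "distr M B\<Omega> (\<lambda>p. z (fst p)) = emp \<Omega> n z" "distr M B\<Omega> (\<lambda>p. w (snd p)) = emp \<Omega> n w"
  proof -
    have m1: "(\<lambda>p. z (fst p)) \<in> M \<rightarrow>\<^sub>M B\<Omega>" "(\<lambda>p. w (snd p)) \<in> M \<rightarrow>\<^sub>M B\<Omega>"
      using z w by (auto simp: measurable_def M_def N_def space_restrict_space space_point_measure sets_point_measure)
    show "distr M B\<Omega> (\<lambda>p. z (fst p)) = emp \<Omega> n z"
    proof (rule measure_eqI)
      fix A assume "A \<in> sets (distr M B\<Omega> (\<lambda>p. z (fst p)))"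
      then have A: "A \<in> sets B\<Omega>" by simp
      have "(\<lambda>p. z (fst p)) -` A \<inter> space M = {i. i < n \<and> z i \<in> A} \<times> {..<n}" by (auto simp: M_def N_def space_point_measure)
      then have "emeasure (distr M B\<Omega> (\<lambda>p. z (fst p))) A = ennreal (\<Sum>i\<in>{i. i < n \<and> z i \<in> A}. \<Sum>j<n. a i j)"
        using emeasure_distr[OF m1(1) A] eM[of "{i. i < n \<and> z i \<in> A} \<times> {..<n}"] by (simp add: N_def sum.cartesian_product subset_iff)
      also have "(\<Sum>i\<in>{i. i < n \<and> z i \<in> A}. \<Sum>j<n. a i j) = (\<Sum>i\<in>{i. i < n \<and> z i \<in> A}. 1 / real n)"
        by (intro sum.cong refl) (use ar(1) in auto)
      finally show "emeasure (distr M B\<Omega> (\<lambda>p. z (fst p))) A = emeasure (emp \<Omega> n z) A" using emp_emeasure[OF z A] by simp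
    qed (simp add: emp_sets)
    show "distr M B\<Omega> (\<lambda>p. w (snd p)) = emp \<Omega> n w"
    proof (rule measure_eqI)
      fix A assume "A \<in> sets (distr M B\<Omega> (\<lambda>p. w (snd p)))"
      then have A: "A \<in> sets B\<Omega>" by simp
      have "(\<lambda>p. w (snd p)) -` A \<inter> space M = {..<n} \<times> {j. j < n \<and> w j \<in> A}" by (auto simp: M_def N_def space_point_measure)
      then have "emeasure (distr M B\<Omega> (\<lambda>p. w (snd p))) A = ennreal (\<Sum>i<n. \<Sum>j\<in>{j. j < n \<and> w j \<in> A}. a i j)"
        using emeasure_distr[OF m1(2) A] eM[of "{..<n} \<times> {j. j < n \<and> w j \<in> A}"] by (simp add: N_def sum.cartesian_product subset_iff)
      also have "(\<Sum>i<n. \<Sum>j\<in>{j. j < n \<and> w j \<in> A}. a i j) = (\<Sum>j\<in>{j. j < n \<and> w j \<in> A}. 1 / real n)"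
        by (subst sum.swap, intro sum.cong refl) (use ar(2) in auto)
      finally show "emeasure (distr M B\<Omega> (\<lambda>p. w (snd p))) A = emeasure (emp \<Omega> n w) A" using emp_emeasure[OF w A] by simp
    qed (simp add: emp_sets)
  qed
  have probM: "prob_space M"
  proof
    have "emeasure M N = ennreal (\<Sum>i<n. \<Sum>j<n. a i j)" using eM[of N] by (simp add: N_def sum.cartesian_product)
    also have "(\<Sum>i<n. \<Sum>j<n. a i j) = (\<Sum>i<n. 1 / real n)" by (intro sum.cong refl) (use ar(1) in auto)
    finally show "emeasure M (space M) = 1" using n by (simp add: M_def space_point_measure)
  qed
  have s\<sigma>: "sets \<sigma> = sets BB" by (simp add: \<sigma>_def)
  have "\<sigma> \<in> couplings \<Omega> (emp \<Omega> n z) (emp \<Omega> n w)"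
    unfolding couplings_def borel_prob_def
  proof (intro CollectI conjI)
    show "prob_space \<sigma>" unfolding \<sigma>_def by (rule prob_space.prob_space_distr[OF probM gM])
    show "sets \<sigma> = sets (restrict_space borel (\<Omega> \<times> \<Omega>))" using s\<sigma> by (simp add: BB_def)
    show "distr \<sigma> B\<Omega> fst = emp \<Omega> n z"
      unfolding \<sigma>_def distr_distr[OF f1(1) gM] marg(1)[symmetric] by (simp add: o_def g_def case_prod_beta')
    show "distr \<sigma> B\<Omega> snd = emp \<Omega> n w"
      unfolding \<sigma>_def distr_distr[OF f1(2) gM] marg(2)[symmetric] by (simp add: o_def g_def case_prod_beta')
    have "{p \<in> space BB. fst p $ 2 = snd p $ 2} \<in> sets BB"
    proof -
      have "closed {p :: (real^2) \<times> (real^2). fst p $ 2 = snd p $ 2}" by (intro closed_Collect_eq continuous_intros)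
      then show ?thesis unfolding BB_def by (auto simp: sets_restrict_space space_restrict_space intro!: image_eqI[of _ _ "{p. fst p $ 2 = snd p $ 2}"])
    qed
    moreover have "AE x in M. fst (g x) $ 2 = snd (g x) $ 2"
      unfolding M_def g_def N_def using a0 by (auto simp: AE_point_measure)
    ultimately show "AE p in \<sigma>. fst p $ 2 = snd p $ 2"
      unfolding \<sigma>_def by (subst AE_distr_iff[OF gM])
  qed
  moreover have "(\<integral>\<^sup>+p. ennreal (norm (fst p - snd p)) \<partial>\<sigma>) = ennreal (plan_cost n z w a)"
  proof -
    have m: "(\<lambda>p. ennreal (norm (fst p - snd p))) \<in> borel_measurable BB"
      unfolding BB_def
      by (intro measurable_restrict_space1 measurable_compose[OF _ measurable_ennreal] borel_measurable_continuous_onI continuous_intros)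
    have "(\<integral>\<^sup>+p. ennreal (norm (fst p - snd p)) \<partial>\<sigma>) = (\<integral>\<^sup>+x. ennreal (norm (fst (g x) - snd (g x))) \<partial>M)"
      unfolding \<sigma>_def by (rule nn_integral_distr[OF gM]) (simp add: m)
    also have "\<dots> = (\<Sum>x\<in>N. (case x of (i, j) \<Rightarrow> ennreal (a i j)) * ennreal (norm (fst (g x) - snd (g x))))"
      unfolding M_def by (rule nn_integral_point_measure_finite[OF fN])
    also have "\<dots> = (\<Sum>x\<in>N. ennreal (case x of (i, j) \<Rightarrow> a i j * norm (z i - w j)))"
      using a0 by (intro sum.cong refl) (auto simp: g_def N_def ennreal_mult[symmetric])
    also have "\<dots> = ennreal (\<Sum>x\<in>N. case x of (i, j) \<Rightarrow> a i j * norm (z i - w j))"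
      using a0 by (intro sum_ennreal) (auto simp: N_def)
    finally show ?thesis by (simp add: plan_cost_def N_def sum.cartesian_product)
  qed
  ultimately show thesis by (rule that)
qed

text \<open>A coupling of two measures with finitely many atoms is concentrated on pairs of atoms.
  Injectivity makes pairs of labels and pairs of atoms correspond, so the masses of single pairs
  have the right row and column sums.\<close>

lemma coupling_plan:
  assumes z: "\<And>i. i < n \<Longrightarrow> z i \<in> \<Omega>" and w: "\<And>i. i < n \<Longrightarrow> w i \<in> \<Omega>"
    and inj: "inj_on z {..<n}" "inj_on w {..<n}" and \<sigma>: "\<sigma> \<in> couplings \<Omega> (emp \<Omega> n z) (emp \<Omega> n w)"
  obtains a where "a \<in> plans n z w" "(\<integral>\<^sup>+p. ennreal (norm (fst p - snd p)) \<partial>\<sigma>) = ennreal (plan_cost n z w a)"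
proof -
  define BB :: "((real^2) \<times> (real^2)) measure" where "BB = restrict_space borel (\<Omega> \<times> \<Omega>)"
  have s: "prob_space \<sigma>" "sets \<sigma> = sets BB" and d: "distr \<sigma> B\<Omega> fst = emp \<Omega> n z" "distr \<sigma> B\<Omega> snd = emp \<Omega> n w"
    and h: "AE p in \<sigma>. fst p $ 2 = snd p $ 2"
    using \<sigma> by (auto simp: couplings_def borel_prob_def BB_def)
  interpret prob_space \<sigma> by (rule s(1))
  have sp: "space \<sigma> = \<Omega> \<times> \<Omega>" using sets_eq_imp_space_eq[OF s(2)] by (simp add: BB_def space_restrict_space)
  have f1: "fst \<in> \<sigma> \<rightarrow>\<^sub>M B\<Omega>" "snd \<in> \<sigma> \<rightarrow>\<^sub>M B\<Omega>"
    unfolding measurable_cong_sets[OF s(2) refl] BB_def by (rule projections_measurable)+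
  have sing: "{(x, y)} \<in> sets \<sigma>" if "x \<in> \<Omega>" "y \<in> \<Omega>" for x y
    unfolding s(2) BB_def using that by (auto simp: sets_restrict_space intro!: image_eqI[of _ _ "{(x, y)}"])
  have sing1: "X \<in> sets B\<Omega>" if "finite X" "X \<subseteq> \<Omega>" for X
    using that by (auto simp: sets_restrict_space finite_imp_closed intro!: image_eqI[of _ _ X])
  define P where "P = z ` {..<n}"
  define Q where "Q = w ` {..<n}"
  have PQ: "finite P" "P \<subseteq> \<Omega>" "finite Q" "Q \<subseteq> \<Omega>" using z w by (auto simp: P_def Q_def)
  have full: "AE p in \<sigma>. f p \<in> v ` {..<n}" if f: "f \<in> \<sigma> \<rightarrow>\<^sub>M B\<Omega>" "distr \<sigma> B\<Omega> f = emp \<Omega> n v" and v: "\<And>i. i < n \<Longrightarrow> v i \<in> \<Omega>"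
    for f :: "(real^2) \<times> (real^2) \<Rightarrow> real^2" and v
  proof -
    have V: "v ` {..<n} \<in> sets B\<Omega>" using v by (intro sing1) auto
    have "prob (f -` (v ` {..<n}) \<inter> space \<sigma>) = 1"
    proof -
      have "emeasure \<sigma> (f -` (v ` {..<n}) \<inter> space \<sigma>) = emeasure (emp \<Omega> n v) (v ` {..<n})"
        using emeasure_distr[OF f(1) V] f(2) by simp
      also have "{i. i < n \<and> v i \<in> v ` {..<n}} = {..<n}" by auto
      then have "emeasure (emp \<Omega> n v) (v ` {..<n}) = 1" using emp_emeasure[OF v V] n by simp
      finally show ?thesis by (simp add: emeasure_eq_measure)
    qed
    then have "AE p in \<sigma>. p \<in> f -` (v ` {..<n}) \<inter> space \<sigma>" by (rule AE_prob_1)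
    then show ?thesis by eventually_elim auto
  qed
  have aeP: "AE p in \<sigma>. fst p \<in> P" unfolding P_def by (rule full[OF f1(1) d(1) z])
  have aeQ: "AE p in \<sigma>. snd p \<in> Q" unfolding Q_def by (rule full[OF f1(2) d(2) w])
  define a where "a i j = prob {(z i, w j)}" for i j
  have row: "(\<Sum>j<n. a i j) = 1 / real n" if i: "i < n" for i
  proof -
    have Z: "{z i} \<in> sets B\<Omega>" using z[OF i] by (intro sing1) auto
    have "(\<Sum>j<n. a i j) = prob (\<Union>j\<in>{..<n}. {(z i, w j)})"
      unfolding a_def using z w i inj(2)
      by (intro finite_measure_finite_Union[symmetric]) (auto simp: disjoint_family_on_def inj_on_def sing)
    also have "\<dots> = prob (fst -` {z i} \<inter> space \<sigma>)"
    proof (rule finite_measure_eq_AE)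
      show "AE x in \<sigma>. (x \<in> (\<Union>j\<in>{..<n}. {(z i, w j)})) = (x \<in> fst -` {z i} \<inter> space \<sigma>)"
        using aeQ AE_space by eventually_elim (auto simp: Q_def)
      show "(\<Union>j\<in>{..<n}. {(z i, w j)}) \<in> sets \<sigma>" using z w i sing by (intro sets.finite_UN) auto
      show "fst -` {z i} \<inter> space \<sigma> \<in> sets \<sigma>" by (rule measurable_sets[OF f1(1) Z])
    qed
    also have "ennreal \<dots> = emeasure (emp \<Omega> n z) {z i}"
      using emeasure_distr[OF f1(1) Z] d(1) by (simp add: emeasure_eq_measure)
    then have "prob (fst -` {z i} \<inter> space \<sigma>) = 1 / real n"
    proof -
      have "{k. k < n \<and> z k = z i} = {i}" using inj(1) i by (auto simp: inj_on_def)
      then have "emeasure (emp \<Omega> n z) {z i} = ennreal (1 / real n)" using emp_emeasure[OF z Z] by simp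
      then show ?thesis using \<open>ennreal (prob (fst -` {z i} \<inter> space \<sigma>)) = emeasure (emp \<Omega> n z) {z i}\<close> by simp
    qed
    finally show ?thesis .
  qed
  have col: "(\<Sum>i<n. a i j) = 1 / real n" if j: "j < n" for j
  proof -
    have Z: "{w j} \<in> sets B\<Omega>" using w[OF j] by (intro sing1) auto
    have "(\<Sum>i<n. a i j) = prob (\<Union>i\<in>{..<n}. {(z i, w j)})"
      unfolding a_def using z w j inj(1)
      by (intro finite_measure_finite_Union[symmetric]) (auto simp: disjoint_family_on_def inj_on_def sing)
    also have "\<dots> = prob (snd -` {w j} \<inter> space \<sigma>)"
    proof (rule finite_measure_eq_AE)
      show "AE x in \<sigma>. (x \<in> (\<Union>i\<in>{..<n}. {(z i, w j)})) = (x \<in> snd -` {w j} \<inter> space \<sigma>)"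
        using aeP AE_space by eventually_elim (auto simp: P_def)
      show "(\<Union>i\<in>{..<n}. {(z i, w j)}) \<in> sets \<sigma>" using z w j sing by (intro sets.finite_UN) auto
      show "snd -` {w j} \<inter> space \<sigma> \<in> sets \<sigma>" by (rule measurable_sets[OF f1(2) Z])
    qed
    also have "ennreal \<dots> = emeasure (emp \<Omega> n w) {w j}"
      using emeasure_distr[OF f1(2) Z] d(2) by (simp add: emeasure_eq_measure)
    then have "prob (snd -` {w j} \<inter> space \<sigma>) = 1 / real n"
    proof -
      have "{k. k < n \<and> w k = w j} = {j}" using inj(2) j by (auto simp: inj_on_def)
      then have "emeasure (emp \<Omega> n w) {w j} = ennreal (1 / real n)" using emp_emeasure[OF w Z] by simp
      then show ?thesis using \<open>ennreal (prob (snd -` {w j} \<inter> space \<sigma>)) = emeasure (emp \<Omega> n w) {w j}\<close> by simp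
    qed
    finally show ?thesis .
  qed
  have "a \<in> plans n z w"
    unfolding plans_def
  proof (intro CollectI conjI allI impI row col)
    fix i j assume ij: "i < n" "j < n"
    show "0 \<le> a i j" by (simp add: a_def)
    assume nz: "a i j \<noteq> 0"
    show "z i $ 2 = w j $ 2"
    proof (rule ccontr)
      assume ne: "z i $ 2 \<noteq> w j $ 2"
      have "AE p in \<sigma>. p \<notin> {(z i, w j)}" using h by eventually_elim (use ne in auto)
      then have "{(z i, w j)} \<in> null_sets \<sigma>" using sing[OF z[OF ij(1)] w[OF ij(2)]] by (simp add: AE_iff_null_sets)
      then show False using nz by (simp add: a_def null_sets_def emeasure_eq_measure)
    qed
  qed
  moreover have "(\<integral>\<^sup>+p. ennreal (norm (fst p - snd p)) \<partial>\<sigma>) = ennreal (plan_cost n z w a)"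
  proof -
    have sg: "(\<lambda>p. ennreal (norm (z i - w j)) * indicator {(z i, w j)} p) \<in> borel_measurable \<sigma>"
      if "i < n" "j < n" for i j
      using sing[OF z w] that by measurable
    have "(\<integral>\<^sup>+p. ennreal (norm (fst p - snd p)) \<partial>\<sigma>)
      = (\<integral>\<^sup>+p. (\<Sum>i<n. \<Sum>j<n. ennreal (norm (z i - w j)) * indicator {(z i, w j)} p) \<partial>\<sigma>)"
    proof (rule nn_integral_cong_AE)
      show "AE p in \<sigma>. ennreal (norm (fst p - snd p)) = (\<Sum>i<n. \<Sum>j<n. ennreal (norm (z i - w j)) * indicator {(z i, w j)} p)"
        using aeP aeQ
      proof eventually_elim
        case (elim p)
        then obtain i j where ij: "i < n" "j < n" "p = (z i, w j)" by (cases p) (auto simp: P_def Q_def)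
        have "(\<Sum>k<n. \<Sum>l<n. ennreal (norm (z k - w l)) * indicator {(z k, w l)} p)
          = (\<Sum>k<n. \<Sum>l<n. if k = i \<and> l = j then ennreal (norm (z i - w j)) else 0)"
          using inj ij by (intro sum.cong refl) (auto simp: indicator_def inj_on_def)
        also have "\<dots> = (\<Sum>k<n. if k = i then ennreal (norm (z i - w j)) else 0)"
          using ij by (intro sum.cong refl) (auto simp: sum.delta)
        also have "\<dots> = ennreal (norm (z i - w j))" using ij by simp
        finally show ?case using ij by simp
      qed
    qed
    also have "\<dots> = (\<Sum>i<n. \<integral>\<^sup>+p. (\<Sum>j<n. ennreal (norm (z i - w j)) * indicator {(z i, w j)} p) \<partial>\<sigma>)"
      by (rule nn_integral_sum) (intro borel_measurable_sum sg; simp)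
    also have "\<dots> = (\<Sum>i<n. \<Sum>j<n. \<integral>\<^sup>+p. ennreal (norm (z i - w j)) * indicator {(z i, w j)} p \<partial>\<sigma>)"
      by (intro sum.cong refl nn_integral_sum sg) simp_all
    also have "\<dots> = (\<Sum>i<n. \<Sum>j<n. ennreal (a i j * norm (z i - w j)))"
      using z w sing by (intro sum.cong refl) (auto simp: nn_integral_cmult_indicator emeasure_eq_measure a_def ennreal_mult[symmetric] mult.commute)
    also have "\<dots> = (\<Sum>i<n. ennreal (\<Sum>j<n. a i j * norm (z i - w j)))"
      by (intro sum.cong refl sum_ennreal) (simp add: a_def)
    also have "\<dots> = ennreal (\<Sum>i<n. \<Sum>j<n. a i j * norm (z i - w j))"
      by (intro sum_ennreal sum_nonneg) (simp add: a_def)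
    finally show ?thesis by (simp add: plan_cost_def)
  qed
  ultimately show thesis by (rule that)
qed

lemma emp_heights:
  assumes z: "\<And>i. i < n \<Longrightarrow> z i \<in> \<Omega>"
  shows "distr (emp \<Omega> n z) borel (\<lambda>x. x $ 2) = distr (uniform_count_measure {..<n}) borel (\<lambda>i. z i $ 2)"
proof -
  have "(\<lambda>x::real^2. x $ 2) \<in> B\<Omega> \<rightarrow>\<^sub>M borel"
    by (intro measurable_restrict_space1 borel_measurable_continuous_onI continuous_intros)
  from distr_distr[OF this emp_measurable[OF z]] show ?thesis by (simp add: emp_def o_def)
qed

lemma diss_dist_emp:
  assumes z: "\<And>i. i < n \<Longrightarrow> z i \<in> \<Omega>" and w: "\<And>i. i < n \<Longrightarrow> w i \<in> \<Omega>"
    and inj: "inj_on z {..<n}" "inj_on w {..<n}" and h: "same_heights n z w"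
  shows "diss_dist \<Omega> (emp \<Omega> n z) (emp \<Omega> n w) = ereal (slip_dist n z w)"
proof -
  have "distr (uniform_count_measure {..<n}) borel (\<lambda>i. z i $ 2) = distr (uniform_count_measure {..<n}) borel (\<lambda>i. w i $ 2)"
    using h by (intro distr_cong) (auto simp: same_heights_def)
  then have eq: "diss_dist \<Omega> (emp \<Omega> n z) (emp \<Omega> n w) =
     (INF \<sigma>\<in>couplings \<Omega> (emp \<Omega> n z) (emp \<Omega> n w). enn2ereal (\<integral>\<^sup>+p. ennreal (norm (fst p - snd p)) \<partial>\<sigma>))"
    by (simp add: diss_dist_def emp_heights z w)
  show ?thesis
  proof (rule antisym)
    have "diss_dist \<Omega> (emp \<Omega> n z) (emp \<Omega> n w) \<le> ereal (plan_cost n z w a)" if a: "a \<in> plans n z w" for a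
    proof -
      obtain \<sigma> where \<sigma>: "\<sigma> \<in> couplings \<Omega> (emp \<Omega> n z) (emp \<Omega> n w)"
        "(\<integral>\<^sup>+p. ennreal (norm (fst p - snd p)) \<partial>\<sigma>) = ennreal (plan_cost n z w a)"
        by (rule plan_coupling[OF z w a])
      have "diss_dist \<Omega> (emp \<Omega> n z) (emp \<Omega> n w) \<le> enn2ereal (\<integral>\<^sup>+p. ennreal (norm (fst p - snd p)) \<partial>\<sigma>)"
        unfolding eq by (rule INF_lower[OF \<sigma>(1)])
      also have "\<dots> = ereal (plan_cost n z w a)" unfolding \<sigma>(2) by (rule enn2ereal_ennreal[OF plan_cost_nonneg[OF a]])
      finally show ?thesis .
    qed
    then have le: "diss_dist \<Omega> (emp \<Omega> n z) (emp \<Omega> n w) \<le> (INF a\<in>plans n z w. ereal (plan_cost n z w a))"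
      by (rule INF_greatest)
    also have "\<dots> = ereal (slip_dist n z w)"
    proof -
      have ne: "plans n z w \<noteq> {}" using diagonal_plan(1)[OF h] by blast
      have "0 \<le> (INF a\<in>plans n z w. ereal (plan_cost n z w a))" by (rule INF_greatest) (simp add: plan_cost_nonneg)
      moreover have "(INF a\<in>plans n z w. ereal (plan_cost n z w a)) \<le> ereal (plan_cost n z w (\<lambda>i j. if i = j then 1 / real n else 0))"
        by (rule INF_lower[OF diagonal_plan(1)[OF h]])
      ultimately have "\<bar>INF a\<in>plans n z w. ereal (plan_cost n z w a)\<bar> \<noteq> \<infinity>" by auto
      then show ?thesis unfolding slip_dist_def by (rule ereal_INF[symmetric])
    qed
    finally show "diss_dist \<Omega> (emp \<Omega> n z) (emp \<Omega> n w) \<le> ereal (slip_dist n z w)" .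
    show "ereal (slip_dist n z w) \<le> diss_dist \<Omega> (emp \<Omega> n z) (emp \<Omega> n w)"
      unfolding eq
    proof (rule INF_greatest)
      fix \<sigma> assume \<sigma>: "\<sigma> \<in> couplings \<Omega> (emp \<Omega> n z) (emp \<Omega> n w)"
      obtain a where a: "a \<in> plans n z w" "(\<integral>\<^sup>+p. ennreal (norm (fst p - snd p)) \<partial>\<sigma>) = ennreal (plan_cost n z w a)"
        by (rule coupling_plan[OF z w inj \<sigma>])
      then show "ereal (slip_dist n z w) \<le> enn2ereal (\<integral>\<^sup>+p. ennreal (norm (fst p - snd p)) \<partial>\<sigma>)"
        using slip_dist_le[OF a(1)] plan_cost_nonneg[OF a(1)] by (simp add: enn2ereal_ennreal)
    qed
  qed
qed

text \<open>Finite distance forces equal distributions of heights, that is, equal multisets of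
  heights, and these differ by a permutation of the labels.\<close>

lemma relabel_heights:
  assumes z: "\<And>i. i < n \<Longrightarrow> z i \<in> \<Omega>" and w: "\<And>i. i < n \<Longrightarrow> w i \<in> \<Omega>"
    and fin: "diss_dist \<Omega> (emp \<Omega> n z) (emp \<Omega> n w) \<noteq> \<infinity>"
  obtains \<pi> where "bij_betw \<pi> {..<n} {..<n}" "same_heights n (z \<circ> \<pi>) w"
proof -
  have eq: "distr (uniform_count_measure {..<n}) borel (\<lambda>i. z i $ 2) = distr (uniform_count_measure {..<n}) borel (\<lambda>i. w i $ 2)"
    using fin by (auto simp: diss_dist_def emp_heights z w split: if_splits)
  have card: "card {i. i < n \<and> z i $ 2 = y} = card {i. i < n \<and> w i $ 2 = y}" for y
  proof -
    have "emeasure (distr (uniform_count_measure {..<n}) borel (\<lambda>i. v i $ 2)) {y} = ennreal (real (card {i. i < n \<and> v i $ 2 = y}) / real n)"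
      for v :: "nat \<Rightarrow> real^2"
    proof -
      have "(\<lambda>i. v i $ 2) -` {y} \<inter> {..<n} = {i. i < n \<and> v i $ 2 = y}" "{i. i < n \<and> v i $ 2 = y} \<subseteq> {..<n}" by auto
      moreover have "(\<lambda>i. v i $ 2) \<in> uniform_count_measure {..<n} \<rightarrow>\<^sub>M borel" by (auto simp: measurable_def)
      ultimately show ?thesis using n by (simp add: emeasure_distr emeasure_uniform_count_measure)
    qed
    from this[of z] this[of w]
    have "ennreal (real (card {i. i < n \<and> z i $ 2 = y}) / real n) = ennreal (real (card {i. i < n \<and> w i $ 2 = y}) / real n)"
      unfolding eq by metis
    then show ?thesis using n by auto
  qed
  have "mset (map (\<lambda>i. w i $ 2) [0..<n]) = mset (map (\<lambda>i. z i $ 2) [0..<n])"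
  proof (rule multiset_eqI)
    fix y
    have "count (mset (map g [0..<m])) y = card {i. i < m \<and> g i = y}" for g :: "nat \<Rightarrow> real" and m
    proof (induction m)
      case (Suc m)
      have "{i. i < Suc m \<and> g i = y} = (if g m = y then insert m {i. i < m \<and> g i = y} else {i. i < m \<and> g i = y})"
        by (auto simp: less_Suc_eq)
      then show ?case using Suc by simp
    qed simp
    then show "count (mset (map (\<lambda>i. w i $ 2) [0..<n])) y = count (mset (map (\<lambda>i. z i $ 2) [0..<n])) y" 
      by (simp only: card)
  qed
  from mset_eq_permutation[OF this]
  obtain \<pi> where \<pi>: "\<pi> permutes {..<n}" "permute_list \<pi> (map (\<lambda>i. z i $ 2) [0..<n]) = map (\<lambda>i. w i $ 2) [0..<n]"
    by auto
  have "z (\<pi> i) $ 2 = w i $ 2" if i: "i < n" for i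
  proof -
    have "\<pi> i < n" using permutes_in_image[OF \<pi>(1)] i by simp
    then show ?thesis using permute_list_nth[of \<pi> "map (\<lambda>i. z i $ 2) [0..<n]" i] \<pi> i by simp
  qed
  then have "same_heights n (z \<circ> \<pi>) w" by (simp add: same_heights_def)
  with permutes_imp_bij[OF \<pi>(1)] show thesis by (rule that)
qed

end

section \<open>Time derivative of the load\<close>

lemma bump_scale:
  assumes "\<eta> > 0"
  shows "bump \<eta> t = bump 1 (t / \<eta>) / \<eta>"
proof -
  have eq: "stepr \<eta> = (\<lambda>t. stepr 1 (t / \<eta>))" by (auto simp: stepr_def)
  have "(stepr \<eta> has_real_derivative (- bump 1 (t / \<eta>)) * (1 / \<eta>)) (at t)"
    unfolding eq by (rule DERIV_chain2[OF stepr_derivative]) (use assms in \<open>auto intro!: derivative_eq_intros\<close>)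
  from DERIV_unique[OF this stepr_derivative] show ?thesis by simp
qed

text \<open>The mollifier has mass 1 on \<open>[a, a + \<eta>]\<close> and is bounded by
  \<open>B / \<eta>\<close> on an interval of length \<open>\<eta>\<close>, so the error is
  \<open>B * e\<close> with \<open>B\<close> independent of \<open>\<eta>\<close>.\<close>

lemma bump_evaluation:
  assumes \<eta>: "0 < \<eta>" and a: "0 \<le> a" "a + \<eta> \<le> T" and g: "continuous_on {0..T} g"
    and B: "\<And>t. \<bar>bump 1 t\<bar> \<le> B" and e: "\<And>t. t \<in> {a..a + \<eta>} \<Longrightarrow> \<bar>g t - g a\<bar> \<le> e"
  shows "\<bar>integral {0..T} (\<lambda>t. bump \<eta> (t - a) * g t) - g a\<bar> \<le> B * e"
proof -
  have B0: "0 \<le> B" using B[of 0] by linarith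
  have cb: "continuous_on S (\<lambda>t. bump \<eta> (t - a))" for S
    by (rule continuous_on_compose2[OF smooth_continuous[OF smooth_bump]]) (auto intro!: continuous_intros)
  have g': "continuous_on {a..a + \<eta>} g" using a by (intro continuous_on_subset[OF g]) auto
  have eq: "integral {0..T} (\<lambda>t. bump \<eta> (t - a) * g t) = integral {a..a + \<eta>} (\<lambda>t. bump \<eta> (t - a) * g t)"
  proof (rule integral_spike_set)
    have "{t \<in> {a..a + \<eta>} - {0..T}. bump \<eta> (t - a) * g t \<noteq> 0} = {}" using a by auto
    then show "negligible {t \<in> {a..a + \<eta>} - {0..T}. bump \<eta> (t - a) * g t \<noteq> 0}" by (simp only: negligible_empty)
    have "{t \<in> {0..T} - {a..a + \<eta>}. bump \<eta> (t - a) * g t \<noteq> 0} = {}"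
    proof -
      have "bump \<eta> (t - a) = 0" if "t \<notin> {a..a + \<eta>}" for t using bump_zero[OF \<eta>, of "t - a"] that by auto
      then show ?thesis by auto
    qed
    then show "negligible {t \<in> {0..T} - {a..a + \<eta>}. bump \<eta> (t - a) * g t \<noteq> 0}" by (simp only: negligible_empty)
  qed
  have "((\<lambda>t. bump \<eta> (t - a)) has_integral 1) {a..a + \<eta>}"
  proof -
    have "((\<lambda>t. - stepr \<eta> (t - a)) has_real_derivative bump \<eta> (t - a)) (at t)" for t
      by (auto intro!: derivative_eq_intros DERIV_chain2[OF stepr_derivative])
    then have "((\<lambda>t. bump \<eta> (t - a)) has_integral (- stepr \<eta> (a + \<eta> - a)) - (- stepr \<eta> (a - a))) {a..a + \<eta>}"
      using \<eta> by (intro fundamental_theorem_of_calculus)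
        (auto simp: has_real_derivative_iff_has_vector_derivative[symmetric] intro: has_field_derivative_at_within)
    then show ?thesis using stepr(1,2)[OF \<eta>] by simp
  qed
  from has_integral_mult_left[OF this, of "g a"]
  have one: "integral {a..a + \<eta>} (\<lambda>t. bump \<eta> (t - a) * g a) = g a" "(\<lambda>t. bump \<eta> (t - a) * g a) integrable_on {a..a + \<eta>}"
    by (simp_all add: has_integral_iff)
  have int: "(\<lambda>t. bump \<eta> (t - a) * g t) integrable_on {a..a + \<eta>}"
    by (intro integrable_continuous_interval continuous_intros cb g')
  have "integral {0..T} (\<lambda>t. bump \<eta> (t - a) * g t) - g a
      = integral {a..a + \<eta>} (\<lambda>t. bump \<eta> (t - a) * g t) - integral {a..a + \<eta>} (\<lambda>t. bump \<eta> (t - a) * g a)"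
    by (simp only: eq one(1))
  also have "\<dots> = integral {a..a + \<eta>} (\<lambda>t. bump \<eta> (t - a) * (g t - g a))"
    unfolding integral_diff[OF int one(2), symmetric] by (simp only: right_diff_distrib)
  also have "\<bar>\<dots>\<bar> \<le> (B / \<eta> * e) * (a + \<eta> - a)"
    unfolding real_norm_def[symmetric]
  proof (rule integral_bound)
    show "continuous_on {a..a + \<eta>} (\<lambda>t. bump \<eta> (t - a) * (g t - g a))" by (intro continuous_intros cb g')
    fix t assume t: "t \<in> {a..a + \<eta>}"
    have "\<bar>bump \<eta> (t - a)\<bar> \<le> B / \<eta>" using B[of "(t - a) / \<eta>"] \<eta> by (simp add: bump_scale[OF \<eta>] divide_right_mono abs_divide)
    then show "norm (bump \<eta> (t - a) * (g t - g a)) \<le> B / \<eta> * e"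
      unfolding real_norm_def abs_mult using e[OF t] B0 \<eta> by (intro mult_mono) auto
  qed (use \<eta> in simp)
  finally show ?thesis using \<eta> by simp
qed

text \<open>Tested with a smooth approximation of the indicator of \<open>[a, b]\<close>, the
  difference of two steps. Its derivative is a mollifier at \<open>a\<close> minus one at
  \<open>b\<close>, which evaluates \<open>g\<close> at the two points in the limit.\<close>

lemma weak_derivative_interior:
  fixes g h :: "real \<Rightarrow> real"
  assumes g: "continuous_on {0..T} g" and h: "set_integrable lebesgue {0..T} h"
    and weak: "\<And>\<phi>. \<phi> \<in> test_functions {0<..<T} \<Longrightarrow>
      (LINT t:{0..T}|lebesgue. deriv \<phi> t * g t) = - (LINT t:{0..T}|lebesgue. \<phi> t * h t)"
    and ab: "0 < a" "a < b" "b < T"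
  shows "g b - g a = integral {a..b} h"
proof -
  \<comment> \<open>The steps descend to the right of their points, so room is needed only between
    \<open>b\<close> and \<open>T\<close>.\<close>
  define \<eta> where "\<eta> k = (T - b) / 2 * inverse (real (Suc k))" for k
  have \<eta>0: "\<eta> k > 0" for k using ab by (simp add: \<eta>_def)
  have \<eta>T: "b + \<eta> k < T" for k
  proof -
    have "inverse (real (Suc k)) \<le> 1" by (rule inverse_le_1_iff[THEN iffD2]) simp
    then have "(T - b) / 2 * inverse (real (Suc k)) \<le> (T - b) / 2 * 1" using ab by (intro mult_left_mono) auto
    then have "\<eta> k \<le> (T - b) / 2" by (simp only: \<eta>_def mult_1_right)
    also have "(T - b) / 2 < T - b" using ab by simp
    finally show ?thesis by (simp add: less_diff_eq add.commute)
  qed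
  have \<eta>lim: "\<eta> \<longlonglongrightarrow> 0"
    unfolding \<eta>_def[abs_def] by (rule tendsto_mult_right_zero[OF LIMSEQ_inverse_real_of_nat])
  obtain B where B: "\<And>t. \<bar>bump 1 t\<bar> \<le> B" using bump_bounded[of 1] by auto
  define \<phi> where "\<phi> k t = stepr (\<eta> k) (t - b) - stepr (\<eta> k) (t - a)" for k t
  have \<phi>_out: "\<phi> k t = 0" if "t \<notin> {a..b + \<eta> k}" for k t
  proof (cases "t < a")
    case True then show ?thesis using stepr(1)[OF \<eta>0] ab by (simp add: \<phi>_def)
  next
    case False then show ?thesis using stepr(2)[OF \<eta>0] that ab by (simp add: \<phi>_def)
  qed
  have \<phi>_test: "\<phi> k \<in> test_functions {0<..<T}" for k
  proof -
    have "Ck m (\<phi> k)" for m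
    proof -
      have "Ck m (\<lambda>t. stepr (\<eta> k) (t + - b) + (-1) * stepr (\<eta> k) (t + - a))"
        using smooth_stepr unfolding smooth_def by (intro Ck_add Ck_mult Ck_const Ck_translate) auto
      then show ?thesis by (simp add: \<phi>_def[abs_def])
    qed
    moreover have "compact {a..b + \<eta> k}" "{a..b + \<eta> k} \<subseteq> {0<..<T}" using ab \<eta>T[of k] by auto
    ultimately show ?thesis using \<phi>_out unfolding test_functions_def by blast
  qed
  have \<phi>_deriv: "deriv (\<phi> k) t = bump (\<eta> k) (t - a) - bump (\<eta> k) (t - b)" for k t
    unfolding \<phi>_def[abs_def]
    by (intro DERIV_imp_deriv) (auto intro!: derivative_eq_intros DERIV_chain2[OF stepr_derivative])
  have \<phi>_bound: "\<bar>\<phi> k t\<bar> \<le> 1" for k t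
    using stepr(3,4)[of "\<eta> k"] unfolding \<phi>_def by (smt (verit))
  have cb: "continuous_on S (\<lambda>t. bump (\<eta> k) (t - c))" for S k c
    by (rule continuous_on_compose2[OF smooth_continuous[OF smooth_bump]]) (auto intro!: continuous_intros)
  have evaluation: "(\<lambda>k. integral {0..T} (\<lambda>t. bump (\<eta> k) (t - c) * g t)) \<longlonglongrightarrow> g c" if c: "0 < c" "c \<le> b" for c
  proof (rule LIMSEQ_I)
    fix e :: real assume e: "e > 0"
    have B0: "0 \<le> B" using B[of 0] by linarith
    have e': "e / (B + 1) > 0" using e B0 by simp
    have "c \<in> {0..T}" using c ab by auto
    then obtain d where d: "d > 0" "\<And>t. t \<in> {0..T} \<Longrightarrow> dist t c < d \<Longrightarrow> dist (g t) (g c) < e / (B + 1)"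
      using g[unfolded continuous_on_iff] e' by blast
    have ev: "\<forall>\<^sub>F k in sequentially. \<eta> k < d" using order_tendstoD(2)[OF \<eta>lim d(1)] .
    have "\<forall>\<^sub>F k in sequentially. norm (integral {0..T} (\<lambda>t. bump (\<eta> k) (t - c) * g t) - g c) < e"
      using ev
    proof eventually_elim
      case (elim k)
      have "\<bar>integral {0..T} (\<lambda>t. bump (\<eta> k) (t - c) * g t) - g c\<bar> \<le> B * (e / (B + 1))"
      proof (rule bump_evaluation[OF \<eta>0 _ _ g B])
        show "c + \<eta> k \<le> T" using \<eta>T[of k] c by linarith
        fix t assume t: "t \<in> {c..c + \<eta> k}"
        have "dist (g t) (g c) < e / (B + 1)"
          using t elim c \<eta>T[of k] by (intro d(2)) (auto simp: dist_real_def)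
        then show "\<bar>g t - g c\<bar> \<le> e / (B + 1)" by (simp add: dist_real_def)
      qed (use c in simp)
      also have "\<dots> < e" using e B0 by (simp add: field_simps)
      finally show ?case by simp
    qed
    then show "\<exists>N. \<forall>k\<ge>N. norm (integral {0..T} (\<lambda>t. bump (\<eta> k) (t - c) * g t) - g c) < e"
      by (simp add: eventually_sequentially)
  qed
  have left: "(LINT t:{0..T}|lebesgue. deriv (\<phi> k) t * g t)
      = integral {0..T} (\<lambda>t. bump (\<eta> k) (t - a) * g t) - integral {0..T} (\<lambda>t. bump (\<eta> k) (t - b) * g t)" for k
  proof -
    have c: "continuous_on {0..T} (\<lambda>t. deriv (\<phi> k) t * g t)" unfolding \<phi>_deriv by (intro continuous_intros cb g)
    have "(LINT t:{0..T}|lebesgue. deriv (\<phi> k) t * g t) = integral {0..T} (\<lambda>t. deriv (\<phi> k) t * g t)"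
      by (rule set_lebesgue_integral_eq_integral(2)) (rule absolutely_integrable_continuous_real[OF c])
    also have "\<dots> = integral {0..T} (\<lambda>t. bump (\<eta> k) (t - a) * g t - bump (\<eta> k) (t - b) * g t)"
      by (simp add: \<phi>_deriv left_diff_distrib)
    also have "\<dots> = integral {0..T} (\<lambda>t. bump (\<eta> k) (t - a) * g t) - integral {0..T} (\<lambda>t. bump (\<eta> k) (t - b) * g t)"
      by (intro integral_diff integrable_continuous_interval continuous_intros cb g)
    finally show ?thesis .
  qed
  have "(\<lambda>k. LINT t:{0..T}|lebesgue. deriv (\<phi> k) t * g t) \<longlonglongrightarrow> g a - g b"
    unfolding left using ab by (intro tendsto_diff evaluation) auto
  then have "(\<lambda>k. - (LINT t:{0..T}|lebesgue. \<phi> k t * h t)) \<longlonglongrightarrow> g a - g b"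
    unfolding weak[OF \<phi>_test] .
  then have 1: "(\<lambda>k. LINT t:{0..T}|lebesgue. \<phi> k t * h t) \<longlonglongrightarrow> g b - g a"
    using tendsto_minus by fastforce
  have 2: "(\<lambda>k. LINT t:{0..T}|lebesgue. \<phi> k t * h t) \<longlonglongrightarrow> (LINT t:{0..T}|lebesgue. indicator {a<..b} t * h t)"
    unfolding set_lebesgue_integral_def
  proof (rule integral_dominated_convergence[where w = "\<lambda>t. indicator {0..T} t * \<bar>h t\<bar>"])
    have hm: "(\<lambda>t. indicator {0..T} t *\<^sub>R h t) \<in> borel_measurable lebesgue"
      using h unfolding set_integrable_def by (rule borel_measurable_integrable)
    have "(\<lambda>t. indicator {a<..b} t * (indicator {0..T} t *\<^sub>R h t)) \<in> borel_measurable lebesgue"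
      by (intro borel_measurable_times hm borel_measurable_indicator) auto
    then show "(\<lambda>t. indicator {0..T} t *\<^sub>R (indicator {a<..b} t * h t)) \<in> borel_measurable lebesgue" by (simp add: mult_ac)
    fix k
    have "Ck 0 (\<phi> k)" using \<phi>_test[of k] unfolding test_functions_def by blast
    then have "\<phi> k \<in> borel_measurable borel" by (intro borel_measurable_continuous_onI Ck_imp_continuous)
    then have "\<phi> k \<in> borel_measurable lebesgue" by (intro measurable_completion) simp
    then have "(\<lambda>t. \<phi> k t * (indicator {0..T} t *\<^sub>R h t)) \<in> borel_measurable lebesgue" by (intro borel_measurable_times hm)
    then show "(\<lambda>t. indicator {0..T} t *\<^sub>R (\<phi> k t * h t)) \<in> borel_measurable lebesgue" by (simp add: mult_ac)
    show "AE t in lebesgue. norm (indicator {0..T} t *\<^sub>R (\<phi> k t * h t)) \<le> indicator {0..T} t * \<bar>h t\<bar>"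
      using \<phi>_bound by (auto simp: indicator_def abs_mult mult_left_le_one_le)
  next
    have "integrable lebesgue (\<lambda>t. \<bar>indicator {0..T} t *\<^sub>R h t\<bar>)" using h unfolding set_integrable_def by (rule integrable_abs)
    then show "integrable lebesgue (\<lambda>t. indicator {0..T} t * \<bar>h t\<bar>)" by (simp add: abs_mult)
    show "AE t in lebesgue. (\<lambda>k. indicator {0..T} t *\<^sub>R (\<phi> k t * h t)) \<longlonglongrightarrow> indicator {0..T} t *\<^sub>R (indicator {a<..b} t * h t)"
    proof (rule AE_I2)
      fix t
      have "\<forall>\<^sub>F k in sequentially. \<phi> k t = indicator {a<..b} t"
      proof (cases "t \<le> a")
        case True then show ?thesis using stepr(1)[OF \<eta>0] ab by (simp add: \<phi>_def)
      next
        case False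
        then have "\<forall>\<^sub>F k in sequentially. \<eta> k < t - a" using order_tendstoD(2)[OF \<eta>lim] by simp
        moreover have "\<forall>\<^sub>F k in sequentially. b < t \<longrightarrow> \<eta> k < t - b" using order_tendstoD(2)[OF \<eta>lim, of "t - b"] by (cases "b < t") auto
        ultimately show ?thesis
        proof eventually_elim
          case (elim k)
          then show ?case using False stepr(1,2)[OF \<eta>0[of k]] by (cases "b < t") (auto simp: \<phi>_def)
        qed
      qed
      then show "(\<lambda>k. indicator {0..T} t *\<^sub>R (\<phi> k t * h t)) \<longlonglongrightarrow> indicator {0..T} t *\<^sub>R (indicator {a<..b} t * h t)"
        by (intro tendsto_eventually) (erule eventually_mono, simp)
    qed
  qed
  have hab: "set_integrable lebesgue {a..b} h" using ab by (intro set_integrable_subset[OF h]) auto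
  have "(LINT t:{0..T}|lebesgue. indicator {a<..b} t * h t) = (LINT t:{a..b}|lebesgue. h t)"
    unfolding set_lebesgue_integral_def
  proof (rule integral_cong_AE)
    have "AE t in lebesgue. t \<noteq> a" by (rule AE_lebesgue_neq)
    then show "AE t in lebesgue. indicator {0..T} t *\<^sub>R (indicator {a<..b} t * h t) = indicator {a..b} t *\<^sub>R h t"
      by eventually_elim (use ab in \<open>auto simp: indicator_def\<close>)
    have "(\<lambda>t. indicator {a<..b} t * (indicator {a..b} t *\<^sub>R h t)) \<in> borel_measurable lebesgue"
      using borel_measurable_integrable[OF hab[unfolded set_integrable_def]]
      by (intro borel_measurable_times borel_measurable_indicator) auto
    also have "(\<lambda>t. indicator {a<..b} t * (indicator {a..b} t *\<^sub>R h t)) = (\<lambda>t. indicator {0..T} t *\<^sub>R (indicator {a<..b} t * h t))"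
      using ab by (auto simp: indicator_def)
    finally show "(\<lambda>t. indicator {0..T} t *\<^sub>R (indicator {a<..b} t * h t)) \<in> borel_measurable lebesgue" .
  qed (rule borel_measurable_integrable[OF hab[unfolded set_integrable_def]])
  also have "\<dots> = integral {a..b} h" by (rule set_lebesgue_integral_eq_integral(2)[OF hab])
  finally show ?thesis using LIMSEQ_unique[OF 1 2] by simp
qed

text \<open>Test functions vanish near 0 and \<open>T\<close>, so the identity is obtained in the
  open interval and extended to the end points by continuity of \<open>G\<close>, which is constant
  there.\<close>

lemma weak_derivative_integral:
  fixes g h :: "real \<Rightarrow> real"
  assumes T: "T > 0" and g: "continuous_on {0..T} g" and h: "set_integrable lebesgue {0..T} h"
    and weak: "\<And>\<phi>. \<phi> \<in> test_functions {0<..<T} \<Longrightarrow>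
      (LINT t:{0..T}|lebesgue. deriv \<phi> t * g t) = - (LINT t:{0..T}|lebesgue. \<phi> t * h t)"
    and st: "0 \<le> s" "s \<le> t" "t \<le> T"
  shows "g t - g s = (LINT r:{s..t}|lebesgue. h r)"
proof -
  have hi: "h integrable_on {0..T}" by (rule set_lebesgue_integral_eq_integral(1)[OF h])
  define G where "G x = g x - integral {0..x} h" for x
  have cG: "continuous_on {0..T} G" unfolding G_def[abs_def] by (intro continuous_intros g indefinite_integral_continuous_1 hi)
  have comb: "integral {0..y} h = integral {0..x} h + integral {x..y} h" if "0 \<le> x" "x \<le> y" "y \<le> T" for x y
    using that by (intro Henstock_Kurzweil_Integration.integral_combine[symmetric] integrable_on_subinterval[OF hi]) auto
  have mono: "G x = G y" if "0 < x" "x < y" "y < T" for x y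
    using weak_derivative_interior[OF g h weak that] comb[of x y] that by (simp add: G_def)
  have inner: "G x = G (T / 2)" if "x \<in> {0<..<T}" for x
  proof (cases x "T / 2" rule: linorder_cases)
    case less then show ?thesis using that T by (intro mono) auto
  next
    case greater then show ?thesis using that T by (intro mono[symmetric]) auto
  next
    case equal then show ?thesis by (simp only:)
  qed
  have const: "G x = G (T / 2)" if x: "x \<in> {0..T}" for x
  proof (rule continuous_constant_on_closure[of "{0<..<T}" G])
    show "continuous_on (closure {0<..<T}) G" "x \<in> closure {0<..<T}" using cG T x by auto
    show "\<And>x. x \<in> {0<..<T} \<Longrightarrow> G x = G (T / 2)" by (rule inner)
  qed
  have "g t - g s = integral {s..t} h"
    using const[of s] const[of t] comb[of s t] st by (simp add: G_def)
  moreover have "set_integrable lebesgue {s..t} h" using st by (intro set_integrable_subset[OF h]) auto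
  ultimately show ?thesis by (simp add: set_lebesgue_integral_eq_integral(2))
qed

section \<open>Pointwise consequences of the regularity of the load in time\<close>

lemma sup_norm_upper: "g \<in> bounded_continuous \<Omega> \<Longrightarrow> x \<in> \<Omega> \<Longrightarrow> \<bar>g x\<bar> \<le> sup_norm \<Omega> g"
proof -
  assume g: "g \<in> bounded_continuous \<Omega>" and x: "x \<in> \<Omega>"
  obtain M where "\<And>x. x \<in> \<Omega> \<Longrightarrow> \<bar>g x\<bar> \<le> M" using g by (auto simp: bounded_continuous_def bounded_iff)
  then have "bdd_above ((\<lambda>x. \<bar>g x\<bar>) ` \<Omega>)" by (intro bdd_aboveI2)
  then show ?thesis unfolding sup_norm_def by (rule cSUP_upper[OF x])
qed

lemma bounded_continuous_diff:
  "g \<in> bounded_continuous \<Omega> \<Longrightarrow> h \<in> bounded_continuous \<Omega> \<Longrightarrow> (\<lambda>x. g x - h x) \<in> bounded_continuous \<Omega>"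
  unfolding bounded_continuous_def by (auto intro: continuous_on_diff bounded_minus_comp)

text \<open>Evaluation at a point is continuous for the sup norm, so the simple functions
  approximating \<open>g\<close> in norm also approximate \<open>g t x\<close> for almost every
  \<open>t\<close>.\<close>

lemma bochner_evaluation_measurable:
  assumes g: "bochner_L1 \<Omega> T g" and x: "x \<in> \<Omega>"
  shows "set_borel_measurable lebesgue {0..T} (\<lambda>t. g t x)"
proof -
  obtain s where s: "\<And>k. simple_function (lebesgue_on {0..T}) (s k)"
      "\<And>k t. t \<in> {0..T} \<Longrightarrow> s k t \<in> bounded_continuous \<Omega>"
    and lim: "AE t in lebesgue_on {0..T}. (\<lambda>k. sup_norm \<Omega> (\<lambda>x. g t x - s k t x)) \<longlonglongrightarrow> 0"
    and gb: "\<And>t. t \<in> {0..T} \<Longrightarrow> g t \<in> bounded_continuous \<Omega>"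
    using g unfolding bochner_L1_def by blast
  have m: "(\<lambda>t. s k t x) \<in> borel_measurable (lebesgue_on {0..T})" for k
    by (intro borel_measurable_simple_function simple_function_compose1[OF s(1)])
  have vm: "(\<lambda>t. lim (\<lambda>k. s k t x)) \<in> borel_measurable (lebesgue_on {0..T})"
    by (rule borel_measurable_lim_metric[OF m])
  have "AE t in lebesgue_on {0..T}. g t x = lim (\<lambda>k. s k t x)"
    using lim AE_space
  proof eventually_elim
    case (elim t)
    then have t: "t \<in> {0..T}" by (simp add: space_restrict_space)
    have "(\<lambda>k. \<bar>g t x - s k t x\<bar>) \<longlonglongrightarrow> 0"
    proof (rule tendsto_sandwich[OF _ _ tendsto_const elim(1)])
      show "\<forall>\<^sub>F k in sequentially. \<bar>g t x - s k t x\<bar> \<le> sup_norm \<Omega> (\<lambda>x. g t x - s k t x)"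
        using sup_norm_upper[OF bounded_continuous_diff[OF gb[OF t] s(2)[OF t]] x] by simp
    qed simp
    then have "(\<lambda>k. g t x - (g t x - s k t x)) \<longlonglongrightarrow> g t x - 0" by (intro tendsto_diff tendsto_const) (rule tendsto_rabs_zero_cancel)
    then show ?case by (simp add: limI)
  qed
  then have "AE t in lebesgue. t \<in> {0..T} \<longrightarrow> g t x = lim (\<lambda>k. s k t x)"
    by (subst (asm) AE_restrict_space_iff) auto
  then have eq: "AE t in lebesgue. indicator {0..T} t *\<^sub>R g t x = indicator {0..T} t *\<^sub>R lim (\<lambda>k. s k t x)"
    by eventually_elim (auto simp: indicator_def)
  have "(\<lambda>t. indicator {0..T} t *\<^sub>R lim (\<lambda>k. s k t x)) \<in> borel_measurable lebesgue"
    using vm by (subst (asm) borel_measurable_restrict_space_iff) auto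
  then show ?thesis unfolding set_borel_measurable_def by (rule lebesgue_measurable_AE_cong[OF _ eq])
qed

lemma abs_continuous_evaluation:
  assumes f: "abs_continuous \<Omega> T f" and b: "\<And>t. t \<in> {0..T} \<Longrightarrow> f t \<in> bounded_continuous \<Omega>" and x: "x \<in> \<Omega>"
  shows "continuous_on {0..T} (\<lambda>t. f t x)"
  unfolding continuous_on_iff
proof (intro ballI allI impI)
  fix t e :: real assume t: "t \<in> {0..T}" and e: "e > 0"
  obtain \<delta> where \<delta>: "\<delta> > 0" "\<forall>(N::nat) a b.
        (\<forall>i<N. 0 \<le> a i \<and> a i \<le> b i \<and> b i \<le> T) \<and>
        disjoint_family_on (\<lambda>i. {a i<..<b i}) {..<N} \<and> (\<Sum>i<N. b i - a i) < \<delta> \<longrightarrow>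
        (\<Sum>i<N. sup_norm \<Omega> (\<lambda>x. f (b i) x - f (a i) x)) < e"
    using f[unfolded abs_continuous_def] e by blast
  have close: "\<bar>f v x - f u x\<bar> < e" if uv: "0 \<le> u" "u \<le> v" "v \<le> T" "v - u < \<delta>" for u v
  proof -
    have "sup_norm \<Omega> (\<lambda>x. f v x - f u x) < e"
      using \<delta>(2)[rule_format, of 1 "\<lambda>_. u" "\<lambda>_. v"] uv by (simp add: disjoint_family_on_def)
    moreover have "\<bar>f v x - f u x\<bar> \<le> sup_norm \<Omega> (\<lambda>x. f v x - f u x)"
      using sup_norm_upper[OF bounded_continuous_diff[OF b b] x, of v u] uv by simp
    ultimately show ?thesis by linarith
  qed
  have "dist (f s x) (f t x) < e" if "s \<in> {0..T}" "dist s t < \<delta>" for s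
    using close[of s t] close[of t s] that t by (cases "s \<le> t") (auto simp: dist_real_def abs_minus_commute)
  with \<delta>(1) show "\<exists>d>0. \<forall>x'\<in>{0..T}. dist x' t < d \<longrightarrow> dist (f x' x) (f t x) < e" by blast
qed

theorem W11_evaluation:
  assumes T: "T > 0" and W: "W11 \<Omega> T f f'"
  shows "\<And>t. t \<in> {0..T} \<Longrightarrow> continuous_on \<Omega> (f t)" "\<And>t. t \<in> {0..T} \<Longrightarrow> continuous_on \<Omega> (f' t)"
    and "\<And>t x. t \<in> {0..T} \<Longrightarrow> x \<in> \<Omega> \<Longrightarrow> \<bar>f' t x\<bar> \<le> sup_norm \<Omega> (f' t)"
    and "set_integrable lebesgue {0..T} (\<lambda>t. sup_norm \<Omega> (f' t))"
    and "\<And>x. x \<in> \<Omega> \<Longrightarrow> set_borel_measurable lebesgue {0..T} (\<lambda>t. f' t x)"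
    and "\<And>x. x \<in> \<Omega> \<Longrightarrow> set_integrable lebesgue {0..T} (\<lambda>t. f' t x)"
    and "\<And>s t x. x \<in> \<Omega> \<Longrightarrow> 0 \<le> s \<Longrightarrow> s \<le> t \<Longrightarrow> t \<le> T \<Longrightarrow> f t x - f s x = (LINT r:{s..t}|lebesgue. f' r x)"
proof -
  note w = W[unfolded W11_def]
  have Bf: "bochner_L1 \<Omega> T f" and B: "bochner_L1 \<Omega> T f'" and A: "abs_continuous \<Omega> T f"
    by (rule conjunct1[OF w], rule conjunct1[OF conjunct2[OF w]], rule conjunct1[OF conjunct2[OF conjunct2[OF w]]])
  have weak: "\<And>\<phi> x. \<phi> \<in> test_functions {0<..<T} \<Longrightarrow> x \<in> \<Omega> \<Longrightarrow>
        (LINT t:{0..T}|lebesgue. deriv \<phi> t * f t x) = - (LINT t:{0..T}|lebesgue. \<phi> t * f' t x)"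
    by (rule bspec[OF bspec[OF conjunct2[OF conjunct2[OF conjunct2[OF w]]]]])
  have b: "\<And>t. t \<in> {0..T} \<Longrightarrow> f t \<in> bounded_continuous \<Omega>"
    by (rule bspec[OF conjunct1[OF Bf[unfolded bochner_L1_def]]])
  have b': "\<And>t. t \<in> {0..T} \<Longrightarrow> f' t \<in> bounded_continuous \<Omega>"
    and i: "integrable (lebesgue_on {0..T}) (\<lambda>t. sup_norm \<Omega> (f' t))"
    by (rule bspec[OF conjunct1[OF B[unfolded bochner_L1_def]]], assumption,
        rule conjunct2[OF conjunct2[OF B[unfolded bochner_L1_def]]])
  show "\<And>t. t \<in> {0..T} \<Longrightarrow> continuous_on \<Omega> (f t)" "\<And>t. t \<in> {0..T} \<Longrightarrow> continuous_on \<Omega> (f' t)"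
    using b b' by (auto simp: bounded_continuous_def)
  show bd: "\<And>t x. t \<in> {0..T} \<Longrightarrow> x \<in> \<Omega> \<Longrightarrow> \<bar>f' t x\<bar> \<le> sup_norm \<Omega> (f' t)"
    using sup_norm_upper[OF b'] .
  show m: "set_integrable lebesgue {0..T} (\<lambda>t. sup_norm \<Omega> (f' t))"
    using i unfolding set_integrable_def by (subst (asm) integrable_restrict_space) auto
  show ms: "\<And>x. x \<in> \<Omega> \<Longrightarrow> set_borel_measurable lebesgue {0..T} (\<lambda>t. f' t x)"
    by (rule bochner_evaluation_measurable[OF B])
  show int: "\<And>x. x \<in> \<Omega> \<Longrightarrow> set_integrable lebesgue {0..T} (\<lambda>t. f' t x)"
  proof -
    fix x assume x: "x \<in> \<Omega>"
    show "set_integrable lebesgue {0..T} (\<lambda>t. f' t x)"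
      by (rule set_integrable_bound[OF m ms[OF x]]) (use bd x in \<open>auto intro!: AE_I2 order_trans[OF _ abs_ge_self]\<close>)
  qed
  show "\<And>s t x. x \<in> \<Omega> \<Longrightarrow> 0 \<le> s \<Longrightarrow> s \<le> t \<Longrightarrow> t \<le> T \<Longrightarrow> f t x - f s x = (LINT r:{s..t}|lebesgue. f' r x)"
    by (rule weak_derivative_integral[OF T abs_continuous_evaluation[OF A b] int weak])
qed

section \<open>Dislocation configurations\<close>

lemma coordinate_tendsto:
  fixes u :: "nat \<Rightarrow> 'i \<Rightarrow> 'b::topological_space"
  assumes "u \<longlonglongrightarrow> x"
  shows "(\<lambda>k. u k i) \<longlonglongrightarrow> x i"
  by (rule continuous_on_tendsto_compose[OF continuous_on_product_coordinates assms]) auto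

lemma emp_cong: "(\<And>i. i < n \<Longrightarrow> z i = w i) \<Longrightarrow> emp \<Omega> n z = emp \<Omega> n w"
  unfolding emp_def by (rule distr_cong) auto

lemma emp_permute:
  assumes n: "n \<ge> 1" and y: "\<And>i. i < n \<Longrightarrow> y i \<in> \<Omega>" and \<pi>: "bij_betw \<pi> {..<n} {..<n}"
  shows "emp \<Omega> n (y \<circ> \<pi>) = emp \<Omega> n y"
proof (rule measure_eqI)
  have \<pi>n: "\<pi> i < n" if "i < n" for i using bij_betwE[OF \<pi>] that by auto
  have y\<pi>: "\<And>i. i < n \<Longrightarrow> (y \<circ> \<pi>) i \<in> \<Omega>" using y \<pi>n by simp
  fix A assume "A \<in> sets (emp \<Omega> n (y \<circ> \<pi>))"
  then have A: "A \<in> sets (restrict_space borel \<Omega>)" by (simp add: emp_sets[OF n])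
  have "bij_betw \<pi> {i. i < n \<and> (y \<circ> \<pi>) i \<in> A} {i. i < n \<and> y i \<in> A}"
    unfolding bij_betw_def
  proof
    show "inj_on \<pi> {i. i < n \<and> (y \<circ> \<pi>) i \<in> A}" using \<pi> by (auto simp: bij_betw_def intro: inj_on_subset)
    have "\<exists>j<n. i = \<pi> j" if "i < n" for i
    proof -
      have "i \<in> \<pi> ` {..<n}" using that \<pi> by (simp add: bij_betw_def)
      then show ?thesis by auto
    qed
    then show "\<pi> ` {i. i < n \<and> (y \<circ> \<pi>) i \<in> A} = {i. i < n \<and> y i \<in> A}" using \<pi>n by fastforce
  qed
  then have card: "card {i. i < n \<and> (y \<circ> \<pi>) i \<in> A} = card {i. i < n \<and> y i \<in> A}" by (rule bij_betw_same_card)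
  have "emeasure (emp \<Omega> n (y \<circ> \<pi>)) A = ennreal (real (card {i. i < n \<and> (y \<circ> \<pi>) i \<in> A}) / real n)"
    by (rule emp_emeasure[OF n y\<pi> A])
  also have "\<dots> = emeasure (emp \<Omega> n y) A"
    unfolding card by (rule emp_emeasure[OF n y A, symmetric])
  finally show "emeasure (emp \<Omega> n (y \<circ> \<pi>)) A = emeasure (emp \<Omega> n y) A" .
qed (simp add: emp_sets[OF n])

text \<open>Here \<open>n\<close> is fixed and \<open>eps\<close>, \<open>rad\<close> are the values
  of the two sequences at \<open>n\<close>. The margin \<open>\<delta>\<close> provides the annuli
  needed for gluing: core disks enlarged by \<open>\<delta>\<close> stay in the domain and are
  pairwise disjoint.\<close>

locale dislocations =
  fixes \<Omega> R :: "(real^2) set" and lam sh eps rad \<delta> :: real and n :: nat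
  assumes \<Omega>: "open \<Omega>" "bounded \<Omega>" and R: "compact R" "R \<subseteq> \<Omega>"
    and lame: "sh > 0" "lam + sh > 0" and eps: "eps > 0" and \<delta>: "\<delta> > 0"
    and margin: "\<And>x. x \<in> R \<Longrightarrow> cball x (eps + \<delta>) \<subseteq> \<Omega>" and rad: "2 * eps + 2 * \<delta> < rad"
    and n: "n \<ge> 1"
begin

abbreviation rows :: "(nat \<Rightarrow> real^2) \<Rightarrow> real set" where
  "rows w \<equiv> strain_rows \<Omega> eps (w ` {..<n}) (1 / real n) lam sh"

definition separated :: "(nat \<Rightarrow> real^2) set" where
  "separated = {w. (\<forall>i<n. w i \<in> R) \<and> (\<forall>i<n. \<forall>j<n. i \<noteq> j \<longrightarrow> rad \<le> norm (w i - w j))}"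

definition energy :: "(nat \<Rightarrow> real^2) \<Rightarrow> real" where
  "energy w = (INF E\<in>rows w. E / 2) - 1 / (2 * (real n)\<^sup>2) * self_energy lam sh eps \<Omega> n w"

text \<open>Coordinates with index at least \<open>n\<close> are irrelevant and pinned to 0 for compactness.\<close>

definition confs :: "(nat \<Rightarrow> real^2) \<Rightarrow> (nat \<Rightarrow> real^2) set" where
  "confs z = {w \<in> separated. same_heights n w z \<and> (\<forall>i\<ge>n. w i = 0) \<and> rows w \<noteq> {}}"

lemma separatedD:
  assumes "w \<in> separated"
  shows "i < n \<Longrightarrow> w i \<in> R" "i < n \<Longrightarrow> w i \<in> \<Omega>" "inj_on w {..<n}"
    "i < n \<Longrightarrow> j < n \<Longrightarrow> i \<noteq> j \<Longrightarrow> rad \<le> norm (w i - w j)"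
proof -
  show "i < n \<Longrightarrow> w i \<in> R" "i < n \<Longrightarrow> w i \<in> \<Omega>" "i < n \<Longrightarrow> j < n \<Longrightarrow> i \<noteq> j \<Longrightarrow> rad \<le> norm (w i - w j)"
    using assms R by (auto simp: separated_def)
  show "inj_on w {..<n}"
  proof (rule inj_onI, rule ccontr)
    fix i j assume ij: "i \<in> {..<n}" "j \<in> {..<n}" "w i = w j" "i \<noteq> j"
    then have "rad \<le> norm (w i - w j)" using assms unfolding separated_def by blast
    then show False using ij rad eps \<delta> by simp
  qed
qed

lemma confsD:
  assumes "w \<in> confs z"
  shows "w \<in> separated" "same_heights n w z" "rows w \<noteq> {}" "n \<le> i \<Longrightarrow> w i = 0"
  using assms by (auto simp: confs_def)

lemma move:
  assumes w: "w \<in> separated" and \<kappa>: "\<kappa> > 0" and u: "u \<longlonglongrightarrow> w" "\<And>k. same_heights n (u k) w"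
  shows "\<forall>\<^sub>F k in sequentially. \<forall>E\<in>rows (u k). \<exists>E'\<in>rows w. E' \<le> (1 + \<kappa>) * E"
proof -
  obtain h0 where h0: "h0 > 0" "\<And>w' E. (\<And>i. i < n \<Longrightarrow> w' i $ 2 = w i $ 2 \<and> norm (w' i - w i) < h0) \<Longrightarrow>
     E \<in> rows w' \<Longrightarrow> \<exists>E'\<in>rows w. E' \<le> (1 + \<kappa>) * E"
  proof (rule config_move[OF lame eps \<delta> _ _ n \<kappa>, of w \<Omega> "1 / real n"])
    show "cball (w i) (eps + \<delta>) \<subseteq> \<Omega>" if "i < n" for i using margin separatedD(1)[OF w that] .
    show "2 * eps + 2 * \<delta> < norm (w i - w j)" if "i < n" "j < n" "i \<noteq> j" for i j
      using separatedD(4)[OF w that] rad by linarith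
  qed blast
  have "\<forall>\<^sub>F k in sequentially. \<forall>i\<in>{..<n}. dist (u k i) (w i) < h0"
    by (intro eventually_ball_finite ballI tendstoD[OF coordinate_tendsto[OF u(1)] h0(1)]) simp
  then show ?thesis
  proof eventually_elim
    case (elim k)
    show ?case
    proof
      fix E assume "E \<in> rows (u k)"
      then show "\<exists>E'\<in>rows w. E' \<le> (1 + \<kappa>) * E"
        using elim u(2)[of k] by (intro h0(2)) (auto simp: dist_norm same_heights_def)
    qed
  qed
qed

text \<open>Beyond closedness of the geometric constraints, the existence of an admissible strain
  has to survive the limit: moving the holes turns a strain of a nearby configuration into one of
  the limit.\<close>

lemma compact_confs: "compact (confs z)"
proof -
  define K where "K = PiE UNIV (\<lambda>i::nat. if i < n then R else {0 :: real^2})"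
  have "compactin (product_topology (\<lambda>_::nat. euclidean :: (real^2) topology) UNIV) K"
    unfolding K_def by (subst compactin_PiE) (use R in auto)
  then have K: "compact K" by (simp add: euclidean_product_topology)
  have sub: "confs z \<subseteq> K" by (auto simp: K_def confs_def separated_def split: if_splits)
  have "closed (confs z)"
    unfolding closed_sequential_limits
  proof (intro allI impI, elim conjE)
    fix u x assume u: "\<forall>k. u k \<in> confs z" and lim: "u \<longlonglongrightarrow> x"
    note c = coordinate_tendsto[OF lim]
    note d = confsD[OF spec[OF u]]
    have s: "x \<in> separated"
      unfolding separated_def
    proof (intro CollectI conjI allI impI)
      show "x i \<in> R" if "i < n" for i
        by (rule closed_sequentially[OF compact_imp_closed[OF R(1)] separatedD(1)[OF d(1) that] c])
      show "rad \<le> norm (x i - x j)" if "i < n" "j < n" "i \<noteq> j" for i j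
        by (rule tendsto_lowerbound[OF tendsto_norm[OF tendsto_diff[OF c c]] always_eventually sequentially_bot])
          (intro allI separatedD(4)[OF d(1) that])
    qed
    have h: "same_heights n x z"
      unfolding same_heights_def
    proof (intro allI impI)
      fix i assume "i < n"
      then have "(\<lambda>k. u k i $ 2) = (\<lambda>k. z i $ 2)" using d(2) by (auto simp: same_heights_def)
      moreover have "(\<lambda>k. u k i $ 2) \<longlonglongrightarrow> x i $ 2" by (rule tendsto_vec_nth[OF c])
      ultimately show "x i $ 2 = z i $ 2" by (simp add: LIMSEQ_const_iff)
    qed
    have z0: "x i = 0" if "n \<le> i" for i
      using c[of i] d(4)[OF that] by (simp add: LIMSEQ_const_iff)
    have "same_heights n (u k) x" for k using d(2)[of k] h by (simp add: same_heights_def)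
    \<comment> \<open>Any factor will do, as only the existence of a strain matters;
      \<open>\<kappa> = 1\<close> is taken.\<close>
    then have "\<forall>\<^sub>F k in sequentially. \<forall>E\<in>rows (u k). \<exists>E'\<in>rows x. E' \<le> (1 + 1) * E"
      by (intro move[OF s _ lim]) auto
    then obtain k where "\<forall>E\<in>rows (u k). \<exists>E'\<in>rows x. E' \<le> (1 + 1) * E"
      using eventually_happens'[OF sequentially_bot] by blast
    moreover obtain E where "E \<in> rows (u k)" using d(3)[of k] by blast
    ultimately have "rows x \<noteq> {}" by blast
    with s h z0 show "x \<in> confs z" by (simp add: confs_def)
  qed
  then have "compact (K \<inter> confs z)" by (rule compact_Int_closed[OF K])
  then show ?thesis using sub by (simp add: Int_absorb1)
qed

lemma rows_nonneg: "E \<in> rows w \<Longrightarrow> 0 \<le> E"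
  by (auto simp: strain_rows_def intro: strain_energy_nonneg lame)

lemma rows_bdd: "bdd_below ((\<lambda>E. E / 2) ` rows w)"
  using rows_nonneg by (intro bdd_belowI2[of _ 0]) simp

text \<open>The elastic part satisfies \<open>I x \<le> (1 + \<kappa>) * I (u k)\<close> eventually,
  for every \<open>\<kappa> > 0\<close>, and the self-energy part converges.\<close>

lemma energy_lsc:
  assumes u: "\<And>k::nat. u k \<in> confs z" and x: "x \<in> confs z" and lim: "u \<longlonglongrightarrow> x" and e: "e > 0"
  shows "\<forall>\<^sub>F k in sequentially. energy x - e < energy (u k)"
proof -
  note dx = confsD[OF x] and du = confsD[OF u]
  define I where "I w = (INF E\<in>rows w. E / 2)" for w
  have I0: "0 \<le> I w" if "rows w \<noteq> {}" for w
    unfolding I_def using that rows_nonneg by (intro cINF_greatest) auto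
  \<comment> \<open>The added 1 keeps \<open>c\<close> positive when \<open>I x = 0\<close>, since
    \<open>\<kappa>\<close> is obtained by dividing by \<open>c\<close>.\<close>
  define c where "c = I x + 1"
  have c: "c > 0" using I0[OF dx(3)] by (simp add: c_def)
  define \<kappa> where "\<kappa> = e / 2 / c"
  have \<kappa>: "\<kappa> > 0" using e c by (simp add: \<kappa>_def)
  have \<kappa>I: "\<kappa> * I x \<le> e / 2"
  proof -
    have "\<kappa> * I x \<le> \<kappa> * c" using \<kappa> by (intro mult_left_mono) (auto simp: c_def)
    also have "\<dots> = e / 2" using c by (simp add: \<kappa>_def)
    finally show ?thesis .
  qed
  have "same_heights n (u k) x" for k using du(2)[of k] dx(2) by (simp add: same_heights_def)
  from move[OF dx(1) \<kappa> lim this]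
  have 1: "\<forall>\<^sub>F k in sequentially. I x - e / 2 \<le> I (u k)"
  proof eventually_elim
    case (elim k)
    have "I x / (1 + \<kappa>) \<le> I (u k)"
      unfolding I_def[of "u k"]
    proof (rule cINF_greatest[OF du(3)])
      fix E assume "E \<in> rows (u k)"
      then obtain E' where E': "E' \<in> rows x" "E' \<le> (1 + \<kappa>) * E" using elim by blast
      have "I x \<le> E' / 2" unfolding I_def by (rule cINF_lower[OF rows_bdd E'(1)])
      then have "I x \<le> E / 2 * (1 + \<kappa>)" using E'(2) by (simp add: mult.commute)
      then show "I x / (1 + \<kappa>) \<le> E / 2" using \<kappa> by (subst pos_divide_le_eq) auto
    qed
    \<comment> \<open>A lower bound linear in \<open>\<kappa>\<close>, from
      \<open>(1 - \<kappa>) * (1 + \<kappa>) \<le> 1\<close>; the loss \<open>\<kappa> * I x\<close>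
      is at most \<open>e / 2\<close>.\<close>
    moreover have "I x * (1 - \<kappa>) \<le> I x / (1 + \<kappa>)"
    proof (subst pos_le_divide_eq)
      have "I x * (1 - \<kappa>) * (1 + \<kappa>) = I x * (1 - \<kappa>\<^sup>2)" by (simp add: algebra_simps power2_eq_square)
      also have "\<dots> \<le> I x * 1" using I0[OF dx(3)] by (intro mult_left_mono) auto
      finally show "I x * (1 - \<kappa>) * (1 + \<kappa>) \<le> I x" by simp
    qed (use \<kappa> in simp)
    ultimately show ?case using \<kappa>I by (simp add: right_diff_distrib mult.commute)
  qed
  define S where "S w = 1 / (2 * (real n)\<^sup>2) * self_energy lam sh eps \<Omega> n w" for w
  have "(\<lambda>k. S (u k)) \<longlonglongrightarrow> S x"
    unfolding S_def
    by (intro tendsto_mult tendsto_const self_energy_continuous[OF \<Omega> eps] separatedD(2)[OF du(1)] coordinate_tendsto[OF lim])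
  then have "\<forall>\<^sub>F k in sequentially. dist (S (u k)) (S x) < e / 2" by (rule tendstoD) (use e in simp)
  with 1 show ?thesis
  proof eventually_elim
    case (elim k)
    have "energy w = I w - S w" for w by (simp add: energy_def I_def S_def)
    from this[of x] this[of "u k"] show ?case using elim unfolding dist_real_def by linarith
  qed
qed

lemma self_energy_image:
  "inj_on w {..<n} \<Longrightarrow> self_energy lam sh eps \<Omega> n w =
    (\<Sum>y\<in>w ` {..<n}. LINT x:(\<Omega> - holes eps (w ` {..<n}))|lebesgue. strain_density lam sh eps (x - y))"
  by (simp add: self_energy_def sum.reindex)

lemma energy_image:
  assumes "x \<in> separated" "y \<in> separated" "x ` {..<n} = y ` {..<n}"
  shows "energy x = energy y"
  unfolding energy_def self_energy_image[OF separatedD(3)[OF assms(1)]] self_energy_image[OF separatedD(3)[OF assms(2)]]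
  by (simp only: assms(3))

lemma zero_dist_image:
  assumes x: "x \<in> confs z" and y: "y \<in> confs z" and "slip_dist n x y = 0"
  shows "x ` {..<n} = y ` {..<n}"
proof -
  have h: "same_heights n x y" "same_heights n y x"
    using confsD(2)[OF x] confsD(2)[OF y] by (auto simp: same_heights_def)
  then show ?thesis using slip_dist_zero[OF n h(1)] slip_dist_zero[OF n h(2)] assms(3) slip_dist_sym[of n x y] by auto
qed

lemma ren_F_emp:
  assumes w: "w \<in> separated" and e: "\<epsilon> n = eps" and r: "r n = rad"
  shows "ren_F \<Omega> R lam sh \<epsilon> r n (emp \<Omega> n w) = (if rows w = {} then \<infinity> else ereal (energy w))"
proof -
  have X: "emp \<Omega> n w \<in> Xn \<Omega> R r n" using w unfolding Xn_emp[OF n R(2)] separated_def r by blast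
  have at: "atoms (emp \<Omega> n w) = w ` {..<n}" by (rule emp_atoms[OF n separatedD(2)[OF w]])
  have F: "F_n \<Omega> lam sh \<epsilon> n (emp \<Omega> n w) = (INF E\<in>rows w. ereal (E / 2))"
    using F_n_strain_rows[OF \<Omega>(1), of "emp \<Omega> n w" lam sh \<epsilon> n] by (simp add: at e)
  have S: "(\<Sum>z\<in>atoms (emp \<Omega> n w). LINT x:Omega_n \<Omega> \<epsilon> n (emp \<Omega> n w)|lebesgue.
      elasticity lam sh (Kn_strain lam sh (\<epsilon> n) x z) \<bullet> Kn_strain lam sh (\<epsilon> n) x z) = self_energy lam sh eps \<Omega> n w"
    unfolding self_energy_image[OF separatedD(3)[OF w]] Omega_n_holes at e strain_density_shift ..
  show ?thesis
  proof (cases "rows w = {}")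
    case True
    then show ?thesis unfolding ren_F_def F S using X by (simp add: top_ereal_def)
  next
    case False
    have "0 \<le> (INF E\<in>rows w. ereal (E / 2))" using rows_nonneg by (intro INF_greatest) simp
    moreover obtain E where "E \<in> rows w" using False by blast
    then have "(INF E\<in>rows w. ereal (E / 2)) \<le> ereal (E / 2)" by (rule INF_lower)
    ultimately have "\<bar>INF E\<in>rows w. ereal (E / 2)\<bar> \<noteq> \<infinity>" by auto
    then have "(INF E\<in>rows w. ereal (E / 2)) = ereal (INF E\<in>rows w. E / 2)" by (rule ereal_INF[symmetric])
    then show ?thesis unfolding ren_F_def F S using X False by (simp add: energy_def)
  qed
qed

end

section \<open>Loads and the quasistatic evolution of configurations\<close>

definition load :: "nat \<Rightarrow> (real \<Rightarrow> real^2 \<Rightarrow> real) \<Rightarrow> real \<Rightarrow> (nat \<Rightarrow> real^2) \<Rightarrow> real" where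
  "load n f t w = (\<Sum>i<n. f t (w i)) / real n"

context dislocations
begin

lemma load_emp:
  assumes "w \<in> separated" "continuous_on \<Omega> (f t)"
  shows "(\<integral>x. f t x \<partial>emp \<Omega> n w) = load n f t w"
  unfolding load_def by (rule emp_integral[OF n separatedD(2)[OF assms(1)] assms(2)])

lemma load_image:
  assumes "x \<in> separated" "y \<in> separated" "x ` {..<n} = y ` {..<n}"
  shows "load n f t x = load n f t y"
proof -
  have "(\<Sum>i<n. f t (w i)) = (\<Sum>p\<in>w ` {..<n}. f t p)" if "w \<in> separated" for w
    by (simp add: sum.reindex[OF separatedD(3)[OF that]])
  then show ?thesis unfolding load_def by (simp only: assms)
qed

lemma load_continuous:
  assumes u: "\<And>k::nat. u k \<in> confs z" and x: "x \<in> confs z" and lim: "u \<longlonglongrightarrow> x" and f: "continuous_on \<Omega> (f t)"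
  shows "(\<lambda>k. load n f t (u k)) \<longlonglongrightarrow> load n f t x"
  unfolding load_def
proof (rule tendsto_divide[OF tendsto_sum tendsto_const])
  fix i assume "i \<in> {..<n}"
  then have i: "i < n" by simp
  show "(\<lambda>k. f t (u k i)) \<longlonglongrightarrow> f t (x i)"
    by (rule continuous_on_tendsto_compose[OF f coordinate_tendsto[OF lim] separatedD(2)[OF confsD(1)[OF x] i]])
      (use separatedD(2)[OF confsD(1)[OF u] i] in auto)
qed (use n in simp)

text \<open>Loads are finite averages of point values, so continuity and measurability reduce to
  those of \<open>f\<close> and \<open>f'\<close> at single points. Zero distance means equal sets
  of points, on which energy and load depend alone; this gives the invariance assumptions.\<close>

lemma quasistatic_system:
  assumes T: "T > 0" and W: "W11 \<Omega> T f f'" and x0: "x0 \<in> confs z"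
    and stable0: "\<And>y. y \<in> confs z \<Longrightarrow> energy x0 - load n f 0 x0 \<le> energy y + slip_dist n y x0 - load n f 0 y"
  shows "energetic_system (confs z) energy (slip_dist n) (load n f) (load n f') (\<lambda>t. sup_norm \<Omega> (f' t)) T x0"
proof
  note w = W11_evaluation[OF T W]
  have h: "same_heights n x y" if "x \<in> confs z" "y \<in> confs z" for x y
    using confsD(2)[OF that(1)] confsD(2)[OF that(2)] by (simp add: same_heights_def)
  have in\<Omega>: "x i \<in> \<Omega>" if "x \<in> confs z" "i < n" for x i using separatedD(2)[OF confsD(1)[OF that(1)] that(2)] .
  show "0 < T" "compact (confs z)" "x0 \<in> confs z" by (rule T compact_confs x0)+
  show "\<And>u x e. (\<And>k::nat. u k \<in> confs z) \<Longrightarrow> x \<in> confs z \<Longrightarrow> u \<longlonglongrightarrow> x \<Longrightarrow> 0 < e \<Longrightarrow>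
      \<forall>\<^sub>F k in sequentially. energy x - e < energy (u k)" by (rule energy_lsc)
  show "\<And>x y. x \<in> confs z \<Longrightarrow> y \<in> confs z \<Longrightarrow> 0 \<le> slip_dist n x y" by (rule slip_dist_nonneg[OF h])
  show refl: "slip_dist n x x = 0" if "x \<in> confs z" for x
    using slip_dist_upper[OF h[OF that that]] slip_dist_nonneg[OF h[OF that that]] by simp
  show "\<And>x y. slip_dist n x y = slip_dist n y x" by (rule slip_dist_sym)
  show "\<And>x y v. x \<in> confs z \<Longrightarrow> y \<in> confs z \<Longrightarrow> v \<in> confs z \<Longrightarrow> slip_dist n x v \<le> slip_dist n x y + slip_dist n y v"
    by (rule slip_dist_triangle[OF n h h])
  show "(\<lambda>k. slip_dist n (u k) x) \<longlonglongrightarrow> 0" if u: "\<And>k::nat. u k \<in> confs z" and x: "x \<in> confs z" and lim: "u \<longlonglongrightarrow> x" for u x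
  proof (rule tendsto_sandwich)
    show "\<forall>\<^sub>F k in sequentially. 0 \<le> slip_dist n (u k) x" by (intro always_eventually allI slip_dist_nonneg h u x)
    show "\<forall>\<^sub>F k in sequentially. slip_dist n (u k) x \<le> (\<Sum>i<n. norm (u k i - x i)) / real n"
      by (intro always_eventually allI slip_dist_upper h u x)
    have "(\<lambda>k. (\<Sum>i<n. norm (u k i - x i)) / real n) \<longlonglongrightarrow> (\<Sum>i<n. norm (x i - x i)) / real n"
      by (intro tendsto_intros coordinate_tendsto[OF lim]) (use n in simp)
    then show "(\<lambda>k. (\<Sum>i<n. norm (u k i - x i)) / real n) \<longlonglongrightarrow> 0" by simp
  qed simp
  show "\<And>x y. x \<in> confs z \<Longrightarrow> y \<in> confs z \<Longrightarrow> slip_dist n x y = 0 \<Longrightarrow> energy x = energy y"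
    by (rule energy_image[OF confsD(1) confsD(1) zero_dist_image])
  show "\<And>t x y. t \<in> {0..T} \<Longrightarrow> x \<in> confs z \<Longrightarrow> y \<in> confs z \<Longrightarrow> slip_dist n x y = 0 \<Longrightarrow> load n f t x = load n f t y"
    "\<And>t x y. t \<in> {0..T} \<Longrightarrow> x \<in> confs z \<Longrightarrow> y \<in> confs z \<Longrightarrow> slip_dist n x y = 0 \<Longrightarrow> load n f' t x = load n f' t y"
    by (rule load_image[OF confsD(1) confsD(1) zero_dist_image]; assumption)+
  show "set_integrable lebesgue {0..T} (\<lambda>t. sup_norm \<Omega> (f' t))" by (rule w(4))
  show "set_borel_measurable lebesgue {0..T} (\<lambda>s. load n f' s x)" if "x \<in> confs z" for x
  proof -
    have "(\<lambda>s. (\<Sum>i<n. indicator {0..T} s *\<^sub>R f' s (x i)) / real n) \<in> borel_measurable lebesgue"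
      using w(5)[OF in\<Omega>[OF that]] by (intro borel_measurable_divide borel_measurable_sum) (auto simp: set_borel_measurable_def)
    then show ?thesis unfolding set_borel_measurable_def load_def by (simp add: sum_distrib_left)
  qed
  show "\<bar>load n f' s x\<bar> \<le> sup_norm \<Omega> (f' s)" if "s \<in> {0..T}" "x \<in> confs z" for s x
  proof -
    have "\<bar>\<Sum>i<n. f' s (x i)\<bar> \<le> (\<Sum>i<n. sup_norm \<Omega> (f' s))"
      by (rule order_trans[OF sum_abs], rule sum_mono, rule w(3)[OF that(1) in\<Omega>[OF that(2)]]) simp
    then show ?thesis using n by (simp add: load_def abs_divide divide_le_eq mult.commute)
  qed
  show "\<And>s u x. s \<in> {0..T} \<Longrightarrow> (\<And>k::nat. u k \<in> confs z) \<Longrightarrow> x \<in> confs z \<Longrightarrow> u \<longlonglongrightarrow> x \<Longrightarrow>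
      (\<lambda>k. load n f' s (u k)) \<longlonglongrightarrow> load n f' s x" by (rule load_continuous[OF _ _ _ w(2)])
  show "\<And>s u x. s \<in> {0..T} \<Longrightarrow> (\<And>k::nat. u k \<in> confs z) \<Longrightarrow> x \<in> confs z \<Longrightarrow> u \<longlonglongrightarrow> x \<Longrightarrow>
      (\<lambda>k. load n f s (u k)) \<longlonglongrightarrow> load n f s x" by (rule load_continuous[OF _ _ _ w(1)])
  show "load n f t x - load n f s x = (LINT r:{s..t}|lebesgue. load n f' r x)"
    if st: "0 \<le> s" "s \<le> t" "t \<le> T" and x: "x \<in> confs z" for s t x
  proof -
    have int: "set_integrable lebesgue {s..t} (\<lambda>r. f' r (x i))" if "i < n" for i
      by (rule set_integrable_subset[OF w(6)[OF in\<Omega>[OF x that]]]) (use st in auto)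
    have "(LINT r:{s..t}|lebesgue. load n f' r x) = (\<integral>r. (\<Sum>i<n. indicator {s..t} r *\<^sub>R f' r (x i)) / real n \<partial>lebesgue)"
      unfolding set_lebesgue_integral_def load_def by (simp add: sum_distrib_left)
    also have "\<dots> = (\<Sum>i<n. LINT r:{s..t}|lebesgue. f' r (x i)) / real n"
      unfolding integral_divide_zero set_lebesgue_integral_def
      by (subst Bochner_Integration.integral_sum) (use int in \<open>auto simp: set_integrable_def\<close>)
    also have "\<dots> = (\<Sum>i<n. f t (x i) - f s (x i)) / real n"
      by (intro arg_cong[where f = "\<lambda>v. v / real n"] sum.cong refl w(7)[symmetric] in\<Omega>[OF x] st) simp_all
    finally show ?thesis by (simp add: load_def sum_subtractf diff_divide_distrib)
  qed
qed (rule stable0)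

lemma separated_emp: "r n = rad \<Longrightarrow> \<mu> \<in> Xn \<Omega> R r n \<longleftrightarrow> (\<exists>w\<in>separated. \<mu> = emp \<Omega> n w)"
  unfolding Xn_emp[OF n R(2)] separated_def by auto

text \<open>Relabels the points and pins the remaining coordinates to 0 without changing the
  measure, so that the new labelling can match the pattern required by \<open>confs\<close>.\<close>

lemma separated_normalize:
  assumes w: "w \<in> separated" and \<pi>: "bij_betw \<pi> {..<n} {..<n}"
  defines "v \<equiv> (\<lambda>i. if i < n then w (\<pi> i) else 0)"
  shows "v \<in> separated" "emp \<Omega> n v = emp \<Omega> n w"
proof -
  have \<pi>n: "\<pi> i < n" if "i < n" for i using bij_betwE[OF \<pi>] that by auto
  have "\<pi> i \<noteq> \<pi> j" if "i < n" "j < n" "i \<noteq> j" for i j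
    using \<pi> that by (auto simp: bij_betw_def inj_on_def)
  then show "v \<in> separated" using w \<pi>n by (simp add: v_def separated_def)
  have "emp \<Omega> n v = emp \<Omega> n (w \<circ> \<pi>)" by (rule emp_cong) (simp add: v_def)
  also have "\<dots> = emp \<Omega> n w" by (rule emp_permute[OF n separatedD(2)[OF w] \<pi>])
  finally show "emp \<Omega> n v = emp \<Omega> n w" .
qed

text \<open>The abstract system knows only competitors with finite energy whose labels match the
  heights of the initial points. Every other measure either makes the right-hand side of the
  stability condition infinite or becomes such a competitor after relabelling.\<close>

lemma quasistatic_evolution:
  assumes T: "T > 0" and W: "W11 \<Omega> T f f'" and e: "\<epsilon> n = eps" and r: "r n = rad"
    and \<mu>0: "\<mu>0 \<in> Xn \<Omega> R r n"
    and stable0: "\<forall>\<nu>\<in>Xn \<Omega> R r n. ren_F \<Omega> R lam sh \<epsilon> r n \<mu>0 - ereal (\<integral>x. f 0 x \<partial>\<mu>0)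
                     \<le> ren_F \<Omega> R lam sh \<epsilon> r n \<nu> + diss_dist \<Omega> \<nu> \<mu>0 - ereal (\<integral>x. f 0 x \<partial>\<nu>)"
  shows "\<exists>\<mu> :: real \<Rightarrow> (real^2) measure.
     (\<forall>t\<in>{0..T}. \<mu> t \<in> borel_prob \<Omega>) \<and> \<mu> 0 = \<mu>0 \<and>
     (\<forall>t\<in>{0..T}. \<mu> t \<in> Xn \<Omega> R r n \<and>
        (\<forall>\<nu>\<in>Xn \<Omega> R r n. ren_F \<Omega> R lam sh \<epsilon> r n (\<mu> t) - ereal (\<integral>x. f t x \<partial>\<mu> t)
                 \<le> ren_F \<Omega> R lam sh \<epsilon> r n \<nu> + diss_dist \<Omega> \<nu> (\<mu> t) - ereal (\<integral>x. f t x \<partial>\<nu>))) \<and>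
     set_integrable lebesgue {0..T} (\<lambda>s. \<integral>x. f' s x \<partial>\<mu> s) \<and>
     (\<forall>t\<in>{0..T}.
        ren_F \<Omega> R lam sh \<epsilon> r n (\<mu> t) + dissipation \<Omega> \<mu> t - ereal (\<integral>x. f t x \<partial>\<mu> t)
        = ren_F \<Omega> R lam sh \<epsilon> r n (\<mu> 0) - ereal (\<integral>x. f 0 x \<partial>\<mu> 0)
          - ereal (LINT s:{0..t}|lebesgue. \<integral>x. f' s x \<partial>\<mu> s))"
proof -
  note w = W11_evaluation[OF T W]
  let ?X = "Xn \<Omega> R r n" and ?F = "ren_F \<Omega> R lam sh \<epsilon> r n"
  note F = ren_F_emp[where \<epsilon> = \<epsilon> and r = r, OF _ e r]
  note X = separated_emp[where r = r, OF r]
  obtain z' where z': "z' \<in> separated" "\<mu>0 = emp \<Omega> n z'" using \<mu>0 X by blast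
  define z where "z = (\<lambda>i. if i < n then z' i else 0)"
  have z: "z \<in> separated" "emp \<Omega> n z = \<mu>0" "\<And>i. n \<le> i \<Longrightarrow> z i = 0"
    using separated_normalize[OF z'(1) bij_betw_id, unfolded id_apply] z'(2) by (simp_all add: z_def)
  have prob: "emp \<Omega> n v \<in> borel_prob \<Omega>" if "v \<in> separated" for v by (rule emp_prob[OF n separatedD(2)[OF that]])
  have in_X: "emp \<Omega> n v \<in> ?X" if "v \<in> separated" for v using X that by blast
  show ?thesis
  proof (cases "rows z = {}")
    case True
    then have inf: "?F \<mu>0 = \<infinity>" using F[OF z(1)] z(2) by simp
    \<comment> \<open>Stability of an initial datum of infinite energy forces the right-hand side to
      be infinite for every competitor, so stability persists at all later times; in the balance
      both sides are infinite.\<close>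
    have inf': "?F \<nu> + diss_dist \<Omega> \<nu> \<mu>0 = \<infinity>" if "\<nu> \<in> ?X" for \<nu>
      using bspec[OF stable0 that] unfolding inf by (cases "?F \<nu> + diss_dist \<Omega> \<nu> \<mu>0") auto
    have inf'': "?F \<nu> + diss_dist \<Omega> \<nu> \<mu>0 - ereal c = \<infinity>" if "\<nu> \<in> ?X" for \<nu> c unfolding inf'[OF that] by simp
    have "set_integrable lebesgue {0..T} (\<lambda>s. load n f' s z)"
    proof -
      have "integrable lebesgue (\<lambda>s. (\<Sum>i<n. indicator {0..T} s *\<^sub>R f' s (z i)) / real n)"
        using w(6)[OF separatedD(2)[OF z(1)]]
        by (intro integrable_divide Bochner_Integration.integrable_sum) (auto simp: set_integrable_def)
      then show ?thesis unfolding set_integrable_def load_def by (simp add: sum_distrib_left)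
    qed
    then have "set_integrable lebesgue {0..T} (\<lambda>s. \<integral>x. f' s x \<partial>\<mu>0)"
      using load_emp[where f = f', OF z(1) w(2)] z(2)
      by (subst set_integrable_cong[where f' = "\<lambda>s. load n f' s z", OF refl refl]) auto
    then show ?thesis
      using prob[OF z(1)] in_X[OF z(1)] inf by (intro exI[of _ "\<lambda>_. \<mu>0"]) (simp add: z(2) inf'')
  next
    case False
    then have zc: "z \<in> confs z" using z by (simp add: confs_def same_heights_def)
    have dist: "diss_dist \<Omega> (emp \<Omega> n x) (emp \<Omega> n y) = ereal (slip_dist n x y)" if x: "x \<in> confs z" and y: "y \<in> confs z" for x y
      using confsD(2)[OF x] confsD(2)[OF y]
      by (intro diss_dist_emp[OF n] separatedD[OF confsD(1)[OF x]] separatedD[OF confsD(1)[OF y]]) (simp_all add: same_heights_def)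
    have en: "?F (emp \<Omega> n x) = ereal (energy x)" if "x \<in> confs z" for x
      using F[OF confsD(1)[OF that]] confsD(3)[OF that] by simp
    have ld: "(\<integral>p. f t p \<partial>emp \<Omega> n x) = load n f t x" "(\<integral>p. f' t p \<partial>emp \<Omega> n x) = load n f' t x"
      if "x \<in> separated" "t \<in> {0..T}" for x t
      using load_emp[where f = f and t = t, OF that(1) w(1)[OF that(2)]] load_emp[where f = f' and t = t, OF that(1) w(2)[OF that(2)]] .
    have T0: "0 \<in> {0..T}" using T by simp
    interpret energetic_system "confs z" energy "slip_dist n" "load n f" "load n f'" "\<lambda>t. sup_norm \<Omega> (f' t)" T z
    proof (rule quasistatic_system[OF T W zc])
      fix y assume y: "y \<in> confs z"
      show "energy z - load n f 0 z \<le> energy y + slip_dist n y z - load n f 0 y"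
        using bspec[OF stable0 in_X[OF confsD(1)[OF y]]]
        unfolding z(2)[symmetric] en[OF zc] en[OF y] dist[OF y zc] ld(1)[OF z(1) T0] ld(1)[OF confsD(1)[OF y] T0] by simp
    qed
    obtain x where x: "\<And>t. x t \<in> confs z" "slip_dist n (x 0) z = 0" "x 0 = z"
      and stab: "\<And>t y. t \<in> {0..T} \<Longrightarrow> y \<in> confs z \<Longrightarrow>
        energy (x t) - load n f t (x t) \<le> energy y + slip_dist n y (x t) - load n f t y"
      and int: "set_integrable lebesgue {0..T} (\<lambda>s. load n f' s (x s))"
      and balance: "\<And>t. t \<in> {0..T} \<Longrightarrow> Sup (ereal ` path_sums x t)
        = ereal (energy z - load n f 0 z - energy (x t) + load n f t (x t) - (LINT s:{0..t}|lebesgue. load n f' s (x s)))"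
      by (rule energetic_solution_exists) blast
    note sx = confsD(1)[OF x(1)]
    define \<mu> where "\<mu> t = emp \<Omega> n (x t)" for t
    have stable: "?F (\<mu> t) - ereal (\<integral>p. f t p \<partial>\<mu> t) \<le> ?F \<nu> + diss_dist \<Omega> \<nu> (\<mu> t) - ereal (\<integral>p. f t p \<partial>\<nu>)"
      if t: "t \<in> {0..T}" and \<nu>: "\<nu> \<in> ?X" for t \<nu>
    proof (cases "?F \<nu> = \<infinity> \<or> diss_dist \<Omega> \<nu> (\<mu> t) = \<infinity>")
      case True then show ?thesis by auto
    next
      case fin: False
      obtain y' where y': "y' \<in> separated" "\<nu> = emp \<Omega> n y'" using \<nu> X by blast
      have finite_dist: "diss_dist \<Omega> (emp \<Omega> n y') (emp \<Omega> n (x t)) \<noteq> \<infinity>" using fin by (simp add: y'(2) \<mu>_def)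
      \<comment> \<open>Finite distance to the current state allows the competitor to be relabelled
        so that its heights match label by label.\<close>
      obtain \<pi> where \<pi>: "bij_betw \<pi> {..<n} {..<n}" "same_heights n (y' \<circ> \<pi>) (x t)"
        by (rule relabel_heights[OF n separatedD(2)[OF y'(1)] separatedD(2)[OF sx] finite_dist])
      define y where "y = (\<lambda>i. if i < n then y' (\<pi> i) else 0)"
      have y: "y \<in> separated" "emp \<Omega> n y = \<nu>" using separated_normalize[OF y'(1) \<pi>(1)] by (simp_all add: y_def y'(2))
      have "rows y \<noteq> {}" using fin F[OF y(1)] y(2) by auto
      then have yc: "y \<in> confs z"
        using y(1) \<pi>(2) confsD(2)[OF x(1)[of t]] by (auto simp: confs_def same_heights_def y_def)
      show ?thesis
        using stab[OF t yc] unfolding \<mu>_def y(2)[symmetric] en[OF x(1)] en[OF yc] dist[OF yc x(1)] ld(1)[OF sx t] ld(1)[OF y(1) t]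
        by simp
    qed
    have diss: "dissipation \<Omega> \<mu> t = Sup (ereal ` path_sums x t)" for t
    proof -
      have "(\<Sum>i<M. diss_dist \<Omega> (\<mu> (\<tau> (Suc i))) (\<mu> (\<tau> i))) = ereal (\<Sum>i<M. slip_dist n (x (\<tau> (Suc i))) (x (\<tau> i)))"
        for M :: nat and \<tau> unfolding \<mu>_def dist[OF x(1) x(1)] by (rule sum_ereal)
      then show ?thesis unfolding dissipation_def path_sums_def by (intro arg_cong[of _ _ Sup]) (auto simp: image_iff)
    qed
    have mem: "\<mu> t \<in> borel_prob \<Omega>" "\<mu> t \<in> ?X" for t unfolding \<mu>_def by (rule prob[OF sx], rule in_X[OF sx])
    have init: "\<mu> 0 = \<mu>0" by (simp add: \<mu>_def x(3) z(2))
    have power: "set_integrable lebesgue {0..T} (\<lambda>s. \<integral>p. f' s p \<partial>\<mu> s)"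
      using int by (subst set_integrable_cong[where f' = "\<lambda>s. load n f' s (x s)", OF refl refl]) (auto simp: \<mu>_def ld(2)[OF sx])
    have energy_balance: "?F (\<mu> t) + dissipation \<Omega> \<mu> t - ereal (\<integral>p. f t p \<partial>\<mu> t)
        = ?F (\<mu> 0) - ereal (\<integral>p. f 0 p \<partial>\<mu> 0) - ereal (LINT s:{0..t}|lebesgue. \<integral>p. f' s p \<partial>\<mu> s)" if t: "t \<in> {0..T}" for t
    proof -
      have "(LINT s:{0..t}|lebesgue. \<integral>p. f' s p \<partial>\<mu> s) = (LINT s:{0..t}|lebesgue. load n f' s (x s))"
        using t by (intro set_lebesgue_integral_cong) (auto simp: \<mu>_def ld(2)[OF sx])
      then show ?thesis
        unfolding diss balance[OF t] unfolding \<mu>_def en[OF x(1)] ld(1)[OF sx t] x(3) en[OF zc] ld(1)[OF z(1) T0] by simp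
    qed
    show ?thesis
      by (intro exI[of _ \<mu>] conjI ballI)
        (rule mem(1), rule init, rule mem(2), rule stable, assumption, assumption, rule power, rule energy_balance, assumption)
  qed
qed

end

theorem theorem4p4:
  fixes \<Omega> :: "(real^2) set" and a b :: "real^2" and l lam shear :: real
    and \<epsilon> r :: "nat \<Rightarrow> real" and n :: nat and T :: real
    and f f' :: "real \<Rightarrow> real^2 \<Rightarrow> real" and \<mu>0 :: "(real^2) measure"
  defines "R \<equiv> cbox a b"
  defines "X \<equiv> Xn \<Omega> R r n"
    and "\<F> \<equiv> ren_F \<Omega> R lam shear \<epsilon> r n"
  assumes \<Omega>: "open \<Omega>" "bounded \<Omega>" "simply_connected \<Omega>" "lipschitz_boundary \<Omega>"
    and R: "a $ 1 < b $ 1" "a $ 2 < b $ 2" "R \<subseteq> \<Omega>" "setdist R (frontier \<Omega>) = l" "l > 0"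
    and lame: "shear > 0" "lam + shear > 0"
    and pos: "\<And>k. \<epsilon> k > 0" "\<And>k. r k > 0"
    and lim: "\<epsilon> \<longlonglongrightarrow> 0" "r \<longlonglongrightarrow> 0" "(\<lambda>k. \<epsilon> k / (r k)^3) \<longlonglongrightarrow> 0" "(\<lambda>k. r k * real k) \<longlonglongrightarrow> 0"
    and n: "n \<ge> 1" "2 * \<epsilon> n < r n" "2 * \<epsilon> n \<le> l"
    and T: "T > 0"
    and f: "W11 \<Omega> T f f'"
    and \<mu>0: "\<mu>0 \<in> X"
    and stable0: "\<forall>\<nu>\<in>X. \<F> \<mu>0 - ereal (\<integral>x. f 0 x \<partial>\<mu>0)
                     \<le> \<F> \<nu> + diss_dist \<Omega> \<nu> \<mu>0 - ereal (\<integral>x. f 0 x \<partial>\<nu>)"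
  shows "\<exists>\<mu> :: real \<Rightarrow> (real^2) measure.
     (\<forall>t\<in>{0..T}. \<mu> t \<in> borel_prob \<Omega>) \<and> \<mu> 0 = \<mu>0 \<and>
     (\<forall>t\<in>{0..T}. \<mu> t \<in> X \<and>
        (\<forall>\<nu>\<in>X. \<F> (\<mu> t) - ereal (\<integral>x. f t x \<partial>\<mu> t)
                 \<le> \<F> \<nu> + diss_dist \<Omega> \<nu> (\<mu> t) - ereal (\<integral>x. f t x \<partial>\<nu>))) \<and>
     set_integrable lebesgue {0..T} (\<lambda>s. \<integral>x. f' s x \<partial>\<mu> s) \<and>
     (\<forall>t\<in>{0..T}.
        \<F> (\<mu> t) + dissipation \<Omega> \<mu> t - ereal (\<integral>x. f t x \<partial>\<mu> t)
        = \<F> (\<mu> 0) - ereal (\<integral>x. f 0 x \<partial>\<mu> 0)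
          - ereal (LINT s:{0..t}|lebesgue. \<integral>x. f' s x \<partial>\<mu> s))"
proof -
  \<comment> \<open>A quarter of each available slack: together with
    \<open>2 * \<epsilon> n \<le> l\<close> this gives \<open>\<epsilon> n + \<delta> < l\<close>
    and \<open>2 * \<epsilon> n + 2 * \<delta> < r n\<close>.\<close>
  define \<delta> where "\<delta> = min (l / 4) ((r n - 2 * \<epsilon> n) / 4)"
  have "\<delta> \<le> l / 4" "\<delta> \<le> (r n - 2 * \<epsilon> n) / 4" "\<delta> > 0"
    unfolding \<delta>_def by (rule min.cobounded1, rule min.cobounded2) (use R(5) n(2) in simp)
  then have \<delta>: "4 * \<delta> \<le> l" "4 * \<delta> \<le> r n - 2 * \<epsilon> n" "\<delta> > 0" by simp_all
  interpret dislocations \<Omega> R lam shear "\<epsilon> n" "r n" \<delta> n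
  proof
    show "compact R" by (simp add: R_def)
    show "2 * \<epsilon> n + 2 * \<delta> < r n" using \<delta> n(2) by linarith
    show "cball x (\<epsilon> n + \<delta>) \<subseteq> \<Omega>" if x: "x \<in> R" for x
    proof (rule ccontr)
      assume "\<not> cball x (\<epsilon> n + \<delta>) \<subseteq> \<Omega>"
      moreover have "x \<in> cball x (\<epsilon> n + \<delta>) \<inter> \<Omega>" using x R(3) pos(1)[of n] \<delta> by (auto simp: subset_iff)
      \<comment> \<open>A connected set that meets the domain without being contained in it meets
        the frontier, which is too far away.\<close>
      ultimately have "cball x (\<epsilon> n + \<delta>) \<inter> frontier \<Omega> \<noteq> {}"
        by (intro connected_Int_frontier convex_connected convex_cball) blast+
      then obtain y where y: "dist x y \<le> \<epsilon> n + \<delta>" "y \<in> frontier \<Omega>" by auto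
      have "l \<le> dist x y" using setdist_le_dist[OF x y(2)] R(4) by simp
      then show False using y(1) n(3) \<delta> R(5) by linarith
    qed
  qed (use \<Omega> R(3) lame pos \<delta> n in auto)
  show ?thesis
    unfolding X_def \<F>_def
    by (rule quasistatic_evolution[OF T f refl refl \<mu>0[unfolded X_def] stable0[unfolded X_def \<F>_def]])
qed

end
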